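(* Let $\mathcal{A}=C^\infty(\mathbb{T}^4_\theta)$ be the smooth algebra of a strictly irrational noncommutative 4-torus, let $\mathcal{A}^o$ be its copy in the commutant of $\mathcal{A}$, let $k\in\mathcal{A}^o$ be positive and invertible, and let $D_k=kDk$ be the conformal rescaling of the flat Dirac operator $D$ on $L^2(\mathbb{T}^4_\theta,\tau)\otimes\mathbb{C}^4$. For one-forms $v=k^2V^a\gamma^a$, $w=k^2W^a\gamma^a$ with $V^a,W^a\in\mathcal{A}$, $a=1,\dots,4$, the metric and Einstein functionals of the conformally rescaled spectral triple are, respectively, $$\mathcal{g}_{D_k}(v,w)=\tau\left(V^aW^ak^{-4}\right),$$ $$\begin{aligned}\mathcal{G}_{D_k}(v,w)=\tau\biggl(V^aW^b\Bigl(&\tfrac13k^{-4}(\delta_ak)k^2(\delta_bk)+\tfrac23k^{-3}(\delta_ak)k(\delta_bk)+k^{-2}(\delta_ak)(\delta_bk)\\&+\tfrac23k^{-1}(\delta_ak)k^{-1}(\delta_bk)-\tfrac43k(\delta_ak)k^{-3}(\delta_bk)-\tfrac23k^2(\delta_ak)k^{-4}(\delta_bk)\\&+\tfrac23k^{-1}(\delta_a\delta_bk)+\delta_{ab}\bigl(\tfrac13k^{-1}(\delta_ck)k^{-1}(\delta_ck)+\tfrac13k^2(\delta_ck)k^{-4}(\delta_ck)\\&+\tfrac23k(\delta_ck)k^{-3}(\delta_ck)-\tfrac23k^{-1}(\Delta k)\bigr)\Bigr)\biggr),\end{aligned}$$ where $\delta_{ab}$ is the Kronecker symbol, $\Delta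 k=\sum_c\delta_c\delta_ck$, and repeated indices are summed.
   Context: The functionals are $\mathcal{g}_{D_k}(v,w)=\mathcal{W}(vw|D_k|^{-n})$ and $\mathcal{G}_{D_k}(v,w)=\mathcal{W}(v\{D_k,w\}D_k|D_k|^{-n})$ with $n=4$ and $\{D_k,w\}=D_kw+wD_k$. Strictly irrational means that the center of the algebra is $\mathbb{C}$. $\gamma^a$ are $4\times4$ gamma matrices with $\{\gamma^a,\gamma^b\}=2\delta_{ab}$. $\hat{\mathcal{A}}$ is the algebra of operators on $L^2(\mathbb{T}^4_\theta,\tau)$ generated by $\mathcal{A}$ and $\mathcal{A}^o$ (the copy of $\mathcal{A}$ commuting with $\mathcal{A}$, e.g. $J\mathcal{A}J$), and $\tau$ in the formulas denotes the factorized trace $\tau(ab^o)=\tau(a)\tau(b^o)$ on $\hat{\mathcal{A}}$, built from the standard normalised trace, $\tau(1)=1$. In the formulas $\delta_a$ denotes the basic $*$-derivations (analogues of $\partial_a$; $\delta_a(U_b)=i\delta_{ab}U_b$ on the unitary generators of $\mathcal{A}$), extended to $\hat{\mathcal{A}}$; correspondingly $\delta_a$ has symbol $i\xi_a$, the flat Dirac operator $D=-i\sum_a\gamma^a\delta_a$ has symbol $\gamma^a\xi_a$, elements of $\hat{\mathcal{A}}$ are their own symbols, and symbols (functions of $\xi\in\mathbb{R}^4$ with values in $\hat{\mathcal{A}}\otimes M_4(\mathbb{C})$) compose as $\sigma(PQ)=\sum_\beta\frac{(-i)^{|\beta|}}{\beta!}\partial^\beta_\xi\sigma(P)\,\delta^\beta\sigma(Q)$.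 The tracial Wodzicki residue is $\mathcal{W}(P)=N\,\tau\big(\int_{\|\xi\|=1}\mathrm{tr}\,\sigma_{-4}(P)(\xi)\,d\xi\big)$ with $\mathrm{tr}$ the matrix trace and normalisation constant $N=\frac{1}{4\cdot2\pi^2}$. Inverses are understood up to the finite-dimensional kernel. *)

theory Defs
  imports "HOL-Analysis.Analysis"
begin

section \<open>Smooth vectors\<close>

definition lat :: "int^4 \<Rightarrow> real^4"
  where "lat m = (\<chi> a. real_of_int (m $ a))"

definition rapid :: "(int^4 \<Rightarrow> complex) \<Rightarrow> bool"
  where "rapid x \<longleftrightarrow> (\<forall>r::nat. \<exists>C. \<forall>m. (1 + norm (lat m)) ^ r * cmod (x m) \<le> C)"

text \<open>
  An element \<open>x\<close> of the following type stands for \<open>\<Sum>m. x m U\<^sup>m\<close>, where the \<open>U\<^sup>m\<close> are the monomials in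
  the unitary generators of the noncommutative torus. The type is at the same time the vector space
  underlying the smooth algebra and the space of smooth vectors of the Hilbert space
  \<open>L\<^sup>2(T\<^sub>\<theta>,\<tau>)\<close>, in which the \<open>U\<^sup>m\<close> form an orthonormal basis. It is invariant under all operators
  below, and operators are considered on it.
\<close>

typedef torus_fun = "{x. rapid x}"
  morphisms coeff Abs_torus_fun
  by (rule exI[of _ "\<lambda>_. 0"]) (auto simp: rapid_def)

setup_lifting type_definition_torus_fun

lemma rapid_add: "rapid x \<Longrightarrow> rapid y \<Longrightarrow> rapid (\<lambda>m. x m + y m)"
  unfolding rapid_def
proof (intro allI)
  fix r :: nat
  assume "\<forall>r. \<exists>C. \<forall>m. (1 + norm (lat m)) ^ r * cmod (x m) \<le> C"
    and "\<forall>r. \<exists>C. \<forall>m. (1 + norm (lat m)) ^ r * cmod (y m) \<le> C"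
  then obtain C C' where C: "\<And>m. (1 + norm (lat m)) ^ r * cmod (x m) \<le> C"
    and C': "\<And>m. (1 + norm (lat m)) ^ r * cmod (y m) \<le> C'"
    by metis
  have "(1 + norm (lat m)) ^ r * cmod (x m + y m) \<le> C + C'" for m
  proof -
    have "(1 + norm (lat m)) ^ r * cmod (x m + y m)
        \<le> (1 + norm (lat m)) ^ r * (cmod (x m) + cmod (y m))"
      by (intro mult_left_mono norm_triangle_ineq) simp
    also have "\<dots> \<le> C + C'"
      using C[of m] C'[of m] by (simp add: distrib_left)
    finally show ?thesis .
  qed
  then show "\<exists>C. \<forall>m. (1 + norm (lat m)) ^ r * cmod (x m + y m) \<le> C" by blast
qed

lemma rapid_mult_bounded:
  assumes x: "rapid x" and B: "\<And>m. cmod (c m) \<le> B * (1 + norm (lat m)) ^ s"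
  shows "rapid (\<lambda>m. c m * x m)"
  unfolding rapid_def
proof (intro allI)
  fix r :: nat
  from x obtain C where C: "\<And>m. (1 + norm (lat m)) ^ (r + s) * cmod (x m) \<le> C"
    unfolding rapid_def by metis
  have B0: "0 \<le> B"
    using order_trans[OF norm_ge_zero B[of 0]] by (simp add: lat_def vec_eq_iff zero_vec_def[symmetric])
  have "(1 + norm (lat m)) ^ r * cmod (c m * x m) \<le> B * C" for m
  proof -
    have "(1 + norm (lat m)) ^ r * cmod (c m * x m)
        = cmod (c m) * ((1 + norm (lat m)) ^ r * cmod (x m))"
      by (simp add: norm_mult)
    also have "\<dots> \<le> (B * (1 + norm (lat m)) ^ s) * ((1 + norm (lat m)) ^ r * cmod (x m))"
      by (intro mult_right_mono B) simp
    also have "\<dots> = B * ((1 + norm (lat m)) ^ (r + s) * cmod (x m))"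
      by (simp add: power_add)
    also have "\<dots> \<le> B * C"
      using C B0 by (intro mult_left_mono)
    finally show ?thesis .
  qed
  then show "\<exists>C. \<forall>m. (1 + norm (lat m)) ^ r * cmod (c m * x m) \<le> C" by blast
qed

lemma rapid_cmult: "rapid x \<Longrightarrow> rapid (\<lambda>m. c * x m)"
  by (rule rapid_mult_bounded[where B = "cmod c" and s = 0]) auto

instantiation torus_fun :: real_vector
begin

lift_definition zero_torus_fun :: torus_fun is "\<lambda>_. 0"
  by (auto simp: rapid_def)
lift_definition plus_torus_fun :: "torus_fun \<Rightarrow> torus_fun \<Rightarrow> torus_fun" is "\<lambda>x y m. x m + y m"
  by (simp add: rapid_add)
lift_definition uminus_torus_fun :: "torus_fun \<Rightarrow> torus_fun" is "\<lambda>x m. - x m"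
  by (simp add: rapid_def)
lift_definition minus_torus_fun :: "torus_fun \<Rightarrow> torus_fun \<Rightarrow> torus_fun" is "\<lambda>x y m. x m - y m"
  subgoal premises p for x y
    using rapid_add[OF p(1) rapid_cmult[OF p(2), of "-1"]] by simp
  done
lift_definition scaleR_torus_fun :: "real \<Rightarrow> torus_fun \<Rightarrow> torus_fun" is "\<lambda>c x m. of_real c * x m"
  by (rule rapid_cmult)

instance
  by standard (transfer; force simp: algebra_simps)+

end

lift_definition scaleC :: "complex \<Rightarrow> torus_fun \<Rightarrow> torus_fun" is "\<lambda>c x m. c * x m"
  by (rule rapid_cmult)

lift_definition U :: "int^4 \<Rightarrow> torus_fun" is "\<lambda>m p. if p = m then 1 else 0"
  unfolding rapid_def
proof (intro allI)
  fix m :: "int^4" and r :: nat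
  show "\<exists>C. \<forall>p. (1 + norm (lat p)) ^ r * cmod (if p = m then 1 else 0) \<le> C"
    by (rule exI[of _ "(1 + norm (lat m)) ^ r"]) auto
qed

text \<open>Inner product of \<open>L\<^sup>2(T\<^sub>\<theta>,\<tau>)\<close>, and the one of \<open>L\<^sup>2(T\<^sub>\<theta>,\<tau>) \<otimes> C\<^sup>4\<close>.\<close>

definition ip :: "torus_fun \<Rightarrow> torus_fun \<Rightarrow> complex"
  where "ip x y = (\<Sum>\<^sub>\<infinity>m. cnj (coeff x m) * coeff y m)"

definition ip4 :: "torus_fun^4 \<Rightarrow> torus_fun^4 \<Rightarrow> complex"
  where "ip4 \<psi> \<phi> = (\<Sum>i\<in>UNIV. ip (\<psi> $ i) (\<phi> $ i))"

definition l2norm :: "torus_fun \<Rightarrow> real"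
  where "l2norm x = sqrt (Re (ip x x))"


section \<open>Operators\<close>

text \<open>
  Complex linear operators on the smooth vectors, as a ring under composition. Operators on
  smooth vectors tensored with \<open>C\<^sup>4\<close> are the 4 by 4 matrices over this ring, composed by \<open>**\<close>.
\<close>

typedef endo = "{f :: torus_fun \<Rightarrow> torus_fun.
    (\<forall>x y. f (x + y) = f x + f y) \<and> (\<forall>c x. f (scaleC c x) = scaleC c (f x))}"
  morphisms app Abs_endo
  by (rule exI[of _ id]) auto

setup_lifting type_definition_endo

lemma scaleC_add: "scaleC c (x + y) = scaleC c x + scaleC c y"
  by transfer (simp add: algebra_simps)

lemma scaleC_diff: "scaleC c (x - y) = scaleC c x - scaleC c y"
  by transfer (simp add: algebra_simps)

lemma scaleC_minus: "scaleC c (- x) = - scaleC c x"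
  by transfer simp

lemma scaleC_zero: "scaleC c 0 = 0"
  by transfer simp

lemma scaleC_scaleC: "scaleC c (scaleC d x) = scaleC (c * d) x"
  by transfer (simp add: algebra_simps)

lemma scaleR_scaleC: "r *\<^sub>R x = scaleC (of_real r) x"
  by transfer simp

lemma scaleC_commute: "scaleC c (scaleC d x) = scaleC d (scaleC c x)"
  by (simp add: scaleC_scaleC mult.commute)

lemma app_scaleR: "app T (r *\<^sub>R x) = r *\<^sub>R app T x"
  unfolding scaleR_scaleC by transfer simp

instantiation endo :: real_algebra_1
begin

lift_definition zero_endo :: endo is "\<lambda>_. 0" by (simp add: scaleC_zero)
lift_definition one_endo :: endo is "\<lambda>x. x" by simp
lift_definition plus_endo :: "endo \<Rightarrow> endo \<Rightarrow> endo" is "\<lambda>S T x. S x + T x"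
  by (simp add: scaleC_add)
lift_definition uminus_endo :: "endo \<Rightarrow> endo" is "\<lambda>T x. - T x"
  by (simp add: scaleC_minus)
lift_definition minus_endo :: "endo \<Rightarrow> endo \<Rightarrow> endo" is "\<lambda>S T x. S x - T x"
  by (simp add: scaleC_diff)
lift_definition times_endo :: "endo \<Rightarrow> endo \<Rightarrow> endo" is "\<lambda>S T x. S (T x)" by simp
lift_definition scaleR_endo :: "real \<Rightarrow> endo \<Rightarrow> endo" is "\<lambda>r T x. r *\<^sub>R T x"
  by (simp add: scaleR_add_right) (simp add: scaleR_scaleC scaleC_commute)

instance
proof
  fix a b c :: endo and r s :: real
  show "a + b + c = a + (b + c)" by transfer (simp add: add.assoc)
  show "a + b = b + a" by transfer (simp add: add.commute)
  show "0 + a = a" by transfer simp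
  show "- a + a = 0" by transfer simp
  show "a - b = a + - b" by transfer simp
  show "a * b * c = a * (b * c)" by transfer simp
  show "1 * a = a" by transfer simp
  show "a * 1 = a" by transfer simp
  show "(a + b) * c = a * c + b * c" by transfer simp
  show "a * (b + c) = a * b + a * c" by transfer simp
  show "r *\<^sub>R (a + b) = r *\<^sub>R a + r *\<^sub>R b" by transfer (simp add: scaleR_add_right)
  show "(r + s) *\<^sub>R a = r *\<^sub>R a + s *\<^sub>R a" by transfer (simp add: scaleR_add_left)
  show "r *\<^sub>R s *\<^sub>R a = (r * s) *\<^sub>R a" by transfer simp
  show "1 *\<^sub>R a = a" by transfer simp
  show "r *\<^sub>R a * b = r *\<^sub>R (a * b)" by transfer simp
  show "a * r *\<^sub>R b = r *\<^sub>R (a * b)" by transfer (simp add: scaleR_scaleC)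
  show "(0::endo) \<noteq> 1"
  proof
    assume "(0::endo) = 1"
    then have "app 0 (U 0) = app 1 (U 0)" by simp
    then have "coeff (U 0) 0 = 0"
      by (simp add: zero_endo.rep_eq one_endo.rep_eq zero_torus_fun.rep_eq[symmetric])
        (metis zero_torus_fun.rep_eq)
    then show False by (simp add: U.rep_eq)
  qed
qed

end

instantiation endo :: inverse
begin
definition inverse_endo :: "endo \<Rightarrow> endo"
  where "inverse_endo T = (THE S. S * T = 1 \<and> T * S = 1)"
definition divide_endo :: "endo \<Rightarrow> endo \<Rightarrow> endo"
  where "divide_endo S T = S * inverse T"
instance ..
end

lift_definition scalar :: "complex \<Rightarrow> endo" is "scaleC"
  by (simp add: scaleC_add scaleC_commute)

definition app4 :: "endo^4^4 \<Rightarrow> torus_fun^4 \<Rightarrow> torus_fun^4"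
  where "app4 P \<psi> = (\<chi> i. \<Sum>j\<in>UNIV. app (P $ i $ j) (\<psi> $ j))"

definition positive_op :: "endo \<Rightarrow> bool"
  where "positive_op T \<longleftrightarrow> (\<forall>x. ip x (app T x) \<in> \<real>\<^sub>\<ge>\<^sub>0)"

text \<open>Norm of an operator on the Hilbert space, infinite for unbounded operators.\<close>

definition opnorm :: "endo \<Rightarrow> ennreal"
  where "opnorm T = (SUP x\<in>{x. l2norm x \<le> 1}. ennreal (l2norm (app T x)))"

lemma cmod_lat_le: "\<bar>real_of_int (m $ a)\<bar> \<le> norm (lat m)"
  using component_le_norm_cart[of "lat m" a] by (simp add: lat_def)

text \<open>The basic derivations, as operators on vectors and extended to operators as commutators.\<close>

lift_definition fourier_deriv :: "4 \<Rightarrow> torus_fun \<Rightarrow> torus_fun" is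
  "\<lambda>a x m. \<i> * of_int (m $ a) * x m"
proof (rule rapid_mult_bounded[where B = 1 and s = 1])
  show "cmod (\<i> * of_int (m $ a)) \<le> 1 * (1 + norm (lat m)) ^ 1" for a m
    using cmod_lat_le[of m a] by (simp add: norm_mult)
qed

lift_definition \<delta>op :: "4 \<Rightarrow> endo" is fourier_deriv
  by (intro conjI allI; transfer; simp add: algebra_simps)

definition \<delta> :: "4 \<Rightarrow> endo \<Rightarrow> endo"
  where "\<delta> a T = \<delta>op a * T - T * \<delta>op a"

definition laplacian :: "endo \<Rightarrow> endo"
  where "laplacian T = (\<Sum>c\<in>UNIV. \<delta> c (\<delta> c T))"


section \<open>The noncommutative torus\<close>

text \<open>
  The monomials satisfy \<open>U\<^sup>l U\<^sup>n = exp (\<pi> \<i> \<theta>(l,n)) U\<^sup>l\<^sup>+\<^sup>n\<close>; for antisymmetric \<open>\<theta>\<close> they are unitary and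
  \<open>U\<^sub>a U\<^sub>b = exp (2 \<pi> \<i> \<theta>\<^sub>a\<^sub>b) U\<^sub>b U\<^sub>a\<close>.
\<close>

definition twist :: "real^4^4 \<Rightarrow> int^4 \<Rightarrow> int^4 \<Rightarrow> complex"
  where "twist \<theta> l n = cis (pi * (\<Sum>a\<in>UNIV. \<Sum>b\<in>UNIV. \<theta> $ a $ b * of_int (l $ a) * of_int (n $ b)))"

definition twisted_conv :: "real^4^4 \<Rightarrow> (int^4 \<Rightarrow> complex) \<Rightarrow> (int^4 \<Rightarrow> complex) \<Rightarrow> int^4 \<Rightarrow> complex"
  where "twisted_conv \<theta> x y p = (\<Sum>\<^sub>\<infinity>l. x l * y (p - l) * twist \<theta> l (p - l))"

lemma norm_twist [simp]: "cmod (twist \<theta> l n) = 1"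
  by (simp add: twist_def)

lemma bounded_sum_int:
  obtains B :: real where "\<And>S :: int set. finite S \<Longrightarrow> (\<Sum>n\<in>S. 1 / (1 + (of_int n)\<^sup>2)) \<le> B"
proof
  fix S :: "int set"
  assume S: "finite S"
  let ?f = "\<lambda>n::int. 1 / (1 + (of_int n)\<^sup>2) :: real"
  let ?g = "\<lambda>n::nat. 1 / (1 + (of_nat n)\<^sup>2) :: real"
  have sg: "summable ?g"
  proof (rule summable_comparison_test)
    show "summable (\<lambda>n. inverse ((real n)\<^sup>2))"
      by (rule inverse_power_summable) simp
    show "\<exists>N. \<forall>n\<ge>N. norm (?g n) \<le> inverse ((real n)\<^sup>2)"
    proof (intro exI[of _ 1] allI impI)
      fix n :: nat
      assume "1 \<le> n"
      then have "0 < (real n)\<^sup>2" by simp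
      then have "1 / (1 + (real n)\<^sup>2) \<le> 1 / (real n)\<^sup>2"
        by (intro divide_left_mono) (auto intro!: mult_pos_pos add_pos_nonneg)
      then show "norm (?g n) \<le> inverse ((real n)\<^sup>2)"
        by (simp add: inverse_eq_divide)
    qed
  qed
  obtain N where N: "\<forall>n\<in>S. nat \<bar>n\<bar> \<le> N"
    using finite_nat_set_iff_bounded_le[of "(\<lambda>n. nat \<bar>n\<bar>) ` S"] S by auto
  have sub: "S \<subseteq> int ` {..N} \<union> (\<lambda>k. - int k) ` {..N}"
  proof
    fix n assume "n \<in> S"
    then have "nat \<bar>n\<bar> \<le> N" using N by blast
    then show "n \<in> int ` {..N} \<union> (\<lambda>k. - int k) ` {..N}"
      by (cases "n \<ge> 0") (auto intro: image_eqI[of _ _ "nat \<bar>n\<bar>"])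
  qed
  have "sum ?f S \<le> sum ?f (int ` {..N} \<union> (\<lambda>k. - int k) ` {..N})"
    using sub by (intro sum_mono2) auto
  also have "\<dots> \<le> sum ?f (int ` {..N}) + sum ?f ((\<lambda>k. - int k) ` {..N})"
    by (subst sum_Un) (auto intro!: sum_nonneg)
  also have "\<dots> = 2 * sum ?g {..N}"
    by (subst (1 2) sum.reindex) (auto simp: inj_on_def)
  also have "\<dots> \<le> 2 * suminf ?g"
    using sum_le_suminf[OF sg, of "{..N}"] by auto
  finally show "sum ?f S \<le> 2 * suminf ?g" .
qed

lemma rapid_summable:
  assumes "rapid x"
  shows "(\<lambda>m. cmod (x m)) summable_on UNIV"
proof -
  obtain B :: real where B: "\<And>S :: int set. finite S \<Longrightarrow> (\<Sum>n\<in>S. 1 / (1 + (of_int n)\<^sup>2)) \<le> B"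
    using bounded_sum_int by blast
  obtain C where C: "\<And>m. (1 + norm (lat m)) ^ 8 * cmod (x m) \<le> C"
    using assms unfolding rapid_def by metis
  have C0: "0 \<le> C"
    using order_trans[OF _ C[of 0]] by simp
  let ?w = "\<lambda>m::int^4. \<Prod>a\<in>UNIV. 1 / (1 + (real_of_int (m $ a))\<^sup>2)"
  have bd: "cmod (x m) \<le> C * ?w m" for m
  proof -
    have "(\<Prod>a\<in>(UNIV::4 set). 1 + (real_of_int (m $ a))\<^sup>2) \<le> (\<Prod>a\<in>(UNIV::4 set). (1 + norm (lat m))\<^sup>2)"
    proof (intro prod_mono conjI)
      fix a :: 4
      have "(real_of_int (m $ a))\<^sup>2 \<le> (norm (lat m))\<^sup>2"
        using cmod_lat_le[of m a] by (metis abs_ge_zero power2_abs power_mono)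
      then show "1 + (real_of_int (m $ a))\<^sup>2 \<le> (1 + norm (lat m))\<^sup>2"
        using norm_ge_zero[of "lat m"] by (simp add: power2_sum del: norm_ge_zero)
    qed simp
    also have "\<dots> = (1 + norm (lat m)) ^ 8"
      by (simp add: power_mult[symmetric])
    finally have p: "(\<Prod>a\<in>(UNIV::4 set). 1 + (real_of_int (m $ a))\<^sup>2) \<le> (1 + norm (lat m)) ^ 8" .
    have pos: "0 < (\<Prod>a\<in>(UNIV::4 set). 1 + (real_of_int (m $ a))\<^sup>2)"
      by (intro prod_pos) (simp add: add_pos_nonneg)
    have "(\<Prod>a\<in>(UNIV::4 set). 1 + (real_of_int (m $ a))\<^sup>2) * cmod (x m)
        \<le> (1 + norm (lat m)) ^ 8 * cmod (x m)"
      using p by (rule mult_right_mono) simp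
    then have "cmod (x m) * (\<Prod>a\<in>(UNIV::4 set). 1 + (real_of_int (m $ a))\<^sup>2) \<le> C"
      using C[of m] by (simp only: mult.commute)
    then have "cmod (x m) \<le> C / (\<Prod>a\<in>(UNIV::4 set). 1 + (real_of_int (m $ a))\<^sup>2)"
      using pos by (simp only: pos_le_divide_eq)
    then show ?thesis
      by (simp add: prod_dividef)
  qed
  show ?thesis
  proof (rule nonneg_bdd_above_summable_on)
    show "bdd_above (sum (\<lambda>m. cmod (x m)) ` {F. F \<subseteq> UNIV \<and> finite F})"
    proof (rule bdd_aboveI2)
      fix F :: "(int^4) set"
      assume "F \<in> {F. F \<subseteq> UNIV \<and> finite F}"
      then have F: "finite F" by simp
      let ?S = "(\<Union>a\<in>UNIV. (\<lambda>m. m $ a) ` F)"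
      have fS: "finite ?S" using F by simp
      have "(\<Sum>m\<in>F. ?w m) = (\<Sum>g\<in>(($) ` F). \<Prod>a\<in>UNIV. 1 / (1 + (real_of_int (g a))\<^sup>2))"
        by (subst sum.reindex) (auto simp: inj_on_def vec_eq_iff)
      also have "\<dots> \<le> (\<Sum>g\<in>PiE UNIV (\<lambda>_::4. ?S). \<Prod>a\<in>UNIV. 1 / (1 + (real_of_int (g a))\<^sup>2))"
        using fS by (intro sum_mono2 finite_PiE) (auto intro!: prod_nonneg)
      also have "\<dots> = (\<Prod>a\<in>(UNIV::4 set). \<Sum>n\<in>?S. 1 / (1 + (real_of_int n)\<^sup>2))"
        using fS by (subst prod_sum_PiE) auto
      also have "\<dots> \<le> (\<Prod>a\<in>(UNIV::4 set). B)"
        using B[OF fS] by (intro prod_mono) (auto intro!: sum_nonneg)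
      finally have w: "(\<Sum>m\<in>F. ?w m) \<le> B ^ 4" by simp
      have "(\<Sum>m\<in>F. cmod (x m)) \<le> (\<Sum>m\<in>F. C * ?w m)"
        by (intro sum_mono bd)
      also have "\<dots> \<le> C * B ^ 4"
        using w C0 by (simp add: sum_distrib_left[symmetric] mult_left_mono)
      finally show "(\<Sum>m\<in>F. cmod (x m)) \<le> C * B ^ 4" .
    qed
  qed simp
qed

lemma rapid_imp_bounded: "rapid x \<Longrightarrow> \<exists>C. \<forall>m. cmod (x m) \<le> C"
  unfolding rapid_def by (drule spec[of _ 0]) simp

lemma twisted_conv_abs_summable:
  assumes "rapid x" "rapid y"
  shows "(\<lambda>l. cmod (x l * y (p - l) * twist \<theta> l (p - l))) summable_on UNIV"
proof -
  obtain C where C: "\<And>m. cmod (y m) \<le> C"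
    using rapid_imp_bounded[OF assms(2)] by blast
  show ?thesis
  proof (rule summable_on_comparison_test)
    show "(\<lambda>l. C * cmod (x l)) summable_on UNIV"
      using rapid_summable[OF assms(1)] by (rule summable_on_cmult_right)
    show "cmod (x l * y (p - l) * twist \<theta> l (p - l)) \<le> C * cmod (x l)" for l
      using mult_right_mono[OF C[of "p - l"], of "cmod (x l)"] by (simp add: norm_mult mult.commute)
  qed simp
qed

lemmas twisted_conv_summable = abs_summable_summable[OF twisted_conv_abs_summable]

lemma lat_add: "lat (m + n) = lat m + lat n"
  by (simp add: lat_def vec_eq_iff)

lemma rapid_twisted_conv:
  assumes x: "rapid x" and y: "rapid y"
  shows "rapid (twisted_conv \<theta> x y)"
  unfolding rapid_def
proof
  fix r :: nat
  obtain C where C: "\<And>m. (1 + norm (lat m)) ^ r * cmod (y m) \<le> C"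
    using y unfolding rapid_def by metis
  let ?x = "\<lambda>l. complex_of_real ((1 + norm (lat l)) ^ r) * x l"
  have rx: "rapid ?x"
    by (rule rapid_mult_bounded[OF x, where B = 1 and s = r]) (simp add: norm_power abs_of_nonneg del: of_real_power)
  have sx: "(\<lambda>l. cmod (?x l)) summable_on UNIV"
    by (rule rapid_summable[OF rx])
  have "(1 + norm (lat p)) ^ r * cmod (twisted_conv \<theta> x y p) \<le> (\<Sum>\<^sub>\<infinity>l. C * cmod (?x l))" for p
  proof -
    have "(1 + norm (lat p)) ^ r * cmod (twisted_conv \<theta> x y p)
        \<le> (1 + norm (lat p)) ^ r * (\<Sum>\<^sub>\<infinity>l. cmod (x l * y (p - l) * twist \<theta> l (p - l)))"
      unfolding twisted_conv_def
      by (intro mult_left_mono norm_infsum_bound twisted_conv_abs_summable[OF x y]) simp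
    also have "\<dots> = (\<Sum>\<^sub>\<infinity>l. (1 + norm (lat p)) ^ r * cmod (x l * y (p - l) * twist \<theta> l (p - l)))"
      by (rule infsum_cmult_right[symmetric]) (rule twisted_conv_abs_summable[OF x y])
    also have "\<dots> \<le> (\<Sum>\<^sub>\<infinity>l. C * cmod (?x l))"
    proof (rule infsum_mono)
      show "(\<lambda>l. (1 + norm (lat p)) ^ r * cmod (x l * y (p - l) * twist \<theta> l (p - l))) summable_on UNIV"
        by (intro summable_on_cmult_right twisted_conv_abs_summable[OF x y])
      show "(\<lambda>l. C * cmod (?x l)) summable_on UNIV"
        by (intro summable_on_cmult_right sx)
      fix l
      have "norm (lat p) \<le> norm (lat l) + norm (lat (p - l))"
        using norm_triangle_ineq[of "lat l" "lat (p - l)"] by (simp add: lat_add[symmetric])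
      moreover have "(1 + norm (lat l)) * (1 + norm (lat (p - l)))
          = 1 + norm (lat l) + norm (lat (p - l)) + norm (lat l) * norm (lat (p - l))"
        by (simp add: algebra_simps)
      moreover have "0 \<le> norm (lat l) * norm (lat (p - l))" by simp
      ultimately have "1 + norm (lat p) \<le> (1 + norm (lat l)) * (1 + norm (lat (p - l)))"
        by linarith
      then have "(1 + norm (lat p)) ^ r \<le> ((1 + norm (lat l)) * (1 + norm (lat (p - l)))) ^ r"
        by (rule power_mono) simp
      then have "(1 + norm (lat p)) ^ r * (cmod (x l) * cmod (y (p - l)))
          \<le> ((1 + norm (lat l)) * (1 + norm (lat (p - l)))) ^ r * (cmod (x l) * cmod (y (p - l)))"
        by (rule mult_right_mono) simp
      also have "\<dots> = ((1 + norm (lat (p - l))) ^ r * cmod (y (p - l))) * ((1 + norm (lat l)) ^ r * cmod (x l))"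
        by (simp only: power_mult_distrib mult_ac)
      also have "\<dots> \<le> C * ((1 + norm (lat l)) ^ r * cmod (x l))"
        by (intro mult_right_mono C) simp
      finally show "(1 + norm (lat p)) ^ r * cmod (x l * y (p - l) * twist \<theta> l (p - l)) \<le> C * cmod (?x l)"
        by (simp add: norm_mult abs_of_nonneg del: of_real_power)
    qed
    finally show ?thesis .
  qed
  then show "\<exists>C. \<forall>m. (1 + norm (lat m)) ^ r * cmod (twisted_conv \<theta> x y m) \<le> C" by blast
qed

lift_definition tmult :: "real^4^4 \<Rightarrow> torus_fun \<Rightarrow> torus_fun \<Rightarrow> torus_fun" is twisted_conv
  by (rule rapid_twisted_conv)

lift_definition lmult :: "real^4^4 \<Rightarrow> torus_fun \<Rightarrow> endo" is "\<lambda>\<theta> a x. tmult \<theta> a x"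
proof (intro conjI allI; transfer)
  fix \<theta> a x y and c :: complex
  assume r: "rapid a" "rapid x"
  show "twisted_conv \<theta> a (\<lambda>m. c * x m) = (\<lambda>m. c * twisted_conv \<theta> a x m)"
    unfolding twisted_conv_def
    by (subst infsum_cmult_right[symmetric, OF twisted_conv_summable[OF r]]) (simp add: mult_ac)
  assume y: "rapid y"
  show "twisted_conv \<theta> a (\<lambda>m. x m + y m) = (\<lambda>m. twisted_conv \<theta> a x m + twisted_conv \<theta> a y m)"
    unfolding twisted_conv_def
    by (subst infsum_add[symmetric, OF twisted_conv_summable[OF r] twisted_conv_summable[OF r(1) y]])
      (simp add: algebra_simps)
qed

lift_definition rmult :: "real^4^4 \<Rightarrow> torus_fun \<Rightarrow> endo" is "\<lambda>\<theta> b x. tmult \<theta> x b"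
proof (intro conjI allI; transfer)
  fix \<theta> b x y and c :: complex
  assume r: "rapid b" "rapid x"
  show "twisted_conv \<theta> (\<lambda>m. c * x m) b = (\<lambda>m. c * twisted_conv \<theta> x b m)"
    unfolding twisted_conv_def
    by (subst infsum_cmult_right[symmetric, OF twisted_conv_summable[OF r(2,1)]]) (simp add: mult_ac)
  assume y: "rapid y"
  show "twisted_conv \<theta> (\<lambda>m. x m + y m) b = (\<lambda>m. twisted_conv \<theta> x b m + twisted_conv \<theta> y b m)"
    unfolding twisted_conv_def
    by (subst infsum_add[symmetric, OF twisted_conv_summable[OF r(2,1)] twisted_conv_summable[OF y r(1)]])
      (simp add: algebra_simps)
qed

text \<open>The smooth algebra, acting by left multiplication, and its copy \<open>J A J\<close>, where \<open>J x = x\<^sup>*\<close>,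
  which consists of the right multiplications.\<close>

definition alg :: "real^4^4 \<Rightarrow> endo set"
  where "alg \<theta> = range (lmult \<theta>)"

definition alg_op :: "real^4^4 \<Rightarrow> endo set"
  where "alg_op \<theta> = range (rmult \<theta>)"

definition strictly_irrational :: "real^4^4 \<Rightarrow> bool"
  where "strictly_irrational \<theta> \<longleftrightarrow> {S \<in> alg \<theta>. \<forall>T\<in>alg \<theta>. S * T = T * S} = range scalar"

inductive_set alg_hat :: "real^4^4 \<Rightarrow> endo set" for \<theta> where
  left: "S \<in> alg \<theta> \<Longrightarrow> S \<in> alg_hat \<theta>"
| right: "S \<in> alg_op \<theta> \<Longrightarrow> S \<in> alg_hat \<theta>"
| scale: "S \<in> alg_hat \<theta> \<Longrightarrow> scalar c * S \<in> alg_hat \<theta>"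
| add: "S \<in> alg_hat \<theta> \<Longrightarrow> T \<in> alg_hat \<theta> \<Longrightarrow> S + T \<in> alg_hat \<theta>"
| mult: "S \<in> alg_hat \<theta> \<Longrightarrow> T \<in> alg_hat \<theta> \<Longrightarrow> S * T \<in> alg_hat \<theta>"

text \<open>
  The factorized trace on \<open>alg_hat \<theta>\<close>: the normalised trace of the torus is the coefficient of
  \<open>U\<^sup>0 = 1\<close>. As the two algebras commute, every element is a sum of products as below; the value does
  not depend on the choice of that sum when \<open>\<theta>\<close> is strictly irrational.
\<close>

definition tau :: "real^4^4 \<Rightarrow> endo \<Rightarrow> complex"
  where "tau \<theta> T = (THE z. \<exists>(n::nat) a b. T = (\<Sum>i<n. lmult \<theta> (a i) * rmult \<theta> (b i)) \<and>
                        z = (\<Sum>i<n. coeff (a i) 0 * coeff (b i) 0))"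


section \<open>Symbols and the Wodzicki residue\<close>

text \<open>
  Smooth functions on the complement of the origin with values in \<open>alg_hat \<theta>\<close>, whose topology is given
  by the seminorms \<open>\<lambda>T. \<parallel>\<delta>\<^sup>\<alpha>(T)\<parallel>\<close>: all iterated partial derivatives \<open>F \<beta>\<close> (\<open>\<beta>\<close> the list of directions)
  exist, have values in \<open>alg_hat \<theta>\<close> and are Frechet differentiable.
\<close>

definition smooth_off_0 :: "real^4^4 \<Rightarrow> (real^4 \<Rightarrow> endo) \<Rightarrow> bool"
  where "smooth_off_0 \<theta> f \<longleftrightarrow> (\<exists>F :: 4 list \<Rightarrow> real^4 \<Rightarrow> endo. F [] = f \<and>
     (\<forall>\<beta>. \<forall>\<xi>. \<xi> \<noteq> 0 \<longrightarrow> F \<beta> \<xi> \<in> alg_hat \<theta> \<and>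
       (\<forall>\<alpha>. ((\<lambda>\<eta>. opnorm (fold \<delta> \<alpha> (F \<beta> \<eta> - F \<beta> \<xi> - (\<Sum>a\<in>UNIV. (\<eta> $ a - \<xi> $ a) *\<^sub>R F (a # \<beta>) \<xi>)))
                    / ennreal (norm (\<eta> - \<xi>))) \<longlongrightarrow> 0) (at \<xi>))))"

definition homogeneous_symbol :: "real^4^4 \<Rightarrow> int \<Rightarrow> (real^4 \<Rightarrow> endo^4^4) \<Rightarrow> bool"
  where "homogeneous_symbol \<theta> l \<sigma> \<longleftrightarrow>
     (\<forall>i j. smooth_off_0 \<theta> (\<lambda>\<xi>. \<sigma> \<xi> $ i $ j)) \<and>
     (\<forall>t>0. \<forall>\<xi>. \<xi> \<noteq> 0 \<longrightarrow> \<sigma> (t *\<^sub>R \<xi>) = (t powi l) *\<^sub>R \<sigma> \<xi>)"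

text \<open>
  \<open>P\<close> is a classical pseudodifferential operator of order at most \<open>d\<close> with homogeneous components
  \<open>\<sigma> l\<close> of degree \<open>l\<close>. The operator with symbol \<open>\<rho>\<close> acts by \<open>U\<^sup>m \<otimes> e \<mapsto> \<rho>(m)(U\<^sup>m \<otimes> e)\<close>, so that \<open>\<delta>\<^sub>a\<close> has
  symbol \<open>\<i> \<xi>\<^sub>a\<close>, elements of \<open>alg_hat \<theta>\<close> are their own symbols, and expanding \<open>\<rho>(m + p)\<close> around \<open>m\<close>, where \<open>p\<close>
  is the frequency detected by the derivations, gives the composition formula
  \<open>\<sigma>(PQ) = \<Sum>\<beta>. (-\<i>)\<^sup>|\<^sup>\<beta>\<^sup>| / \<beta>! \<partial>\<^sup>\<beta>\<sigma>(P) \<delta>\<^sup>\<beta>\<sigma>(Q)\<close>. The remainder after \<open>N\<close> terms has to be of order \<open>d - N\<close>,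
  uniformly for all derivatives of the symbol along the torus; the latter are expressed by the rapid
  decay in \<open>p\<close> of the coefficients of \<open>U\<^sup>m\<^sup>+\<^sup>p\<close>. Smoothing operators, in particular those of finite rank
  such as the projection onto the kernel of a Dirac operator, do not affect \<open>\<sigma>\<close>.
\<close>

definition has_classical_symbol ::
    "real^4^4 \<Rightarrow> int \<Rightarrow> endo^4^4 \<Rightarrow> (int \<Rightarrow> real^4 \<Rightarrow> endo^4^4) \<Rightarrow> bool"
  where "has_classical_symbol \<theta> d P \<sigma> \<longleftrightarrow>
     (\<forall>l. homogeneous_symbol \<theta> l (\<sigma> l)) \<and> (\<forall>l>d. \<sigma> l = (\<lambda>_. 0)) \<and>
     (\<forall>(N::nat) (r::nat). \<exists>C. \<forall>m. m \<noteq> 0 \<longrightarrow> (\<forall>p i j.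
        (1 + norm (lat p)) ^ r *
        cmod (coeff (app (P $ i $ j - (\<Sum>l\<in>{d - int N<..d}. \<sigma> l (lat m) $ i $ j)) (U m)) (m + p))
        \<le> C * norm (lat m) powi (d - int N)))"

text \<open>Surface measure of the unit sphere: the measure of a set is 4 times the volume of the cone over it.\<close>

definition sphere_measure :: "(real^4) measure"
  where "sphere_measure =
     distr (density lborel (\<lambda>x. 4 * indicator (ball 0 1 - {0}) x)) borel (\<lambda>x. x /\<^sub>R norm x)"

text \<open>Integral of an operator-valued function, coefficientwise.\<close>

definition sphere_integral :: "(real^4 \<Rightarrow> endo) \<Rightarrow> endo"
  where "sphere_integral f =
     Abs_endo (\<lambda>x. Abs_torus_fun (\<lambda>m. \<integral>\<xi>. coeff (app (f \<xi>) x) m \<partial>sphere_measure))"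

definition wres :: "real^4^4 \<Rightarrow> endo^4^4 \<Rightarrow> complex"
  where "wres \<theta> P = (THE w. \<exists>d \<sigma>. has_classical_symbol \<theta> d P \<sigma> \<and>
     w = 1 / (4 * (2 * of_real pi ^ 2)) * tau \<theta> (sphere_integral (\<lambda>\<xi>. trace (\<sigma> (-4) \<xi>))))"


section \<open>Dirac operators and the functionals\<close>

definition flat_dirac :: "(4 \<Rightarrow> complex^4^4) \<Rightarrow> endo^4^4"
  where "flat_dirac \<gamma> = (\<chi> i j. \<Sum>a\<in>UNIV. scalar (- \<i> * \<gamma> a $ i $ j) * \<delta>op a)"

definition conformal_dirac :: "(4 \<Rightarrow> complex^4^4) \<Rightarrow> endo \<Rightarrow> endo^4^4"
  where "conformal_dirac \<gamma> k = mat k ** flat_dirac \<gamma> ** mat k"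

text \<open>The one-form \<open>k\<^sup>2 V\<^sup>a \<gamma>\<^sup>a\<close>.\<close>

definition one_form :: "(4 \<Rightarrow> complex^4^4) \<Rightarrow> endo \<Rightarrow> (4 \<Rightarrow> endo) \<Rightarrow> endo^4^4"
  where "one_form \<gamma> k V = (\<chi> i j. \<Sum>a\<in>UNIV. k ^ 2 * V a * scalar (\<gamma> a $ i $ j))"

text \<open>The operator that vanishes on the kernel of \<open>P\<close> and inverts \<open>P\<close> on the orthogonal complement of
  its kernel (for symmetric \<open>P\<close> with closed range).\<close>

definition ker_perp :: "endo^4^4 \<Rightarrow> (torus_fun^4) set"
  where "ker_perp P = {\<psi>. \<forall>\<phi>. app4 P \<phi> = 0 \<longrightarrow> ip4 \<phi> \<psi> = 0}"

definition inverse_off_kernel :: "endo^4^4 \<Rightarrow> endo^4^4"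
  where "inverse_off_kernel P = (THE T. (\<forall>\<psi>. app4 P \<psi> = 0 \<longrightarrow> app4 T \<psi> = 0) \<and>
     (\<forall>\<psi>\<in>ker_perp P. app4 T \<psi> \<in> ker_perp P \<and> app4 P (app4 T \<psi>) = \<psi>))"

text \<open>\<open>|D|\<^sup>-\<^sup>4\<close> for a symmetric operator \<open>D\<close>, for which \<open>|D|\<^sup>4 = (D\<^sup>2)\<^sup>2\<close>.\<close>

definition abs_inv4 :: "endo^4^4 \<Rightarrow> endo^4^4"
  where "abs_inv4 D = inverse_off_kernel ((D ** D) ** (D ** D))"

definition metric_functional :: "real^4^4 \<Rightarrow> endo^4^4 \<Rightarrow> endo^4^4 \<Rightarrow> endo^4^4 \<Rightarrow> complex"
  where "metric_functional \<theta> D v w = wres \<theta> (v ** w ** abs_inv4 D)"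

definition einstein_functional :: "real^4^4 \<Rightarrow> endo^4^4 \<Rightarrow> endo^4^4 \<Rightarrow> endo^4^4 \<Rightarrow> complex"
  where "einstein_functional \<theta> D v w = wres \<theta> (v ** (D ** w + w ** D) ** D ** abs_inv4 D)"

end

theory Submission
  imports Defs "HOL-Analysis.Kronecker_Approximation_Theorem"
begin

text \<open>
  The operator \<open>|D\<^sub>k|\<^sup>-\<^sup>4\<close> is \<open>G\<^sup>4\<close>, where \<open>G\<close>, the inverse of \<open>D\<^sub>k\<close> off its kernel, is \<open>k\<^sup>-\<^sup>1 D\<^sup>-\<^sup>1 k\<^sup>-\<^sup>1\<close> up to the
  rank-one projection onto \<open>k\<^sup>-\<^sup>1 1\<close>. As \<open>D\<close> is of first order, \<open>D(\<sigma> U\<^sup>m) = (m\<^sub>a \<gamma>\<^sup>a \<sigma> + D(\<sigma>)) U\<^sup>m\<close> exactly, so the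
  symbol of \<open>D\<^sup>-\<^sup>1 P\<close> is obtained from that of \<open>P\<close> by a recursion involving neither \<open>\<xi>\<close>-derivatives nor a
  Taylor remainder. In the Einstein functional the anticommutator
  \<open>{D\<^sub>k, w} = 2 k\<^sup>3 W\<^sup>b (-\<i> \<delta>\<^sub>b) k + \<gamma>\<^sup>c \<gamma>\<^sup>b k (-\<i> \<delta>\<^sub>c(k\<^sup>2 W\<^sup>b)) k\<close> leaves \<open>k G\<^sup>3\<close> on its right, whose symbol is needed to
  second order: it is a sum of words in \<open>\<xi>\<^sub>a \<gamma>\<^sup>a\<close> and \<open>\<gamma>\<^sup>c\<close> tensored with words in \<open>k\<^sup>-\<^sup>1\<close> and its derivatives. The
  former are averaged over the sphere, and the latter reduced by cyclicity and integration by parts to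
  \<open>\<tau>(k\<^sup>-\<^sup>p (\<delta>\<^sub>a k) k\<^sup>q (\<delta>\<^sub>b k))\<close>.

  The symbol of an operator is unique since a homogeneous symbol of lower order at all lattice points
  vanishes by an almost periodicity argument, and the factorized trace is well defined by averaging over
  the characters of the lattice, none of which is trivial for a strictly irrational torus.
\<close>

section \<open>Operators on smooth vectors\<close>

text \<open>The factor \<open>k\<close> commutes with \<open>V a\<close> and \<open>W a\<close>, but
  not with its own derivatives, so words in \<open>k\<close>, its inverse \<open>K\<close> and
  \<open>-i \<delta> k\<close> keep their order until the trace is taken. Order count: since
  \<open>D_k G^4 = G^3\<close>, the operator in the Einstein functional has order -2. Degree -4
  therefore lies two steps below the leading symbol in the first-order part of the anticommutator,
  and one step below in its zeroth-order part. In the latter the derivative may also fall on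
  \<open>W\<close>. The three words concerned have the values -1, -3, -5 times a common one and the
  weights 1/2, -1, 1/2, so they cancel; this is why only \<open>V^a W^b\<close> is left. The words
  of each part have coefficients made from sphere moments of degree at most four. Every pair of
  derivatives is computed with \<open>-i \<delta>\<close>, which accounts for a global sign at the
  end. The constant \<open>8 pi^2\<close> is the matrix size 4 times the area \<open>2 pi^2\<close>
  of the sphere. The final formula contains second derivatives of \<open>k\<close>, the computation
  only products of first ones; the two are compared under the trace, not as operators.\<close>

lemma torus_fun_eqI: "(\<And>m. coeff x m = coeff y m) \<Longrightarrow> x = y"
  by (simp add: coeff_inject[symmetric] fun_eq_iff)

lemma endo_eqI: "(\<And>x. app S x = app T x) \<Longrightarrow> S = T"
  by (simp add: app_inject[symmetric] fun_eq_iff)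

lemma rapid_coeff: "rapid (coeff x)"
  using coeff by blast

lemmas coeff_simps [simp] = zero_torus_fun.rep_eq plus_torus_fun.rep_eq uminus_torus_fun.rep_eq
  minus_torus_fun.rep_eq scaleR_torus_fun.rep_eq scaleC.rep_eq fourier_deriv.rep_eq

lemma coeff_sum [simp]: "coeff (sum f A) m = (\<Sum>i\<in>A. coeff (f i) m)"
  by (induction A rule: infinite_finite_induct) auto

lemmas app_simps [simp] = zero_endo.rep_eq one_endo.rep_eq plus_endo.rep_eq uminus_endo.rep_eq
  minus_endo.rep_eq times_endo.rep_eq scaleR_endo.rep_eq scalar.rep_eq \<delta>op.rep_eq
  lmult.rep_eq rmult.rep_eq

lemma app_sum [simp]: "app (sum f A) x = (\<Sum>i\<in>A. app (f i) x)"
  by (induction A rule: infinite_finite_induct) auto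

lemma app_add_vec [simp]: "app T (x + y) = app T x + app T y"
  by transfer simp

lemma app_scaleC [simp]: "app T (scaleC c x) = scaleC c (app T x)"
  by transfer simp

lemma app_zero_vec [simp]: "app T 0 = 0"
  using app_scaleC[of T 0 0] by (simp add: torus_fun_eqI[of "scaleC 0 _" 0])

lemma app_minus_vec [simp]: "app T (- x) = - app T x"
  using app_add_vec[of T "- x" x] by (simp add: eq_neg_iff_add_eq_0)

lemma app_diff_vec [simp]: "app T (x - y) = app T x - app T y"
  using app_add_vec[of T x "- y"] by simp

lemma app_sum_vec [simp]: "app T (sum f A) = (\<Sum>i\<in>A. app T (f i))"
  by (induction A rule: infinite_finite_induct) auto

lemma scaleC_one [simp]: "scaleC 1 x = x"
  by (rule torus_fun_eqI) simp

lemma scaleC_0_left [simp]: "scaleC 0 x = 0"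
  by (rule torus_fun_eqI) simp

lemma scalar_0 [simp]: "scalar 0 = 0"
  by (rule endo_eqI) simp

lemma scalar_1 [simp]: "scalar 1 = 1"
  by (rule endo_eqI) simp

lemma scalar_add: "scalar (a + b) = scalar a + scalar b"
  by (intro endo_eqI torus_fun_eqI) (simp add: algebra_simps)

lemma scalar_minus: "scalar (- a) = - scalar a"
  by (intro endo_eqI torus_fun_eqI) simp

lemma scalar_diff: "scalar (a - b) = scalar a - scalar b"
  by (intro endo_eqI torus_fun_eqI) (simp add: algebra_simps)

lemma scalar_mult: "scalar (a * b) = scalar a * scalar b"
  by (intro endo_eqI torus_fun_eqI) simp

lemma scalar_sum: "scalar (sum f A) = (\<Sum>i\<in>A. scalar (f i))"
  by (induction A rule: infinite_finite_induct) (auto simp: scalar_add)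

lemma scalar_commute: "T * scalar c = scalar c * T"
  by (intro endo_eqI) simp

lemma scalar_left_commute: "S * (scalar c * T) = scalar c * (S * T)"
  by (intro endo_eqI) simp

lemma scaleR_scalar: "r *\<^sub>R T = scalar (of_real r) * T"
  by (intro endo_eqI torus_fun_eqI) simp

section \<open>Bounded operators\<close>

lemma norm_lat_minus [simp]: "norm (lat (- m)) = norm (lat m)"
proof -
  have "lat (- m) = - lat m" by (simp add: lat_def vec_eq_iff)
  then show ?thesis by simp
qed

lemma lat_0 [simp]: "lat 0 = 0"
  by (simp add: lat_def vec_eq_iff)

lemma lat_eq_0_iff [simp]: "lat m = 0 \<longleftrightarrow> m = 0"
  by (simp add: lat_def vec_eq_iff)

text \<open>Nonzero frequencies stay away from the origin, so \<open>norm (lat m) powi d\<close> is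
  increasing in \<open>d\<close>, and bounds of low order imply bounds of higher order.\<close>

lemma norm_lat_ge_1: "m \<noteq> 0 \<Longrightarrow> 1 \<le> norm (lat m)"
proof -
  assume "m \<noteq> 0"
  then obtain a where "m $ a \<noteq> 0" by (auto simp: vec_eq_iff)
  then have "1 \<le> \<bar>real_of_int (m $ a)\<bar>" by linarith
  then show ?thesis using cmod_lat_le[of m a] by linarith
qed

lemma bij_reflect: "bij (\<lambda>l::'a::ab_group_add. p - l)"
  by (rule o_bij[of "\<lambda>l. p - l"]) (auto simp: fun_eq_iff)

lemma bij_shift: "bij (\<lambda>l::'a::ab_group_add. l + p)"
  by (rule o_bij[of "\<lambda>l. l - p"]) (auto simp: fun_eq_iff)

lemma summable_coeff: "(\<lambda>m. cmod (coeff x m)) summable_on UNIV"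
  by (rule rapid_summable[OF rapid_coeff])

lemma summable_coeff_mult_bounded:
  assumes "\<And>m. cmod (f m) \<le> C"
  shows "(\<lambda>m. cmod (f m * coeff x m)) summable_on UNIV"
proof (rule summable_on_comparison_test)
  show "(\<lambda>m. C * cmod (coeff x m)) summable_on UNIV"
    by (intro summable_on_cmult_right summable_coeff)
  show "cmod (f m * coeff x m) \<le> C * cmod (coeff x m)" for m
    using mult_right_mono[OF assms] by (simp add: norm_mult)
qed simp

lemma coeff_bounded: obtains C where "\<And>m. cmod (coeff x m) \<le> C"
  using rapid_imp_bounded[OF rapid_coeff] by blast

lemma summable_ip: "(\<lambda>m. cnj (coeff x m) * coeff y m) summable_on UNIV"
proof -
  obtain C where "\<And>m. cmod (coeff x m) \<le> C" using coeff_bounded by blast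
  then have "\<And>m. cmod (cnj (coeff x m)) \<le> C" by simp
  from summable_coeff_mult_bounded[OF this] show ?thesis
    by (rule abs_summable_summable)
qed

text \<open>A real sum, whereas \<open>ip x x\<close> is complex; working with squared norms keeps
  square roots out of the estimates.\<close>

definition l2sq :: "torus_fun \<Rightarrow> real"
  where "l2sq x = (\<Sum>\<^sub>\<infinity>m. (cmod (coeff x m))\<^sup>2)"

lemma summable_l2sq: "(\<lambda>m. (cmod (coeff x m))\<^sup>2) summable_on UNIV"
proof -
  obtain C where "\<And>m. cmod (coeff x m) \<le> C" using coeff_bounded by blast
  from summable_coeff_mult_bounded[OF this] show ?thesis
    by (simp add: norm_mult power2_eq_square)
qed

lemma l2sq_nonneg [simp]: "0 \<le> l2sq x"
  unfolding l2sq_def by (intro infsum_nonneg) auto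

lemma ip_self: "ip x x = of_real (l2sq x)"
proof -
  have "ip x x = (\<Sum>\<^sub>\<infinity>m. complex_of_real ((cmod (coeff x m))\<^sup>2))"
    unfolding ip_def by (intro infsum_cong) (simp add: complex_norm_square mult.commute del: of_real_power)
  also have "\<dots> = of_real (l2sq x)"
    unfolding l2sq_def by (intro infsumI has_sum_of_real has_sum_infsum summable_l2sq)
  finally show ?thesis .
qed

lemma l2norm_eq: "l2norm x = sqrt (l2sq x)"
  by (simp add: l2norm_def ip_self)

lemma l2sq_ge_sum: "finite F \<Longrightarrow> (\<Sum>m\<in>F. (cmod (coeff x m))\<^sup>2) \<le> l2sq x"
  unfolding l2sq_def by (rule finite_sum_le_infsum[OF summable_l2sq]) auto

lemma l2sq_ge_coeff: "(cmod (coeff x m))\<^sup>2 \<le> l2sq x"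
  using l2sq_ge_sum[of "{m}" x] by simp

lemma l2sq_leI: "(\<And>F. finite F \<Longrightarrow> (\<Sum>m\<in>F. (cmod (coeff x m))\<^sup>2) \<le> B) \<Longrightarrow> l2sq x \<le> B"
  unfolding l2sq_def by (rule infsum_le_finite_sums[OF summable_l2sq]) auto

lemma l2sq_add: "l2sq (x + y) \<le> 2 * l2sq x + 2 * l2sq y"
proof (rule l2sq_leI)
  fix F :: "(int^4) set" assume F: "finite F"
  have "(cmod (a + b))\<^sup>2 \<le> 2 * (cmod a)\<^sup>2 + 2 * (cmod b)\<^sup>2" for a b
  proof -
    have "(cmod (a + b))\<^sup>2 \<le> (cmod a + cmod b)\<^sup>2"
      by (intro power_mono norm_triangle_ineq) simp
    also have "\<dots> \<le> 2 * (cmod a)\<^sup>2 + 2 * (cmod b)\<^sup>2"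
      using zero_le_power2[of "cmod a - cmod b"] by (simp add: power2_sum power2_diff)
    finally show ?thesis .
  qed
  then have "(\<Sum>m\<in>F. (cmod (coeff (x + y) m))\<^sup>2)
      \<le> (\<Sum>m\<in>F. 2 * (cmod (coeff x m))\<^sup>2 + 2 * (cmod (coeff y m))\<^sup>2)"
    by (intro sum_mono) simp
  also have "\<dots> \<le> 2 * l2sq x + 2 * l2sq y"
    using l2sq_ge_sum[OF F] by (simp add: sum.distrib sum_distrib_left[symmetric] add_mono)
  finally show "(\<Sum>m\<in>F. (cmod (coeff (x + y) m))\<^sup>2) \<le> 2 * l2sq x + 2 * l2sq y" .
qed

lemma l2sq_scaleC [simp]: "l2sq (scaleC c x) = (cmod c)\<^sup>2 * l2sq x"
  unfolding l2sq_def by (simp add: norm_mult power_mult_distrib infsum_cmult_right')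

definition bdd_op :: "endo \<Rightarrow> bool"
  where "bdd_op T \<longleftrightarrow> (\<exists>C\<ge>0. \<forall>x. l2sq (app T x) \<le> C * l2sq x)"

lemma bdd_opI: "0 \<le> C \<Longrightarrow> (\<And>x. l2sq (app T x) \<le> C * l2sq x) \<Longrightarrow> bdd_op T"
  unfolding bdd_op_def by blast

lemma bdd_op_scalar: "bdd_op (scalar c)"
  by (rule bdd_opI[of "(cmod c)\<^sup>2"]) auto

lemma bdd_op_add:
  assumes "bdd_op S" "bdd_op T" shows "bdd_op (S + T)"
proof -
  from assms obtain C D where C: "0 \<le> C" "\<And>x. l2sq (app S x) \<le> C * l2sq x"
    and D: "0 \<le> D" "\<And>x. l2sq (app T x) \<le> D * l2sq x" unfolding bdd_op_def by blast
  show ?thesis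
  proof (rule bdd_opI[of "2 * C + 2 * D"])
    fix x
    show "l2sq (app (S + T) x) \<le> (2 * C + 2 * D) * l2sq x"
      using l2sq_add[of "app S x" "app T x"] C(2)[of x] D(2)[of x] by (simp add: algebra_simps)
  qed (use C D in auto)
qed

lemma bdd_op_mult:
  assumes "bdd_op S" "bdd_op T" shows "bdd_op (S * T)"
proof -
  from assms obtain C D where C: "0 \<le> C" "\<And>x. l2sq (app S x) \<le> C * l2sq x"
    and D: "0 \<le> D" "\<And>x. l2sq (app T x) \<le> D * l2sq x" unfolding bdd_op_def by blast
  show ?thesis
  proof (rule bdd_opI[of "C * D"])
    fix x
    show "l2sq (app (S * T) x) \<le> (C * D) * l2sq x"
      using C(2)[of "app T x"] mult_left_mono[OF D(2)[of x] C(1)] by (simp add: algebra_simps)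
  qed (use C D in auto)
qed

lemma bdd_op_diff: "bdd_op S \<Longrightarrow> bdd_op T \<Longrightarrow> bdd_op (S - T)"
  using bdd_op_add[of S "scalar (-1) * T"] bdd_op_mult[OF bdd_op_scalar[of "-1"], of T]
  by (simp add: scalar_minus)

lemma opnorm_le:
  assumes "0 \<le> C" and "\<And>x. l2sq (app T x) \<le> C\<^sup>2 * l2sq x"
  shows "opnorm T \<le> ennreal C"
  unfolding opnorm_def
proof (intro SUP_least)
  fix x assume "x \<in> {x. l2norm x \<le> 1}"
  then have "l2sq x \<le> 1" by (simp add: l2norm_eq)
  then have "l2sq (app T x) \<le> C\<^sup>2"
    using assms(2)[of x] mult_left_mono[of "l2sq x" 1 "C\<^sup>2"] by simp
  then have "l2norm (app T x) \<le> C"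
    using assms(1) by (simp add: l2norm_eq real_le_lsqrt)
  then show "ennreal (l2norm (app T x)) \<le> ennreal C" by (rule ennreal_leI)
qed

lemma has_sum_sum:
  fixes f :: "'a \<Rightarrow> 'b \<Rightarrow> 'c::topological_comm_monoid_add"
  assumes "\<And>i. i \<in> I \<Longrightarrow> (f i has_sum s i) A"
  shows "((\<lambda>x. \<Sum>i\<in>I. f i x) has_sum (\<Sum>i\<in>I. s i)) A"
  using assms by (induction I rule: infinite_finite_induct) (auto intro!: has_sum_add has_sum_0)

lemma infsum_tail_small:
  fixes f :: "'a \<Rightarrow> real"
  assumes "f summable_on UNIV" "\<epsilon> > 0"
  obtains F where "finite F" "infsum f (- F) \<le> \<epsilon>"
proof -
  obtain F where F: "finite F" "dist (sum f F) (infsum f UNIV) \<le> \<epsilon>"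
    using infsum_finite_approximation[OF assms] by blast
  have "infsum f UNIV = infsum f F + infsum f (- F)"
    using infsum_Un_disjoint[of f F "- F"] F(1) summable_on_subset_banach[OF assms(1)]
    by simp
  then have "infsum f (- F) \<le> \<epsilon>"
    using F by (simp add: dist_real_def)
  then show thesis using F that by blast
qed

text \<open>Finite combinations of the \<open>U m\<close> are dense in \<open>L^2\<close>. On a
  monomial the twisted product is a mere shift of coefficients up to phases, so operator identities
  in the algebras are checked there.\<close>

lemma bdd_op_eqI:
  assumes "bdd_op S" "bdd_op T" and eq: "\<And>m. app S (U m) = app T (U m)"
  shows "S = T"
proof -
  have "bdd_op (S - T)" using assms by (intro bdd_op_diff)
  then obtain C where C: "0 \<le> C" "\<And>x. l2sq (app (S - T) x) \<le> C * l2sq x"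
    unfolding bdd_op_def by blast
  have "coeff (app (S - T) x) p = 0" for x p
  proof -
    have "(cmod (coeff (app (S - T) x) p))\<^sup>2 \<le> 0 + e" if "e > 0" for e :: real
    proof -
      \<comment> \<open>The summand 1 covers \<open>C = 0\<close>. Removing from \<open>x\<close>
        the modes in \<open>F\<close> changes nothing for \<open>S - T\<close> and leaves a vector
        of small norm.\<close>
      have "0 < e / (C + 1)" using that C(1) by simp
      from infsum_tail_small[OF summable_l2sq this]
      obtain F where F: "finite F" "infsum (\<lambda>m. (cmod (coeff x m))\<^sup>2) (- F) \<le> e / (C + 1)"
        by blast
      let ?y = "x - (\<Sum>m\<in>F. scaleC (coeff x m) (U m))"
      have "(\<Sum>n\<in>F. coeff x n * coeff (U n) m) = (if m \<in> F then coeff x m else 0)" for m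
        using F(1) by (simp add: U.rep_eq mult_delta_right sum.delta')
      then have cy: "coeff ?y m = (if m \<in> F then 0 else coeff x m)" for m
        by simp
      have "l2sq ?y = infsum (\<lambda>m. (cmod (coeff x m))\<^sup>2) (- F)"
        unfolding l2sq_def cy by (rule infsum_cong_neutral) auto
      moreover have "app (S - T) ?y = app (S - T) x"
        by (simp add: eq)
      ultimately have "(cmod (coeff (app (S - T) x) p))\<^sup>2 \<le> C * (e / (C + 1))"
        using l2sq_ge_coeff[of "app (S - T) x" p] C(2)[of ?y] mult_left_mono[OF F(2) C(1)] by simp
      also have "\<dots> \<le> e"
        using C(1) that by (simp add: field_simps)
      finally show ?thesis by simp
    qed
    from field_le_epsilon[OF this] show ?thesis by simp
  qed
  then have "app S x = app T x" for x
    by (intro torus_fun_eqI) simp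
  then show ?thesis by (rule endo_eqI)
qed

section \<open>The algebra of the torus\<close>

lemma twist_add_left: "twist \<theta> (l + l') n = twist \<theta> l n * twist \<theta> l' n"
  by (simp add: twist_def cis_mult sum.distrib distrib_left distrib_right)

lemma twist_add_right: "twist \<theta> l (n + n') = twist \<theta> l n * twist \<theta> l n'"
  by (simp add: twist_def cis_mult sum.distrib distrib_left distrib_right)

lemma twist_0_left [simp]: "twist \<theta> 0 n = 1" and twist_0_right [simp]: "twist \<theta> l 0 = 1"
  by (simp_all add: twist_def)

lemma twist_nonzero [simp]: "twist \<theta> l n \<noteq> 0"
  using norm_twist[of \<theta> l n] by (metis norm_zero zero_neq_one)

lemma twist_minus_left: "twist \<theta> (- l) n = inverse (twist \<theta> l n)"
  using twist_add_left[of \<theta> "- l" l n] by (simp add: field_simps)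

lemma twist_minus_right: "twist \<theta> l (- n) = inverse (twist \<theta> l n)"
  using twist_add_right[of \<theta> l "- n" n] by (simp add: field_simps)

lemma twist_diff_left: "twist \<theta> (l - l') n = twist \<theta> l n / twist \<theta> l' n"
  using twist_add_left[of \<theta> "l - l'" l' n] by simp

lemma twist_diff_right: "twist \<theta> l (n - n') = twist \<theta> l n / twist \<theta> l n'"
  using twist_add_right[of \<theta> l "n - n'" n'] by simp

lemma coeff_tmult: "coeff (tmult \<theta> x y) p = (\<Sum>\<^sub>\<infinity>l. coeff x l * coeff y (p - l) * twist \<theta> l (p - l))"
  by (simp add: tmult.rep_eq twisted_conv_def)

text \<open>With \<open>y\<close> as the summed factor, right multiplication takes the same
  convolution form as left multiplication, so one estimate serves both.\<close>

lemma coeff_tmult_flip: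
  "coeff (tmult \<theta> x y) p = (\<Sum>\<^sub>\<infinity>l. coeff y l * coeff x (p - l) * twist \<theta> (p - l) l)"
proof -
  have "coeff (tmult \<theta> x y) p
      = (\<Sum>\<^sub>\<infinity>l. coeff x (p - l) * coeff y (p - (p - l)) * twist \<theta> (p - l) (p - (p - l)))"
    unfolding coeff_tmult
    by (rule infsum_reindex_bij_betw[OF bij_reflect, of
      "\<lambda>l. coeff x l * coeff y (p - l) * twist \<theta> l (p - l)", symmetric])
  then show ?thesis by (simp add: mult_ac)
qed

lemma coeff_tmult_U_right: "coeff (tmult \<theta> a (U m)) p = coeff a (p - m) * twist \<theta> (p - m) m"
proof -
  have "coeff (tmult \<theta> a (U m)) p
      = (\<Sum>\<^sub>\<infinity>l\<in>{m}. coeff (U m) l * coeff a (p - l) * twist \<theta> (p - l) l)"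
    unfolding coeff_tmult_flip by (rule infsum_cong_neutral) (auto simp: U.rep_eq)
  then show ?thesis by (simp add: U.rep_eq)
qed

lemma coeff_tmult_U_left: "coeff (tmult \<theta> (U m) b) p = coeff b (p - m) * twist \<theta> m (p - m)"
proof -
  have "coeff (tmult \<theta> (U m) b) p
      = (\<Sum>\<^sub>\<infinity>l\<in>{m}. coeff (U m) l * coeff b (p - l) * twist \<theta> l (p - l))"
    unfolding coeff_tmult by (rule infsum_cong_neutral) (auto simp: U.rep_eq)
  then show ?thesis by (simp add: U.rep_eq)
qed

text \<open>Cauchy-Schwarz for the weights \<open>cmod (coeff a l)\<close>, each split into two
  square roots. The unimodular factor \<open>t\<close> stands for the twist.\<close>

lemma young_coeff:
  fixes t :: "int^4 \<Rightarrow> complex"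
  assumes t: "\<And>l. cmod (t l) = 1"
  shows "(cmod (\<Sum>\<^sub>\<infinity>l. coeff a l * coeff x (p - l) * t l))\<^sup>2
      \<le> (\<Sum>\<^sub>\<infinity>l. cmod (coeff a l)) * (\<Sum>\<^sub>\<infinity>l. cmod (coeff a l) * (cmod (coeff x (p - l)))\<^sup>2)"
    and "(\<lambda>l. cmod (coeff a l) * (cmod (coeff x (p - l)))\<^sup>2) summable_on UNIV"
proof -
  let ?A = "\<Sum>\<^sub>\<infinity>l. cmod (coeff a l)" and ?S = "\<Sum>\<^sub>\<infinity>l. cmod (coeff a l) * (cmod (coeff x (p - l)))\<^sup>2"
  obtain C where C: "\<And>m. cmod (coeff x m) \<le> C" using coeff_bounded by blast
  have sum1: "(\<lambda>l. cmod (coeff a l * coeff x (p - l) * t l)) summable_on UNIV"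
    using summable_coeff_mult_bounded[of "\<lambda>l. coeff x (p - l)" C a] C
    by (simp add: norm_mult t mult.commute)
  have C2: "(cmod (coeff x m))\<^sup>2 \<le> C\<^sup>2" for m by (intro power_mono C) simp
  show sum2: "(\<lambda>l. cmod (coeff a l) * (cmod (coeff x (p - l)))\<^sup>2) summable_on UNIV"
    using summable_coeff_mult_bounded[of "\<lambda>l. of_real ((cmod (coeff x (p - l)))\<^sup>2)" "C\<^sup>2" a] C2
    by (simp add: norm_mult mult.commute norm_power)
  have "(\<Sum>l\<in>F. cmod (coeff a l * coeff x (p - l) * t l)) \<le> sqrt (?A * ?S)" if F: "finite F" for F
  proof (rule real_le_rsqrt)
    have "(\<Sum>l\<in>F. cmod (coeff a l * coeff x (p - l) * t l))
        = (\<Sum>l\<in>F. sqrt (cmod (coeff a l)) * (sqrt (cmod (coeff a l)) * cmod (coeff x (p - l))))"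
      by (simp add: norm_mult t mult.assoc[symmetric])
    also have "\<dots>\<^sup>2
        \<le> (\<Sum>l\<in>F. (sqrt (cmod (coeff a l)))\<^sup>2) * (\<Sum>l\<in>F. (sqrt (cmod (coeff a l)) * cmod (coeff x (p - l)))\<^sup>2)"
      by (rule Cauchy_Schwarz_ineq_sum)
    also have "\<dots> = (\<Sum>l\<in>F. cmod (coeff a l)) * (\<Sum>l\<in>F. cmod (coeff a l) * (cmod (coeff x (p - l)))\<^sup>2)"
      by (simp add: power_mult_distrib)
    also have "\<dots> \<le> ?A * ?S"
      using F by (intro mult_mono finite_sum_le_infsum summable_coeff sum2) (auto intro!: sum_nonneg infsum_nonneg)
    finally show "(\<Sum>l\<in>F. cmod (coeff a l * coeff x (p - l) * t l))\<^sup>2 \<le> ?A * ?S" .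
  qed
  then have "(\<Sum>\<^sub>\<infinity>l. cmod (coeff a l * coeff x (p - l) * t l)) \<le> sqrt (?A * ?S)"
    by (intro infsum_le_finite_sums[OF sum1]) auto
  then have "cmod (\<Sum>\<^sub>\<infinity>l. coeff a l * coeff x (p - l) * t l) \<le> sqrt (?A * ?S)"
    using norm_infsum_bound[OF sum1] by linarith
  then have "(cmod (\<Sum>\<^sub>\<infinity>l. coeff a l * coeff x (p - l) * t l))\<^sup>2 \<le> (sqrt (?A * ?S))\<^sup>2"
    by (intro power_mono) auto
  then show "(cmod (\<Sum>\<^sub>\<infinity>l. coeff a l * coeff x (p - l) * t l))\<^sup>2 \<le> ?A * ?S"
    by (simp add: infsum_nonneg mult_nonneg_nonneg)
qed

text \<open>Young's inequality for an \<open>l^1\<close> and an \<open>l^2\<close> sequence: after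
  \<open>young_coeff\<close>, summing over \<open>p\<close> first gives at most
  \<open>l2sq x\<close> for every \<open>l\<close> by translation invariance. The sum over
  \<open>p\<close> is finite, which makes the interchange elementary.\<close>

lemma young:
  fixes t :: "int^4 \<Rightarrow> int^4 \<Rightarrow> complex"
  assumes t: "\<And>p l. cmod (t p l) = 1"
    and y: "\<And>p. coeff y p = (\<Sum>\<^sub>\<infinity>l. coeff a l * coeff x (p - l) * t p l)"
  shows "l2sq y \<le> (\<Sum>\<^sub>\<infinity>l. cmod (coeff a l))\<^sup>2 * l2sq x"
proof (rule l2sq_leI)
  let ?A = "\<Sum>\<^sub>\<infinity>l. cmod (coeff a l)"
  have A: "0 \<le> ?A" by (intro infsum_nonneg) simp
  fix F :: "(int^4) set" assume F: "finite F"
  have s: "(\<lambda>l. cmod (coeff a l) * (cmod (coeff x (p - l)))\<^sup>2) summable_on UNIV" for p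
    using young_coeff(2)[of "\<lambda>_. 1"] by simp
  have "(\<Sum>p\<in>F. (cmod (coeff y p))\<^sup>2) \<le> (\<Sum>p\<in>F. ?A * (\<Sum>\<^sub>\<infinity>l. cmod (coeff a l) * (cmod (coeff x (p - l)))\<^sup>2))"
    unfolding y by (intro sum_mono young_coeff t)
  also have "\<dots> = ?A * (\<Sum>\<^sub>\<infinity>l. \<Sum>p\<in>F. cmod (coeff a l) * (cmod (coeff x (p - l)))\<^sup>2)"
    by (simp only: infsumI[OF has_sum_sum[OF has_sum_infsum[OF s]]] sum_distrib_left)
  also have "(\<Sum>\<^sub>\<infinity>l. \<Sum>p\<in>F. cmod (coeff a l) * (cmod (coeff x (p - l)))\<^sup>2)
      \<le> (\<Sum>\<^sub>\<infinity>l. l2sq x * cmod (coeff a l))"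
  proof (rule infsum_mono)
    show "(\<lambda>l. \<Sum>p\<in>F. cmod (coeff a l) * (cmod (coeff x (p - l)))\<^sup>2) summable_on UNIV"
      by (rule has_sum_imp_summable[OF has_sum_sum[OF has_sum_infsum[OF s]]])
    show "(\<lambda>l. l2sq x * cmod (coeff a l)) summable_on UNIV"
      by (intro summable_on_cmult_right summable_coeff)
    fix l
    have "(\<Sum>p\<in>F. (cmod (coeff x (p - l)))\<^sup>2) = (\<Sum>p\<in>(\<lambda>p. p - l) ` F. (cmod (coeff x p))\<^sup>2)"
      by (subst sum.reindex) (auto simp: inj_on_def)
    also have "\<dots> \<le> l2sq x" by (intro l2sq_ge_sum finite_imageI F)
    finally show "(\<Sum>p\<in>F. cmod (coeff a l) * (cmod (coeff x (p - l)))\<^sup>2) \<le> l2sq x * cmod (coeff a l)"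
      by (simp add: sum_distrib_left[symmetric] mult.commute[of "l2sq x"] mult_left_mono)
  qed
  also have "\<dots> = l2sq x * ?A" by (rule infsum_cmult_right')
  finally show "(\<Sum>p\<in>F. (cmod (coeff y p))\<^sup>2) \<le> ?A\<^sup>2 * l2sq x"
    using A mult_left_mono[OF _ A] by (simp add: power2_eq_square mult.assoc mult.commute[of "l2sq x"])
qed

lemma bdd_op_lmult [simp]: "bdd_op (lmult \<theta> a)"
  by (rule bdd_opI[of "(\<Sum>\<^sub>\<infinity>l. cmod (coeff a l))\<^sup>2"])
    (auto intro!: young[where t = "\<lambda>p l. twist \<theta> l (p - l)"] simp: coeff_tmult)

lemma bdd_op_rmult [simp]: "bdd_op (rmult \<theta> a)"
  by (rule bdd_opI[of "(\<Sum>\<^sub>\<infinity>l. cmod (coeff a l))\<^sup>2"])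
    (auto intro!: young[where t = "\<lambda>p l. twist \<theta> (p - l) l"] simp: coeff_tmult_flip)

lemma bdd_op_alg_hat: "T \<in> alg_hat \<theta> \<Longrightarrow> bdd_op T"
  by (induction rule: alg_hat.induct)
    (auto intro: bdd_op_scalar bdd_op_add bdd_op_mult simp: alg_def alg_op_def)

lemmas coeff_tmult_U = coeff_tmult_U_left coeff_tmult_U_right

lemma rmult_add: "rmult \<theta> (a + b) = rmult \<theta> a + rmult \<theta> b"
  by (rule bdd_op_eqI) (auto intro!: bdd_op_add torus_fun_eqI simp: coeff_tmult_U algebra_simps)

lemma lmult_scaleC: "lmult \<theta> (scaleC c a) = scalar c * lmult \<theta> a"
  by (rule bdd_op_eqI)
    (auto intro!: bdd_op_mult bdd_op_scalar torus_fun_eqI simp: coeff_tmult_U algebra_simps)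

lemma rmult_scaleC: "rmult \<theta> (scaleC c a) = scalar c * rmult \<theta> a"
  by (rule bdd_op_eqI)
    (auto intro!: bdd_op_mult bdd_op_scalar torus_fun_eqI simp: coeff_tmult_U algebra_simps)

lemma lmult_U0: "lmult \<theta> (U 0) = 1"
  by (intro endo_eqI torus_fun_eqI) (simp add: coeff_tmult_U)

lemma rmult_U0: "rmult \<theta> (U 0) = 1"
  by (intro endo_eqI torus_fun_eqI) (simp add: coeff_tmult_U)

text \<open>Associativity and the commutation of left and right multiplication come down to one
  identity between products of two twists; these rules carry it past the coefficients.\<close>

lemma mult_regroup:
  fixes a :: "'a::comm_semiring_1"
  assumes "s * t = s' * t'"
  shows "a * (b * s) * t = s' * (a * b * t')" "a * s * b * t = a * b * (s' * t')"
proof -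
  have "a * (b * s) * t = a * b * (s * t)" "a * s * b * t = a * b * (s * t)"
    by (simp_all only: mult_ac)
  then show "a * (b * s) * t = s' * (a * b * t')" "a * s * b * t = a * b * (s' * t')"
    by (simp_all only: assms mult_ac)
qed

text \<open>Associativity of the twisted product, tested on \<open>U m\<close>. It holds because the
  bicharacter \<open>twist\<close> is a 2-cocycle, which is the identity isolated in the
  proof.\<close>

lemma lmult_mult: "lmult \<theta> a * lmult \<theta> b = lmult \<theta> (tmult \<theta> a b)"
proof (rule bdd_op_eqI)
  fix m
  show "app (lmult \<theta> a * lmult \<theta> b) (U m) = app (lmult \<theta> (tmult \<theta> a b)) (U m)"
  proof (intro torus_fun_eqI)
    fix q
    have "coeff (tmult \<theta> a (tmult \<theta> b (U m))) q
        = (\<Sum>\<^sub>\<infinity>l. coeff a l * (coeff b (q - l - m) * twist \<theta> (q - l - m) m) * twist \<theta> l (q - l))"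
      unfolding coeff_tmult[of \<theta> a] by (simp add: coeff_tmult_U)
    also have "\<dots> = (\<Sum>\<^sub>\<infinity>l. twist \<theta> (q - m) m * (coeff a l * coeff b (q - m - l) * twist \<theta> l (q - m - l)))"
    proof (intro infsum_cong)
      fix l
      have "q - l - m = q - m - l" by simp
      moreover have "twist \<theta> (q - m - l) m * twist \<theta> l (q - l) = twist \<theta> (q - m) m * twist \<theta> l (q - m - l)"
        by (simp add: twist_diff_left twist_diff_right)
      ultimately show "coeff a l * (coeff b (q - l - m) * twist \<theta> (q - l - m) m) * twist \<theta> l (q - l)
          = twist \<theta> (q - m) m * (coeff a l * coeff b (q - m - l) * twist \<theta> l (q - m - l))"
        by (simp only: mult_regroup(1))
    qed
    also have "\<dots> = coeff (tmult \<theta> (tmult \<theta> a b) (U m)) q"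
      by (simp only: infsum_cmult_right') (simp add: coeff_tmult_U_right coeff_tmult[of \<theta> a] mult.commute)
    finally show "coeff (app (lmult \<theta> a * lmult \<theta> b) (U m)) q = coeff (app (lmult \<theta> (tmult \<theta> a b)) (U m)) q"
      by simp
  qed
qed (auto intro: bdd_op_mult)

lemma rmult_mult: "rmult \<theta> a * rmult \<theta> b = rmult \<theta> (tmult \<theta> b a)"
proof (rule bdd_op_eqI)
  fix m
  show "app (rmult \<theta> a * rmult \<theta> b) (U m) = app (rmult \<theta> (tmult \<theta> b a)) (U m)"
  proof (intro torus_fun_eqI)
    fix q
    have "coeff (tmult \<theta> (tmult \<theta> (U m) b) a) q
        = (\<Sum>\<^sub>\<infinity>l. coeff a l * (coeff b (q - l - m) * twist \<theta> m (q - l - m)) * twist \<theta> (q - l) l)"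
      unfolding coeff_tmult_flip[of \<theta> _ a] by (simp add: coeff_tmult_U)
    also have "\<dots> = (\<Sum>\<^sub>\<infinity>l. twist \<theta> m (q - m) * (coeff a l * coeff b (q - m - l) * twist \<theta> (q - m - l) l))"
    proof (intro infsum_cong)
      fix l
      have "q - l - m = q - m - l" by simp
      moreover have "twist \<theta> m (q - m - l) * twist \<theta> (q - l) l = twist \<theta> m (q - m) * twist \<theta> (q - m - l) l"
        by (simp add: twist_diff_left twist_diff_right)
      ultimately show "coeff a l * (coeff b (q - l - m) * twist \<theta> m (q - l - m)) * twist \<theta> (q - l) l
          = twist \<theta> m (q - m) * (coeff a l * coeff b (q - m - l) * twist \<theta> (q - m - l) l)"
        by (simp only: mult_regroup(1))
    qed
    also have "\<dots> = coeff (tmult \<theta> (U m) (tmult \<theta> b a)) q"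
      by (simp only: infsum_cmult_right') (simp add: coeff_tmult_U_left coeff_tmult_flip[of \<theta> b] mult.commute)
    finally show "coeff (app (rmult \<theta> a * rmult \<theta> b) (U m)) q = coeff (app (rmult \<theta> (tmult \<theta> b a)) (U m)) q"
      by simp
  qed
qed (auto intro: bdd_op_mult)

lemma coeff_lmult_rmult_U:
  "coeff (app (lmult \<theta> a * rmult \<theta> b) (U m)) q
     = (\<Sum>\<^sub>\<infinity>l. coeff a l * coeff b (q - m - l) * (twist \<theta> m (q - m - l) * twist \<theta> l (q - l)))"
  unfolding times_endo.rep_eq lmult.rep_eq rmult.rep_eq coeff_tmult[of \<theta> a]
proof (intro infsum_cong)
  fix l
  have "q - l - m = q - m - l" by simp
  then show "coeff a l * coeff (tmult \<theta> (U m) b) (q - l) * twist \<theta> l (q - l)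
      = coeff a l * coeff b (q - m - l) * (twist \<theta> m (q - m - l) * twist \<theta> l (q - l))"
    by (simp only: coeff_tmult_U mult.assoc)
qed

text \<open>Again associativity, read as \<open>(a x) b = a (x b)\<close>; shifting the summation
  index by \<open>m\<close> aligns the two convolutions.\<close>

lemma lmult_rmult_commute: "rmult \<theta> b * lmult \<theta> a = lmult \<theta> a * rmult \<theta> b"
proof (rule bdd_op_eqI)
  fix m
  show "app (rmult \<theta> b * lmult \<theta> a) (U m) = app (lmult \<theta> a * rmult \<theta> b) (U m)"
  proof (intro torus_fun_eqI)
    fix q
    have "coeff (app (rmult \<theta> b * lmult \<theta> a) (U m)) q
        = (\<Sum>\<^sub>\<infinity>l. coeff (tmult \<theta> a (U m)) l * coeff b (q - l) * twist \<theta> l (q - l))"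
      by (simp add: coeff_tmult[of \<theta> _ b])
    also have "\<dots> = (\<Sum>\<^sub>\<infinity>l. coeff (tmult \<theta> a (U m)) (l + m) * coeff b (q - (l + m)) * twist \<theta> (l + m) (q - (l + m)))"
      by (rule infsum_reindex_bij_betw[OF bij_shift, of
        "\<lambda>l. coeff (tmult \<theta> a (U m)) l * coeff b (q - l) * twist \<theta> l (q - l)", symmetric])
    also have "\<dots> = coeff (app (lmult \<theta> a * rmult \<theta> b) (U m)) q"
      unfolding coeff_lmult_rmult_U
    proof (intro infsum_cong)
      fix l
      have "q - (l + m) = q - m - l" by simp
      moreover have "twist \<theta> l m * twist \<theta> (l + m) (q - m - l) = twist \<theta> m (q - m - l) * twist \<theta> l (q - l)"
        by (simp add: twist_add_left twist_diff_right mult_ac)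
      ultimately show "coeff (tmult \<theta> a (U m)) (l + m) * coeff b (q - (l + m)) * twist \<theta> (l + m) (q - (l + m))
          = coeff a l * coeff b (q - m - l) * (twist \<theta> m (q - m - l) * twist \<theta> l (q - l))"
        by (simp only: coeff_tmult_U add_diff_cancel_right' mult_regroup(2))
    qed
    finally show "coeff (app (rmult \<theta> b * lmult \<theta> a) (U m)) q = coeff (app (lmult \<theta> a * rmult \<theta> b) (U m)) q" .
  qed
qed (auto intro: bdd_op_mult)

text \<open>The frequency \<open>p\<close> of a product term is the sum of the frequencies
  \<open>l\<close> and \<open>p - l\<close> of its factors. The two versions differ in the order of
  the summands, for left and right multiplication.\<close>

lemma deriv_leibniz:
  fixes x y t :: complex and p l :: "int^4"
  shows "\<i> * of_int (l $ c) * x * y * t + x * (\<i> * of_int ((p - l) $ c) * y) * t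
    = \<i> * of_int (p $ c) * (x * y * t)"
    and "x * (\<i> * of_int ((p - l) $ c) * y) * t + \<i> * of_int (l $ c) * x * y * t
    = \<i> * of_int (p $ c) * (x * y * t)"
  by (simp_all add: ring_distribs mult_ac)

lemma \<delta>_lmult: "\<delta> c (lmult \<theta> a) = lmult \<theta> (fourier_deriv c a)"
proof (intro endo_eqI torus_fun_eqI)
  fix x p
  note s = twisted_conv_summable[OF rapid_coeff rapid_coeff]
  have "coeff (app (lmult \<theta> (fourier_deriv c a)) x) p + coeff (tmult \<theta> a (fourier_deriv c x)) p
      = (\<Sum>\<^sub>\<infinity>l. \<i> * of_int (p $ c) * (coeff a l * coeff x (p - l) * twist \<theta> l (p - l)))"
    unfolding coeff_tmult app_simps
    by (subst infsum_add[OF s s, symmetric], intro infsum_cong, unfold coeff_simps, (rule deriv_leibniz)+)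
  also have "\<dots> = \<i> * of_int (p $ c) * coeff (tmult \<theta> a x) p"
    unfolding coeff_tmult by (rule infsum_cmult_right')
  finally show "coeff (app (\<delta> c (lmult \<theta> a)) x) p = coeff (app (lmult \<theta> (fourier_deriv c a)) x) p"
    by (simp add: \<delta>_def algebra_simps)
qed

lemma \<delta>_rmult: "\<delta> c (rmult \<theta> a) = rmult \<theta> (fourier_deriv c a)"
proof (intro endo_eqI torus_fun_eqI)
  fix x p
  note s = twisted_conv_summable[OF rapid_coeff rapid_coeff]
  have "coeff (app (rmult \<theta> (fourier_deriv c a)) x) p + coeff (tmult \<theta> (fourier_deriv c x) a) p
      = (\<Sum>\<^sub>\<infinity>l. \<i> * of_int (p $ c) * (coeff x l * coeff a (p - l) * twist \<theta> l (p - l)))"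
    unfolding coeff_tmult app_simps
    by (subst infsum_add[OF s s, symmetric], intro infsum_cong, unfold coeff_simps, (rule deriv_leibniz)+)
  also have "\<dots> = \<i> * of_int (p $ c) * coeff (tmult \<theta> x a) p"
    unfolding coeff_tmult by (rule infsum_cmult_right')
  finally show "coeff (app (\<delta> c (rmult \<theta> a)) x) p = coeff (app (rmult \<theta> (fourier_deriv c a)) x) p"
    by (simp add: \<delta>_def algebra_simps)
qed

lemma algI: "lmult \<theta> a \<in> alg \<theta>" and alg_opI: "rmult \<theta> a \<in> alg_op \<theta>"
  by (simp_all add: alg_def alg_op_def)

lemma scalar_eq_lmult: "scalar c = lmult \<theta> (scaleC c (U 0))"
  and scalar_eq_rmult: "scalar c = rmult \<theta> (scaleC c (U 0))"
  by (simp_all add: lmult_scaleC lmult_U0 rmult_scaleC rmult_U0)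

lemma scalar_in_alg [simp]: "scalar c \<in> alg \<theta>" and scalar_in_alg_op [simp]: "scalar c \<in> alg_op \<theta>"
  by (metis scalar_eq_lmult algI) (metis scalar_eq_rmult alg_opI)

lemma one_in_alg_op [simp]: "1 \<in> alg_op \<theta>"
  using scalar_in_alg_op[of 1] by simp

lemma alg_mult: "S \<in> alg \<theta> \<Longrightarrow> T \<in> alg \<theta> \<Longrightarrow> S * T \<in> alg \<theta>"
  by (auto simp: alg_def lmult_mult)

lemma alg_op_mult: "S \<in> alg_op \<theta> \<Longrightarrow> T \<in> alg_op \<theta> \<Longrightarrow> S * T \<in> alg_op \<theta>"
  by (auto simp: alg_op_def rmult_mult)

lemma alg_op_add: "S \<in> alg_op \<theta> \<Longrightarrow> T \<in> alg_op \<theta> \<Longrightarrow> S + T \<in> alg_op \<theta>"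
  by (auto simp: alg_op_def rmult_add[symmetric])

lemma alg_op_minus: "S \<in> alg_op \<theta> \<Longrightarrow> - S \<in> alg_op \<theta>"
  using alg_op_mult[OF scalar_in_alg_op[of "-1"]] by (simp add: scalar_minus)

lemma alg_op_diff: "S \<in> alg_op \<theta> \<Longrightarrow> T \<in> alg_op \<theta> \<Longrightarrow> S - T \<in> alg_op \<theta>"
  using alg_op_add[OF _ alg_op_minus] by fastforce

lemma alg_op_scaleR: "S \<in> alg_op \<theta> \<Longrightarrow> r *\<^sub>R S \<in> alg_op \<theta>"
  using alg_op_mult[OF scalar_in_alg_op[of "of_real r"]] by (simp add: scaleR_scalar)

lemma alg_op_0 [simp]: "0 \<in> alg_op \<theta>"
  using scalar_in_alg_op[of 0] by simp

lemma alg_op_sum: "(\<And>i. i \<in> A \<Longrightarrow> f i \<in> alg_op \<theta>) \<Longrightarrow> sum f A \<in> alg_op \<theta>"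
  by (induction A rule: infinite_finite_induct) (auto intro: alg_op_add)

lemma alg_op_power: "S \<in> alg_op \<theta> \<Longrightarrow> S ^ n \<in> alg_op \<theta>"
  by (induction n) (auto intro: alg_op_mult)

lemma alg_op_\<delta>: "S \<in> alg_op \<theta> \<Longrightarrow> \<delta> c S \<in> alg_op \<theta>"
  by (auto simp: alg_op_def \<delta>_rmult)

lemma alg_\<delta>: "S \<in> alg \<theta> \<Longrightarrow> \<delta> c S \<in> alg \<theta>"
  by (auto simp: alg_def \<delta>_lmult)

lemma alg_op_alg_commute: "S \<in> alg_op \<theta> \<Longrightarrow> T \<in> alg \<theta> \<Longrightarrow> S * T = T * S"
  by (auto simp: alg_def alg_op_def lmult_rmult_commute)

lemma scalar_in_alg_hat [simp]: "scalar c \<in> alg_hat \<theta>"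
  by (rule alg_hat.left) simp

lemma alg_hat_0 [simp]: "0 \<in> alg_hat \<theta>"
  using scalar_in_alg_hat[of 0] by simp

lemma alg_hat_1 [simp]: "1 \<in> alg_hat \<theta>"
  using scalar_in_alg_hat[of 1] by simp

lemma alg_hat_minus: "S \<in> alg_hat \<theta> \<Longrightarrow> - S \<in> alg_hat \<theta>"
  using alg_hat.scale[of S \<theta> "-1"] by (simp add: scalar_minus)

lemma alg_hat_diff: "S \<in> alg_hat \<theta> \<Longrightarrow> T \<in> alg_hat \<theta> \<Longrightarrow> S - T \<in> alg_hat \<theta>"
  using alg_hat.add[OF _ alg_hat_minus] by fastforce

lemma alg_hat_sum: "(\<And>i. i \<in> A \<Longrightarrow> f i \<in> alg_hat \<theta>) \<Longrightarrow> sum f A \<in> alg_hat \<theta>"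
  by (induction A rule: infinite_finite_induct) (auto intro: alg_hat.add)

lemma \<delta>_add: "\<delta> c (S + T) = \<delta> c S + \<delta> c T"
  and \<delta>_mult: "\<delta> c (S * T) = \<delta> c S * T + S * \<delta> c T"
  and \<delta>_scalar [simp]: "\<delta> c (scalar z) = 0"
  and \<delta>_minus: "\<delta> c (- T) = - \<delta> c T"
  and \<delta>_0 [simp]: "\<delta> c 0 = 0"
  and \<delta>_1 [simp]: "\<delta> c 1 = 0"
  by (simp_all add: \<delta>_def algebra_simps scalar_commute)

lemma \<delta>_diff: "\<delta> c (S - T) = \<delta> c S - \<delta> c T"
  by (simp add: \<delta>_def algebra_simps)

lemma \<delta>_scalar_mult: "\<delta> c (scalar z * T) = scalar z * \<delta> c T"
  by (simp add: \<delta>_mult)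

lemma alg_hat_\<delta>: "S \<in> alg_hat \<theta> \<Longrightarrow> \<delta> c S \<in> alg_hat \<theta>"
proof (induction rule: alg_hat.induct)
  case (mult S T)
  then show ?case by (auto simp: \<delta>_mult intro: alg_hat.intros)
qed (auto simp: \<delta>_add \<delta>_scalar_mult intro: alg_hat.intros alg_\<delta> alg_op_\<delta>)

section \<open>The factorized trace\<close>

text \<open>Lists instead of indexed families make addition a concatenation and allow list induction
  over \<open>alg_hat\<close>.\<close>

definition tensor_sum :: "real^4^4 \<Rightarrow> (torus_fun \<times> torus_fun) list \<Rightarrow> endo"
  where "tensor_sum \<theta> xs = (\<Sum>(a, b)\<leftarrow>xs. lmult \<theta> a * rmult \<theta> b)"

lemma tensor_sum_simps [simp]: "tensor_sum \<theta> [] = 0"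
  "tensor_sum \<theta> ((a, b) # xs) = lmult \<theta> a * rmult \<theta> b + tensor_sum \<theta> xs"
  "tensor_sum \<theta> (xs @ ys) = tensor_sum \<theta> xs + tensor_sum \<theta> ys"
  by (simp_all add: tensor_sum_def)

lemma tensor_mult: "lmult \<theta> a * rmult \<theta> b * (lmult \<theta> a' * rmult \<theta> b')
    = lmult \<theta> (tmult \<theta> a a') * rmult \<theta> (tmult \<theta> b' b)"
  by (metis lmult_mult rmult_mult lmult_rmult_commute mult.assoc)

lemma tensor_sum_mult1: "\<exists>zs. lmult \<theta> a * rmult \<theta> b * tensor_sum \<theta> ys = tensor_sum \<theta> zs"
proof (induction ys)
  case (Cons y ys)
  then obtain zs where "lmult \<theta> a * rmult \<theta> b * tensor_sum \<theta> ys = tensor_sum \<theta> zs" by blast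
  then have "lmult \<theta> a * rmult \<theta> b * tensor_sum \<theta> (y # ys)
      = tensor_sum \<theta> ((tmult \<theta> a (fst y), tmult \<theta> (snd y) b) # zs)"
    by (cases y) (simp add: distrib_left tensor_mult)
  then show ?case by blast
qed (auto intro: exI[of _ "[]"])

lemma tensor_sum_mult: "\<exists>zs. tensor_sum \<theta> xs * tensor_sum \<theta> ys = tensor_sum \<theta> zs"
proof (induction xs)
  case (Cons x xs)
  then obtain zs where "tensor_sum \<theta> xs * tensor_sum \<theta> ys = tensor_sum \<theta> zs" by blast
  moreover obtain us where "lmult \<theta> (fst x) * rmult \<theta> (snd x) * tensor_sum \<theta> ys = tensor_sum \<theta> us"
    using tensor_sum_mult1 by blast
  ultimately have "tensor_sum \<theta> (x # xs) * tensor_sum \<theta> ys = tensor_sum \<theta> (us @ zs)"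
    by (cases x) (simp add: distrib_right)
  then show ?case by blast
qed (auto intro: exI[of _ "[]"])

text \<open>Since left and right multiplications commute, a product of elementary tensors is again
  one, so sums of them are already closed under multiplication.\<close>

lemma alg_hat_tensor_sum: "T \<in> alg_hat \<theta> \<Longrightarrow> \<exists>xs. T = tensor_sum \<theta> xs"
proof (induction rule: alg_hat.induct)
  case (left S)
  then obtain a where "S = tensor_sum \<theta> [(a, U 0)]" by (auto simp: alg_def rmult_U0)
  then show ?case by blast
next
  case (right S)
  then obtain b where "S = tensor_sum \<theta> [(U 0, b)]" by (auto simp: alg_op_def lmult_U0)
  then show ?case by blast
next
  case (scale S c)
  have "scalar c = tensor_sum \<theta> [(scaleC c (U 0), U 0)]"
    by (simp add: lmult_scaleC lmult_U0 rmult_U0)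
  then show ?case using scale tensor_sum_mult by metis
next
  case (add S T)
  then show ?case by (metis tensor_sum_simps(3))
next
  case (mult S T)
  then show ?case using tensor_sum_mult by metis
qed

text \<open>The commutation factor in \<open>U^l U^m = chi \<theta> l m U^m U^l\<close>, which for
  fixed \<open>l\<close> is a character of the lattice in \<open>m\<close>.\<close>

definition chi :: "real^4^4 \<Rightarrow> int^4 \<Rightarrow> int^4 \<Rightarrow> complex"
  where "chi \<theta> l m = twist \<theta> l m * twist \<theta> m (- l)"

lemma norm_chi [simp]: "cmod (chi \<theta> l m) = 1"
  by (simp add: chi_def norm_mult)

lemma chi_add: "chi \<theta> l (m + n) = chi \<theta> l m * chi \<theta> l n"
  by (simp add: chi_def twist_add_left twist_add_right)

lemma chi_0_left [simp]: "chi \<theta> 0 m = 1"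
  by (simp add: chi_def)

text \<open>At a fixed offset \<open>p\<close> the matrix coefficients of an element of
  \<open>alg_hat\<close> are, up to a phase, an absolutely convergent sum of characters in
  \<open>m\<close>. Both uniqueness results, for the trace and for symbols, rest on this almost
  periodicity. For \<open>p = 0\<close> the coefficient at \<open>l = 0\<close> is the value that
  the trace should take.\<close>

lemma coeff_tensor_sum_U:
  fixes \<theta> :: "real^4^4"
  defines "G \<equiv> \<lambda>xs p l. \<Sum>(a, b)\<leftarrow>xs. coeff a l * coeff b (p - l) * twist \<theta> l (p - l)"
  shows "(\<lambda>l. cmod (G xs p l)) summable_on UNIV"
    and "coeff (app (tensor_sum \<theta> xs) (U m)) (m + p) = twist \<theta> m p * (\<Sum>\<^sub>\<infinity>l. G xs p l * chi \<theta> l m)"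
proof -
  have "(\<lambda>l. cmod (G xs p l)) summable_on UNIV \<and>
    coeff (app (tensor_sum \<theta> xs) (U m)) (m + p) = twist \<theta> m p * (\<Sum>\<^sub>\<infinity>l. G xs p l * chi \<theta> l m)"
  proof (induction xs)
    case Nil
    then show ?case by (simp add: G_def)
  next
    case (Cons x xs)
    obtain a b where x: "x = (a, b)" by (cases x)
    let ?f = "\<lambda>l. coeff a l * coeff b (p - l) * twist \<theta> l (p - l)"
    have G: "G (x # xs) p l = ?f l + G xs p l" for l
      by (simp add: G_def x)
    have sf: "(\<lambda>l. cmod (?f l)) summable_on UNIV"
      by (rule twisted_conv_abs_summable[OF rapid_coeff rapid_coeff])
    have sG: "(\<lambda>l. cmod (G xs p l)) summable_on UNIV" using Cons by blast
    have chi_sum: "(\<lambda>l. f l * chi \<theta> l m) summable_on UNIV"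
      if "(\<lambda>l. cmod (f l)) summable_on UNIV" for f
      by (rule abs_summable_summable) (use that in \<open>simp add: norm_mult\<close>)
    have "coeff (app (lmult \<theta> a * rmult \<theta> b) (U m)) (m + p)
        = (\<Sum>\<^sub>\<infinity>l. twist \<theta> m p * (?f l * chi \<theta> l m))"
      unfolding coeff_lmult_rmult_U
    proof (intro infsum_cong)
      fix l
      have "twist \<theta> m (p - l) * twist \<theta> l (m + p - l) = twist \<theta> m p * (twist \<theta> l (p - l) * chi \<theta> l m)"
        by (simp add: chi_def twist_add_right twist_diff_right twist_minus_right divide_inverse mult_ac)
      moreover have "m + p - m - l = p - l" by simp
      ultimately show "coeff a l * coeff b (m + p - m - l) * (twist \<theta> m (m + p - m - l) * twist \<theta> l (m + p - l))
          = twist \<theta> m p * (?f l * chi \<theta> l m)"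
        by (simp only:) (simp only: mult_ac)
    qed
    also have "\<dots> = twist \<theta> m p * (\<Sum>\<^sub>\<infinity>l. ?f l * chi \<theta> l m)"
      by (rule infsum_cmult_right')
    finally have "coeff (app (tensor_sum \<theta> (x # xs)) (U m)) (m + p)
        = twist \<theta> m p * ((\<Sum>\<^sub>\<infinity>l. ?f l * chi \<theta> l m) + (\<Sum>\<^sub>\<infinity>l. G xs p l * chi \<theta> l m))"
      using Cons by (simp add: x distrib_left)
    also have "\<dots> = twist \<theta> m p * (\<Sum>\<^sub>\<infinity>l. G (x # xs) p l * chi \<theta> l m)"
      unfolding G distrib_right by (simp only: infsum_add[OF chi_sum[OF sf] chi_sum[OF sG]])
    finally have "coeff (app (tensor_sum \<theta> (x # xs)) (U m)) (m + p)
        = twist \<theta> m p * (\<Sum>\<^sub>\<infinity>l. G (x # xs) p l * chi \<theta> l m)" .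
    moreover have "(\<lambda>l. cmod (G (x # xs) p l)) summable_on UNIV"
      unfolding G
      by (rule summable_on_comparison_test[OF summable_on_add[OF sf sG]])
        (auto intro: norm_triangle_ineq)
    ultimately show ?case by blast
  qed
  then show "(\<lambda>l. cmod (G xs p l)) summable_on UNIV"
    and "coeff (app (tensor_sum \<theta> xs) (U m)) (m + p) = twist \<theta> m p * (\<Sum>\<^sub>\<infinity>l. G xs p l * chi \<theta> l m)"
    by blast+
qed

text \<open>If the character of \<open>l\<close> were trivial, \<open>U l\<close> would commute with
  the whole algebra and be a scalar; but a scalar cannot map \<open>U 0\<close> to
  \<open>U l\<close>.\<close>

lemma chi_nontrivial:
  assumes "strictly_irrational \<theta>" "l \<noteq> 0"
  shows "\<exists>m. chi \<theta> l m \<noteq> 1"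
proof (rule ccontr)
  assume "\<not> (\<exists>m. chi \<theta> l m \<noteq> 1)"
  then have "chi \<theta> l m = 1" for m by blast
  then have tw: "twist \<theta> l m = twist \<theta> m l" for m
    by (simp add: chi_def twist_minus_right field_simps)
  have "tmult \<theta> (U l) a = tmult \<theta> a (U l)" for a
    by (intro torus_fun_eqI) (simp add: coeff_tmult_U_left coeff_tmult_U_right tw)
  then have "lmult \<theta> (U l) \<in> {S \<in> alg \<theta>. \<forall>T\<in>alg \<theta>. S * T = T * S}"
    by (auto simp: alg_def lmult_mult)
  then obtain c where "lmult \<theta> (U l) = scalar c"
    using assms(1) unfolding strictly_irrational_def by blast
  then have "coeff (app (lmult \<theta> (U l)) (U 0)) l = coeff (app (scalar c) (U 0)) l" by simp
  then show False using assms(2) by (simp add: coeff_tmult_U_left U.rep_eq)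
qed

lemma cmod_half_sum_less_1:
  assumes "cmod w = 1" "w \<noteq> 1"
  shows "cmod ((1 + w) / 2) < 1"
proof -
  have w2: "(Re w)\<^sup>2 + (Im w)\<^sup>2 = 1" using assms(1) by (metis cmod_power2 power_one)
  have "Re w \<noteq> 1"
    using w2 assms(2) by (auto simp: complex_eq_iff)
  moreover have "Re w \<le> 1" using complex_Re_le_cmod[of w] assms(1) by simp
  ultimately have "Re w < 1" by simp
  then have "(cmod (1 + w))\<^sup>2 < 2\<^sup>2"
    using w2 unfolding cmod_power2 by (simp add: power2_sum)
  then have "cmod (1 + w) < 2" by (rule power_less_imp_less_base) simp
  then show ?thesis by (simp add: norm_divide)
qed

text \<open>Averaging over translates with the weights \<open>((1 + \<kappa>(n)) / 2)\<^sup>N\<close> removes any nontrivial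
  character without increasing the other coefficients.\<close>

lemma suppress_characters:
  fixes g :: "'l::zero \<Rightarrow> complex" and \<kappa> :: "'l \<Rightarrow> 'm::ab_group_add \<Rightarrow> complex"
  assumes g: "(\<lambda>l. cmod (g l)) summable_on UNIV"
    and \<kappa>: "\<And>l m n. \<kappa> l (m + n) = \<kappa> l m * \<kappa> l n" "\<And>l m. cmod (\<kappa> l m) = 1" "\<And>m. \<kappa> 0 m = 1"
    and nontriv: "\<And>l. l \<noteq> 0 \<Longrightarrow> \<exists>m. \<kappa> l m \<noteq> 1"
    and vanish: "\<And>m. (\<Sum>\<^sub>\<infinity>l. g l * \<kappa> l m) = 0"
    and F: "finite F" "0 \<notin> F" and "e > 0"
  shows "\<exists>h. h 0 = g 0 \<and> (\<forall>l. cmod (h l) \<le> cmod (g l)) \<and> (\<forall>m. (\<Sum>\<^sub>\<infinity>l. h l * \<kappa> l m) = 0)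
    \<and> (\<Sum>l\<in>F. cmod (h l)) \<le> e"
  using F \<open>e > 0\<close>
proof (induction F arbitrary: e)
  case empty
  then show ?case using vanish by (intro exI[of _ g]) auto
next
  case (insert l F)
  from insert.IH[of "e / 2"] insert.prems obtain h where h: "h 0 = g 0" "\<And>l. cmod (h l) \<le> cmod (g l)"
    "\<And>m. (\<Sum>\<^sub>\<infinity>l. h l * \<kappa> l m) = 0" "(\<Sum>l\<in>F. cmod (h l)) \<le> e / 2" by auto
  obtain n where n: "\<kappa> l n \<noteq> 1" using nontriv[of l] insert.prems by blast
  define z where "z j = (1 + \<kappa> j n) / 2" for j
  define k where "k N j = h j * z j ^ N" for N j
  have z1: "cmod (z j) \<le> 1" for j
    using norm_triangle_ineq[of 1 "\<kappa> j n"] by (simp add: z_def norm_divide \<kappa>)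
  have kh: "cmod (k N j) \<le> cmod (h j)" for N j
    using mult_left_mono[OF power_le_one[OF norm_ge_zero z1], of "cmod (h j)" j N]
    by (simp add: k_def norm_mult norm_power)
  have ks: "(\<lambda>j. k N j * \<kappa> j m) summable_on UNIV" for N m
    by (rule abs_summable_summable, rule summable_on_comparison_test[OF g])
      (auto simp: norm_mult \<kappa> intro: order_trans[OF kh h(2)])
  have k0: "(\<Sum>\<^sub>\<infinity>j. k N j * \<kappa> j m) = 0" for N m
  proof (induction N arbitrary: m)
    case 0
    then show ?case by (simp add: k_def h)
  next
    case (Suc N)
    have "(\<Sum>\<^sub>\<infinity>j. k (Suc N) j * \<kappa> j m) = (\<Sum>\<^sub>\<infinity>j. 1 / 2 * (k N j * \<kappa> j m + k N j * \<kappa> j (m + n)))"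
      by (intro infsum_cong) (simp add: k_def z_def \<kappa> field_simps)
    also have "\<dots> = 0"
      unfolding infsum_cmult_right' by (subst infsum_add[OF ks ks]) (simp add: Suc)
    finally show ?case .
  qed
  have "(\<lambda>N. cmod (g l) * cmod (z l) ^ N) \<longlonglongrightarrow> cmod (g l) * 0"
    using cmod_half_sum_less_1[OF \<kappa>(2) n] by (intro tendsto_mult LIMSEQ_power_zero) (auto simp: z_def)
  then have "\<forall>\<^sub>F N in sequentially. cmod (g l) * cmod (z l) ^ N < e / 2"
    using insert.prems by (intro order_tendstoD) auto
  then obtain N where N: "cmod (g l) * cmod (z l) ^ N < e / 2"
    by (auto simp: eventually_sequentially)
  have "cmod (k N l) \<le> e / 2"
    using N mult_right_mono[OF h(2)[of l], of "cmod (z l) ^ N"] by (simp add: k_def norm_mult norm_power)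
  moreover have "(\<Sum>j\<in>F. cmod (k N j)) \<le> e / 2"
    using sum_mono[of F "\<lambda>j. cmod (k N j)" "\<lambda>j. cmod (h j)"] kh h(4) by force
  ultimately have "(\<Sum>j\<in>insert l F. cmod (k N j)) \<le> e"
    using insert.hyps by simp
  moreover have "k N 0 = g 0" by (simp add: k_def z_def \<kappa> h)
  moreover have "cmod (k N j) \<le> cmod (g j)" for j using order_trans[OF kh h(2)] .
  ultimately show ?case using k0 by blast
qed

text \<open>Uniqueness of the constant coefficient of an almost periodic function. Suppressing the
  finitely many other characters that carry all but \<open>e / 2\<close> of the mass leaves a
  vanishing sum in which the coefficient at 0 is balanced by at most \<open>e\<close>.\<close>

lemma trivial_character_coeff_0:
  fixes g :: "'l::zero \<Rightarrow> complex" and \<kappa> :: "'l \<Rightarrow> 'm::ab_group_add \<Rightarrow> complex"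
  assumes g: "(\<lambda>l. cmod (g l)) summable_on UNIV"
    and \<kappa>: "\<And>l m n. \<kappa> l (m + n) = \<kappa> l m * \<kappa> l n" "\<And>l m. cmod (\<kappa> l m) = 1" "\<And>m. \<kappa> 0 m = 1"
    and nontriv: "\<And>l. l \<noteq> 0 \<Longrightarrow> \<exists>m. \<kappa> l m \<noteq> 1"
    and vanish: "\<And>m. (\<Sum>\<^sub>\<infinity>l. g l * \<kappa> l m) = 0"
  shows "g 0 = 0"
proof -
  have "cmod (g 0) \<le> 0 + e" if e: "e > 0" for e :: real
  proof -
    obtain F where F: "finite F" "infsum (\<lambda>l. cmod (g l)) (- F) \<le> e / 2"
      using infsum_tail_small[OF g, of "e / 2"] e by auto
    obtain h where h: "h 0 = g 0" "\<And>l. cmod (h l) \<le> cmod (g l)"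
      "\<And>m. (\<Sum>\<^sub>\<infinity>l. h l * \<kappa> l m) = 0" "(\<Sum>l\<in>F - {0}. cmod (h l)) \<le> e / 2"
      using suppress_characters[OF g \<kappa> nontriv vanish, of "F - {0}" "e / 2"] F(1) e by auto
    have hs: "(\<lambda>l. cmod (h l)) summable_on UNIV"
      by (rule summable_on_comparison_test[OF g]) (auto simp: h)
    have hcs: "(\<lambda>l. cmod (h l * \<kappa> l 0)) summable_on A" for A
      using summable_on_subset_banach[OF hs, of A] by (simp add: norm_mult \<kappa>)
    let ?B = "UNIV - {0}"
    have "0 = (\<Sum>\<^sub>\<infinity>l. h l * \<kappa> l 0)" by (simp add: h)
    also have "\<dots> = (\<Sum>\<^sub>\<infinity>l\<in>{0}. h l * \<kappa> l 0) + (\<Sum>\<^sub>\<infinity>l\<in>?B. h l * \<kappa> l 0)"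
      by (subst infsum_Un_disjoint[symmetric]) (auto intro: abs_summable_summable[OF hcs])
    finally have "g 0 = - (\<Sum>\<^sub>\<infinity>l\<in>?B. h l * \<kappa> l 0)"
      by (simp add: \<kappa> h eq_neg_iff_add_eq_0)
    then have "cmod (g 0) \<le> (\<Sum>\<^sub>\<infinity>l\<in>?B. cmod (h l * \<kappa> l 0))"
      using norm_infsum_bound[OF hcs, of ?B] by simp
    also have "\<dots> = (\<Sum>\<^sub>\<infinity>l\<in>?B. cmod (h l))" by (simp add: norm_mult \<kappa>)
    also have "\<dots> = (\<Sum>\<^sub>\<infinity>l\<in>F - {0}. cmod (h l)) + (\<Sum>\<^sub>\<infinity>l\<in>- F - {0}. cmod (h l))"
      by (subst infsum_Un_disjoint[symmetric])
        (auto intro: summable_on_subset_banach[OF hs] intro!: arg_cong[of _ _ "infsum _"])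
    also have "\<dots> \<le> e / 2 + (\<Sum>\<^sub>\<infinity>l\<in>- F. cmod (g l))"
    proof (intro add_mono)
      show "(\<Sum>\<^sub>\<infinity>l\<in>F - {0}. cmod (h l)) \<le> e / 2" using h(4) F(1) by simp
      show "(\<Sum>\<^sub>\<infinity>l\<in>- F - {0}. cmod (h l)) \<le> (\<Sum>\<^sub>\<infinity>l\<in>- F. cmod (g l))"
        by (rule infsum_mono_neutral) (auto simp: h intro: summable_on_subset_banach[OF hs] summable_on_subset_banach[OF g])
    qed
    also have "\<dots> \<le> 0 + e" using F(2) by simp
    finally show ?thesis .
  qed
  then have "cmod (g 0) \<le> 0" by (rule field_le_epsilon)
  then show ?thesis by simp
qed

text \<open>A chord is at most as long as its arc.\<close>

lemma cmod_cis_minus_1_le: "cmod (cis x - 1) \<le> \<bar>x\<bar>"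
proof (rule power2_le_imp_le)
  have "(cmod (cis x - 1))\<^sup>2 = 2 - 2 * cos x"
    unfolding cmod_power2 using sin_cos_squared_add[of x] by (simp add: power2_diff)
  also have "\<dots> = 4 * (sin (x / 2))\<^sup>2"
    using cos_double_sin[of "x / 2"] by simp
  also have "\<dots> \<le> 4 * (x / 2)\<^sup>2"
    using abs_sin_x_le_abs_x[of "x / 2"] by (simp only: abs_le_square_iff mult_le_cancel_left_pos zero_less_numeral)
  finally show "(cmod (cis x - 1))\<^sup>2 \<le> \<bar>x\<bar>\<^sup>2" by (simp add: power_divide)
qed simp

text \<open>Simultaneous Dirichlet approximation of the arguments, arranged so that the return time
  can be made as late as desired.\<close>

lemma unimodular_recurrence:
  fixes z :: "'l \<Rightarrow> complex"
  assumes "finite F" "\<And>l. cmod (z l) = 1" "e > 0"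
  shows "\<exists>t\<ge>t0. \<forall>l\<in>F. cmod (z l ^ t - 1) \<le> e"
proof -
  \<comment> \<open>Approximating the arguments of \<open>z l ^ L\<close> instead of
    \<open>z l\<close> makes the exponent a positive multiple of \<open>L\<close>, hence at least
    \<open>t0\<close>.\<close>
  define L where "L = Suc t0"
  define n where "n = card F"
  obtain f where f: "bij_betw f {..<n} F"
    using ex_bij_betw_nat_finite[OF assms(1)] by (auto simp: n_def atLeast0LessThan)
  define \<alpha> where "\<alpha> i = Arg (z (f i) ^ L) / (2 * pi)" for i
  \<comment> \<open>The arguments are measured in units of \<open>2 * pi\<close>, so an error below
    \<open>1 / N\<close> moves the power by at most \<open>2 * pi / N\<close>.\<close>
  obtain N where N: "2 * pi / e < real N" using reals_Archimedean2 by blast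
  have "0 < 2 * pi / e" using assms(3) by simp
  then have N0: "0 < N" using N by (cases N) auto
  obtain q p where q: "0 < q" and qp: "\<And>i. i < n \<Longrightarrow> \<bar>of_int q * \<alpha> i - of_int (p i)\<bar> < 1 / N"
    using Dirichlet_approx_simult[OF N0, of n \<alpha>] by blast
  have "cmod (z l ^ (L * nat q) - 1) \<le> e" if "l \<in> F" for l
  proof -
    obtain i where i: "i < n" "l = f i" using f \<open>l \<in> F\<close> by (auto simp: bij_betw_def)
    have n1: "cmod (z l ^ L) = 1" by (simp add: norm_power assms)
    then have "z l ^ L \<noteq> 0" by (metis norm_zero zero_neq_one)
    then have "z l ^ L = cis (2 * pi * \<alpha> i)"
      using cis_Arg[of "z l ^ L"] n1 by (simp add: \<alpha>_def i sgn_div_norm)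
    then have "z l ^ (L * nat q) = cis (2 * pi * \<alpha> i) ^ nat q" by (simp add: power_mult)
    also have "\<dots> = cis (real (nat q) * (2 * pi * \<alpha> i))" by (rule Complex.DeMoivre)
    also have "\<dots> = cis (2 * pi * (of_int q * \<alpha> i - of_int (p i))) * cis (2 * pi * of_int (p i))"
      using q by (simp add: cis_mult algebra_simps)
    also have "cis (2 * pi * of_int (p i)) = 1" by (rule cis_multiple_2pi) simp
    finally have "cmod (z l ^ (L * nat q) - 1) \<le> \<bar>2 * pi * (of_int q * \<alpha> i - of_int (p i))\<bar>"
      using cmod_cis_minus_1_le by simp
    also have "\<dots> \<le> 2 * pi * (1 / N)"
      using mult_left_mono[OF less_imp_le[OF qp[OF i(1)]], of "2 * pi"] by (simp only: abs_mult) simp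
    also have "\<dots> \<le> e" using N N0 assms(3) by (simp add: field_simps)
    finally show ?thesis .
  qed
  moreover have "t0 \<le> L * nat q"
  proof -
    have "L * 1 \<le> L * nat q" using q by (intro mult_le_mono2) linarith
    then show ?thesis by (simp add: L_def)
  qed
  ultimately show ?thesis by blast
qed

text \<open>At a late return time the sum is close both to its value at \<open>t = 0\<close> and to
  its limit.\<close>

lemma almost_periodic_tendsto_0:
  fixes c z :: "'l \<Rightarrow> complex"
  assumes c: "(\<lambda>l. cmod (c l)) summable_on UNIV" and z: "\<And>l. cmod (z l) = 1"
    and lim: "(\<lambda>t. \<Sum>\<^sub>\<infinity>l. c l * z l ^ t) \<longlonglongrightarrow> 0"
  shows "(\<Sum>\<^sub>\<infinity>l. c l) = 0"
proof -
  let ?A = "\<Sum>\<^sub>\<infinity>l. cmod (c l)"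
  have A0: "0 \<le> ?A" by (intro infsum_nonneg) simp
  have "cmod (\<Sum>\<^sub>\<infinity>l. c l) \<le> 0 + e" if e: "e > 0" for e :: real
  proof -
    \<comment> \<open>The tail enters twice, through \<open>c l\<close> and through
      \<open>c l * z l ^ t\<close>, so \<open>e / 6\<close> yields one third of \<open>e\<close>;
      the recurrence on \<open>F\<close> and the limit supply the other two.\<close>
    obtain F where F: "finite F" "infsum (\<lambda>l. cmod (c l)) (- F) \<le> e / 6"
      using infsum_tail_small[OF c, of "e / 6"] e by auto
    obtain t0 where t0: "\<And>t. t \<ge> t0 \<Longrightarrow> cmod (\<Sum>\<^sub>\<infinity>l. c l * z l ^ t) < e / 3"
      using LIMSEQ_D[OF lim, of "e / 3"] e by auto
    have "0 < e / (3 * (?A + 1))" using A0 e by simp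
    from unimodular_recurrence[of F z, OF F(1) z this, of t0]
    obtain t where t: "t \<ge> t0" "\<And>l. l \<in> F \<Longrightarrow> cmod (z l ^ t - 1) \<le> e / (3 * (?A + 1))" by blast
    have s1: "(\<lambda>l. c l) summable_on UNIV" using c by (rule abs_summable_summable)
    have s2: "(\<lambda>l. - (c l * z l ^ t)) summable_on UNIV"
      by (rule abs_summable_summable) (use c in \<open>simp add: norm_mult norm_power z\<close>)
    have s3: "(\<lambda>l. cmod (c l + - (c l * z l ^ t))) summable_on UNIV"
    proof (rule summable_on_comparison_test[OF summable_on_cmult_right[OF c, of 2]])
      show "cmod (c l + - (c l * z l ^ t)) \<le> 2 * cmod (c l)" for l
        using norm_triangle_ineq[of "c l" "- (c l * z l ^ t)"] by (simp add: norm_mult norm_power z)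
    qed simp
    have cancel: "a * (e / (3 * a)) = e / 3" if "a \<noteq> 0" for a :: real using that by simp
    have b2: "cmod (c l + - (c l * z l ^ t)) \<le> 2 * cmod (c l)" for l
      using norm_triangle_ineq[of "c l" "- (c l * z l ^ t)"] by (simp add: norm_mult norm_power z)
    have b1: "cmod (c l + - (c l * z l ^ t)) \<le> cmod (c l) * (e / (3 * (?A + 1)))" if "l \<in> F" for l
    proof -
      have "c l + - (c l * z l ^ t) = - (c l * (z l ^ t - 1))" by (simp add: algebra_simps)
      then show ?thesis using mult_left_mono[OF t(2)[OF that], of "cmod (c l)"] by (simp add: norm_mult)
    qed
    have "cmod ((\<Sum>\<^sub>\<infinity>l. c l) + (\<Sum>\<^sub>\<infinity>l. - (c l * z l ^ t))) \<le> (\<Sum>\<^sub>\<infinity>l. cmod (c l + - (c l * z l ^ t)))"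
      using norm_infsum_bound[OF s3] by (simp only: infsum_add[OF s1 s2])
    also have "\<dots> = (\<Sum>\<^sub>\<infinity>l\<in>F. cmod (c l + - (c l * z l ^ t))) + (\<Sum>\<^sub>\<infinity>l\<in>- F. cmod (c l + - (c l * z l ^ t)))"
      using infsum_Un_disjoint[of "\<lambda>l. cmod (c l + - (c l * z l ^ t))" F "- F"] F(1) summable_on_subset_banach[OF s3]
      by simp
    also have "\<dots> \<le> (\<Sum>l\<in>F. cmod (c l) * (e / (3 * (?A + 1)))) + (\<Sum>\<^sub>\<infinity>l\<in>- F. 2 * cmod (c l))"
    proof (intro add_mono)
      show "(\<Sum>\<^sub>\<infinity>l\<in>F. cmod (c l + - (c l * z l ^ t))) \<le> (\<Sum>l\<in>F. cmod (c l) * (e / (3 * (?A + 1))))"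
        using F(1) b1 by (simp add: sum_mono)
      show "(\<Sum>\<^sub>\<infinity>l\<in>- F. cmod (c l + - (c l * z l ^ t))) \<le> (\<Sum>\<^sub>\<infinity>l\<in>- F. 2 * cmod (c l))"
        by (intro infsum_mono b2 summable_on_cmult_right summable_on_subset_banach[OF c] summable_on_subset_banach[OF s3]) auto
    qed
    also have "(\<Sum>l\<in>F. cmod (c l) * (e / (3 * (?A + 1)))) \<le> (?A + 1) * (e / (3 * (?A + 1)))"
      unfolding sum_distrib_right[symmetric]
      using finite_sum_le_infsum[OF c F(1)] A0 e by (intro mult_right_mono) auto
    also have "(?A + 1) * (e / (3 * (?A + 1))) = e / 3" using A0 cancel[of "?A + 1"] by auto
    also have "(\<Sum>\<^sub>\<infinity>l\<in>- F. 2 * cmod (c l)) \<le> e / 3"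
      unfolding infsum_cmult_right' using F(2) by simp
    finally have "cmod ((\<Sum>\<^sub>\<infinity>l. c l) - (\<Sum>\<^sub>\<infinity>l. c l * z l ^ t)) \<le> e / 3 + e / 3"
      by (simp add: infsum_uminus)
    then show ?thesis
      using t0[OF t(1)] norm_triangle_ineq[of "(\<Sum>\<^sub>\<infinity>l. c l) - (\<Sum>\<^sub>\<infinity>l. c l * z l ^ t)" "\<Sum>\<^sub>\<infinity>l. c l * z l ^ t"]
      by simp
  qed
  then have "cmod (\<Sum>\<^sub>\<infinity>l. c l) \<le> 0" by (rule field_le_epsilon)
  then show ?thesis by simp
qed

text \<open>The vector state of the constant \<open>U 0\<close>. It is the normalised trace on each
  of the two algebras, but on a product of elements of both it differs from \<open>tau\<close>,
  which is then a product of two values of \<open>phi\<close>.\<close>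

definition phi :: "endo \<Rightarrow> complex"
  where "phi T = coeff (app T (U 0)) 0"

lemma phi_simps: "phi (S + T) = phi S + phi T" "phi (- S) = - phi S" "phi (S - T) = phi S - phi T"
  "phi (scalar c * S) = c * phi S" "phi 0 = 0" "phi (r *\<^sub>R S) = of_real r * phi S"
  by (simp_all add: phi_def)

lemma phi_sum: "phi (sum f A) = (\<Sum>i\<in>A. phi (f i))"
  by (simp add: phi_def)

lemma phi_lmult [simp]: "phi (lmult \<theta> a) = coeff a 0" and phi_rmult [simp]: "phi (rmult \<theta> a) = coeff a 0"
  by (simp_all add: phi_def coeff_tmult_U)

text \<open>At \<open>p = 0\<close> the two convolutions have the same summands, because
  \<open>twist \<theta> l (- l)\<close> and \<open>twist \<theta> (- l) l\<close> coincide.\<close>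

lemma phi_cyclic:
  assumes "S \<in> alg_op \<theta>" "T \<in> alg_op \<theta>"
  shows "phi (S * T) = phi (T * S)"
proof -
  obtain a b where "S = rmult \<theta> a" "T = rmult \<theta> b" using assms by (auto simp: alg_op_def)
  moreover have "coeff (tmult \<theta> a b) 0 = coeff (tmult \<theta> b a) 0"
    unfolding coeff_tmult[of \<theta> a] coeff_tmult_flip[of \<theta> b]
    by (intro infsum_cong) (simp add: twist_minus_left twist_minus_right)
  ultimately show ?thesis by (simp add: rmult_mult)
qed

text \<open>The derivation multiplies the coefficient at 0 by the frequency 0. With the Leibniz rule
  this is integration by parts.\<close>

lemma phi_\<delta>: "S \<in> alg_op \<theta> \<Longrightarrow> phi (\<delta> c S) = 0"
  by (auto simp: alg_op_def \<delta>_rmult)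

section \<open>Well-definedness and linearity of the factorized trace\<close>

context
  fixes \<theta> :: "real^4^4"
  assumes irr: "strictly_irrational \<theta>"
begin

text \<open>The diagonal coefficients of the zero operator are a vanishing sum of characters, whose
  constant coefficient is the sum in question.\<close>

lemma tensor_sum_0_imp:
  assumes "tensor_sum \<theta> xs = 0"
  shows "(\<Sum>(a, b)\<leftarrow>xs. coeff a 0 * coeff b 0) = 0"
proof -
  let ?G = "\<lambda>l. \<Sum>(a, b)\<leftarrow>xs. coeff a l * coeff b (0 - l) * twist \<theta> l (0 - l)"
  have "(\<Sum>\<^sub>\<infinity>l. ?G l * chi \<theta> l m) = 0" for m
    using coeff_tensor_sum_U(2)[of \<theta> xs m 0] by (simp add: assms)
  moreover have "(\<lambda>l. cmod (?G l)) summable_on UNIV" by (rule coeff_tensor_sum_U(1))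
  ultimately have "?G 0 = 0"
    using chi_nontrivial[OF irr]
    by (intro trivial_character_coeff_0[where \<kappa> = "chi \<theta>" and g = ?G]) (auto simp: chi_add)
  then show ?thesis by simp
qed

lemma tensor_sum_eq_imp:
  assumes "tensor_sum \<theta> xs = tensor_sum \<theta> ys"
  shows "(\<Sum>(a, b)\<leftarrow>xs. coeff a 0 * coeff b 0) = (\<Sum>(a, b)\<leftarrow>ys. coeff a 0 * coeff b 0)"
proof -
  let ?zs = "map (\<lambda>(a, b). (scaleC (-1) a, b)) ys"
  have "tensor_sum \<theta> ?zs = - tensor_sum \<theta> ys"
    by (induction ys) (auto simp: lmult_scaleC scalar_minus)
  then have "tensor_sum \<theta> (xs @ ?zs) = 0" using assms by simp
  moreover have "(\<Sum>(a, b)\<leftarrow>?zs. coeff a 0 * coeff b 0) = - (\<Sum>(a, b)\<leftarrow>ys. coeff a 0 * coeff b 0)"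
    by (induction ys) auto
  ultimately show ?thesis
    using tensor_sum_0_imp[of "xs @ ?zs"] by simp
qed

text \<open>Translates between the indexed sums in \<open>tau_def\<close> and lists; the definite
  description is then resolved by \<open>tensor_sum_eq_imp\<close>.\<close>

lemma tau_tensor_sum: "tau \<theta> (tensor_sum \<theta> xs) = (\<Sum>(a, b)\<leftarrow>xs. coeff a 0 * coeff b 0)"
  unfolding tau_def
proof (rule the_equality)
  have list: "(\<Sum>i<n. F (a i) (b i)) = (\<Sum>(a, b)\<leftarrow>map (\<lambda>i. (a i, b i)) [0..<n]. F a b)"
    for n and a b :: "nat \<Rightarrow> torus_fun" and F :: "torus_fun \<Rightarrow> torus_fun \<Rightarrow> 'c::comm_monoid_add"
    by (simp add: sum_list_distinct_conv_sum_set atLeast0LessThan comp_def case_prod_beta')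
  show "\<exists>(n::nat) a b. tensor_sum \<theta> xs = (\<Sum>i<n. lmult \<theta> (a i) * rmult \<theta> (b i))
      \<and> (\<Sum>(a, b)\<leftarrow>xs. coeff a 0 * coeff b 0) = (\<Sum>i<n. coeff (a i) 0 * coeff (b i) 0)"
    by (rule exI[of _ "length xs"], rule exI[of _ "\<lambda>i. fst (xs ! i)"], rule exI[of _ "\<lambda>i. snd (xs ! i)"])
      (simp add: tensor_sum_def sum_list_sum_nth case_prod_beta' atLeast0LessThan)
  fix z
  assume "\<exists>(n::nat) a b. tensor_sum \<theta> xs = (\<Sum>i<n. lmult \<theta> (a i) * rmult \<theta> (b i))
      \<and> z = (\<Sum>i<n. coeff (a i) 0 * coeff (b i) 0)"
  then obtain n :: nat and a b where
    "tensor_sum \<theta> xs = (\<Sum>i<n. lmult \<theta> (a i) * rmult \<theta> (b i))" and z: "z = (\<Sum>i<n. coeff (a i) 0 * coeff (b i) 0)"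
    by blast
  then have "tensor_sum \<theta> xs = tensor_sum \<theta> (map (\<lambda>i. (a i, b i)) [0..<n])"
    unfolding tensor_sum_def[of _ "map _ _"] list[symmetric] by simp
  from tensor_sum_eq_imp[OF this] show "z = (\<Sum>(a, b)\<leftarrow>xs. coeff a 0 * coeff b 0)"
    using z list[of "\<lambda>a b. coeff a 0 * coeff b 0"] by simp
qed

lemma tau_add: "S \<in> alg_hat \<theta> \<Longrightarrow> T \<in> alg_hat \<theta> \<Longrightarrow> tau \<theta> (S + T) = tau \<theta> S + tau \<theta> T"
  using alg_hat_tensor_sum tau_tensor_sum tensor_sum_simps(3)[of \<theta>, symmetric]
  by (metis (no_types, lifting) map_append sum_list_append)

lemma tau_tensor:
  assumes "S \<in> alg \<theta>" "T \<in> alg_op \<theta>"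
  shows "tau \<theta> (S * T) = phi S * phi T"
proof -
  obtain a b where "S = lmult \<theta> a" "T = rmult \<theta> b" using assms by (auto simp: alg_def alg_op_def)
  then show ?thesis using tau_tensor_sum[of "[(a, b)]"] by simp
qed

lemma tau_0: "tau \<theta> 0 = 0"
  using tau_tensor_sum[of "[]"] by simp

lemma tau_scalar:
  assumes "S \<in> alg_hat \<theta>"
  shows "tau \<theta> (scalar c * S) = c * tau \<theta> S"
proof -
  obtain xs where xs: "S = tensor_sum \<theta> xs" using alg_hat_tensor_sum[OF assms] by blast
  let ?ys = "map (\<lambda>(a, b). (scaleC c a, b)) xs"
  have "scalar c * S = tensor_sum \<theta> ?ys"
    unfolding xs by (induction xs) (auto simp: lmult_scaleC distrib_left mult.assoc)
  then have "tau \<theta> (scalar c * S) = (\<Sum>(a, b)\<leftarrow>?ys. coeff a 0 * coeff b 0)" by (simp add: tau_tensor_sum)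
  also have "\<dots> = c * (\<Sum>(a, b)\<leftarrow>xs. coeff a 0 * coeff b 0)"
    by (induction xs) (auto simp: algebra_simps)
  finally show ?thesis by (simp add: xs tau_tensor_sum)
qed

lemma tau_sum: "(\<And>i. i \<in> A \<Longrightarrow> f i \<in> alg_hat \<theta>) \<Longrightarrow> tau \<theta> (sum f A) = (\<Sum>i\<in>A. tau \<theta> (f i))"
  by (induction A rule: infinite_finite_induct) (auto simp: tau_0 tau_add alg_hat_sum)

end

section \<open>Homogeneous symbols\<close>

text \<open>Generated by the coordinates and \<open>1 / (\<xi> \<bullet> \<xi>)\<close>: large
  enough for the inverse of the symbol of \<open>D\<close>, closed under partial derivatives, and
  inductive so that scaling, growth and differentiability follow by rule induction. The zero
  function is given every degree.\<close>

inductive hom :: "int \<Rightarrow> (real^4 \<Rightarrow> complex) \<Rightarrow> bool" where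
  hom_zero: "hom l (\<lambda>_. 0)"
| hom_const: "hom 0 (\<lambda>_. c)"
| hom_coord: "hom 1 (\<lambda>\<xi>. of_real (\<xi> $ a))"
| hom_inv: "hom (-2) (\<lambda>\<xi>. of_real (inverse (\<xi> \<bullet> \<xi>)))"
| hom_add: "hom l f \<Longrightarrow> hom l g \<Longrightarrow> hom l (\<lambda>\<xi>. f \<xi> + g \<xi>)"
| hom_mult: "hom k f \<Longrightarrow> hom l g \<Longrightarrow> hom (k + l) (\<lambda>\<xi>. f \<xi> * g \<xi>)"

lemma hom_cmult: "hom l f \<Longrightarrow> hom l (\<lambda>\<xi>. c * f \<xi>)"
  using hom_mult[OF hom_const] by simp

lemma hom_sum: "(\<And>i. i \<in> A \<Longrightarrow> hom l (f i)) \<Longrightarrow> hom l (\<lambda>\<xi>. \<Sum>i\<in>A. f i \<xi>)"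
  by (induction A rule: infinite_finite_induct) (auto intro: hom_zero hom_add)

lemma hom_scale:
  assumes "hom l f" "t > 0" "\<xi> \<noteq> 0"
  shows "f (t *\<^sub>R \<xi>) = of_real (t powi l) * f \<xi>"
  using assms(1)
proof (induction rule: hom.induct)
  case hom_inv
  then show ?case using assms by (simp add: power_int_minus power2_eq_square mult_ac)
next
  case (hom_mult k f l g)
  then show ?case using assms by (simp add: power_int_add)
qed (auto simp: algebra_simps)

lemma hom_bound:
  assumes "hom l f"
  shows "\<exists>C\<ge>0. \<forall>\<xi>. \<xi> \<noteq> 0 \<longrightarrow> cmod (f \<xi>) \<le> C * norm \<xi> powi l"
  using assms
proof (induction rule: hom.induct)
  case (hom_zero l)
  then show ?case by (intro exI[of _ 0]) auto
next
  case (hom_const c)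
  then show ?case by (intro exI[of _ "cmod c"]) auto
next
  case (hom_coord a)
  then show ?case by (intro exI[of _ 1]) (auto simp: component_le_norm_cart)
next
  case hom_inv
  have "cmod (of_real (inverse (\<xi> \<bullet> \<xi>))) \<le> 1 * norm \<xi> powi (-2)" for \<xi> :: "real^4"
    by (simp add: power_int_minus power2_norm_eq_inner norm_inverse del: of_real_inverse)
  then show ?case by (intro exI[of _ 1]) auto
next
  case (hom_add l f g)
  then obtain C D where C: "0 \<le> C" "\<And>\<xi>. \<xi> \<noteq> 0 \<Longrightarrow> cmod (f \<xi>) \<le> C * norm \<xi> powi l"
    and D: "0 \<le> D" "\<And>\<xi>. \<xi> \<noteq> 0 \<Longrightarrow> cmod (g \<xi>) \<le> D * norm \<xi> powi l" by blast
  have "cmod (f \<xi> + g \<xi>) \<le> (C + D) * norm \<xi> powi l" if "\<xi> \<noteq> 0" for \<xi>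
    using norm_triangle_ineq[of "f \<xi>" "g \<xi>"] C(2)[OF that] D(2)[OF that] by (simp add: distrib_right)
  then show ?case using C(1) D(1) by (intro exI[of _ "C + D"]) auto
next
  case (hom_mult k f l g)
  then obtain C D where C: "0 \<le> C" "\<And>\<xi>. \<xi> \<noteq> 0 \<Longrightarrow> cmod (f \<xi>) \<le> C * norm \<xi> powi k"
    and D: "0 \<le> D" "\<And>\<xi>. \<xi> \<noteq> 0 \<Longrightarrow> cmod (g \<xi>) \<le> D * norm \<xi> powi l" by blast
  have "cmod (f \<xi> * g \<xi>) \<le> (C * D) * norm \<xi> powi (k + l)" if "\<xi> \<noteq> 0" for \<xi>
  proof -
    have "cmod (f \<xi> * g \<xi>) \<le> (C * norm \<xi> powi k) * (D * norm \<xi> powi l)"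
      unfolding norm_mult using C D that by (intro mult_mono) (auto intro!: mult_nonneg_nonneg)
    then show ?thesis using that by (simp add: power_int_add mult_ac)
  qed
  then show ?case using C(1) D(1) by (intro exI[of _ "C * D"]) auto
qed

lemma hom_deriv:
  assumes "hom l f"
  shows "\<exists>g. (\<forall>a. hom (l - 1) (g a)) \<and>
    (\<forall>\<xi>. \<xi> \<noteq> 0 \<longrightarrow> (f has_derivative (\<lambda>h. \<Sum>a\<in>UNIV. of_real (h $ a) * g a \<xi>)) (at \<xi>))"
  using assms
proof (induction rule: hom.induct)
  case (hom_zero l)
  then show ?case by (intro exI[of _ "\<lambda>_ _. 0"]) (auto intro: hom.hom_zero)
next
  case (hom_const c)
  then show ?case by (intro exI[of _ "\<lambda>_ _. 0"]) (auto intro: hom.hom_zero)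
next
  case (hom_coord a)
  have "((\<lambda>\<xi>. of_real (\<xi> $ a) :: complex) has_derivative
      (\<lambda>h. \<Sum>b\<in>UNIV. of_real (h $ b) * (if b = a then 1 else 0))) (at \<xi>)" for \<xi> :: "real^4"
    by (auto intro!: derivative_eq_intros bounded_linear.has_derivative[OF bounded_linear_vec_nth]
      simp: mult_delta_right sum.delta)
  then show ?case
    using hom.hom_const by (intro exI[of _ "\<lambda>b \<xi>. if b = a then 1 else 0"]) auto
next
  case hom_inv
  let ?g = "\<lambda>a (\<xi>::real^4). -2 * (of_real (\<xi> $ a) * (of_real (inverse (\<xi> \<bullet> \<xi>)) * of_real (inverse (\<xi> \<bullet> \<xi>)))) :: complex"
  have A: "((\<lambda>\<xi>. of_real (inverse (\<xi> \<bullet> \<xi>)) :: complex) has_derivative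
      (\<lambda>h. \<Sum>a\<in>UNIV. of_real (h $ a) * ?g a \<xi>)) (at \<xi>)" if "\<xi> \<noteq> 0" for \<xi> :: "real^4"
  proof (rule has_derivative_eq_rhs)
    show "((\<lambda>\<xi>. of_real (inverse (\<xi> \<bullet> \<xi>)) :: complex) has_derivative
      (\<lambda>h. of_real (- (inverse (\<xi> \<bullet> \<xi>) * (\<xi> \<bullet> h + h \<bullet> \<xi>) * inverse (\<xi> \<bullet> \<xi>))))) (at \<xi>)"
      using that by (auto intro!: derivative_eq_intros)
    show "(\<lambda>h. of_real (- (inverse (\<xi> \<bullet> \<xi>) * (\<xi> \<bullet> h + h \<bullet> \<xi>) * inverse (\<xi> \<bullet> \<xi>))))
      = (\<lambda>h. \<Sum>a\<in>UNIV. of_real (h $ a) * ?g a \<xi>)"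
    proof
      fix h
      have "(\<Sum>a\<in>UNIV. of_real (h $ a) * ?g a \<xi>)
        = of_real (-2 * (inverse (\<xi> \<bullet> \<xi>) * inverse (\<xi> \<bullet> \<xi>)) * (\<Sum>a\<in>UNIV. h $ a * \<xi> $ a))"
        unfolding of_real_mult of_real_sum sum_distrib_left by (intro sum.cong refl) (simp add: mult_ac)
      also have "(\<Sum>a\<in>UNIV. h $ a * \<xi> $ a) = h \<bullet> \<xi>" by (simp add: inner_vec_def)
      finally show "of_real (- (inverse (\<xi> \<bullet> \<xi>) * (\<xi> \<bullet> h + h \<bullet> \<xi>) * inverse (\<xi> \<bullet> \<xi>)))
        = (\<Sum>a\<in>UNIV. of_real (h $ a) * ?g a \<xi>)"
        by (simp add: inner_commute[of \<xi> h] algebra_simps)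
    qed
  qed
  have B: "hom (- 2 - 1) (?g a)" for a
    using hom_cmult[OF hom.hom_mult[OF hom.hom_coord hom.hom_mult[OF hom.hom_inv hom.hom_inv]], of "-2" a] by simp
  show ?case by (intro exI[of _ ?g] conjI allI impI A B)
next
  case (hom_add l f g)
  then obtain f' g' where f': "\<And>a. hom (l - 1) (f' a)"
      "\<And>\<xi>. \<xi> \<noteq> 0 \<Longrightarrow> (f has_derivative (\<lambda>h. \<Sum>a\<in>UNIV. of_real (h $ a) * f' a \<xi>)) (at \<xi>)"
    and g': "\<And>a. hom (l - 1) (g' a)"
      "\<And>\<xi>. \<xi> \<noteq> 0 \<Longrightarrow> (g has_derivative (\<lambda>h. \<Sum>a\<in>UNIV. of_real (h $ a) * g' a \<xi>)) (at \<xi>)" by blast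
  have A: "((\<lambda>\<xi>. f \<xi> + g \<xi>) has_derivative (\<lambda>h. \<Sum>a\<in>UNIV. of_real (h $ a) * (f' a \<xi> + g' a \<xi>))) (at \<xi>)"
    if "\<xi> \<noteq> 0" for \<xi>
    by (rule has_derivative_eq_rhs[OF has_derivative_add[OF f'(2)[OF that] g'(2)[OF that]]])
      (simp add: distrib_left sum.distrib)
  show ?case
    by (intro exI[of _ "\<lambda>a \<xi>. f' a \<xi> + g' a \<xi>"] conjI allI impI A hom.hom_add f'(1) g'(1))
next
  case (hom_mult k f l g)
  then obtain f' g' where f': "\<And>a. hom (k - 1) (f' a)"
      "\<And>\<xi>. \<xi> \<noteq> 0 \<Longrightarrow> (f has_derivative (\<lambda>h. \<Sum>a\<in>UNIV. of_real (h $ a) * f' a \<xi>)) (at \<xi>)"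
    and g': "\<And>a. hom (l - 1) (g' a)"
      "\<And>\<xi>. \<xi> \<noteq> 0 \<Longrightarrow> (g has_derivative (\<lambda>h. \<Sum>a\<in>UNIV. of_real (h $ a) * g' a \<xi>)) (at \<xi>)" by blast
  have A: "((\<lambda>\<xi>. f \<xi> * g \<xi>) has_derivative (\<lambda>h. \<Sum>a\<in>UNIV. of_real (h $ a) * (f \<xi> * g' a \<xi> + f' a \<xi> * g \<xi>))) (at \<xi>)"
    if "\<xi> \<noteq> 0" for \<xi>
    by (rule has_derivative_eq_rhs[OF has_derivative_mult[OF f'(2)[OF that] g'(2)[OF that]]])
      (simp add: distrib_left sum.distrib sum_distrib_left sum_distrib_right mult_ac)
  have B: "hom (k + l - 1) (\<lambda>\<xi>. f \<xi> * g' a \<xi> + f' a \<xi> * g \<xi>)" for a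
    using hom.hom_add[of "k + l - 1" "\<lambda>\<xi>. f \<xi> * g' a \<xi>" "\<lambda>\<xi>. f' a \<xi> * g \<xi>"]
      hom.hom_mult[OF hom_mult.hyps(1) g'(1)[of a]] hom.hom_mult[OF f'(1)[of a] hom_mult.hyps(2)]
    by (simp add: algebra_simps)
  show ?case by (intro exI[of _ "\<lambda>a \<xi>. f \<xi> * g' a \<xi> + f' a \<xi> * g \<xi>"] conjI allI impI A B)
qed

text \<open>Finite sums of scalar functions times fixed operators. All dependence on \<xi> is
  scalar, so differentiability in every seminorm of the algebra reduces to the scalar case.\<close>

inductive esym :: "real^4^4 \<Rightarrow> int \<Rightarrow> (real^4 \<Rightarrow> endo) \<Rightarrow> bool" for \<theta> l where
  esym_elem: "hom l f \<Longrightarrow> T \<in> alg_hat \<theta> \<Longrightarrow> esym \<theta> l (\<lambda>\<xi>. scalar (f \<xi>) * T)"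
| esym_add: "esym \<theta> l f \<Longrightarrow> esym \<theta> l g \<Longrightarrow> esym \<theta> l (\<lambda>\<xi>. f \<xi> + g \<xi>)"

lemma esym_zero: "esym \<theta> l (\<lambda>_. 0)"
  using esym_elem[OF hom_zero[of l] alg_hat_0[of \<theta>]] by simp

lemma esym_sum: "(\<And>i. i \<in> A \<Longrightarrow> esym \<theta> l (f i)) \<Longrightarrow> esym \<theta> l (\<lambda>\<xi>. \<Sum>i\<in>A. f i \<xi>)"
  by (induction A rule: infinite_finite_induct) (auto intro: esym_zero esym_add)

lemma esym_const: "T \<in> alg_hat \<theta> \<Longrightarrow> esym \<theta> 0 (\<lambda>_. T)"
  using esym_elem[OF hom_const[of 1]] by simp

lemma esym_mult_hom:
  assumes "hom k h" "esym \<theta> l f"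
  shows "esym \<theta> (k + l) (\<lambda>\<xi>. scalar (h \<xi>) * f \<xi>)"
  using assms(2)
proof (induction rule: esym.induct)
  case (esym_elem f T)
  have "esym \<theta> (k + l) (\<lambda>\<xi>. scalar (h \<xi> * f \<xi>) * T)"
    using esym_elem assms by (intro esym.esym_elem hom_mult)
  then show ?case by (simp add: scalar_mult mult.assoc)
next
  case (esym_add f g)
  then show ?case by (simp add: distrib_left esym.esym_add)
qed

lemma esym_mult_left:
  assumes "A \<in> alg_hat \<theta>" "esym \<theta> l f"
  shows "esym \<theta> l (\<lambda>\<xi>. A * f \<xi>)"
  using assms(2)
proof (induction rule: esym.induct)
  case (esym_elem f T)
  then show ?case using esym.esym_elem[OF esym_elem(1) alg_hat.mult[OF assms(1) esym_elem(2)]]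
    by (simp add: scalar_left_commute)
next
  case (esym_add f g)
  then show ?case by (simp add: distrib_left esym.esym_add)
qed

lemma esym_\<delta>:
  assumes "esym \<theta> l f"
  shows "esym \<theta> l (\<lambda>\<xi>. \<delta> c (f \<xi>))"
  using assms
proof (induction rule: esym.induct)
  case (esym_elem f T)
  then show ?case by (simp add: \<delta>_scalar_mult esym.esym_elem alg_hat_\<delta>)
next
  case (esym_add f g)
  then show ?case by (simp add: \<delta>_add esym.esym_add)
qed

lemma esym_scale:
  assumes "esym \<theta> l f" "t > 0" "\<xi> \<noteq> 0"
  shows "f (t *\<^sub>R \<xi>) = (t powi l) *\<^sub>R f \<xi>"
  using assms(1)
proof (induction rule: esym.induct)
  case (esym_elem f T)
  show ?case unfolding hom_scale[OF esym_elem(1) assms(2,3)]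
    by (simp add: scaleR_scalar scalar_mult mult.assoc)
qed (simp add: scaleR_add_right)

lemma fold_\<delta>_scalar: "fold \<delta> \<alpha> (scalar c * T) = scalar c * fold \<delta> \<alpha> T"
  by (induction \<alpha> arbitrary: T) (auto simp: \<delta>_scalar_mult)

lemma fold_\<delta>_add: "fold \<delta> \<alpha> (S + T) = fold \<delta> \<alpha> S + fold \<delta> \<alpha> T"
  by (induction \<alpha> arbitrary: S T) (auto simp: \<delta>_add)

lemma fold_\<delta>_alg_hat: "T \<in> alg_hat \<theta> \<Longrightarrow> fold \<delta> \<alpha> T \<in> alg_hat \<theta>"
  by (induction \<alpha> arbitrary: T) (auto simp: alg_hat_\<delta>)

text \<open>The factors 2 are inherited from \<open>l2sq_add\<close>; they are harmless in limits
  equal to 0.\<close>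

lemma opnorm_add: "opnorm (S + T) \<le> 2 * opnorm S + 2 * opnorm T"
  unfolding opnorm_def[of "S + T"]
proof (intro SUP_least)
  fix x assume x: "x \<in> {x. l2norm x \<le> 1}"
  let ?a = "l2norm (app S x)" and ?b = "l2norm (app T x)"
  have nn: "0 \<le> ?a" "0 \<le> ?b" by (simp_all add: l2norm_eq)
  have "l2norm (app (S + T) x) \<le> 2 * ?a + 2 * ?b"
    unfolding l2norm_eq[of "app (S + T) x"]
  proof (rule real_le_lsqrt)
    have "l2sq (app (S + T) x) \<le> 2 * ?a\<^sup>2 + 2 * ?b\<^sup>2"
      using l2sq_add[of "app S x" "app T x"] by (simp add: l2norm_eq)
    also have "\<dots> \<le> (2 * ?a + 2 * ?b)\<^sup>2"
      using nn by (simp add: power2_sum power_mult_distrib)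
    finally show "l2sq (app (S + T) x) \<le> (2 * ?a + 2 * ?b)\<^sup>2" .
  qed (use nn in auto)
  then have "ennreal (l2norm (app (S + T) x)) \<le> ennreal (2 * ?a + 2 * ?b)" by (rule ennreal_leI)
  also have "\<dots> = 2 * ennreal ?a + 2 * ennreal ?b"
    using nn by (simp add: ennreal_plus ennreal_mult)
  also have "\<dots> \<le> 2 * opnorm S + 2 * opnorm T"
    using x unfolding opnorm_def by (intro add_mono mult_left_mono SUP_upper) auto
  finally show "ennreal (l2norm (app (S + T) x)) \<le> 2 * opnorm S + 2 * opnorm T" .
qed

lemma opnorm_scalar_le:
  assumes "T \<in> alg_hat \<theta>"
  obtains C where "0 \<le> C" "\<And>c. opnorm (scalar c * T) \<le> ennreal (cmod c * C)"
proof -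
  obtain C where C: "0 \<le> C" "\<And>x. l2sq (app T x) \<le> C * l2sq x"
    using bdd_op_alg_hat[OF assms] unfolding bdd_op_def by blast
  have "opnorm (scalar c * T) \<le> ennreal (cmod c * sqrt C)" for c
  proof (rule opnorm_le)
    fix x
    have "l2sq (app (scalar c * T) x) \<le> (cmod c)\<^sup>2 * (C * l2sq x)"
      using mult_left_mono[OF C(2)[of x], of "(cmod c)\<^sup>2"] by simp
    then show "l2sq (app (scalar c * T) x) \<le> (cmod c * sqrt C)\<^sup>2 * l2sq x"
      using C(1) by (simp add: power_mult_distrib mult.assoc)
  qed (use C in auto)
  then show thesis using that[of "sqrt C"] C(1) by simp
qed

text \<open>The derivatives are chosen by recursion on the list of directions, so that they form the
  single family asked for in \<open>smooth_off_0\<close>; tracking the degree keeps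
  \<open>hom_deriv\<close> applicable at each step.\<close>

lemma hom_iterated_deriv:
  assumes "hom l f"
  obtains D where "D [] = f" "\<And>\<beta> \<xi>. \<xi> \<noteq> 0 \<Longrightarrow>
    (D \<beta> has_derivative (\<lambda>h. \<Sum>a\<in>UNIV. of_real (h $ a) * D (a # \<beta>) \<xi>)) (at \<xi>)"
proof -
  define P where "P l f g \<longleftrightarrow> (\<forall>a. hom (l - 1) (g a)) \<and>
    (\<forall>\<xi>. \<xi> \<noteq> 0 \<longrightarrow> (f has_derivative (\<lambda>h. \<Sum>a\<in>UNIV. of_real (h $ a) * g a \<xi>)) (at \<xi>))" for l f g
  define d where "d l f = (SOME g. P l f g)" for l f
  have d: "P l f (d l f)" if "hom l f" for l f
  proof -
    have "\<exists>g. P l f g" unfolding P_def by (rule hom_deriv[OF that])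
    then show ?thesis unfolding d_def by (rule someI_ex)
  qed
  define D where "D = rec_list f (\<lambda>a \<beta> g. d (l - int (length \<beta>)) g a)"
  have D: "D [] = f" "\<And>a \<beta>. D (a # \<beta>) = d (l - int (length \<beta>)) (D \<beta>) a"
    by (simp_all add: D_def)
  have "hom (l - int (length \<beta>)) (D \<beta>)" for \<beta>
  proof (induction \<beta>)
    case (Cons a \<beta>)
    then have "hom (l - int (length \<beta>) - 1) (D (a # \<beta>))"
      using d[OF Cons] unfolding P_def D by blast
    then show ?case by (simp add: algebra_simps)
  qed (simp add: D assms)
  from d[OF this] have "(D \<beta> has_derivative (\<lambda>h. \<Sum>a\<in>UNIV. of_real (h $ a) * D (a # \<beta>) \<xi>)) (at \<xi>)"
    if "\<xi> \<noteq> 0" for \<beta> \<xi>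
    using that unfolding P_def D by blast
  with D(1) show thesis by (rule that)
qed

lemma smooth_off_0_elem:
  assumes "hom l f" and T: "T \<in> alg_hat \<theta>"
  shows "smooth_off_0 \<theta> (\<lambda>\<xi>. scalar (f \<xi>) * T)"
proof -
  obtain D where D: "D [] = f" "\<And>\<beta> \<xi>. \<xi> \<noteq> 0 \<Longrightarrow>
    (D \<beta> has_derivative (\<lambda>h. \<Sum>a\<in>UNIV. of_real (h $ a) * D (a # \<beta>) \<xi>)) (at \<xi>)"
    using hom_iterated_deriv[OF assms(1)] by blast
  have "((\<lambda>\<eta>. opnorm (fold \<delta> \<alpha> (scalar (D \<beta> \<eta>) * T - scalar (D \<beta> \<xi>) * T
      - (\<Sum>a\<in>UNIV. (\<eta> $ a - \<xi> $ a) *\<^sub>R (scalar (D (a # \<beta>) \<xi>) * T)))) / ennreal (norm (\<eta> - \<xi>))) \<longlongrightarrow> 0) (at \<xi>)"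
    if \<xi>: "\<xi> \<noteq> 0" for \<alpha> \<beta> \<xi>
  proof -
    \<comment> \<open>The first-order Taylor remainder of the scalar factor; the operator remainder
      is this number times \<open>T\<close>.\<close>
    define e where "e \<eta> = D \<beta> \<eta> - D \<beta> \<xi> - (\<Sum>a\<in>UNIV. of_real ((\<eta> - \<xi>) $ a) * D (a # \<beta>) \<xi>)" for \<eta>
    have E: "scalar (D \<beta> \<eta>) * T - scalar (D \<beta> \<xi>) * T
      - (\<Sum>a\<in>UNIV. (\<eta> $ a - \<xi> $ a) *\<^sub>R (scalar (D (a # \<beta>) \<xi>) * T)) = scalar (e \<eta>) * T" for \<eta>
      unfolding e_def scalar_diff scalar_sum left_diff_distrib sum_distrib_right
      by (simp add: scaleR_scalar scalar_mult mult.assoc)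
    obtain C where C: "0 \<le> C" "\<And>c. opnorm (scalar c * fold \<delta> \<alpha> T) \<le> ennreal (cmod c * C)"
      using opnorm_scalar_le[OF fold_\<delta>_alg_hat[OF T]] by blast
    have lim: "((\<lambda>\<eta>. ennreal (cmod (e \<eta>) / norm (\<eta> - \<xi>) * C)) \<longlongrightarrow> 0) (at \<xi>)"
    proof -
      have "((\<lambda>\<eta>. cmod (e \<eta>) / norm (\<eta> - \<xi>)) \<longlongrightarrow> 0) (at \<xi>)"
        using D(2)[OF \<xi>, of \<beta>] unfolding has_derivative_iff_norm e_def by simp
      from tendsto_ennrealI[OF tendsto_mult_left_zero[OF this, of C]] show ?thesis by simp
    qed
    show ?thesis
      unfolding E fold_\<delta>_scalar
    proof (rule tendsto_sandwich[OF _ _ tendsto_const lim])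
      show "\<forall>\<^sub>F \<eta> in at \<xi>. opnorm (scalar (e \<eta>) * fold \<delta> \<alpha> T) / ennreal (norm (\<eta> - \<xi>))
          \<le> ennreal (cmod (e \<eta>) / norm (\<eta> - \<xi>) * C)"
        unfolding eventually_at_filter
      proof (intro always_eventually allI impI)
        fix \<eta> assume "\<eta> \<noteq> \<xi>"
        then have "opnorm (scalar (e \<eta>) * fold \<delta> \<alpha> T) / ennreal (norm (\<eta> - \<xi>))
            \<le> ennreal (cmod (e \<eta>) * C) / ennreal (norm (\<eta> - \<xi>))"
          by (intro divide_right_mono_ennreal C)
        also have "\<dots> = ennreal (cmod (e \<eta>) / norm (\<eta> - \<xi>) * C)"
          using \<open>\<eta> \<noteq> \<xi>\<close> C(1) by (simp add: divide_ennreal)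
        finally show "opnorm (scalar (e \<eta>) * fold \<delta> \<alpha> T) / ennreal (norm (\<eta> - \<xi>))
            \<le> ennreal (cmod (e \<eta>) / norm (\<eta> - \<xi>) * C)" .
      qed
    qed simp
  qed
  then show ?thesis
    unfolding smooth_off_0_def
    by (intro exI[of _ "\<lambda>\<beta> \<xi>. scalar (D \<beta> \<xi>) * T"]) (auto simp: D T intro: alg_hat.intros)
qed

lemma diff_diff_add_regroup: "a + b - (c + d) - (s + t) = (a - c - s) + (b - d - t)" for a :: "'a::ab_group_add"
  by (simp add: algebra_simps)

lemma smooth_off_0_add:
  assumes "smooth_off_0 \<theta> f" "smooth_off_0 \<theta> g"
  shows "smooth_off_0 \<theta> (\<lambda>\<xi>. f \<xi> + g \<xi>)"
proof -
  let ?E = "\<lambda>F \<alpha> \<beta> \<xi> \<eta>. fold \<delta> \<alpha> (F \<beta> \<eta> - F \<beta> \<xi> - (\<Sum>a\<in>UNIV. (\<eta> $ a - \<xi> $ a) *\<^sub>R F (a # \<beta>) \<xi>))"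
  from assms obtain F G where F: "F [] = f" "\<And>\<beta> \<xi>. \<xi> \<noteq> 0 \<Longrightarrow> F \<beta> \<xi> \<in> alg_hat \<theta>"
      "\<And>\<alpha> \<beta> \<xi>. \<xi> \<noteq> 0 \<Longrightarrow> ((\<lambda>\<eta>. opnorm (?E F \<alpha> \<beta> \<xi> \<eta>) / ennreal (norm (\<eta> - \<xi>))) \<longlongrightarrow> 0) (at \<xi>)"
    and G: "G [] = g" "\<And>\<beta> \<xi>. \<xi> \<noteq> 0 \<Longrightarrow> G \<beta> \<xi> \<in> alg_hat \<theta>"
      "\<And>\<alpha> \<beta> \<xi>. \<xi> \<noteq> 0 \<Longrightarrow> ((\<lambda>\<eta>. opnorm (?E G \<alpha> \<beta> \<xi> \<eta>) / ennreal (norm (\<eta> - \<xi>))) \<longlongrightarrow> 0) (at \<xi>)"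
    unfolding smooth_off_0_def by blast
  let ?H = "\<lambda>\<beta> \<xi>. F \<beta> \<xi> + G \<beta> \<xi>"
  have "((\<lambda>\<eta>. opnorm (?E ?H \<alpha> \<beta> \<xi> \<eta>) / ennreal (norm (\<eta> - \<xi>))) \<longlongrightarrow> 0) (at \<xi>)"
    if \<xi>: "\<xi> \<noteq> 0" for \<alpha> \<beta> \<xi>
  proof -
    let ?f = "\<lambda>\<eta>. opnorm (?E F \<alpha> \<beta> \<xi> \<eta>) / ennreal (norm (\<eta> - \<xi>))"
      and ?g = "\<lambda>\<eta>. opnorm (?E G \<alpha> \<beta> \<xi> \<eta>) / ennreal (norm (\<eta> - \<xi>))"
    have lim: "((\<lambda>\<eta>. (?f \<eta> + ?f \<eta>) + (?g \<eta> + ?g \<eta>)) \<longlongrightarrow> (0 + 0) + (0 + 0)) (at \<xi>)"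
      by (intro tendsto_add F G \<xi>)
    show ?thesis
    proof (rule tendsto_sandwich[OF _ _ tendsto_const lim[unfolded add_0]])
      have "opnorm (?E ?H \<alpha> \<beta> \<xi> \<eta>) / ennreal (norm (\<eta> - \<xi>)) \<le> (?f \<eta> + ?f \<eta>) + (?g \<eta> + ?g \<eta>)" for \<eta>
      proof -
        have "?E ?H \<alpha> \<beta> \<xi> \<eta> = ?E F \<alpha> \<beta> \<xi> \<eta> + ?E G \<alpha> \<beta> \<xi> \<eta>"
          by (simp only: fold_\<delta>_add[symmetric] scaleR_add_right sum.distrib diff_diff_add_regroup)
        then have "opnorm (?E ?H \<alpha> \<beta> \<xi> \<eta>) \<le> 2 * opnorm (?E F \<alpha> \<beta> \<xi> \<eta>) + 2 * opnorm (?E G \<alpha> \<beta> \<xi> \<eta>)"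
          by (simp only: opnorm_add)
        from divide_right_mono_ennreal[OF this] show ?thesis
          by (simp add: add_divide_distrib_ennreal mult_2)
      qed
      then show "\<forall>\<^sub>F \<eta> in at \<xi>. opnorm (?E ?H \<alpha> \<beta> \<xi> \<eta>) / ennreal (norm (\<eta> - \<xi>)) \<le> (?f \<eta> + ?f \<eta>) + (?g \<eta> + ?g \<eta>)"
        by (intro always_eventually allI)
    qed simp
  qed
  then show ?thesis
    unfolding smooth_off_0_def
    using F(1,2) G(1,2) by (intro exI[of _ ?H]) (auto intro: alg_hat.intros)
qed

lemma smooth_off_0_esym: "esym \<theta> l f \<Longrightarrow> smooth_off_0 \<theta> f"
  by (induction rule: esym.induct) (auto intro: smooth_off_0_elem smooth_off_0_add)

lemma l2norm_U [simp]: "l2norm (U m) = 1"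
proof -
  have "l2sq (U m) = (\<Sum>\<^sub>\<infinity>n\<in>{m}. 1)"
    unfolding l2sq_def by (rule infsum_cong_neutral) (auto simp: U.rep_eq)
  then show ?thesis by (simp add: l2norm_eq)
qed

lemma coeff_le_opnorm: "ennreal (cmod (coeff (app T (U m)) q)) \<le> opnorm T"
proof -
  have "cmod (coeff (app T (U m)) q) \<le> l2norm (app T (U m))"
    unfolding l2norm_eq by (rule real_le_rsqrt[OF l2sq_ge_coeff])
  then have "ennreal (cmod (coeff (app T (U m)) q)) \<le> ennreal (l2norm (app T (U m)))" by (rule ennreal_leI)
  also have "\<dots> \<le> opnorm T" unfolding opnorm_def by (intro SUP_upper) simp
  finally show ?thesis .
qed

lemma alg_hat_coeff_bounded:
  assumes "T \<in> alg_hat \<theta>"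
  obtains C where "0 \<le> C" "\<And>m q. cmod (coeff (app T (U m)) q) \<le> C"
proof -
  obtain C where C: "0 \<le> C" "\<And>c. opnorm (scalar c * T) \<le> ennreal (cmod c * C)"
    using opnorm_scalar_le[OF assms] by blast
  have "cmod (coeff (app T (U m)) q) \<le> C" for m q
    using order_trans[OF coeff_le_opnorm[of T m q], of "ennreal C"] C(2)[of 1] C(1) by simp
  then show thesis using C(1) that by blast
qed

text \<open>Differentiability in the plain operator norm gives a local Lipschitz bound. Its
  uniformity in \<open>m\<close> and \<open>q\<close> matters later, where \<open>m\<close> tends to
  infinity along a ray.\<close>

lemma smooth_off_0_continuous:
  assumes "smooth_off_0 \<theta> f" "\<xi> \<noteq> 0" "e > 0"
  shows "\<exists>d>0. \<forall>\<eta>. norm (\<eta> - \<xi>) < d \<longrightarrow> (\<forall>m q. cmod (coeff (app (f \<eta>) (U m)) q - coeff (app (f \<xi>) (U m)) q) \<le> e)"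
proof -
  obtain F where F: "F [] = f" "\<And>\<beta>. F \<beta> \<xi> \<in> alg_hat \<theta>"
    and lim: "\<And>\<alpha>. ((\<lambda>\<eta>. opnorm (fold \<delta> \<alpha> (F [] \<eta> - F [] \<xi> - (\<Sum>a\<in>UNIV. (\<eta> $ a - \<xi> $ a) *\<^sub>R F [a] \<xi>)))
                    / ennreal (norm (\<eta> - \<xi>))) \<longlongrightarrow> 0) (at \<xi>)"
    using assms(1,2) unfolding smooth_off_0_def by blast
  define E where "E \<eta> = f \<eta> - f \<xi> - (\<Sum>a\<in>UNIV. (\<eta> $ a - \<xi> $ a) *\<^sub>R F [a] \<xi>)" for \<eta>
  have "\<forall>a. \<exists>C\<ge>0. \<forall>m q. cmod (coeff (app (F [a] \<xi>) (U m)) q) \<le> C"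
    using alg_hat_coeff_bounded[OF F(2)] by metis
  then obtain C where C: "\<And>a. 0 \<le> C a" "\<And>a m q. cmod (coeff (app (F [a] \<xi>) (U m)) q) \<le> C a" by metis
  \<comment> \<open>A Lipschitz constant near \<xi>: the remainder contributes 1, as it is at most
    \<open>norm (\<eta> - \<xi>)\<close> there, and each partial derivative its bound
    \<open>C a\<close>.\<close>
  define B where "B = 1 + (\<Sum>a\<in>UNIV. C a)"
  have B: "B \<ge> 1" using C(1) by (simp add: B_def sum_nonneg)
  have "((\<lambda>\<eta>. opnorm (E \<eta>) / ennreal (norm (\<eta> - \<xi>))) \<longlongrightarrow> 0) (at \<xi>)"
    using lim[of "[]"] by (simp add: E_def F(1))
  then have "\<forall>\<^sub>F \<eta> in at \<xi>. opnorm (E \<eta>) / ennreal (norm (\<eta> - \<xi>)) < 1"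
    by (rule order_tendstoD) simp
  then obtain d where d: "d > 0" "\<And>\<eta>. \<eta> \<noteq> \<xi> \<Longrightarrow> norm (\<eta> - \<xi>) < d \<Longrightarrow> opnorm (E \<eta>) / ennreal (norm (\<eta> - \<xi>)) < 1"
    unfolding eventually_at by (auto simp: dist_norm)
  have "cmod (coeff (app (f \<eta>) (U m)) q - coeff (app (f \<xi>) (U m)) q) \<le> e"
    if \<eta>: "norm (\<eta> - \<xi>) < min d (e / B)" for \<eta> m q
  proof (cases "\<eta> = \<xi>")
    case False
    then have n0: "norm (\<eta> - \<xi>) > 0" by simp
    have "ennreal (cmod (coeff (app (E \<eta>) (U m)) q) / norm (\<eta> - \<xi>))
        = ennreal (cmod (coeff (app (E \<eta>) (U m)) q)) / ennreal (norm (\<eta> - \<xi>))"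
      using n0 by (simp add: divide_ennreal)
    also have "\<dots> \<le> opnorm (E \<eta>) / ennreal (norm (\<eta> - \<xi>))"
      by (intro divide_right_mono_ennreal coeff_le_opnorm)
    also have "\<dots> < 1" using d(2)[OF False] \<eta> by simp
    finally have "cmod (coeff (app (E \<eta>) (U m)) q) / norm (\<eta> - \<xi>) < 1"
      by (simp add: ennreal_less_one_iff)
    then have E1: "cmod (coeff (app (E \<eta>) (U m)) q) \<le> norm (\<eta> - \<xi>)"
      using n0 by (simp add: field_simps)
    have "coeff (app (f \<eta>) (U m)) q - coeff (app (f \<xi>) (U m)) q = coeff (app (E \<eta>) (U m)) q
        + (\<Sum>a\<in>UNIV. of_real (\<eta> $ a - \<xi> $ a) * coeff (app (F [a] \<xi>) (U m)) q)"
      by (simp add: E_def)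
    also have "cmod \<dots> \<le> cmod (coeff (app (E \<eta>) (U m)) q)
        + (\<Sum>a\<in>UNIV. cmod (of_real (\<eta> $ a - \<xi> $ a) * coeff (app (F [a] \<xi>) (U m)) q))"
      by (intro order_trans[OF norm_triangle_ineq] add_left_mono norm_sum)
    also have "\<dots> \<le> norm (\<eta> - \<xi>) + (\<Sum>a\<in>UNIV. norm (\<eta> - \<xi>) * C a)"
    proof (intro add_mono E1 sum_mono)
      fix a
      have "\<bar>\<eta> $ a - \<xi> $ a\<bar> \<le> norm (\<eta> - \<xi>)" using component_le_norm_cart[of "\<eta> - \<xi>" a] by simp
      then show "cmod (of_real (\<eta> $ a - \<xi> $ a) * coeff (app (F [a] \<xi>) (U m)) q) \<le> norm (\<eta> - \<xi>) * C a"
        unfolding norm_mult norm_of_real using C by (intro mult_mono) auto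
    qed
    also have "\<dots> = norm (\<eta> - \<xi>) * B" by (simp add: B_def distrib_left sum_distrib_left)
    also have "\<dots> \<le> e" using \<eta> B by (simp add: field_simps)
    finally show ?thesis .
  qed (use assms in simp)
  moreover have "min d (e / B) > 0" using d(1) B assms(3) by simp
  ultimately show ?thesis by blast
qed

section \<open>Matrices of operators\<close>

text \<open>Elementary tensors of a numerical matrix and an operator; in this form gamma words and
  words in \<open>k\<close> multiply separately.\<close>

definition tens :: "complex^4^4 \<Rightarrow> endo \<Rightarrow> endo^4^4"
  where "tens A T = (\<chi> i j. scalar (A $ i $ j) * T)"

lemma tens_nth [simp]: "tens A T $ i $ j = scalar (A $ i $ j) * T"
  by (simp add: tens_def)

lemma mat_nth: "mat T $ i $ j = (if i = j then T else 0)"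
  by (simp add: mat_def)

lemma mat_eq_tens: "mat T = tens (mat 1) T"
  by (simp add: vec_eq_iff mat_def)

lemma matrix_mult_nth: "(A ** B) $ i $ j = (\<Sum>k\<in>UNIV. A $ i $ k * B $ k $ j)"
  by (simp add: matrix_matrix_mult_def)

lemma tens_mult: "tens A S ** tens B T = tens (A ** B) (S * T)"
proof -
  have "scalar a * S * (scalar b * T) = scalar (a * b) * (S * T)" for a b
    by (metis mult.assoc scalar_left_commute scalar_mult)
  then show ?thesis
    by (simp add: vec_eq_iff matrix_mult_nth scalar_sum sum_distrib_right)
qed

lemma tens_add_left: "tens (A + B) T = tens A T + tens B T"
  by (simp add: vec_eq_iff scalar_add distrib_right)

lemma tens_add_right: "tens A (S + T) = tens A S + tens A T"
  by (simp add: vec_eq_iff distrib_left)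

lemma tens_minus_right: "tens A (- T) = - tens A T"
  by (simp add: vec_eq_iff)

lemma tens_0_left [simp]: "tens 0 T = 0" and tens_0_right [simp]: "tens A 0 = 0"
  by (simp_all add: vec_eq_iff)

lemma tens_sum_right: "tens A (sum f I) = (\<Sum>i\<in>I. tens A (f i))"
  by (induction I rule: infinite_finite_induct) (auto simp: tens_add_right)

lemma trace_tens: "trace (tens A T) = scalar (trace A) * T"
  by (simp add: trace_def scalar_sum sum_distrib_right)

lemma trace_add_endo: "trace (A + B) = trace A + trace B" for A B :: "'a::ring_1^'n^'n"
  by (simp add: trace_def sum.distrib)

lemma trace_sum: "trace (sum f I) = (\<Sum>i\<in>I. trace (f i))" for f :: "_ \<Rightarrow> 'a::ring_1^'n^'n"
  by (simp add: trace_def) (subst sum.swap, simp)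

lemma matrix_sum_left: "sum f I ** B = (\<Sum>i\<in>I. f i ** B)" for B :: "'a::ring_1^'n^'m"
  by (simp add: vec_eq_iff matrix_mult_nth sum_distrib_right) (subst sum.swap, simp)

lemma matrix_sum_right: "B ** sum f I = (\<Sum>i\<in>I. B ** f i)" for B :: "'a::ring_1^'n^'m"
  by (simp add: vec_eq_iff matrix_mult_nth sum_distrib_left) (subst sum.swap, simp)

lemma matrix_diff_right: "A ** (B - C) = A ** B - A ** C" for A :: "'a::ring_1^'n^'m"
  by (simp add: vec_eq_iff matrix_mult_nth right_diff_distrib sum_subtractf)

lemma matrix_diff_left: "(A - B) ** C = A ** C - B ** C" for C :: "'a::ring_1^'n^'m"
  by (simp add: vec_eq_iff matrix_mult_nth left_diff_distrib sum_subtractf)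

lemma matrix_minus_right: "A ** (- B) = - (A ** B)" for A :: "'a::ring_1^'n^'m"
  by (simp add: vec_eq_iff matrix_mult_nth sum_negf)

lemma mat_mult: "mat S ** mat T = (mat (S * T) :: endo^4^4)"
  by (simp add: mat_eq_tens tens_mult)

lemma mat_mult_nth: "(mat T ** A) $ i $ j = T * A $ i $ j" for A :: "endo^4^4"
  by (simp add: matrix_mult_nth mat_nth if_distribR mult_delta_left sum.delta')

text \<open>The factor \<open>-\<i>\<close> makes this the commutator with \<open>Dop c\<close>,
  whose symbol is the real coordinate \<open>\<xi> $ c\<close>; the symbol recursion is thus free of
  imaginary units.\<close>

definition pm :: "4 \<Rightarrow> endo \<Rightarrow> endo"
  where "pm c T = scalar (- \<i>) * \<delta> c T"

lemma pm_add: "pm c (S + T) = pm c S + pm c T"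
  and pm_mult: "pm c (S * T) = pm c S * T + S * pm c T"
  and pm_minus: "pm c (- T) = - pm c T"
  and pm_diff: "pm c (S - T) = pm c S - pm c T"
  and pm_0 [simp]: "pm c 0 = 0"
  and pm_1 [simp]: "pm c 1 = 0"
  and pm_scalar [simp]: "pm c (scalar z) = 0"
  by (simp_all add: pm_def \<delta>_add \<delta>_mult \<delta>_diff \<delta>_minus distrib_left right_diff_distrib
      scalar_left_commute mult.assoc)

lemma pm_scalar_mult: "pm c (scalar z * T) = scalar z * pm c T"
  by (simp add: pm_mult)

lemma pm_sum: "pm c (sum f I) = (\<Sum>i\<in>I. pm c (f i))"
  by (induction I rule: infinite_finite_induct) (auto simp: pm_add)

lemma alg_op_pm: "S \<in> alg_op \<theta> \<Longrightarrow> pm c S \<in> alg_op \<theta>"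
  by (simp add: pm_def alg_op_mult alg_op_\<delta>)

lemma alg_pm: "S \<in> alg \<theta> \<Longrightarrow> pm c S \<in> alg \<theta>"
  by (simp add: pm_def alg_mult alg_\<delta>)

lemma phi_pm: "S \<in> alg_op \<theta> \<Longrightarrow> phi (pm c S) = 0"
  by (simp add: pm_def phi_simps phi_\<delta>)

definition pmm :: "4 \<Rightarrow> endo^4^4 \<Rightarrow> endo^4^4"
  where "pmm c X = (\<chi> i j. pm c (X $ i $ j))"

lemma pmm_nth [simp]: "pmm c X $ i $ j = pm c (X $ i $ j)"
  by (simp add: pmm_def)

lemma pmm_tens: "pmm c (tens A T) = tens A (pm c T)"
  by (simp add: vec_eq_iff pm_scalar_mult)

lemma pmm_diff: "pmm c (X - Y) = pmm c X - pmm c Y"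
  by (simp add: vec_eq_iff pm_diff)

lemma pmm_minus: "pmm c (- X) = - pmm c X"
  by (simp add: vec_eq_iff pm_minus)

lemma pmm_sum: "pmm c (sum f I) = (\<Sum>i\<in>I. pmm c (f i))"
  by (simp add: vec_eq_iff pm_sum)

section \<open>The flat Dirac operator and its inverse off the constants\<close>

definition Dop :: "4 \<Rightarrow> endo"
  where "Dop a = scalar (- \<i>) * \<delta>op a"

lemma coeff_Dop [simp]: "coeff (app (Dop a) x) q = of_real (lat q $ a) * coeff x q"
  by (simp add: Dop_def lat_def mult.assoc[symmetric])

lemma Dop_mult: "Dop a * T = pm a T + T * Dop a"
  by (simp add: Dop_def pm_def \<delta>_def right_diff_distrib scalar_left_commute mult.assoc)

lemma abs_lat_div_le: "\<bar>lat q $ a / (lat q \<bullet> lat q)\<bar> \<le> 1"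
proof (cases "q = 0")
  case False
  then have 1: "1 \<le> norm (lat q)" by (rule norm_lat_ge_1)
  have "\<bar>lat q $ a\<bar> \<le> norm (lat q)" by (rule component_le_norm_cart)
  also have "\<dots> \<le> norm (lat q) * norm (lat q)" using mult_left_mono[OF 1, of "norm (lat q)"] by simp
  also have "\<dots> = lat q \<bullet> lat q" by (simp add: power2_norm_eq_inner[symmetric] power2_eq_square)
  finally have "\<bar>lat q $ a\<bar> \<le> lat q \<bullet> lat q" .
  moreover have "0 < lat q \<bullet> lat q" using False by simp
  ultimately show ?thesis unfolding abs_divide by (simp only: abs_of_pos divide_le_eq_1_pos)
qed simp

text \<open>At \<open>q = 0\<close> the quotient has the value 0, so the constants are annihilated,
  as an inverse off the kernel must do.\<close>

lift_definition hmul :: "4 \<Rightarrow> torus_fun \<Rightarrow> torus_fun"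
  is "\<lambda>a x q. of_real (lat q $ a / (lat q \<bullet> lat q)) * x q"
proof (rule rapid_mult_bounded[where B = 1 and s = 0])
  fix a and q :: "int^4"
  show "cmod (of_real (lat q $ a / (lat q \<bullet> lat q))) \<le> 1 * (1 + norm (lat q)) ^ 0"
    by (simp only: norm_of_real power_0 mult_1 abs_lat_div_le)
qed

lift_definition hop :: "4 \<Rightarrow> endo" is hmul
  by (intro conjI allI torus_fun_eqI) (simp_all only: hmul.rep_eq coeff_simps distrib_left mult.left_commute)

lemma coeff_hop [simp]: "coeff (app (hop a) x) q = of_real (lat q $ a / (lat q \<bullet> lat q)) * coeff x q"
  by (simp add: hop.rep_eq hmul.rep_eq)

text \<open>Projection onto the constants; applied in each component it projects onto the kernel of
  the flat Dirac operator.\<close>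

lift_definition pi0 :: endo is "\<lambda>x. scaleC (coeff x 0) (U 0)"
  by (auto intro!: torus_fun_eqI simp: algebra_simps)

lemma coeff_pi0 [simp]: "coeff (app pi0 x) q = (if q = 0 then coeff x 0 else 0)"
  by (simp add: pi0.rep_eq U.rep_eq)

lemma sum_Dop_hop: "(\<Sum>a\<in>UNIV. Dop a * hop a) = 1 - pi0"
proof (intro endo_eqI torus_fun_eqI)
  fix x q
  have "coeff (app (\<Sum>a\<in>UNIV. Dop a * hop a) x) q
      = of_real ((\<Sum>a\<in>UNIV. lat q $ a * lat q $ a) / (lat q \<bullet> lat q)) * coeff x q"
    by (simp add: sum_distrib_right sum_divide_distrib mult.assoc)
  also have "(\<Sum>a\<in>UNIV. lat q $ a * lat q $ a) = lat q \<bullet> lat q" by (simp add: inner_vec_def)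
  finally show "coeff (app (\<Sum>a\<in>UNIV. Dop a * hop a) x) q = coeff (app (1 - pi0) x) q"
    by auto
qed

lemma Dop_hop_commute: "hop a * Dop b = Dop b * hop a"
  by (intro endo_eqI torus_fun_eqI) simp

lemma Dop_hop_swap: "Dop a * hop b = Dop b * hop a"
  by (intro endo_eqI torus_fun_eqI) simp

lemma pi0_hop: "pi0 * hop a = 0" "hop a * pi0 = 0" "pi0 * Dop a = 0" "Dop a * pi0 = 0"
  by (auto intro!: endo_eqI torus_fun_eqI)

lemma tens_mat_2: "tens (mat 2) T = mat T + mat T"
proof -
  have "scalar 2 * T = T + T" by (intro endo_eqI torus_fun_eqI) simp
  then show ?thesis by (simp add: vec_eq_iff mat_def)
qed

locale clifford =
  fixes \<gamma> :: "4 \<Rightarrow> complex^4^4"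
  assumes anticommute: "\<And>a b. \<gamma> a ** \<gamma> b + \<gamma> b ** \<gamma> a = mat (if a = b then 2 else 0)"
begin

text \<open>Adding the same sum with \<open>a\<close> and \<open>b\<close> exchanged turns every
  product into an anticommutator; the doubled identity is then halved.\<close>

lemma clifford_symmetric_sum:
  assumes "\<And>a b. x a b = x b a"
  shows "(\<Sum>a\<in>UNIV. \<Sum>b\<in>UNIV. tens (\<gamma> a ** \<gamma> b) (x a b)) = mat (\<Sum>a\<in>UNIV. x a a)"
    (is "?L = ?R")
proof -
  have "?L = (\<Sum>a\<in>UNIV. \<Sum>b\<in>UNIV. tens (\<gamma> b ** \<gamma> a) (x a b))"
    by (subst sum.swap) (simp add: assms)
  then have "?L + ?L = (\<Sum>a\<in>UNIV. \<Sum>b\<in>UNIV. tens (\<gamma> a ** \<gamma> b + \<gamma> b ** \<gamma> a) (x a b))"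
    by (simp add: sum.distrib tens_add_left)
  also have "\<dots> = (\<Sum>a\<in>UNIV. \<Sum>b\<in>UNIV. if a = b then tens (mat 2) (x a a) else 0)"
    by (intro sum.cong refl) (auto simp: anticommute mat_0)
  also have "\<dots> = (\<Sum>a\<in>UNIV. mat (x a a) + mat (x a a))"
    by (simp add: sum.delta' tens_mat_2)
  also have "\<dots> = ?R + ?R"
    by (simp add: sum.distrib mat_eq_tens tens_sum_right)
  finally have "2 *\<^sub>R ?L = 2 *\<^sub>R ?R" by (simp only: scaleR_2)
  then show ?thesis by simp
qed

definition Dinv :: "endo^4^4"
  where "Dinv = (\<Sum>a\<in>UNIV. tens (\<gamma> a) (hop a))"

lemma flat_dirac_eq: "flat_dirac \<gamma> = (\<Sum>a\<in>UNIV. tens (\<gamma> a) (Dop a))"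
proof -
  have "scalar (- \<i> * z) * T = scalar z * (scalar (- \<i>) * T)" for z T
    by (simp only: scalar_mult[symmetric] mult.assoc[symmetric] mult.commute)
  then show ?thesis by (simp add: vec_eq_iff flat_dirac_def Dop_def del: mult_minus_left)
qed

lemma Dinv_flat: "Dinv ** flat_dirac \<gamma> = mat 1 - mat pi0"
  and flat_Dinv: "flat_dirac \<gamma> ** Dinv = mat 1 - mat pi0"
proof -
  have m: "mat (1 - pi0) = mat 1 - mat pi0" by (simp add: vec_eq_iff mat_def)
  have "Dinv ** flat_dirac \<gamma> = (\<Sum>a\<in>UNIV. \<Sum>b\<in>UNIV. tens (\<gamma> a ** \<gamma> b) (hop a * Dop b))"
    unfolding Dinv_def flat_dirac_eq matrix_sum_left matrix_sum_right tens_mult by (rule sum.swap)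
  also have "\<dots> = mat (\<Sum>a\<in>UNIV. hop a * Dop a)"
    by (rule clifford_symmetric_sum) (simp only: Dop_hop_commute Dop_hop_swap)
  finally show "Dinv ** flat_dirac \<gamma> = mat 1 - mat pi0"
    by (simp add: Dop_hop_commute sum_Dop_hop m)
  have "flat_dirac \<gamma> ** Dinv = (\<Sum>a\<in>UNIV. \<Sum>b\<in>UNIV. tens (\<gamma> a ** \<gamma> b) (Dop a * hop b))"
    unfolding Dinv_def flat_dirac_eq matrix_sum_left matrix_sum_right tens_mult by (rule sum.swap)
  also have "\<dots> = mat (\<Sum>a\<in>UNIV. Dop a * hop a)"
    by (rule clifford_symmetric_sum) (rule Dop_hop_swap)
  finally show "flat_dirac \<gamma> ** Dinv = mat 1 - mat pi0"
    by (simp add: sum_Dop_hop m)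
qed

lemma Dinv_pi0: "Dinv ** mat pi0 = 0" "mat pi0 ** Dinv = 0" "flat_dirac \<gamma> ** mat pi0 = 0" "mat pi0 ** flat_dirac \<gamma> = 0"
  by (simp_all add: Dinv_def flat_dirac_eq mat_eq_tens matrix_sum_left matrix_sum_right tens_mult pi0_hop)

definition slash :: "real^4 \<Rightarrow> complex^4^4"
  where "slash \<xi> = (\<Sum>a\<in>UNIV. (\<xi> $ a) *\<^sub>R \<gamma> a)"

definition nhat :: "real^4 \<Rightarrow> complex^4^4"
  where "nhat \<xi> = inverse (\<xi> \<bullet> \<xi>) *\<^sub>R slash \<xi>"

lemma tens_slash: "tens (slash \<xi>) T = (\<Sum>a\<in>UNIV. tens (\<gamma> a) (scalar (of_real (\<xi> $ a)) * T))"
proof -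
  have "scalar (\<Sum>a\<in>UNIV. (\<xi> $ a) *\<^sub>R \<gamma> a $ i $ j) * T = (\<Sum>a\<in>UNIV. scalar (\<gamma> a $ i $ j) * (scalar (of_real (\<xi> $ a)) * T))" for i j
    unfolding scalar_sum sum_distrib_right
    by (intro sum.cong refl endo_eqI torus_fun_eqI) (simp add: scaleR_conv_of_real mult_ac)
  then show ?thesis by (simp add: vec_eq_iff slash_def)
qed

text \<open>Transfers an identity back from operators to numerical matrices, so that the square of
  \<open>slash\<close> can be computed by \<open>clifford_symmetric_sum\<close>.\<close>

lemma tens_mat_1_cancel: "tens A 1 = tens B 1 \<Longrightarrow> A = B"
proof (simp add: vec_eq_iff, intro allI)
  fix i j
  assume "\<forall>i j. scalar (A $ i $ j) = scalar (B $ i $ j)"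
  then have "coeff (app (scalar (A $ i $ j)) (U 0)) 0 = coeff (app (scalar (B $ i $ j)) (U 0)) 0" by metis
  then show "A $ i $ j = B $ i $ j" by (simp add: U.rep_eq)
qed

lemma slash_slash: "slash \<xi> ** slash \<xi> = (\<xi> \<bullet> \<xi>) *\<^sub>R mat 1"
proof (rule tens_mat_1_cancel)
  have "tens (slash \<xi> ** slash \<xi>) 1 = tens (slash \<xi>) 1 ** tens (slash \<xi>) 1" by (simp add: tens_mult)
  also have "\<dots> = (\<Sum>a\<in>UNIV. \<Sum>b\<in>UNIV. tens (\<gamma> a ** \<gamma> b) (scalar (of_real (\<xi> $ a * \<xi> $ b))))"
    unfolding tens_slash matrix_sum_left matrix_sum_right tens_mult
    by (subst sum.swap) (simp add: scalar_mult)
  also have "\<dots> = mat (\<Sum>a\<in>UNIV. scalar (of_real (\<xi> $ a * \<xi> $ a)))"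
    by (rule clifford_symmetric_sum) (simp add: mult.commute)
  also have "(\<Sum>a\<in>UNIV. scalar (of_real (\<xi> $ a * \<xi> $ a))) = scalar (of_real (\<xi> \<bullet> \<xi>))"
    by (simp only: scalar_sum[symmetric] of_real_sum[symmetric]) (simp add: inner_vec_def)
  also have "mat \<dots> = tens ((\<xi> \<bullet> \<xi>) *\<^sub>R mat 1) 1"
    by (simp add: vec_eq_iff mat_def of_real_def)
  finally show "tens (slash \<xi> ** slash \<xi>) 1 = tens ((\<xi> \<bullet> \<xi>) *\<^sub>R mat 1) 1" .
qed

end

lemma scaleR_matrix_mult: "(r *\<^sub>R A) ** B = r *\<^sub>R (A ** B)" "A ** (r *\<^sub>R B) = r *\<^sub>R (A ** B)"
  for A B :: "'a::real_algebra_1^'n^'n"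
  by (simp_all add: vec_eq_iff matrix_mult_nth scaleR_sum_right)

context clifford begin

lemma slash_nhat: "\<xi> \<noteq> 0 \<Longrightarrow> slash \<xi> ** nhat \<xi> = mat 1"
  by (simp add: nhat_def scaleR_matrix_mult slash_slash)

end

section \<open>Pseudodifferential calculus\<close>

text \<open>A seminorm centred at the frequency \<open>m\<close>: what the calculus makes of
  \<open>U m\<close> is concentrated near \<open>m\<close>, with decay in the offset
  \<open>p\<close>.\<close>

definition bnd :: "nat \<Rightarrow> int^4 \<Rightarrow> torus_fun \<Rightarrow> real \<Rightarrow> bool"
  where "bnd r m y B \<longleftrightarrow> (\<forall>p. (1 + norm (lat p)) ^ r * cmod (coeff y (m + p)) \<le> B)"

text \<open>Order 0 in a form stable under composition: for each rate of decay the constant does not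
  depend on the centre \<open>m\<close>.\<close>

definition tame :: "endo \<Rightarrow> bool"
  where "tame T \<longleftrightarrow> (\<forall>r. \<exists>C\<ge>0. \<forall>B m y. bnd r m y B \<longrightarrow> bnd r m (app T y) (C * B))"

lemma bnd_mono: "bnd r m y A \<Longrightarrow> A \<le> B \<Longrightarrow> bnd r m y B"
  unfolding bnd_def by (blast intro: order_trans)

lemma bnd_add: "bnd r m x A \<Longrightarrow> bnd r m y B \<Longrightarrow> bnd r m (x + y) (A + B)"
  unfolding bnd_def
proof
  fix p
  assume "\<forall>p. (1 + norm (lat p)) ^ r * cmod (coeff x (m + p)) \<le> A"
    "\<forall>p. (1 + norm (lat p)) ^ r * cmod (coeff y (m + p)) \<le> B"
  then have "(1 + norm (lat p)) ^ r * (cmod (coeff x (m + p)) + cmod (coeff y (m + p))) \<le> A + B"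
    by (simp add: distrib_left add_mono)
  moreover have "(1 + norm (lat p)) ^ r * cmod (coeff (x + y) (m + p))
    \<le> (1 + norm (lat p)) ^ r * (cmod (coeff x (m + p)) + cmod (coeff y (m + p)))"
    by (intro mult_left_mono) (auto intro: norm_triangle_ineq)
  ultimately show "(1 + norm (lat p)) ^ r * cmod (coeff (x + y) (m + p)) \<le> A + B" by linarith
qed

lemma bnd_0 [simp]: "bnd r m 0 0"
  by (simp add: bnd_def)

lemma bnd_sum: "(\<And>i. i \<in> I \<Longrightarrow> bnd r m (f i) (B i)) \<Longrightarrow> bnd r m (sum f I) (sum B I)"
  by (induction I rule: infinite_finite_induct) (auto intro: bnd_add)

lemma bnd_U: "bnd r m (U m) 1"
proof -
  have "(1 + norm (lat p)) ^ r * cmod (coeff (U m) (m + p)) \<le> 1" for p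
    by (cases "p = 0") (auto simp: U.rep_eq)
  then show ?thesis by (simp add: bnd_def)
qed

lemma tameE:
  assumes "tame T"
  obtains C where "0 \<le> C" "\<And>B m y. bnd r m y B \<Longrightarrow> bnd r m (app T y) (C * B)"
  using assms[unfolded tame_def, THEN spec, of r] by auto

lemma tame_add:
  assumes "tame S" "tame T"
  shows "tame (S + T)"
  unfolding tame_def
proof
  fix r
  obtain C where C: "C \<ge> 0" "\<And>B m y. bnd r m y B \<Longrightarrow> bnd r m (app S y) (C * B)"
    using tameE[OF assms(1)] by metis
  obtain D where D: "D \<ge> 0" "\<And>B m y. bnd r m y B \<Longrightarrow> bnd r m (app T y) (D * B)"
    using tameE[OF assms(2)] by metis
  have "bnd r m (app (S + T) y) ((C + D) * B)" if "bnd r m y B" for B m y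
    using bnd_add[OF C(2)[OF that] D(2)[OF that]] by (simp add: distrib_right)
  then show "\<exists>C\<ge>0. \<forall>B m y. bnd r m y B \<longrightarrow> bnd r m (app (S + T) y) (C * B)"
    using C(1) D(1) by (intro exI[of _ "C + D"]) simp
qed

lemma tame_mult:
  assumes "tame S" "tame T"
  shows "tame (S * T)"
  unfolding tame_def
proof
  fix r
  obtain C where C: "C \<ge> 0" "\<And>B m y. bnd r m y B \<Longrightarrow> bnd r m (app S y) (C * B)"
    using tameE[OF assms(1)] by metis
  obtain D where D: "D \<ge> 0" "\<And>B m y. bnd r m y B \<Longrightarrow> bnd r m (app T y) (D * B)"
    using tameE[OF assms(2)] by metis
  have "bnd r m (app (S * T) y) ((C * D) * B)" if "bnd r m y B" for B m y
    using C(2)[OF D(2)[OF that]] by (simp add: mult.assoc)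
  then show "\<exists>C\<ge>0. \<forall>B m y. bnd r m y B \<longrightarrow> bnd r m (app (S * T) y) (C * B)"
    using C(1) D(1) by (intro exI[of _ "C * D"]) simp
qed

lemma tame_multiplier:
  assumes "0 \<le> C" and "\<And>y q. cmod (coeff (app T y) q) \<le> C * cmod (coeff y q)"
  shows "tame T"
  unfolding tame_def
proof (intro allI exI[of _ C] conjI impI assms(1))
  fix r B m y assume y: "bnd r m y B"
  have "(1 + norm (lat p)) ^ r * cmod (coeff (app T y) (m + p)) \<le> C * B" for p
  proof -
    have "(1 + norm (lat p)) ^ r * cmod (coeff (app T y) (m + p))
        \<le> (1 + norm (lat p)) ^ r * (C * cmod (coeff y (m + p)))"
      by (intro mult_left_mono assms) simp
    also have "\<dots> = C * ((1 + norm (lat p)) ^ r * cmod (coeff y (m + p)))" by simp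
    also have "\<dots> \<le> C * B" using y assms(1) by (intro mult_left_mono) (auto simp: bnd_def)
    finally show ?thesis .
  qed
  then show "bnd r m (app T y) (C * B)" by (simp add: bnd_def)
qed

lemma tame_scalar: "tame (scalar c)"
  by (rule tame_multiplier[of "cmod c"]) (auto simp: norm_mult)

lemma tame_hop: "tame (hop a)"
proof (rule tame_multiplier[of 1])
  fix y q
  show "cmod (coeff (app (hop a) y) q) \<le> 1 * cmod (coeff y q)"
    unfolding coeff_hop norm_mult norm_of_real by (intro mult_right_mono abs_lat_div_le) auto
qed simp

lemma tame_sum: "(\<And>i. i \<in> I \<Longrightarrow> tame (f i)) \<Longrightarrow> tame (sum f I)"
  using tame_scalar[of 0] by (induction I rule: infinite_finite_induct) (auto intro: tame_add)

text \<open>Submultiplicativity of the weight, a form of Peetre's inequality; it moves decay from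
  one centre to another.\<close>

lemma jb_add: "1 + norm (lat (p + q)) \<le> (1 + norm (lat p)) * (1 + norm (lat q))"
proof -
  have "norm (lat (p + q)) \<le> norm (lat p) + norm (lat q)"
    unfolding lat_add by (rule norm_triangle_ineq)
  moreover have "0 \<le> norm (lat p) * norm (lat q)" by simp
  moreover have "(1 + norm (lat p)) * (1 + norm (lat q)) = 1 + norm (lat p) + norm (lat q) + norm (lat p) * norm (lat q)"
    by (simp add: algebra_simps)
  ultimately show ?thesis by linarith
qed

lemma jb_add_power: "(1 + norm (lat (p + q))) ^ r \<le> (1 + norm (lat p)) ^ r * (1 + norm (lat q)) ^ r"
  unfolding power_mult_distrib[symmetric] by (intro power_mono jb_add) simp

lemma summable_weighted: "(\<lambda>l. (1 + norm (lat l)) ^ r * cmod (coeff a l)) summable_on UNIV"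
proof -
  have "rapid (\<lambda>l. of_real ((1 + norm (lat l)) ^ r) * coeff a l)"
    by (rule rapid_mult_bounded[OF rapid_coeff, where B = 1 and s = r]) (simp add: norm_power abs_of_nonneg del: of_real_power)
  from rapid_summable[OF this] show ?thesis
    by (simp add: norm_mult norm_power abs_of_nonneg del: of_real_power of_real_add)
qed

text \<open>Peetre's inequality splits the weight at \<open>p\<close> into one at \<open>l\<close>,
  absorbed by the rapid decay of \<open>a\<close>, and one at \<open>p - l\<close>, absorbed by the
  bound on \<open>y\<close>.\<close>

lemma tame_convolution:
  assumes t: "\<And>p l. cmod (t p l) = 1"
    and T: "\<And>y p. coeff (app T y) p = (\<Sum>\<^sub>\<infinity>l. coeff a l * coeff y (p - l) * t p l)"
  shows "tame T"
  unfolding tame_def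
proof
  fix r
  let ?A = "\<Sum>\<^sub>\<infinity>l. (1 + norm (lat l)) ^ r * cmod (coeff a l)"
  have "(1 + norm (lat p)) ^ r * cmod (coeff (app T y) (m + p)) \<le> ?A * B" if y: "bnd r m y B" for B m y p
  proof -
    obtain C where C: "\<And>m. cmod (coeff y m) \<le> C" using coeff_bounded by blast
    have s: "(\<lambda>l. cmod (coeff a l * coeff y (m + p - l) * t (m + p) l)) summable_on UNIV"
      using summable_coeff_mult_bounded[of "\<lambda>l. coeff y (m + p - l)" C a] C
      by (simp add: norm_mult t mult.commute)
    have "(1 + norm (lat p)) ^ r * cmod (coeff (app T y) (m + p))
        \<le> (1 + norm (lat p)) ^ r * (\<Sum>\<^sub>\<infinity>l. cmod (coeff a l * coeff y (m + p - l) * t (m + p) l))"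
      unfolding T by (intro mult_left_mono norm_infsum_bound s) simp
    also have "\<dots> = (\<Sum>\<^sub>\<infinity>l. (1 + norm (lat p)) ^ r * cmod (coeff a l * coeff y (m + p - l) * t (m + p) l))"
      by (rule infsum_cmult_right'[symmetric])
    also have "\<dots> \<le> (\<Sum>\<^sub>\<infinity>l. B * ((1 + norm (lat l)) ^ r * cmod (coeff a l)))"
    proof (rule infsum_mono)
      fix l
      have "(1 + norm (lat p)) ^ r * cmod (coeff y (m + p - l))
          \<le> ((1 + norm (lat l)) ^ r * (1 + norm (lat (p - l))) ^ r) * cmod (coeff y (m + p - l))"
        using jb_add_power[of l "p - l" r] by (intro mult_right_mono) auto
      also have "\<dots> = (1 + norm (lat l)) ^ r * ((1 + norm (lat (p - l))) ^ r * cmod (coeff y (m + (p - l))))"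
        by (simp add: add_diff_eq)
      also have "\<dots> \<le> (1 + norm (lat l)) ^ r * B"
        using y by (intro mult_left_mono) (auto simp: bnd_def)
      finally have "cmod (coeff a l) * ((1 + norm (lat p)) ^ r * cmod (coeff y (m + p - l)))
          \<le> cmod (coeff a l) * ((1 + norm (lat l)) ^ r * B)"
        by (rule mult_left_mono) simp
      then show "(1 + norm (lat p)) ^ r * cmod (coeff a l * coeff y (m + p - l) * t (m + p) l)
          \<le> B * ((1 + norm (lat l)) ^ r * cmod (coeff a l))"
        by (simp add: norm_mult t mult_ac)
    qed (intro summable_on_cmult_right s summable_weighted)+
    also have "\<dots> = ?A * B" by (simp add: infsum_cmult_right' mult.commute)
    finally show ?thesis .
  qed
  moreover have "0 \<le> ?A" by (intro infsum_nonneg) simp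
  ultimately show "\<exists>C\<ge>0. \<forall>B m y. bnd r m y B \<longrightarrow> bnd r m (app T y) (C * B)"
    by (intro exI[of _ ?A]) (auto simp: bnd_def)
qed

lemma tame_alg_hat: "T \<in> alg_hat \<theta> \<Longrightarrow> tame T"
proof (induction rule: alg_hat.induct)
  case (left S)
  then obtain a where "S = lmult \<theta> a" by (auto simp: alg_def)
  then show ?case
    by (intro tame_convolution[of "\<lambda>p l. twist \<theta> l (p - l)" _ a]) (auto simp: coeff_tmult)
next
  case (right S)
  then obtain a where "S = rmult \<theta> a" by (auto simp: alg_op_def)
  then show ?case
    by (intro tame_convolution[of "\<lambda>p l. twist \<theta> (p - l) l" _ a]) (auto simp: coeff_tmult_flip)
qed (auto intro: tame_add tame_mult tame_scalar)

text \<open>Families of operators, evaluated at the frequency \<open>m\<close>, that are \<open>O(\<bar>m\<bar>\<^sup>d)\<close> together with all their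
  derivatives along the torus.\<close>

definition ordR :: "int \<Rightarrow> (int^4 \<Rightarrow> endo^4^4) \<Rightarrow> bool"
  where "ordR d R \<longleftrightarrow> (\<forall>r. \<exists>C\<ge>0. \<forall>m. m \<noteq> 0 \<longrightarrow> (\<forall>i j. bnd r m (app (R m $ i $ j) (U m)) (C * norm (lat m) powi d)))"

lemma ordR_cong:
  assumes "ordR d R" "\<And>m i j. m \<noteq> 0 \<Longrightarrow> app (R m $ i $ j) (U m) = app (R' m $ i $ j) (U m)"
  shows "ordR d R'"
  using assms unfolding ordR_def by simp

lemma ordRE:
  assumes "ordR d R"
  obtains C where "0 \<le> C" "\<And>m i j. m \<noteq> 0 \<Longrightarrow> bnd r m (app (R m $ i $ j) (U m)) (C * norm (lat m) powi d)"
  using assms[unfolded ordR_def, THEN spec, of r] by auto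

lemma powi_norm_lat_mono: "m \<noteq> 0 \<Longrightarrow> d \<le> e \<Longrightarrow> norm (lat m) powi d \<le> norm (lat m) powi e"
  by (rule power_int_increasing) (auto simp: norm_lat_ge_1)

lemma ordR_mono: "ordR d R \<Longrightarrow> d \<le> e \<Longrightarrow> ordR e R"
  unfolding ordR_def
proof
  fix r assume "\<forall>r. \<exists>C\<ge>0. \<forall>m. m \<noteq> 0 \<longrightarrow> (\<forall>i j. bnd r m (app (R m $ i $ j) (U m)) (C * norm (lat m) powi d))"
    and de: "d \<le> e"
  then obtain C where C: "0 \<le> C" "\<And>m i j. m \<noteq> 0 \<Longrightarrow> bnd r m (app (R m $ i $ j) (U m)) (C * norm (lat m) powi d)"
    by blast
  have "bnd r m (app (R m $ i $ j) (U m)) (C * norm (lat m) powi e)" if "m \<noteq> 0" for m i j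
    using C(2)[OF that] by (rule bnd_mono) (intro mult_left_mono powi_norm_lat_mono that de C)
  then show "\<exists>C\<ge>0. \<forall>m. m \<noteq> 0 \<longrightarrow> (\<forall>i j. bnd r m (app (R m $ i $ j) (U m)) (C * norm (lat m) powi e))"
    using C(1) by blast
qed

lemma ordR_add:
  assumes "ordR d R" "ordR d S"
  shows "ordR d (\<lambda>m. R m + S m)"
  unfolding ordR_def
proof
  fix r
  obtain C where C: "0 \<le> C" "\<And>m i j. m \<noteq> 0 \<Longrightarrow> bnd r m (app (R m $ i $ j) (U m)) (C * norm (lat m) powi d)"
    by (rule ordRE[OF assms(1), where r = "r"]) (rule that; assumption)
  obtain D where D: "0 \<le> D" "\<And>m i j. m \<noteq> 0 \<Longrightarrow> bnd r m (app (S m $ i $ j) (U m)) (D * norm (lat m) powi d)"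
    by (rule ordRE[OF assms(2), where r = "r"]) (rule that; assumption)
  have "bnd r m (app ((R m + S m) $ i $ j) (U m)) ((C + D) * norm (lat m) powi d)" if "m \<noteq> 0" for m i j
    using bnd_add[OF C(2)[OF that] D(2)[OF that]] by (simp add: distrib_right)
  then show "\<exists>C\<ge>0. \<forall>m. m \<noteq> 0 \<longrightarrow> (\<forall>i j. bnd r m (app ((R m + S m) $ i $ j) (U m)) (C * norm (lat m) powi d))"
    using C(1) D(1) by (intro exI[of _ "C + D"]) auto
qed

lemma ordR_0: "ordR d (\<lambda>_. 0)"
  unfolding ordR_def by (intro allI exI[of _ 0]) auto

lemma ordR_sum: "(\<And>i. i \<in> I \<Longrightarrow> ordR d (f i)) \<Longrightarrow> ordR d (\<lambda>m. \<Sum>i\<in>I. f i m)"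
  by (induction I rule: infinite_finite_induct) (auto intro: ordR_0 ordR_add)

lemma ordR_tame_mult:
  assumes A: "\<And>i j. tame (A $ i $ j)" and R: "ordR d R"
  shows "ordR d (\<lambda>m. A ** R m)"
  unfolding ordR_def
proof
  fix r
  obtain C where C: "0 \<le> C" "\<And>m i j. m \<noteq> 0 \<Longrightarrow> bnd r m (app (R m $ i $ j) (U m)) (C * norm (lat m) powi d)"
    by (rule ordRE[OF R, where r = "r"]) (rule that; assumption)
  have "\<exists>D\<ge>0. \<forall>B m y. bnd r m y B \<longrightarrow> bnd r m (app (A $ i $ j) y) (D * B)" for i j
    using A[of i j, unfolded tame_def, THEN spec, of r] .
  then obtain D where D: "\<And>i j. 0 \<le> D i j" "\<And>i j B m y. bnd r m y B \<Longrightarrow> bnd r m (app (A $ i $ j) y) (D i j * B)"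
    by metis
  let ?E = "\<Sum>i\<in>UNIV. \<Sum>k\<in>UNIV. D i k * C"
  have "bnd r m (app ((A ** R m) $ i $ j) (U m)) (?E * norm (lat m) powi d)" if m: "m \<noteq> 0" for m i j
  proof (rule bnd_mono)
    show "bnd r m (app ((A ** R m) $ i $ j) (U m)) (\<Sum>k\<in>UNIV. D i k * (C * norm (lat m) powi d))"
      unfolding matrix_mult_nth app_sum times_endo.rep_eq by (intro bnd_sum D C m)
    have "(\<Sum>k\<in>UNIV. D i k * C) \<le> ?E"
      by (rule member_le_sum[of i UNIV "\<lambda>i. \<Sum>k\<in>UNIV. D i k * C"]) (auto intro!: sum_nonneg mult_nonneg_nonneg D C)
    then have "(\<Sum>k\<in>UNIV. D i k * C) * norm (lat m) powi d \<le> ?E * norm (lat m) powi d"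
      by (intro mult_right_mono) auto
    then show "(\<Sum>k\<in>UNIV. D i k * (C * norm (lat m) powi d)) \<le> ?E * norm (lat m) powi d"
      by (simp add: sum_distrib_right mult.assoc)
  qed
  then show "\<exists>C\<ge>0. \<forall>m. m \<noteq> 0 \<longrightarrow> (\<forall>i j. bnd r m (app ((A ** R m) $ i $ j) (U m)) (C * norm (lat m) powi d))"
    by (intro exI[of _ ?E]) (auto intro!: sum_nonneg mult_nonneg_nonneg D C)
qed

lemma ordR_minus:
  assumes "ordR d R"
  shows "ordR d (\<lambda>m. - R m)"
proof -
  have "ordR d (\<lambda>m. mat (scalar (-1)) ** R m)"
    using tame_scalar[of 0] by (intro ordR_tame_mult assms) (simp add: mat_nth tame_scalar)
  then show ?thesis
    by (rule ordR_cong) (auto simp: mat_mult_nth intro!: torus_fun_eqI)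
qed

lemma ordR_diff: "ordR d R \<Longrightarrow> ordR d S \<Longrightarrow> ordR d (\<lambda>m. R m - S m)"
  using ordR_add[OF _ ordR_minus] by fastforce

definition msym :: "real^4^4 \<Rightarrow> int \<Rightarrow> (real^4 \<Rightarrow> endo^4^4) \<Rightarrow> bool"
  where "msym \<theta> l s \<longleftrightarrow> (\<forall>i j. esym \<theta> l (\<lambda>\<xi>. s \<xi> $ i $ j))"

lemma esym_ord:
  assumes "esym \<theta> l f"
  shows "\<exists>C\<ge>0. \<forall>m. m \<noteq> 0 \<longrightarrow> bnd r m (app (f (lat m)) (U m)) (C * norm (lat m) powi l)"
  using assms
proof (induction rule: esym.induct)
  case (esym_elem f T)
  obtain C where C: "0 \<le> C" "\<And>\<xi>. \<xi> \<noteq> 0 \<Longrightarrow> cmod (f \<xi>) \<le> C * norm \<xi> powi l"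
    using hom_bound[OF esym_elem(1)] by blast
  obtain D where D: "0 \<le> D" "\<And>B m y. bnd r m y B \<Longrightarrow> bnd r m (app T y) (D * B)"
    using tameE[OF tame_alg_hat[OF esym_elem(2)]] by metis
  have "bnd r m (app (scalar (f (lat m)) * T) (U m)) (C * D * norm (lat m) powi l)" if m: "m \<noteq> 0" for m
    unfolding bnd_def
  proof
    fix p
    have "(1 + norm (lat p)) ^ r * cmod (coeff (app T (U m)) (m + p)) \<le> D"
      using D(2)[OF bnd_U[of r m]] by (simp add: bnd_def)
    then have "cmod (f (lat m)) * ((1 + norm (lat p)) ^ r * cmod (coeff (app T (U m)) (m + p)))
      \<le> (C * norm (lat m) powi l) * D"
      using C m by (intro mult_mono) (auto intro!: mult_nonneg_nonneg)
    then show "(1 + norm (lat p)) ^ r * cmod (coeff (app (scalar (f (lat m)) * T) (U m)) (m + p))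
      \<le> C * D * norm (lat m) powi l" by (simp add: norm_mult mult_ac)
  qed
  then show ?case using C(1) D(1) by (intro exI[of _ "C * D"]) auto
next
  case (esym_add f g)
  from esym_add.IH(1) obtain C where C: "0 \<le> C" "\<And>m. m \<noteq> 0 \<Longrightarrow> bnd r m (app (f (lat m)) (U m)) (C * norm (lat m) powi l)"
    by auto
  from esym_add.IH(2) obtain D where D: "0 \<le> D" "\<And>m. m \<noteq> 0 \<Longrightarrow> bnd r m (app (g (lat m)) (U m)) (D * norm (lat m) powi l)"
    by auto
  have "bnd r m (app (f (lat m) + g (lat m)) (U m)) ((C + D) * norm (lat m) powi l)" if "m \<noteq> 0" for m
    using bnd_add[OF C(2)[OF that] D(2)[OF that]] by (simp add: distrib_right)
  then show ?case using C(1) D(1) by (intro exI[of _ "C + D"]) auto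
qed

lemma ordR_msym:
  assumes "msym \<theta> l s"
  shows "ordR l (\<lambda>m. s (lat m))"
  unfolding ordR_def
proof
  fix r
  have "\<forall>i j. \<exists>C\<ge>0. \<forall>m. m \<noteq> 0 \<longrightarrow> bnd r m (app (s (lat m) $ i $ j) (U m)) (C * norm (lat m) powi l)"
    using assms esym_ord unfolding msym_def by blast
  then obtain C where C: "\<And>i j. 0 \<le> C i j" "\<And>i j m. m \<noteq> 0 \<Longrightarrow> bnd r m (app (s (lat m) $ i $ j) (U m)) (C i j * norm (lat m) powi l)"
    by metis
  let ?E = "\<Sum>i\<in>UNIV. \<Sum>j\<in>UNIV. C i j"
  have "C i j \<le> ?E" for i j
    using member_le_sum[of j UNIV "C i"] member_le_sum[of i UNIV "\<lambda>i. \<Sum>j\<in>UNIV. C i j"] C(1)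
    by (simp add: sum_nonneg)
  then have "bnd r m (app (s (lat m) $ i $ j) (U m)) (?E * norm (lat m) powi l)" if "m \<noteq> 0" for m i j
    using C(2)[OF that] by (rule_tac bnd_mono) (auto intro: mult_right_mono)
  then show "\<exists>C\<ge>0. \<forall>m. m \<noteq> 0 \<longrightarrow> (\<forall>i j. bnd r m (app (s (lat m) $ i $ j) (U m)) (C * norm (lat m) powi l))"
    using C(1) by (intro exI[of _ ?E]) (auto intro!: sum_nonneg)
qed

text \<open>A frequency \<open>m + p\<close> has size at most
  \<open>norm (lat m) * (1 + norm (lat p))\<close>, because \<open>norm (lat m)\<close> is at least
  1. The first factor raises the order by one, the second costs one unit of decay, hence
  \<open>Suc r\<close>.\<close>

lemma ordR_Dop:
  assumes "ordR d R"
  shows "ordR (d + 1) (\<lambda>m. mat (Dop b) ** R m)"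
  unfolding ordR_def
proof
  fix r
  obtain C where C: "0 \<le> C" "\<And>m i j. m \<noteq> 0 \<Longrightarrow> bnd (Suc r) m (app (R m $ i $ j) (U m)) (C * norm (lat m) powi d)"
    by (rule ordRE[OF assms, where r = "Suc r"]) (rule that; assumption)
  have "bnd r m (app ((mat (Dop b) ** R m) $ i $ j) (U m)) (C * norm (lat m) powi (d + 1))" if m: "m \<noteq> 0" for m i j
    unfolding bnd_def
  proof
    fix p
    let ?y = "app (R m $ i $ j) (U m)"
    have "\<bar>lat (m + p) $ b\<bar> \<le> norm (lat m) + norm (lat p)"
      using component_le_norm_cart[of "lat (m + p)" b] norm_triangle_ineq[of "lat m" "lat p"]
      by (simp add: lat_add)
    also have "\<dots> \<le> norm (lat m) * (1 + norm (lat p))"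
      using mult_right_mono[OF norm_lat_ge_1[OF m], of "norm (lat p)"] by (simp add: distrib_left)
    finally have "(1 + norm (lat p)) ^ r * (\<bar>lat (m + p) $ b\<bar> * cmod (coeff ?y (m + p)))
      \<le> (1 + norm (lat p)) ^ r * ((norm (lat m) * (1 + norm (lat p))) * cmod (coeff ?y (m + p)))"
      by (intro mult_left_mono mult_right_mono) auto
    also have "\<dots> = norm (lat m) * ((1 + norm (lat p)) ^ Suc r * cmod (coeff ?y (m + p)))" by simp
    also have "\<dots> \<le> norm (lat m) * (C * norm (lat m) powi d)"
      using C(2)[OF m] by (intro mult_left_mono) (auto simp: bnd_def)
    also have "\<dots> = C * norm (lat m) powi (d + 1)" using m by (simp add: power_int_add mult_ac)
    finally show "(1 + norm (lat p)) ^ r * cmod (coeff (app ((mat (Dop b) ** R m) $ i $ j) (U m)) (m + p))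
      \<le> C * norm (lat m) powi (d + 1)" by (simp add: mat_mult_nth norm_mult)
  qed
  then show "\<exists>C\<ge>0. \<forall>m. m \<noteq> 0 \<longrightarrow> (\<forall>i j. bnd r m (app ((mat (Dop b) ** R m) $ i $ j) (U m)) (C * norm (lat m) powi (d + 1)))"
    using C(1) by blast
qed

text \<open>Rank-one operators between smooth vectors are smoothing: \<open>R m\<close> maps
  \<open>U m\<close> to something concentrated near \<open>m\<close>, where \<open>w\<close> is
  small beyond all powers. Hence the order \<open>e\<close> is arbitrary.\<close>

lemma ordR_rank_one:
  assumes \<rho>: "\<And>x. app \<rho> x = scaleC (ip w x) v" and R: "ordR d R"
  shows "ordR e (\<lambda>m. mat \<rho> ** R m)"
  unfolding ordR_def
proof
  fix r
  \<comment> \<open>Of these powers of decay of \<open>w\<close>, \<open>r\<close> recentre the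
    decay of \<open>v\<close> from the origin to \<open>m\<close>, and \<open>nat (d - e)\<close>
    lower the order from \<open>d\<close> to \<open>e\<close>.\<close>
  define r' where "r' = r + nat (d - e)"
  obtain C where C: "0 \<le> C" "\<And>m i j. m \<noteq> 0 \<Longrightarrow> bnd r' m (app (R m $ i $ j) (U m)) (C * norm (lat m) powi d)"
    by (rule ordRE[OF R, where r = "r'"]) (rule that; assumption)
  let ?W = "\<Sum>\<^sub>\<infinity>q. (1 + norm (lat q)) ^ r' * cmod (coeff w q)"
  have W: "0 \<le> ?W" by (intro infsum_nonneg) simp
  obtain V where V: "\<And>q. (1 + norm (lat q)) ^ r * cmod (coeff v q) \<le> V"
    using rapid_coeff[of v] unfolding rapid_def by metis
  have V0: "0 \<le> V" using order_trans[OF _ V[of 0]] by simp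
  have "bnd r m (app ((mat \<rho> ** R m) $ i $ j) (U m)) (?W * C * V * norm (lat m) powi e)" if m: "m \<noteq> 0" for m i j
    unfolding bnd_def
  proof
    fix p
    let ?y = "app (R m $ i $ j) (U m)"
    have wq: "(1 + norm (lat m)) ^ r' * (cmod (coeff w q) * cmod (coeff ?y q))
        \<le> (C * norm (lat m) powi d) * ((1 + norm (lat q)) ^ r' * cmod (coeff w q))" for q
    proof -
      have "(1 + norm (lat m)) ^ r' \<le> (1 + norm (lat q)) ^ r' * (1 + norm (lat (q - m))) ^ r'"
        using jb_add_power[of q "m - q" r'] norm_lat_minus[of "q - m"] by simp
      then have "(1 + norm (lat m)) ^ r' * cmod (coeff ?y q)
          \<le> ((1 + norm (lat q)) ^ r' * (1 + norm (lat (q - m))) ^ r') * cmod (coeff ?y q)"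
        by (rule mult_right_mono) simp
      also have "\<dots> = (1 + norm (lat q)) ^ r' * ((1 + norm (lat (q - m))) ^ r' * cmod (coeff ?y (m + (q - m))))"
        by (simp add: mult.assoc)
      also have "\<dots> \<le> (1 + norm (lat q)) ^ r' * (C * norm (lat m) powi d)"
        using C(2)[OF m, of i j, unfolded bnd_def, THEN spec, of "q - m"] by (intro mult_left_mono) auto
      finally have "cmod (coeff w q) * ((1 + norm (lat m)) ^ r' * cmod (coeff ?y q))
          \<le> cmod (coeff w q) * ((1 + norm (lat q)) ^ r' * (C * norm (lat m) powi d))"
        by (rule mult_left_mono) simp
      then show ?thesis by (simp add: mult_ac)
    qed
    have s: "(\<lambda>q. cmod (cnj (coeff w q) * coeff ?y q)) summable_on UNIV"
    proof -
      obtain K where "\<And>q. cmod (coeff ?y q) \<le> K" using coeff_bounded by blast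
      from summable_coeff_mult_bounded[of "coeff ?y", OF this, of w] show ?thesis
        by (simp add: norm_mult mult.commute)
    qed
    have "(1 + norm (lat m)) ^ r' * cmod (ip w ?y)
        \<le> (1 + norm (lat m)) ^ r' * (\<Sum>\<^sub>\<infinity>q. cmod (cnj (coeff w q) * coeff ?y q))"
      unfolding ip_def by (intro mult_left_mono norm_infsum_bound s) simp
    also have "\<dots> = (\<Sum>\<^sub>\<infinity>q. (1 + norm (lat m)) ^ r' * cmod (cnj (coeff w q) * coeff ?y q))"
      by (rule infsum_cmult_right'[symmetric])
    also have "\<dots> \<le> (\<Sum>\<^sub>\<infinity>q. (C * norm (lat m) powi d) * ((1 + norm (lat q)) ^ r' * cmod (coeff w q)))"
      by (intro infsum_mono summable_on_cmult_right s summable_weighted) (simp add: norm_mult wq)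
    also have "\<dots> = (C * norm (lat m) powi d) * ?W" by (rule infsum_cmult_right')
    finally have ipb: "(1 + norm (lat m)) ^ r' * cmod (ip w ?y) \<le> (C * norm (lat m) powi d) * ?W" .
    have "(1 + norm (lat p)) ^ r \<le> (1 + norm (lat m)) ^ r * (1 + norm (lat (m + p))) ^ r"
      using jb_add_power[of "- m" "m + p" r] by simp
    then have "(1 + norm (lat p)) ^ r * cmod (coeff v (m + p))
        \<le> ((1 + norm (lat m)) ^ r * (1 + norm (lat (m + p))) ^ r) * cmod (coeff v (m + p))"
      by (rule mult_right_mono) simp
    also have "\<dots> \<le> (1 + norm (lat m)) ^ r * V"
      unfolding mult.assoc by (intro mult_left_mono V) simp
    finally have "cmod (ip w ?y) * ((1 + norm (lat p)) ^ r * cmod (coeff v (m + p)))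
        \<le> cmod (ip w ?y) * ((1 + norm (lat m)) ^ r * V)"
      by (rule mult_left_mono) simp
    also have "\<dots> \<le> ?W * C * V * norm (lat m) powi e"
    proof -
      have n1: "1 \<le> norm (lat m)" by (rule norm_lat_ge_1[OF m])
      have "(1 + norm (lat m)) ^ r * norm (lat m) ^ nat (d - e) \<le> (1 + norm (lat m)) ^ r'"
        unfolding r'_def power_add by (intro mult_left_mono power_mono) auto
      then have "((1 + norm (lat m)) ^ r * norm (lat m) ^ nat (d - e)) * cmod (ip w ?y)
          \<le> (1 + norm (lat m)) ^ r' * cmod (ip w ?y)"
        by (rule mult_right_mono) simp
      also note ipb
      finally have 1: "norm (lat m) ^ nat (d - e) * ((1 + norm (lat m)) ^ r * cmod (ip w ?y)) \<le> ?W * C * norm (lat m) powi d"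
        by (simp add: mult_ac)
      have pos: "0 < norm (lat m) ^ nat (d - e)" using m by (intro zero_less_power) simp
      have "norm (lat m) powi d \<le> norm (lat m) powi (int (nat (d - e)) + e)"
        by (rule powi_norm_lat_mono[OF m]) simp
      also have "\<dots> = norm (lat m) ^ nat (d - e) * norm (lat m) powi e"
      proof -
        have "norm (lat m) \<noteq> 0" using m by simp
        then show ?thesis by (simp only: power_int_add power_int_of_nat simp_thms)
      qed
      finally have "?W * C * norm (lat m) powi d \<le> ?W * C * (norm (lat m) ^ nat (d - e) * norm (lat m) powi e)"
        using W C(1) by (intro mult_left_mono) auto
      with 1 have "norm (lat m) ^ nat (d - e) * ((1 + norm (lat m)) ^ r * cmod (ip w ?y))
          \<le> norm (lat m) ^ nat (d - e) * (?W * C * norm (lat m) powi e)" by (simp add: mult_ac)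
      then have "(1 + norm (lat m)) ^ r * cmod (ip w ?y) \<le> ?W * C * norm (lat m) powi e"
        using pos by (simp only: mult_le_cancel_left_pos)
      from mult_right_mono[OF this V0] show ?thesis by (simp add: mult_ac)
    qed
    finally show "(1 + norm (lat p)) ^ r * cmod (coeff (app ((mat \<rho> ** R m) $ i $ j) (U m)) (m + p))
      \<le> ?W * C * V * norm (lat m) powi e"
      by (simp add: mat_mult_nth \<rho> norm_mult mult_ac)
  qed
  then show "\<exists>C\<ge>0. \<forall>m. m \<noteq> 0 \<longrightarrow> (\<forall>i j. bnd r m (app ((mat \<rho> ** R m) $ i $ j) (U m)) (C * norm (lat m) powi e))"
    using W C(1) V0 by (intro exI[of _ "?W * C * V"]) auto
qed

text \<open>An asymptotic expansion numbered downwards from the top degree, so that symbols can be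
  defined by recursion on \<open>n\<close>. Its terms have the special form \<open>msym\<close>,
  which is narrower than the homogeneous symbols of \<open>has_classical_symbol\<close>.\<close>

definition osymb :: "real^4^4 \<Rightarrow> int \<Rightarrow> endo^4^4 \<Rightarrow> (nat \<Rightarrow> real^4 \<Rightarrow> endo^4^4) \<Rightarrow> bool"
  where "osymb \<theta> d P s \<longleftrightarrow> (\<forall>n. msym \<theta> (d - int n) (s n)) \<and>
    (\<forall>N. ordR (d - int N) (\<lambda>m. P - (\<Sum>n<N. s n (lat m))))"

lemma esym_minus: "esym \<theta> l f \<Longrightarrow> esym \<theta> l (\<lambda>\<xi>. - f \<xi>)"
  using esym_mult_left[OF alg_hat_minus[OF alg_hat_1], of \<theta> l f] by simp

lemma msym_add: "msym \<theta> l s \<Longrightarrow> msym \<theta> l t \<Longrightarrow> msym \<theta> l (\<lambda>\<xi>. s \<xi> + t \<xi>)"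
  unfolding msym_def by (auto intro: esym_add)

lemma msym_minus: "msym \<theta> l s \<Longrightarrow> msym \<theta> l (\<lambda>\<xi>. - s \<xi>)"
  unfolding msym_def by (auto intro: esym_minus)

lemma msym_diff: "msym \<theta> l s \<Longrightarrow> msym \<theta> l t \<Longrightarrow> msym \<theta> l (\<lambda>\<xi>. s \<xi> - t \<xi>)"
  using msym_add[OF _ msym_minus] by fastforce

lemma msym_zero: "msym \<theta> l (\<lambda>_. 0)"
  unfolding msym_def by (auto intro: esym_zero)

lemma msym_sum: "(\<And>i. i \<in> I \<Longrightarrow> msym \<theta> l (f i)) \<Longrightarrow> msym \<theta> l (\<lambda>\<xi>. \<Sum>i\<in>I. f i \<xi>)"
  by (induction I rule: infinite_finite_induct) (auto intro: msym_zero msym_add)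

lemma msym_pmm: "msym \<theta> l s \<Longrightarrow> msym \<theta> l (\<lambda>\<xi>. pmm c (s \<xi>))"
  unfolding msym_def by (auto simp: pm_def intro!: esym_mult_left esym_\<delta>)

lemma msym_left:
  assumes "\<And>i j. A $ i $ j \<in> alg_hat \<theta>" "msym \<theta> l s"
  shows "msym \<theta> l (\<lambda>\<xi>. A ** s \<xi>)"
  using assms unfolding msym_def matrix_mult_nth by (auto intro!: esym_sum esym_mult_left)

lemma msym_hom:
  assumes "\<And>i j. hom k (\<lambda>\<xi>. A \<xi> $ i $ j)" "msym \<theta> l s"
  shows "msym \<theta> (k + l) (\<lambda>\<xi>. tens (A \<xi>) 1 ** s \<xi>)"
  using assms unfolding msym_def matrix_mult_nth by (auto intro!: esym_sum esym_mult_hom)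

lemma osymb_one: "osymb \<theta> 0 (mat 1) (\<lambda>n \<xi>. if n = 0 then mat 1 else 0)"
proof -
  have m: "msym \<theta> 0 (\<lambda>_. mat 1)"
    unfolding msym_def by (auto simp: mat_nth intro: esym_const)
  have "ordR (0 - int N) (\<lambda>m. mat 1 - (\<Sum>n<N. if n = 0 then mat 1 else 0))" for N
  proof (cases N)
    case 0
    then show ?thesis using ordR_msym[OF m] by simp
  next
    case (Suc N')
    then show ?thesis by (simp add: sum.delta ordR_0)
  qed
  then show ?thesis unfolding osymb_def by (auto intro: m msym_zero)
qed

lemma osymb_left:
  assumes A: "\<And>i j. A $ i $ j \<in> alg_hat \<theta>" and P: "osymb \<theta> d P s"
  shows "osymb \<theta> d (A ** P) (\<lambda>n \<xi>. A ** s n \<xi>)"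
proof -
  have "ordR (d - int N) (\<lambda>m. A ** (P - (\<Sum>n<N. s n (lat m))))" for N
    using P tame_alg_hat[OF A] unfolding osymb_def by (intro ordR_tame_mult) auto
  then show ?thesis
    using P unfolding osymb_def by (auto simp: matrix_diff_right matrix_sum_right intro!: msym_left A)
qed

lemma osymb_add:
  assumes "osymb \<theta> d P s" "osymb \<theta> d Q t"
  shows "osymb \<theta> d (P + Q) (\<lambda>n \<xi>. s n \<xi> + t n \<xi>)"
proof -
  have "ordR (d - int N) (\<lambda>m. (P - (\<Sum>n<N. s n (lat m))) + (Q - (\<Sum>n<N. t n (lat m))))" for N
    using assms unfolding osymb_def by (intro ordR_add) auto
  then show ?thesis
    using assms unfolding osymb_def by (auto simp: sum.distrib add_diff_add intro!: msym_add)
qed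

lemma osymb_sum:
  assumes "\<And>i. i \<in> I \<Longrightarrow> osymb \<theta> d (P i) (s i)"
  shows "osymb \<theta> d (sum P I) (\<lambda>n \<xi>. \<Sum>i\<in>I. s i n \<xi>)"
proof -
  have z: "osymb \<theta> d 0 (\<lambda>n \<xi>. 0)" by (simp add: osymb_def msym_zero ordR_0)
  show ?thesis
    using assms by (induction I rule: infinite_finite_induct) (auto intro: z osymb_add)
qed

text \<open>A vanishing leading term raises the nominal order by one, so that operators of
  neighbouring orders can be added with aligned indices.\<close>

lemma osymb_shift:
  assumes "osymb \<theta> d P s"
  shows "osymb \<theta> (d + 1) P (\<lambda>n \<xi>. case n of 0 \<Rightarrow> 0 | Suc k \<Rightarrow> s k \<xi>)"
proof -
  have o: "ordR (d - int N) (\<lambda>m. P - (\<Sum>n<N. s n (lat m)))" for N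
    using assms unfolding osymb_def by blast
  have "ordR (d + 1 - int N) (\<lambda>m. P - (\<Sum>n<N. case n of 0 \<Rightarrow> 0 | Suc k \<Rightarrow> s k (lat m)))" for N
  proof (cases N)
    case 0
    then show ?thesis using ordR_mono[OF o[of 0], of "d + 1"] by simp
  next
    case (Suc N')
    then show ?thesis using o[of N'] by (simp add: sum.lessThan_Suc_shift del: sum.lessThan_Suc)
  qed
  moreover have "msym \<theta> (d + 1 - int n) (\<lambda>\<xi>. case n of 0 \<Rightarrow> 0 | Suc k \<Rightarrow> s k \<xi>)" for n
    using assms unfolding osymb_def by (cases n) (auto intro: msym_zero)
  ultimately show ?thesis unfolding osymb_def by blast
qed

lemma osymb_smoothing:
  assumes P: "osymb \<theta> d P s" and R: "\<And>e. ordR e (\<lambda>_. R)"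
  shows "osymb \<theta> d (P - R) s"
proof -
  have "ordR (d - int N) (\<lambda>m. (P - (\<Sum>n<N. s n (lat m))) - R)" for N
    by (rule ordR_diff[OF _ R]) (use P in \<open>simp add: osymb_def\<close>)
  moreover have "(P - S) - R = P - R - S" for S by simp
  ultimately show ?thesis using P unfolding osymb_def by simp
qed

lemma osymb_cong:
  assumes "osymb \<theta> d P s" "\<And>n \<xi>. s n \<xi> = t n \<xi>"
  shows "osymb \<theta> d P t"
proof -
  have "s = t" using assms(2) by (simp add: fun_eq_iff)
  with assms(1) show ?thesis by simp
qed

lemma app_Dop_U: "app (Dop b) (U m) = scaleC (of_real (lat m $ b)) (U m)"
  by (rule torus_fun_eqI) (auto simp: U.rep_eq)

lemma app_Dop_mult_U: "app (Dop b * T) (U m) = app (scalar (of_real (lat m $ b)) * T + pm b T) (U m)"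
  unfolding Dop_mult by (simp add: app_Dop_U)

lemma osymb_Dop:
  assumes P: "osymb \<theta> d P s"
  shows "osymb \<theta> (d + 1) (mat (Dop b) ** P)
    (\<lambda>n \<xi>. mat (scalar (of_real (\<xi> $ b))) ** s n \<xi> + (case n of 0 \<Rightarrow> 0 | Suc k \<Rightarrow> pmm b (s k \<xi>)))"
    (is "osymb _ _ _ ?s")
proof -
  have o: "ordR (d - int N) (\<lambda>m. P - (\<Sum>n<N. s n (lat m)))" and ms: "msym \<theta> (d - int n) (s n)" for N n
    using P unfolding osymb_def by blast+
  \<comment> \<open>Applying \<open>Dop b\<close> to the first \<open>N\<close> terms gives the
    first \<open>N\<close> terms of the new symbol and one derivative too many, that of the last
    term; its order is exactly that of the permitted remainder.\<close>
  define g where "g N \<xi> = (case N of 0 \<Rightarrow> 0 | Suc k \<Rightarrow> pmm b (s k \<xi>))" for N \<xi>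
  have g: "msym \<theta> (d + 1 - int N) (g N)" for N
  proof (cases N)
    case 0
    then have "g N = (\<lambda>_. 0)" by (simp add: g_def fun_eq_iff)
    then show ?thesis by (simp add: msym_zero)
  next
    case (Suc k)
    then have "g N = (\<lambda>\<xi>. pmm b (s k \<xi>))" by (simp add: g_def fun_eq_iff)
    then show ?thesis using msym_pmm[OF ms[of k], of b] Suc by simp
  qed
  define L where "L n \<xi> = mat (scalar (of_real (\<xi> $ b))) ** s n \<xi> + pmm b (s n \<xi>)" for n \<xi>
  have L: "(\<Sum>n<N. L n \<xi>) = (\<Sum>n<N. ?s n \<xi>) + g N \<xi>" for N \<xi>
  proof (induction N)
    case (Suc N)
    then show ?case unfolding sum.lessThan_Suc by (simp add: L_def g_def add_ac)
  qed (simp add: g_def)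
  have "ordR (d + 1 - int N) (\<lambda>m. mat (Dop b) ** P - (\<Sum>n<N. ?s n (lat m)))" for N
  proof (rule ordR_cong)
    have "ordR (d - int N + 1) (\<lambda>m. mat (Dop b) ** (P - (\<Sum>n<N. s n (lat m))))"
      by (rule ordR_Dop[OF o])
    then show "ordR (d + 1 - int N) (\<lambda>m. mat (Dop b) ** (P - (\<Sum>n<N. s n (lat m))) + g N (lat m))"
      by (intro ordR_add ordR_msym[OF g]) (simp add: algebra_simps)
    fix m i j
    have "app ((mat (Dop b) ** s n (lat m)) $ i $ j) (U m) = app (L n (lat m) $ i $ j) (U m)" for n
      unfolding mat_mult_nth L_def vector_add_component pmm_nth by (rule app_Dop_mult_U)
    then have "app ((\<Sum>n<N. mat (Dop b) ** s n (lat m)) $ i $ j) (U m) = app ((\<Sum>n<N. L n (lat m)) $ i $ j) (U m)"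
      by simp
    then show "app ((mat (Dop b) ** (P - (\<Sum>n<N. s n (lat m))) + g N (lat m)) $ i $ j) (U m)
        = app ((mat (Dop b) ** P - (\<Sum>n<N. ?s n (lat m))) $ i $ j) (U m)"
      unfolding matrix_diff_right matrix_sum_right L by simp
  qed
  moreover have "msym \<theta> (d + 1 - int n) (?s n)" for n
  proof (rule msym_add)
    have "esym \<theta> (1 + (d - int n)) (\<lambda>\<xi>. scalar (of_real (\<xi> $ b)) * s n \<xi> $ i $ j)" for i j
      using ms unfolding msym_def by (intro esym_mult_hom hom_coord) auto
    then show "msym \<theta> (d + 1 - int n) (\<lambda>\<xi>. mat (scalar (of_real (\<xi> $ b))) ** s n \<xi>)"
      unfolding msym_def mat_mult_nth by (simp add: algebra_simps)
    show "msym \<theta> (d + 1 - int n) (\<lambda>\<xi>. case n of 0 \<Rightarrow> 0 | Suc k \<Rightarrow> pmm b (s k \<xi>))"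
      using g[of n] unfolding g_def .
  qed
  ultimately show ?thesis unfolding osymb_def by blast
qed

lemma ev_left: "(\<And>k. app (X $ k $ j) x = app (Y $ k $ j) x) \<Longrightarrow> app ((A ** X) $ i $ j) x = app ((A ** Y) $ i $ j) x"
  by (simp add: matrix_mult_nth)

lemma ip_U0: "ip (U 0) x = coeff x 0"
proof -
  have "ip (U 0) x = (\<Sum>\<^sub>\<infinity>m\<in>{0}. cnj (coeff (U 0) m) * coeff x m)"
    unfolding ip_def by (rule infsum_cong_neutral) (auto simp: U.rep_eq)
  then show ?thesis by (simp add: U.rep_eq)
qed

lemma pi0_rank_one: "app pi0 x = scaleC (ip (U 0) x) (U 0)"
  by (simp add: pi0.rep_eq ip_U0)

context clifford begin

definition gpm :: "endo^4^4 \<Rightarrow> endo^4^4"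
  where "gpm X = (\<Sum>c\<in>UNIV. tens (\<gamma> c) 1 ** pmm c X)"

text \<open>The symbol of \<open>D\<^sup>-\<^sup>1 P\<close>, solved from \<open>D (D\<^sup>-\<^sup>1 P) = P\<close>: composition with \<open>D\<close> on the left is exact after
  two terms, so no Taylor expansion is needed.\<close>

primrec dsym :: "(nat \<Rightarrow> real^4 \<Rightarrow> endo^4^4) \<Rightarrow> nat \<Rightarrow> real^4 \<Rightarrow> endo^4^4" where
  "dsym s 0 = (\<lambda>\<xi>. tens (nhat \<xi>) 1 ** s 0 \<xi>)"
| "dsym s (Suc n) = (\<lambda>\<xi>. tens (nhat \<xi>) 1 ** (s (Suc n) \<xi> - gpm (dsym s n \<xi>)))"

lemma hom_nhat: "hom (-1) (\<lambda>\<xi>. nhat \<xi> $ i $ j)"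
proof -
  have "hom (1 + -2) (\<lambda>\<xi>. \<Sum>a\<in>UNIV. of_real (\<xi> $ a) * (of_real (inverse (\<xi> \<bullet> \<xi>)) * \<gamma> a $ i $ j))"
    using hom_mult[OF hom_coord hom_mult[OF hom_inv hom_const]] by (intro hom_sum) simp
  then show ?thesis
    by (simp add: nhat_def slash_def scaleR_sum_right) (simp add: scaleR_conv_of_real mult_ac)
qed

lemma msym_gpm: "msym \<theta> l s \<Longrightarrow> msym \<theta> l (\<lambda>\<xi>. gpm (s \<xi>))"
  unfolding gpm_def by (intro msym_sum msym_left msym_pmm) simp_all

lemma msym_dsym:
  assumes "\<And>n. msym \<theta> (d - int n) (s n)"
  shows "msym \<theta> (d - 1 - int n) (dsym s n)"
proof (induction n)
  case 0
  then show ?case using msym_hom[OF hom_nhat assms[of 0]] by simp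
next
  case (Suc n)
  have "msym \<theta> (-1 + (d - int (Suc n))) (\<lambda>\<xi>. tens (nhat \<xi>) 1 ** (s (Suc n) \<xi> - gpm (dsym s n \<xi>)))"
    using Suc by (intro msym_hom hom_nhat msym_diff assms msym_gpm) (simp add: algebra_simps)
  then show ?case by (simp add: algebra_simps)
qed

lemma flat_ev: "app ((flat_dirac \<gamma> ** T) $ i $ j) (U m) = app ((tens (slash (lat m)) 1 ** T + gpm T) $ i $ j) (U m)"
proof -
  let ?Y = "\<lambda>a. mat (scalar (of_real (lat m $ a))) ** T + pmm a T"
  have 1: "flat_dirac \<gamma> ** T = (\<Sum>a\<in>UNIV. tens (\<gamma> a) 1 ** (mat (Dop a) ** T))"
    unfolding flat_dirac_eq matrix_sum_left by (simp add: matrix_mul_assoc mat_eq_tens tens_mult)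
  have 2: "app ((tens (\<gamma> a) 1 ** (mat (Dop a) ** T)) $ i $ j) (U m) = app ((tens (\<gamma> a) 1 ** ?Y a) $ i $ j) (U m)" for a
    by (rule ev_left) (simp only: mat_mult_nth vector_add_component pmm_nth app_Dop_mult_U)
  have 3: "(\<Sum>a\<in>UNIV. tens (\<gamma> a) 1 ** ?Y a) = tens (slash (lat m)) 1 ** T + gpm T"
    by (simp add: matrix_add_ldistrib sum.distrib gpm_def tens_slash matrix_sum_left matrix_mul_assoc mat_eq_tens tens_mult)
  show ?thesis unfolding 1 3[symmetric] sum_component app_sum by (intro sum.cong refl 2)
qed

text \<open>The sum telescopes: by the recursion, \<open>slash\<close> times term
  \<open>n + 1\<close> plus \<open>gpm\<close> of term \<open>n\<close> is \<open>s (n + 1)\<close>,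
  so only the last \<open>gpm\<close> is left over.\<close>

lemma slash_dsym:
  assumes "\<xi> \<noteq> 0"
  shows "(\<Sum>n<Suc N. tens (slash \<xi>) 1 ** dsym s n \<xi> + gpm (dsym s n \<xi>)) = (\<Sum>n<Suc N. s n \<xi>) + gpm (dsym s N \<xi>)"
proof -
  have c: "tens (slash \<xi>) 1 ** (tens (nhat \<xi>) 1 ** X) = X" for X
    using assms by (simp add: matrix_mul_assoc tens_mult slash_nhat mat_eq_tens[symmetric])
  show ?thesis
  proof (induction N)
    case (Suc N)
    then show ?case unfolding sum.lessThan_Suc[of _ "Suc N"] by (simp add: c)
  qed (simp add: c)
qed

lemma tame_Dinv: "tame (Dinv $ i $ j)"
  unfolding Dinv_def by (auto intro!: tame_sum tame_mult tame_scalar tame_hop)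

text \<open>The remainder \<open>E\<close> is recovered by \<open>Dinv\<close> from
  \<open>flat_dirac \<gamma> ** E\<close>, which \<open>slash_dsym\<close> identifies; the
  constants, invisible to this, contribute smoothing terms only.\<close>

lemma osymb_Dinv:
  assumes P: "osymb \<theta> d P s"
  shows "osymb \<theta> (d - 1) (Dinv ** P) (dsym s)"
proof -
  have o: "ordR (d - int N) (\<lambda>m. P - (\<Sum>n<N. s n (lat m)))" and ms: "msym \<theta> (d - int n) (s n)" for N n
    using P unfolding osymb_def by blast+
  note t = msym_dsym[of \<theta> d s, OF ms]
  define E where "E N m = Dinv ** P - (\<Sum>n<N. dsym s n (lat m))" for N m
  \<comment> \<open>Here \<open>Dinv\<close> counts only as an operator of order 0, so after
    \<open>Suc N\<close> terms the remainder is bounded with the order due after \<open>N\<close>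
    terms. Putting one term back at the end of the proof repairs this.\<close>
  have E_Suc: "ordR (d - 1 - int N) (E (Suc N))" for N
  proof (rule ordR_cong)
    let ?F = "\<lambda>m. P - (\<Sum>n<Suc N. s n (lat m)) - gpm (dsym s N (lat m))"
    have "ordR (d - 1 - int N) (\<lambda>m. P - (\<Sum>n<Suc N. s n (lat m)))"
      using o[of "Suc N"] by (simp add: algebra_simps del: sum.lessThan_Suc)
    then have F: "ordR (d - 1 - int N) ?F"
      by (rule ordR_diff[OF _ ordR_msym[OF msym_gpm[OF t]]])
    have "ordR (d - 1 - int N) (\<lambda>m. mat pi0 ** dsym s n (lat m))" for n
      by (rule ordR_rank_one[OF pi0_rank_one ordR_msym[OF t]])
    then have pi: "ordR (d - 1 - int N) (\<lambda>m. \<Sum>n<Suc N. mat pi0 ** dsym s n (lat m))"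
      by (rule ordR_sum)
    show "ordR (d - 1 - int N) (\<lambda>m. Dinv ** ?F m - (\<Sum>n<Suc N. mat pi0 ** dsym s n (lat m)))"
      by (intro ordR_diff ordR_tame_mult tame_Dinv F pi)
    fix m :: "int^4" and i j assume m: "m \<noteq> 0"
    have d1: "Dinv ** (flat_dirac \<gamma> ** X) + mat pi0 ** X = X" for X
      unfolding matrix_mul_assoc Dinv_flat by (simp add: matrix_diff_left)
    have "mat pi0 ** E (Suc N) m = - (\<Sum>n<Suc N. mat pi0 ** dsym s n (lat m))"
      unfolding E_def matrix_diff_right matrix_sum_right matrix_mul_assoc Dinv_pi0 by simp
    then have EE: "E (Suc N) m = Dinv ** (flat_dirac \<gamma> ** E (Suc N) m) - (\<Sum>n<Suc N. mat pi0 ** dsym s n (lat m))"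
      using d1[of "E (Suc N) m"] by (metis add_uminus_conv_diff)
    \<comment> \<open>Compared with \<open>?F m\<close>, the operator \<open>P\<close> carries the
      factor \<open>mat 1 - mat pi0\<close>; the difference is annihilated by
      \<open>Dinv\<close>.\<close>
    let ?F' = "(mat 1 - mat pi0) ** P - (\<Sum>n<Suc N. s n (lat m)) - gpm (dsym s N (lat m))"
    have "app ((flat_dirac \<gamma> ** E (Suc N) m) $ k $ j) (U m) = app (?F' $ k $ j) (U m)" for k
    proof -
      have "app ((\<Sum>n<Suc N. flat_dirac \<gamma> ** dsym s n (lat m)) $ k $ j) (U m)
          = app ((\<Sum>n<Suc N. tens (slash (lat m)) 1 ** dsym s n (lat m) + gpm (dsym s n (lat m))) $ k $ j) (U m)"
        by (simp only: sum_component app_sum flat_ev)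
      also have "\<dots> = app (((\<Sum>n<Suc N. s n (lat m)) + gpm (dsym s N (lat m))) $ k $ j) (U m)"
        using m by (simp only: slash_dsym lat_eq_0_iff not_False_eq_True)
      finally show ?thesis
        unfolding E_def matrix_diff_right matrix_sum_right matrix_mul_assoc flat_Dinv
        by (simp only: vector_minus_component vector_add_component app_simps) simp
    qed
    then have "app ((Dinv ** (flat_dirac \<gamma> ** E (Suc N) m)) $ i $ j) (U m) = app ((Dinv ** ?F') $ i $ j) (U m)"
      by (rule ev_left)
    also have "Dinv ** ?F' = Dinv ** ?F m"
      unfolding matrix_diff_right matrix_diff_left matrix_mul_assoc Dinv_pi0 by simp
    finally show "app ((Dinv ** ?F m - (\<Sum>n<Suc N. mat pi0 ** dsym s n (lat m))) $ i $ j) (U m) = app (E (Suc N) m $ i $ j) (U m)"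
      by (subst EE) simp
  qed
  have "ordR (d - 1 - int N) (E N)" for N
  proof (rule ordR_cong)
    show "ordR (d - 1 - int N) (\<lambda>m. E (Suc N) m + dsym s N (lat m))"
      by (rule ordR_add[OF E_Suc ordR_msym[OF t]])
  qed (simp add: E_def)
  then show ?thesis unfolding osymb_def E_def using t by blast
qed

end

section \<open>The inverse of the conformally rescaled Dirac operator\<close>

lemma ip_add_right: "ip x (y + z) = ip x y + ip x z"
  unfolding ip_def by (simp add: distrib_left infsum_add[OF summable_ip summable_ip])

lemma ip_scaleC_right: "ip x (scaleC c y) = c * ip x y"
proof -
  have "ip x (scaleC c y) = (\<Sum>\<^sub>\<infinity>m. c * (cnj (coeff x m) * coeff y m))"
    unfolding ip_def by (intro infsum_cong) (simp add: mult_ac)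
  then show ?thesis unfolding ip_def infsum_cmult_right' .
qed

lemma ip_cnj: "cnj (ip x y) = ip y x"
  unfolding ip_def infsum_cnj[symmetric] by (intro infsum_cong) simp

lemma ip_add_left: "ip (x + y) z = ip x z + ip y z"
  by (metis ip_cnj ip_add_right complex_cnj_add)

lemma ip_scaleC_left: "ip (scaleC c x) y = cnj c * ip x y"
  by (metis ip_cnj ip_scaleC_right complex_cnj_mult)

lemma l2sq_eq_0: "l2sq x = 0 \<Longrightarrow> x = 0"
proof (rule torus_fun_eqI)
  fix m assume "l2sq x = 0"
  then show "coeff x m = coeff 0 m" using l2sq_ge_coeff[of x m] by simp
qed

text \<open>Polarization: the quadratic form is real at \<open>x\<close>, \<open>y\<close>,
  \<open>x + y\<close> and \<open>x + \<i> y\<close>.\<close>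

lemma positive_op_symmetric:
  assumes "positive_op T"
  shows "ip x (app T y) = ip (app T x) y"
proof -
  let ?f = "\<lambda>x y. ip x (app T y)"
  have re: "Im (?f z z) = 0" for z
  proof -
    have "?f z z \<in> \<real>\<^sub>\<ge>\<^sub>0" using assms unfolding positive_op_def by blast
    then show ?thesis by (auto elim!: nonneg_Reals_cases)
  qed
  have "Im (?f (x + y) (x + y)) = Im (?f x y) + Im (?f y x) + (Im (?f x x) + Im (?f y y))"
    by (simp add: ip_add_left ip_add_right)
  then have 1: "Im (?f x y) + Im (?f y x) = 0"
    using re[of x] re[of y] re[of "x + y"] by linarith
  have "Im (?f (x + scaleC \<i> y) (x + scaleC \<i> y)) = Re (?f x y) - Re (?f y x) + (Im (?f x x) + Im (?f y y))"
    by (simp add: ip_add_left ip_add_right ip_scaleC_left ip_scaleC_right)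
  then have 2: "Re (?f x y) = Re (?f y x)"
    using re[of x] re[of y] re[of "x + scaleC \<i> y"] by linarith
  have "?f x y = cnj (?f y x)"
    using 1 2 by (simp add: complex_eq_iff)
  then show ?thesis by (simp add: ip_cnj)
qed

lemma app4_nth: "app4 P \<psi> $ i = (\<Sum>j\<in>UNIV. app (P $ i $ j) (\<psi> $ j))"
  by (simp add: app4_def)

lemma app4_mult: "app4 (A ** B) \<psi> = app4 A (app4 B \<psi>)"
  by (simp add: vec_eq_iff app4_nth matrix_mult_nth) (subst sum.swap, simp)

lemma app4_mat: "app4 (mat T) \<psi> = (\<chi> i. app T (\<psi> $ i))"
proof -
  have "app (mat T $ i $ j) (\<psi> $ j) = (if j = i then app T (\<psi> $ j) else 0)" for i j
    by (simp add: mat_nth)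
  then show ?thesis by (simp add: vec_eq_iff app4_nth sum.delta)
qed

lemma app4_add: "app4 P (\<psi> + \<phi>) = app4 P \<psi> + app4 P \<phi>"
  by (simp add: vec_eq_iff app4_nth sum.distrib)

lemma app4_0 [simp]: "app4 P 0 = 0"
  by (simp add: vec_eq_iff app4_nth)

lemma app4_eqI:
  assumes "\<And>\<psi>. app4 A \<psi> = app4 B \<psi>"
  shows "A = B"
proof -
  have "app4 P (axis j x) $ i = app (P $ i $ j) x" for P i j x
  proof -
    have "app (P $ i $ k) (axis j x $ k) = (if k = j then app (P $ i $ k) x else 0)" for k
      by (simp add: axis_def)
    then show ?thesis by (simp add: app4_nth sum.delta)
  qed
  then have "app (A $ i $ j) x = app (B $ i $ j) x" for i j x
    using assms by metis
  then show ?thesis by (simp add: vec_eq_iff endo_eqI)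
qed

lift_definition rank1 :: "torus_fun \<Rightarrow> torus_fun \<Rightarrow> endo" is "\<lambda>w v x. scaleC (ip w x) v"
  by (auto intro!: torus_fun_eqI simp: ip_add_right ip_scaleC_right algebra_simps)

text \<open>Since \<open>inverse\<close> on operators is a definite description, negative powers of
  \<open>k\<close> are evaluated by exhibiting a two-sided inverse.\<close>

lemma inverse_endo_eq:
  fixes S T :: endo
  assumes "S * T = 1" "T * S = 1"
  shows "inverse T = S"
  unfolding inverse_endo_def
proof (rule the_equality)
  fix R assume "R * T = 1 \<and> T * R = 1"
  then show "R = S" using assms by (metis mult.assoc mult_1_left mult_1_right)
qed (use assms in simp)

locale conformal = clifford +
  fixes \<theta> :: "real^4^4" and k K :: endo
  assumes k_alg: "k \<in> alg_op \<theta>" and K_alg: "K \<in> alg_op \<theta>"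
    and k_K: "k * K = 1" and K_k: "K * k = 1" and k_pos: "positive_op k"
begin

lemma k_sym: "ip x (app k y) = ip (app k x) y"
  by (rule positive_op_symmetric[OF k_pos])

lemma k_K_app: "app k (app K x) = x"
  using k_K by (metis one_endo.rep_eq times_endo.rep_eq)

lemma K_sym: "ip x (app K y) = ip (app K x) y"
  by (metis k_sym k_K_app)

text \<open>\<open>k\<close> maps this vector to the constant \<open>U 0\<close>, so its multiples
  in each component form the kernel of the rescaled operator. \<open>rho\<close> is the orthogonal
  projection onto it, written with rank one so that it is smoothing.\<close>

definition w0 :: torus_fun where "w0 = app K (U 0)"

definition rho :: endo where "rho = rank1 (scaleC (1 / ip w0 w0) w0) w0"

definition Q :: endo where "Q = 1 - rho"

lemma w0_nonzero: "ip w0 w0 \<noteq> 0"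
proof
  assume "ip w0 w0 = 0"
  then have "w0 = 0" by (simp add: ip_self l2sq_eq_0)
  then have "U 0 = 0" using k_K_app[of "U 0"] by (simp add: w0_def)
  then have "coeff (U 0) 0 = 0" by simp
  then show False by (simp add: U.rep_eq)
qed

lemma app_rho: "app rho x = scaleC (ip w0 x / ip w0 w0) w0"
  by (simp add: rho_def rank1.rep_eq ip_scaleC_left ip_cnj divide_inverse mult.commute)

lemma ip_w0_rho: "ip w0 (app rho x) = ip w0 x"
  using w0_nonzero by (simp add: app_rho ip_scaleC_right)

lemma ip_w0_Q: "ip w0 (app Q x) = 0"
proof -
  have "app Q x + app rho x = x" by (simp add: Q_def)
  then have "ip w0 (app Q x) + ip w0 (app rho x) = ip w0 x" by (metis ip_add_right)
  then show ?thesis by (simp add: ip_w0_rho)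
qed

lemma Q_w0: "app Q w0 = 0"
  using w0_nonzero by (simp add: Q_def app_rho)

lemma rho_rho: "rho * rho = rho"
  by (rule endo_eqI) (simp add: app_rho ip_scaleC_right w0_nonzero)

text \<open>By symmetry of \<open>K\<close>, \<open>pi0 * K\<close> takes the inner product with
  \<open>w0\<close>, and \<open>Q\<close> maps into the complement of \<open>w0\<close>.\<close>

lemma pi0_K_Q: "pi0 * K * Q = 0"
proof (intro endo_eqI)
  fix x
  have "coeff (app K (app Q x)) 0 = 0"
    using ip_w0_Q[of x] by (simp add: ip_U0[symmetric] K_sym w0_def)
  then show "app (pi0 * K * Q) x = app 0 x" by (simp add: pi0.rep_eq)
qed

lemma Q_K_pi0: "Q * (K * pi0) = 0"
  using Q_w0 by (intro endo_eqI) (simp add: pi0.rep_eq w0_def scaleC_zero)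

lemma Dop_k_rho: "Dop a * (k * rho) = 0"
  by (intro endo_eqI torus_fun_eqI) (auto simp: app_rho w0_def k_K_app U.rep_eq)

lemma rho_k_Dop: "rho * k * Dop a = 0"
proof (intro endo_eqI)
  fix x
  have "ip w0 (app k (app (Dop a) x)) = 0"
    by (simp add: k_sym w0_def k_K_app ip_U0)
  then show "app (rho * k * Dop a) x = app 0 x" by (simp add: app_rho)
qed

abbreviation "Dk \<equiv> conformal_dirac \<gamma> k"

text \<open>\<open>K ** Dinv ** K\<close> inverts the rescaled operator only up to terms containing
  \<open>pi0\<close>. Cutting down with \<open>Q\<close> on both sides makes both products equal to
  \<open>Q\<close> exactly.\<close>

definition G :: "endo^4^4"
  where "G = mat Q ** (mat K ** (Dinv ** (mat K ** mat Q)))"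

lemma mat_diff: "mat (S - T) = (mat S - mat T :: endo^4^4)"
  by (simp add: vec_eq_iff mat_def)

lemma Dk_rho: "Dk ** mat rho = 0"
proof -
  have "flat_dirac \<gamma> ** mat (k * rho) = 0"
    by (simp add: flat_dirac_eq mat_eq_tens matrix_sum_left tens_mult Dop_k_rho)
  then show ?thesis
    by (simp add: conformal_dirac_def matrix_mul_assoc[symmetric] mat_mult)
qed

lemma rho_Dk: "mat rho ** Dk = 0"
proof -
  have "mat (rho * k) ** flat_dirac \<gamma> = 0"
    by (simp add: flat_dirac_eq mat_eq_tens matrix_sum_right tens_mult rho_k_Dop)
  then show ?thesis
    by (simp add: conformal_dirac_def matrix_mul_assoc mat_mult)
qed

lemma Dk_Q: "Dk ** mat Q = Dk" and Q_Dk: "mat Q ** Dk = Dk"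
  by (simp_all add: Q_def mat_diff matrix_diff_right matrix_diff_left Dk_rho rho_Dk)

lemma Q_Q: "mat Q ** mat Q = (mat Q :: endo^4^4)"
proof -
  have "Q * Q = Q" by (simp add: Q_def left_diff_distrib right_diff_distrib rho_rho)
  then show ?thesis by (simp add: mat_mult)
qed

lemma Q_G: "mat Q ** G = G" and G_Q: "G ** mat Q = G"
  unfolding G_def using Q_Q by (simp_all add: matrix_mul_assoc) (simp add: matrix_mul_assoc[symmetric])

lemma Dk_G: "Dk ** G = mat Q"
proof -
  have "Dk ** G = (Dk ** mat Q) ** (mat K ** (Dinv ** (mat K ** mat Q)))"
    by (simp add: G_def matrix_mul_assoc)
  also have "\<dots> = mat k ** (flat_dirac \<gamma> ** (mat (k * K) ** (Dinv ** (mat K ** mat Q))))"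
    unfolding Dk_Q by (simp add: conformal_dirac_def matrix_mul_assoc[symmetric] mat_mult[symmetric])
  also have "\<dots> = mat k ** ((mat 1 - mat pi0) ** mat (K * Q))"
    by (simp add: k_K matrix_mul_assoc flat_Dinv mat_mult)
  also have "\<dots> = mat (k * (K * Q)) - mat (k * (pi0 * K * Q))"
    by (simp add: matrix_diff_left matrix_diff_right mat_mult mult.assoc)
  also have "\<dots> = mat Q"
    unfolding pi0_K_Q by (simp add: mult.assoc[symmetric] k_K mat_0)
  finally show ?thesis .
qed

lemma G_Dk: "G ** Dk = mat Q"
proof -
  have "G ** Dk = mat Q ** (mat K ** (Dinv ** (mat K ** (mat Q ** Dk))))"
    by (simp add: G_def matrix_mul_assoc[symmetric])
  also have "\<dots> = mat Q ** (mat K ** (Dinv ** (mat (K * k) ** (flat_dirac \<gamma> ** mat k))))"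
    unfolding Q_Dk by (simp add: conformal_dirac_def matrix_mul_assoc[symmetric] mat_mult[symmetric])
  also have "\<dots> = mat (Q * K) ** ((Dinv ** flat_dirac \<gamma>) ** mat k)"
    by (simp add: K_k matrix_mul_assoc[symmetric] mat_mult[symmetric])
  also have "\<dots> = mat (Q * (K * k)) - mat (Q * (K * pi0) * k)"
    by (simp add: Dinv_flat matrix_diff_left matrix_diff_right mat_mult mult.assoc)
  also have "\<dots> = mat Q"
    unfolding Q_K_pi0 by (simp add: K_k mat_0)
  finally show ?thesis .
qed

lemma Dk_G_left: "Dk ** (G ** X) = mat Q ** X" and G_Dk_left: "G ** (Dk ** X) = mat Q ** X"
  and Q_Dk_left: "mat Q ** (Dk ** X) = Dk ** X" and Q_G_left: "mat Q ** (G ** X) = G ** X"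
  by (simp_all add: matrix_mul_assoc Dk_G G_Dk Q_Dk Q_G)

lemmas DkG = Dk_G G_Dk Dk_Q Q_Dk Q_G G_Q Dk_G_left G_Dk_left Q_Dk_left Q_G_left Q_Q

text \<open>With \<open>P\<close> the fourth power of the rescaled operator and \<open>T\<close>
  that of \<open>G\<close>, both products are \<open>mat Q\<close>. Hence \<open>P\<close> and
  \<open>Q\<close> have the same kernel, whose orthogonal complement is the range of
  \<open>Q\<close>, and there \<open>T\<close> is the only inverse with values in the
  complement.\<close>

lemma abs_inv4_Dk: "abs_inv4 Dk = G ** (G ** (G ** G))"
proof -
  define P where "P = (Dk ** Dk) ** (Dk ** Dk)"
  define T where "T = G ** (G ** (G ** G))"
  have PT: "P ** T = mat Q" and TP: "T ** P = mat Q" and PQ: "P ** mat Q = P"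
    and QT: "mat Q ** T = T" and TQ: "T ** mat Q = T"
    unfolding P_def T_def by (simp_all add: matrix_mul_assoc[symmetric] DkG)
  have ker: "app4 P \<psi> = 0 \<longleftrightarrow> app4 (mat Q) \<psi> = 0" for \<psi>
    using app4_mult[of T P \<psi>] app4_mult[of P "mat Q" \<psi>] by (auto simp: TP PQ)
  have split: "app4 (mat rho) \<psi> + app4 (mat Q) \<psi> = \<psi>" for \<psi>
    by (simp add: app4_mat vec_eq_iff Q_def)
  have Qrho: "app4 (mat Q) (app4 (mat rho) \<psi>) = 0" for \<psi>
  proof -
    have "app rho (app rho x) = app rho x" for x using rho_rho by (metis times_endo.rep_eq)
    then show ?thesis by (simp add: app4_mat vec_eq_iff Q_def)
  qed
  have rhoQ: "ip (app rho x) (app Q y) = 0" for x y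
    by (simp add: app_rho ip_scaleC_left ip_w0_Q)
  have perp: "ker_perp P = {\<psi>. app4 (mat Q) \<psi> = \<psi>}"
  proof (intro set_eqI iffI)
    \<comment> \<open>Orthogonality to the kernel is tested on the kernel component of \<psi>
      itself, which yields the squared norm of that component.\<close>
    fix \<psi> assume "\<psi> \<in> ker_perp P"
    then have "ip4 (app4 (mat rho) \<psi>) \<psi> = 0"
      unfolding ker_perp_def by (simp add: ker Qrho)
    moreover have "ip (app rho x) x = of_real (l2sq (app rho x))" for x
    proof -
      have "x = app rho x + app Q x" by (simp add: Q_def)
      then have "ip (app rho x) x = ip (app rho x) (app rho x) + ip (app rho x) (app Q x)"
        by (metis ip_add_right)
      then show ?thesis by (simp add: rhoQ ip_self)
    qed
    ultimately have "of_real (\<Sum>i\<in>UNIV. l2sq (app rho (\<psi> $ i))) = (0 :: complex)"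
      by (simp add: ip4_def app4_mat)
    then have "(\<Sum>i\<in>UNIV. l2sq (app rho (\<psi> $ i))) = 0" by (simp only: of_real_eq_0_iff)
    then have "l2sq (app rho (\<psi> $ i)) = 0" for i
      by (subst (asm) sum_nonneg_eq_0_iff) auto
    then have "app4 (mat rho) \<psi> = 0" by (simp add: app4_mat vec_eq_iff l2sq_eq_0)
    then show "\<psi> \<in> {\<psi>. app4 (mat Q) \<psi> = \<psi>}" using split[of \<psi>] by simp
  next
    fix \<psi> assume "\<psi> \<in> {\<psi>. app4 (mat Q) \<psi> = \<psi>}"
    then have \<psi>: "app4 (mat Q) \<psi> = \<psi>" by simp
    have "ip4 \<phi> \<psi> = 0" if "app4 P \<phi> = 0" for \<phi>
    proof -
      have "app4 (mat rho) \<phi> = \<phi>" using split[of \<phi>] that ker by simp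
      then have "ip4 \<phi> \<psi> = ip4 (app4 (mat rho) \<phi>) (app4 (mat Q) \<psi>)" by (simp add: \<psi>)
      then show ?thesis by (simp add: ip4_def app4_mat rhoQ)
    qed
    then show "\<psi> \<in> ker_perp P" unfolding ker_perp_def by blast
  qed
  have "inverse_off_kernel P = T"
    unfolding inverse_off_kernel_def
  proof (rule the_equality)
    have "app4 T \<psi> = 0" if "app4 P \<psi> = 0" for \<psi>
      using app4_mult[of T "mat Q" \<psi>] that by (simp add: ker TQ)
    moreover have "app4 T \<psi> \<in> ker_perp P \<and> app4 P (app4 T \<psi>) = \<psi>" if "\<psi> \<in> ker_perp P" for \<psi>
      using that unfolding perp by (simp add: app4_mult[symmetric] QT PT)
    ultimately show "(\<forall>\<psi>. app4 P \<psi> = 0 \<longrightarrow> app4 T \<psi> = 0) \<and>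
        (\<forall>\<psi>\<in>ker_perp P. app4 T \<psi> \<in> ker_perp P \<and> app4 P (app4 T \<psi>) = \<psi>)" by blast
    fix S
    assume S: "(\<forall>\<psi>. app4 P \<psi> = 0 \<longrightarrow> app4 S \<psi> = 0) \<and>
        (\<forall>\<psi>\<in>ker_perp P. app4 S \<psi> \<in> ker_perp P \<and> app4 P (app4 S \<psi>) = \<psi>)"
    show "S = T"
    proof (rule app4_eqI)
      fix \<psi>
      let ?\<phi> = "app4 (mat Q) \<psi>"
      have \<phi>: "?\<phi> \<in> ker_perp P" unfolding perp by (simp add: app4_mult[symmetric] Q_Q)
      have "app4 P (app4 (mat rho) \<psi>) = 0" by (simp add: ker Qrho)
      then have "app4 S (app4 (mat rho) \<psi>) = 0" using S by blast
      then have "app4 S \<psi> = app4 S ?\<phi>"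
        using app4_add[of S "app4 (mat rho) \<psi>" ?\<phi>] by (simp add: split)
      also have "\<dots> = app4 (mat Q) (app4 S ?\<phi>)" using S \<phi> perp by auto
      also have "\<dots> = app4 T (app4 P (app4 S ?\<phi>))" by (simp add: app4_mult[symmetric] matrix_mul_assoc TP)
      also have "app4 P (app4 S ?\<phi>) = ?\<phi>" using S \<phi> by blast
      also have "app4 T ?\<phi> = app4 T \<psi>" by (simp add: app4_mult[symmetric] TQ)
      finally show "app4 S \<psi> = app4 T \<psi>" .
    qed
  qed
  then show ?thesis unfolding abs_inv4_def P_def T_def .
qed

text \<open>\<open>Q\<close> differs from 1 by the smoothing operator \<open>rho\<close>, which is
  invisible in the symbol.\<close>

lemma osymb_Q:
  assumes "osymb \<theta> d P s"
  shows "osymb \<theta> d (mat Q ** P) s"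
proof -
  have "ordR d (\<lambda>_. P)" using assms[unfolded osymb_def, THEN conjunct2, THEN spec, of 0] by simp
  then have "ordR e (\<lambda>_. mat rho ** P)" for e
    by (rule ordR_rank_one[rotated]) (simp add: rho_def rank1.rep_eq)
  then have "osymb \<theta> d (P - mat rho ** P) s" by (rule osymb_smoothing[OF assms])
  then show ?thesis by (simp add: Q_def mat_diff matrix_diff_left)
qed

lemma mat_alg_hat: "T \<in> alg_op \<theta> \<Longrightarrow> mat T $ i $ j \<in> alg_hat \<theta>"
  by (simp add: mat_nth alg_hat.right)

lemma osymb_G:
  assumes "osymb \<theta> d P s"
  shows "osymb \<theta> (d - 1) (G ** P) (\<lambda>n \<xi>. mat K ** dsym (\<lambda>n \<xi>. mat K ** s n \<xi>) n \<xi>)"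
proof -
  have "osymb \<theta> d (mat K ** (mat Q ** P)) (\<lambda>n \<xi>. mat K ** s n \<xi>)"
    by (rule osymb_left[OF mat_alg_hat[OF K_alg] osymb_Q[OF assms]])
  then have "osymb \<theta> (d - 1) (mat Q ** (mat K ** (Dinv ** (mat K ** (mat Q ** P)))))
      (\<lambda>n \<xi>. mat K ** dsym (\<lambda>n \<xi>. mat K ** s n \<xi>) n \<xi>)"
    by (rule osymb_Q[OF osymb_left[OF mat_alg_hat[OF K_alg] osymb_Dinv]])
  then show ?thesis by (simp add: G_def matrix_mul_assoc)
qed

end

section \<open>Moments of the unit sphere\<close>

text \<open>Boxes determine Lebesgue measure, and the preimage of a box is its image under the
  inverse orthogonal map, which has the same volume.\<close>

lemma distr_orthogonal_lborel:
  fixes f :: "real^4 \<Rightarrow> real^4"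
  assumes f: "orthogonal_transformation f"
  shows "distr lborel borel f = lborel"
proof (rule lborel_eqI[symmetric])
  have lin: "linear f" by (rule orthogonal_transformation_linear[OF f])
  have bij: "bij f" by (rule orthogonal_transformation_bij[OF f])
  have inv: "orthogonal_transformation (inv f)" by (rule orthogonal_transformation_inv[OF f])
  have meas: "f \<in> borel_measurable borel"
    by (intro borel_measurable_continuous_onI linear_continuous_on) (simp add: lin linear_conv_bounded_linear[symmetric])
  fix l u :: "real^4" assume lu: "\<And>b. b \<in> Basis \<Longrightarrow> l \<bullet> b \<le> u \<bullet> b"
  have vim: "f -` box l u = inv f ` box l u" using bij by (rule bij_vimage_eq_inv_image)
  have "emeasure (distr lborel borel f) (box l u) = emeasure lborel (f -` box l u)"
    using meas by (subst emeasure_distr) auto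
  also have "\<dots> = emeasure lebesgue (inv f ` box l u)"
    unfolding vim[symmetric] using measurable_sets[OF meas, of "box l u"] by simp
  also have "\<dots> = ennreal (measure lebesgue (inv f ` box l u))"
  proof (intro emeasure_eq_measure2)
    have "bounded (inv f ` box l u)"
      using orthogonal_transformation_linear[OF inv]
      by (intro bounded_linear_image) (auto simp: linear_conv_bounded_linear)
    then show "inv f ` box l u \<in> lmeasurable"
      using measurable_sets[OF meas, of "box l u"] by (intro bounded_set_imp_lmeasurable) (auto simp: vim)
  qed
  also have "measure lebesgue (inv f ` box l u) = measure lebesgue (box l u)"
    by (rule measure_orthogonal_image[OF inv]) simp
  also have "\<dots> = (\<Prod>b\<in>Basis. (u - l) \<bullet> b)"
    using lu by (simp add: measure_lborel_box)
  finally show "emeasure (distr lborel borel f) (box l u) = ennreal (\<Prod>b\<in>Basis. (u - l) \<bullet> b)" .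
qed simp

lemma normalize_measurable: "(\<lambda>x::real^4. x /\<^sub>R norm x) \<in> borel_measurable borel"
  by measurable

lemma ball_density_measurable [measurable]:
  "(\<lambda>x::real^4. 4 * indicator (ball 0 1 - {0}) x :: ennreal) \<in> borel_measurable borel"
  "(\<lambda>x::real^4. 4 * indicator (ball 0 1 - {0}) x :: real) \<in> borel_measurable borel"
proof -
  have A: "ball (0::real^4) 1 - {0} \<in> sets borel" by (intro sets.Diff) auto
  show "(\<lambda>x::real^4. 4 * indicator (ball 0 1 - {0}) x :: ennreal) \<in> borel_measurable borel"
    "(\<lambda>x::real^4. 4 * indicator (ball 0 1 - {0}) x :: real) \<in> borel_measurable borel"
    using A by measurable
qed

abbreviation "ball_density \<equiv> density lborel (\<lambda>x::real^4. 4 * indicator (ball 0 1 - {0}) x)"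

lemma sets_sphere_measure [simp, measurable_cong]: "sets sphere_measure = sets borel"
  and space_sphere_measure [simp]: "space sphere_measure = UNIV"
  by (simp_all add: sphere_measure_def)

lemma emeasure_sphere: "emeasure sphere_measure UNIV = ennreal (2 * pi\<^sup>2)"
proof -
  have "emeasure sphere_measure UNIV = emeasure ball_density UNIV"
    unfolding sphere_measure_def using normalize_measurable by (subst emeasure_distr) auto
  also have "\<dots> = (\<integral>\<^sup>+x. 4 * indicator (ball 0 1 - {0::real^4}) x \<partial>lborel)"
    by (subst emeasure_density) auto
  also have "\<dots> = 4 * emeasure lborel (ball (0::real^4) 1 - {0})"
    by (subst nn_integral_cmult_indicator) auto
  also have "emeasure lborel (ball (0::real^4) 1 - {0}) = emeasure lborel (ball (0::real^4) 1)"
    by (rule emeasure_Diff_null_set) (auto simp: null_sets_def)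
  also have "\<dots> = ennreal (unit_ball_vol 4)" by (simp add: emeasure_ball)
  also have "unit_ball_vol 4 = pi\<^sup>2 / 2" using unit_ball_vol_even[of 2] by (simp add: eval_nat_numeral)
  also have "4 * ennreal (pi\<^sup>2 / 2) = ennreal (4 * (pi\<^sup>2 / 2))" by (subst ennreal_mult) auto
  finally show ?thesis by simp
qed

lemma finite_sphere_measure: "finite_measure sphere_measure"
  by (rule finite_measureI) (simp add: emeasure_sphere)

lemma AE_sphere: "AE \<xi> in sphere_measure. norm \<xi> = 1"
  unfolding sphere_measure_def using normalize_measurable
  by (subst AE_distr_iff) (auto simp: AE_density split: split_indicator)

lemma integrable_sphere:
  fixes g :: "real^4 \<Rightarrow> 'b::{banach, second_countable_topology}"
  assumes "g \<in> borel_measurable borel" "\<And>\<xi>. norm \<xi> = 1 \<Longrightarrow> norm (g \<xi>) \<le> B"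
  shows "integrable sphere_measure g"
proof -
  interpret finite_measure sphere_measure by (rule finite_sphere_measure)
  show ?thesis
    using AE_sphere assms by (intro integrable_const_bound[of _ B]) (auto elim: AE_mp)
qed

text \<open>The punctured ball is invariant under orthogonal maps, and radial projection commutes
  with them, so invariance descends from Lebesgue measure.\<close>

lemma sphere_integral_orthogonal:
  fixes g :: "real^4 \<Rightarrow> real"
  assumes f: "orthogonal_transformation f" and g: "g \<in> borel_measurable borel"
  shows "(\<integral>\<xi>. g (f \<xi>) \<partial>sphere_measure) = (\<integral>\<xi>. g \<xi> \<partial>sphere_measure)"
proof -
  have fm: "f \<in> borel_measurable borel"
    using orthogonal_transformation_linear[OF f]
    by (intro borel_measurable_continuous_onI linear_continuous_on) (simp add: linear_conv_bounded_linear[symmetric])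
  have lin: "f (c *\<^sub>R x) = c *\<^sub>R f x" for c x
    using orthogonal_transformation_linear[OF f] by (rule linear_scale)
  have nf: "norm (f x) = norm x" for x using f by (rule orthogonal_transformation_norm)
  have f0: "f x = 0 \<longleftrightarrow> x = 0" for x using nf[of x] by (metis norm_eq_zero)
  have rep: "(\<integral>\<xi>. h \<xi> \<partial>sphere_measure) = (\<integral>x. (4 * indicator (ball 0 1 - {0}) x) *\<^sub>R h (x /\<^sub>R norm x) \<partial>lborel)"
    if h[measurable]: "h \<in> borel_measurable borel" for h :: "real^4 \<Rightarrow> real"
  proof -
    have d: "ball_density = density lborel (\<lambda>x. ennreal (4 * indicator (ball 0 1 - {0}) x))"
      by (intro density_cong) (auto split: split_indicator)
    show ?thesis
      unfolding sphere_measure_def d using normalize_measurable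
      by (subst integral_distr; (subst integral_density)?) (auto simp: AE_I2 split: split_indicator)
  qed
  let ?h = "\<lambda>x. (4 * indicator (ball 0 1 - {0}) x) *\<^sub>R g (x /\<^sub>R norm x)"
  have hm: "?h \<in> borel_measurable borel" using g normalize_measurable by measurable
  have "(\<integral>\<xi>. g (f \<xi>) \<partial>sphere_measure) = (\<integral>x. ?h (f x) \<partial>lborel)"
    using rep[OF measurable_compose[OF fm g]] by (simp add: lin nf f0 indicator_def)
  also have "\<dots> = (\<integral>x. ?h x \<partial>distr lborel borel f)"
    using fm hm by (subst integral_distr) auto
  also have "\<dots> = (\<integral>\<xi>. g \<xi> \<partial>sphere_measure)"
    unfolding distr_orthogonal_lborel[OF f] rep[OF g] ..
  finally show ?thesis .
qed

lemma sphere_power_invariant: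
  fixes v w :: "real^4"
  assumes "norm v = norm w"
  shows "(\<integral>\<xi>. (\<xi> \<bullet> v) ^ n \<partial>sphere_measure) = (\<integral>\<xi>. (\<xi> \<bullet> w) ^ n \<partial>sphere_measure)"
proof -
  obtain f where f: "orthogonal_transformation f" "f w = v"
    using orthogonal_transformation_exists assms by metis
  have "(\<integral>\<xi>. (\<xi> \<bullet> v) ^ n \<partial>sphere_measure) = (\<integral>\<xi>. (f \<xi> \<bullet> v) ^ n \<partial>sphere_measure)"
    by (rule sphere_integral_orthogonal[OF f(1), symmetric]) measurable
  also have "\<dots> = (\<integral>\<xi>. (\<xi> \<bullet> w) ^ n \<partial>sphere_measure)"
    using f by (simp add: orthogonal_transformation_def f(2)[symmetric])
  finally show ?thesis .
qed

text \<open>By rotation invariance only \<open>norm v\<close> matters, and homogeneity does the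
  rest. Polarization then determines the second and fourth moments up to one constant each.\<close>

lemma sphere_power:
  obtains c where "\<And>v :: real^4. (\<integral>\<xi>. (\<xi> \<bullet> v) ^ n \<partial>sphere_measure) = c * norm v ^ n"
proof
  fix v :: "real^4"
  let ?e = "axis 1 1 :: real^4"
  have "(\<integral>\<xi>. (\<xi> \<bullet> v) ^ n \<partial>sphere_measure) = (\<integral>\<xi>. (\<xi> \<bullet> (norm v *\<^sub>R ?e)) ^ n \<partial>sphere_measure)"
    by (rule sphere_power_invariant) simp
  also have "\<dots> = (\<integral>\<xi>. norm v ^ n * (\<xi> \<bullet> ?e) ^ n \<partial>sphere_measure)"
    by (simp add: power_mult_distrib)
  finally show "(\<integral>\<xi>. (\<xi> \<bullet> v) ^ n \<partial>sphere_measure) = (\<integral>\<xi>. (\<xi> \<bullet> ?e) ^ n \<partial>sphere_measure) * norm v ^ n"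
    by simp
qed

lemma integrable_sphere_inner_prod: "integrable sphere_measure (\<lambda>\<xi>. \<Prod>i\<in>I. \<xi> \<bullet> v i)" for v :: "'i \<Rightarrow> real^4"
proof (rule integrable_sphere)
  fix \<xi> :: "real^4" assume "norm \<xi> = 1"
  then have "\<bar>\<xi> \<bullet> v i\<bar> \<le> norm (v i)" for i using Cauchy_Schwarz_ineq2[of \<xi> "v i"] by simp
  then show "norm (\<Prod>i\<in>I. \<xi> \<bullet> v i) \<le> (\<Prod>i\<in>I. norm (v i))"
    by (simp add: abs_prod prod_mono)
qed measurable

lemma integrable_sphere_power: "integrable sphere_measure (\<lambda>\<xi>. (\<xi> \<bullet> v) ^ n)" for v :: "real^4"
  using integrable_sphere_inner_prod[of "\<lambda>_. v" "{..<n}"] by simp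

lemma integral_sphere_1: "(\<integral>\<xi>. 1 \<partial>sphere_measure) = (2 * pi\<^sup>2 :: real)"
  using emeasure_sphere by (simp add: measure_def)

lemma sphere_moment_2_inner:
  fixes v w :: "real^4"
  obtains c where "\<And>v w :: real^4. (\<integral>\<xi>. (\<xi> \<bullet> v) * (\<xi> \<bullet> w) \<partial>sphere_measure) = c * (v \<bullet> w)"
proof -
  obtain c where c: "\<And>v :: real^4. (\<integral>\<xi>. (\<xi> \<bullet> v) ^ 2 \<partial>sphere_measure) = c * norm v ^ 2"
    using sphere_power[of 2] by blast
  have "(\<integral>\<xi>. (\<xi> \<bullet> v) * (\<xi> \<bullet> w) \<partial>sphere_measure) = c * (v \<bullet> w)" for v w :: "real^4"
  proof -
    have "(\<integral>\<xi>. (\<xi> \<bullet> v) * (\<xi> \<bullet> w) \<partial>sphere_measure)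
      = (\<integral>\<xi>. 1/4 * ((\<xi> \<bullet> (v + w)) ^ 2 - (\<xi> \<bullet> (v - w)) ^ 2) \<partial>sphere_measure)"
      by (intro Bochner_Integration.integral_cong refl) (simp add: inner_simps power2_eq_square algebra_simps)
    also have "\<dots> = 1/4 * (c * norm (v + w) ^ 2 - c * norm (v - w) ^ 2)"
      by (simp add: integrable_sphere_power c)
    also have "\<dots> = c * (v \<bullet> w)"
      by (simp add: power2_norm_eq_inner inner_simps inner_commute algebra_simps)
    finally show ?thesis .
  qed
  then show thesis by (rule that)
qed

text \<open>One representative from each pair of opposite sign patterns in the polarization of a
  fourth power; \<open>192 = 4! * 2^3\<close>.\<close>

lemma polarization_4:
  fixes a b c d :: real
  shows "a * b * c * d = ((a+b+c+d)^4 - (a-b+c+d)^4 - (a+b-c+d)^4 - (a+b+c-d)^4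
    + (a-b-c+d)^4 + (a-b+c-d)^4 + (a+b-c-d)^4 - (a-b-c-d)^4) / 192"
  by (simp add: power4_eq_xxxx algebra_simps)

lemma sphere_moment_4_inner:
  obtains c where "\<And>s t u v :: real^4. (\<integral>\<xi>. (\<xi> \<bullet> s) * (\<xi> \<bullet> t) * (\<xi> \<bullet> u) * (\<xi> \<bullet> v) \<partial>sphere_measure)
    = c * ((s \<bullet> t) * (u \<bullet> v) + (s \<bullet> u) * (t \<bullet> v) + (s \<bullet> v) * (t \<bullet> u))"
proof -
  obtain c where c: "\<And>v :: real^4. (\<integral>\<xi>. (\<xi> \<bullet> v) ^ 4 \<partial>sphere_measure) = c * norm v ^ 4"
    using sphere_power[of 4] by blast
  have n4: "norm v ^ 4 = (v \<bullet> v) ^ 2" for v :: "real^4"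
    by (simp add: power2_norm_eq_inner[symmetric])
  have "(\<integral>\<xi>. (\<xi> \<bullet> s) * (\<xi> \<bullet> t) * (\<xi> \<bullet> u) * (\<xi> \<bullet> v) \<partial>sphere_measure)
    = (c / 3) * ((s \<bullet> t) * (u \<bullet> v) + (s \<bullet> u) * (t \<bullet> v) + (s \<bullet> v) * (t \<bullet> u))" for s t u v :: "real^4"
  proof -
    have "(\<integral>\<xi>. (\<xi> \<bullet> s) * (\<xi> \<bullet> t) * (\<xi> \<bullet> u) * (\<xi> \<bullet> v) \<partial>sphere_measure)
      = (\<integral>\<xi>. ((\<xi> \<bullet> (s+t+u+v))^4 - (\<xi> \<bullet> (s-t+u+v))^4 - (\<xi> \<bullet> (s+t-u+v))^4 - (\<xi> \<bullet> (s+t+u-v))^4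
       + (\<xi> \<bullet> (s-t-u+v))^4 + (\<xi> \<bullet> (s-t+u-v))^4 + (\<xi> \<bullet> (s+t-u-v))^4 - (\<xi> \<bullet> (s-t-u-v))^4) / 192 \<partial>sphere_measure)"
      by (intro Bochner_Integration.integral_cong refl) (simp only: inner_add_right inner_diff_right polarization_4[symmetric])
    also have "\<dots> = (c * norm (s+t+u+v) ^ 4 - c * norm (s-t+u+v) ^ 4 - c * norm (s+t-u+v) ^ 4 - c * norm (s+t+u-v) ^ 4
       + c * norm (s-t-u+v) ^ 4 + c * norm (s-t+u-v) ^ 4 + c * norm (s+t-u-v) ^ 4 - c * norm (s-t-u-v) ^ 4) / 192"
      by (simp add: integrable_sphere_power c)
    also have "\<dots> = (c / 3) * ((s \<bullet> t) * (u \<bullet> v) + (s \<bullet> u) * (t \<bullet> v) + (s \<bullet> v) * (t \<bullet> u))"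
      unfolding n4 inner_add_left inner_add_right inner_diff_left inner_diff_right
        inner_commute[of t s] inner_commute[of u s] inner_commute[of v s] inner_commute[of u t] inner_commute[of v t] inner_commute[of v u]
      by (simp add: power2_eq_square field_simps)
    finally show ?thesis .
  qed
  then show thesis by (rule that)
qed

lemma norm_1_sum: "norm (\<xi> :: real^4) = 1 \<Longrightarrow> (\<Sum>a\<in>UNIV. \<xi> $ a * \<xi> $ a) = 1"
  by (simp add: norm_eq_sqrt_inner inner_vec_def)

lemma axis_nth_of_bool: "axis a 1 $ b = (of_bool (a = b) :: real)"
  by (simp add: axis_def)

text \<open>Tracing over \<open>a = b\<close> gives the area of the sphere as \<open>4 * c\<close>,
  which fixes the constant.\<close>

lemma sphere_moment_2:
  "(\<integral>\<xi>. \<xi> $ a * \<xi> $ b \<partial>sphere_measure) = pi\<^sup>2 / 2 * of_bool (a = b)"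
proof -
  obtain c where c: "\<And>v w :: real^4. (\<integral>\<xi>. (\<xi> \<bullet> v) * (\<xi> \<bullet> w) \<partial>sphere_measure) = c * (v \<bullet> w)"
    using sphere_moment_2_inner by blast
  have m: "(\<integral>\<xi>. \<xi> $ a * \<xi> $ b \<partial>sphere_measure) = c * of_bool (a = b)" for a b
    using c[of "axis a 1" "axis b 1"] by (simp add: inner_axis axis_nth_of_bool)
  have int: "integrable sphere_measure (\<lambda>\<xi>. \<xi> $ a * \<xi> $ a)" for a
    using integrable_sphere_power[of "axis a 1" 2] by (simp add: inner_axis power2_eq_square)
  have "2 * pi\<^sup>2 = (\<integral>\<xi>. (\<Sum>a\<in>UNIV. \<xi> $ a * \<xi> $ a) \<partial>sphere_measure)"
    unfolding integral_sphere_1[symmetric]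
    using AE_sphere by (intro integral_cong_AE) (auto elim!: AE_mp simp: norm_1_sum)
  also have "\<dots> = 4 * c" by (subst Bochner_Integration.integral_sum) (auto simp: int m)
  finally have "c = pi\<^sup>2 / 2" by simp
  then show ?thesis by (simp add: m)
qed

text \<open>Summing over two pairs of equal indices gives the area of the sphere as
  \<open>16 + 2 * 4 = 24\<close> times the constant.\<close>

lemma sphere_moment_4:
  "(\<integral>\<xi>. \<xi> $ a * \<xi> $ b * \<xi> $ c * \<xi> $ d \<partial>sphere_measure)
     = pi\<^sup>2 / 12 * (of_bool (a = b) * of_bool (c = d) + of_bool (a = c) * of_bool (b = d) + of_bool (a = d) * of_bool (b = c))"
proof -
  obtain k where k: "\<And>s t u v :: real^4. (\<integral>\<xi>. (\<xi> \<bullet> s) * (\<xi> \<bullet> t) * (\<xi> \<bullet> u) * (\<xi> \<bullet> v) \<partial>sphere_measure)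
    = k * ((s \<bullet> t) * (u \<bullet> v) + (s \<bullet> u) * (t \<bullet> v) + (s \<bullet> v) * (t \<bullet> u))"
    using sphere_moment_4_inner by blast
  have m: "(\<integral>\<xi>. \<xi> $ a * \<xi> $ b * \<xi> $ c * \<xi> $ d \<partial>sphere_measure)
     = k * (of_bool (a = b) * of_bool (c = d) + of_bool (a = c) * of_bool (b = d) + of_bool (a = d) * of_bool (b = c))" for a b c d
    using k[of "axis a 1" "axis b 1" "axis c 1" "axis d 1"] by (simp add: inner_axis axis_nth_of_bool)
  have int: "integrable sphere_measure (\<lambda>\<xi>. \<xi> $ a * \<xi> $ a * \<xi> $ b * \<xi> $ b)" for a b
  proof (rule integrable_sphere[where B = 1])
    fix \<xi> :: "real^4" assume n: "norm \<xi> = 1"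
    have 1: "\<bar>\<xi> $ a\<bar> \<le> 1" for a using component_le_norm_cart[of \<xi> a] n by simp
    show "norm (\<xi> $ a * \<xi> $ a * \<xi> $ b * \<xi> $ b) \<le> 1"
      unfolding real_norm_def abs_mult by (intro mult_le_one mult_nonneg_nonneg 1 abs_ge_zero)
  qed measurable
  have "2 * pi\<^sup>2 = (\<integral>\<xi>. (\<Sum>a\<in>UNIV. \<Sum>b\<in>UNIV. \<xi> $ a * \<xi> $ a * \<xi> $ b * \<xi> $ b) \<partial>sphere_measure)"
    unfolding integral_sphere_1[symmetric]
  proof (intro integral_cong_AE)
    show "AE \<xi> in sphere_measure. 1 = (\<Sum>a\<in>UNIV. \<Sum>b\<in>UNIV. \<xi> $ a * \<xi> $ a * \<xi> $ b * \<xi> $ b)"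
      using AE_sphere
    proof (rule AE_mp, intro AE_I2 impI)
      fix \<xi> :: "real^4" assume "norm \<xi> = 1"
      then have "(\<Sum>a\<in>UNIV. \<xi> $ a * \<xi> $ a * (\<Sum>b\<in>UNIV. \<xi> $ b * \<xi> $ b)) = 1" by (simp add: norm_1_sum)
      then show "1 = (\<Sum>a\<in>UNIV. \<Sum>b\<in>UNIV. \<xi> $ a * \<xi> $ a * \<xi> $ b * \<xi> $ b)"
        by (simp add: sum_distrib_left mult.assoc)
    qed
  qed auto
  also have "\<dots> = (\<Sum>a\<in>UNIV. \<Sum>b\<in>UNIV. k * (1 + 2 * of_bool ((a::4) = b)))"
    by (simp add: Bochner_Integration.integral_sum int Bochner_Integration.integrable_sum m) (intro sum.cong refl, auto)
  also have "\<dots> = 24 * k"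
    by (simp add: sum.distrib sum_distrib_left[symmetric] of_bool_def sum.delta)
  finally have "k = pi\<^sup>2 / 12" by simp
  then show ?thesis by (simp add: m)
qed

section \<open>Uniqueness of the symbol and the residue\<close>

definition smul :: "nat \<Rightarrow> int^4 \<Rightarrow> int^4"
  where "smul t q = (\<chi> a. int t * q $ a)"

lemma smul_0 [simp]: "smul 0 q = 0" and smul_Suc: "smul (Suc t) q = smul t q + q"
  by (simp_all add: smul_def vec_eq_iff algebra_simps)

lemma lat_smul: "lat (smul t q) = real t *\<^sub>R lat q"
  by (simp add: smul_def lat_def vec_eq_iff)

lemma chi_smul: "chi \<theta> l (smul t q + s) = chi \<theta> l s * chi \<theta> l q ^ t"
  by (induction t) (simp_all add: smul_Suc chi_add add.commute[of _ q] add.assoc)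

text \<open>Along the progression \<open>smul t q + s\<close> each character contributes a pure
  power in \<open>t\<close>, so a coefficient tending to 0 already vanishes at
  \<open>t = 0\<close>.\<close>

lemma app_U_0_if_ray_tendsto_0:
  assumes T: "T \<in> alg_hat \<theta>"
    and lim: "\<And>p. (\<lambda>t. cmod (coeff (app T (U (smul t q + s))) (smul t q + s + p))) \<longlonglongrightarrow> 0"
  shows "app T (U s) = 0"
proof (rule torus_fun_eqI)
  fix r
  define p where "p = r - s"
  obtain xs where xs: "T = tensor_sum \<theta> xs" using alg_hat_tensor_sum[OF T] by blast
  define G where "G l = (\<Sum>(a, b)\<leftarrow>xs. coeff a l * coeff b (p - l) * twist \<theta> l (p - l))" for l
  have G: "(\<lambda>l. cmod (G l)) summable_on UNIV" unfolding G_def by (rule coeff_tensor_sum_U(1))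
  have cT: "coeff (app T (U m)) (m + p) = twist \<theta> m p * (\<Sum>\<^sub>\<infinity>l. G l * chi \<theta> l m)" for m
    unfolding xs G_def by (rule coeff_tensor_sum_U(2))
  have "(\<Sum>\<^sub>\<infinity>l. G l * chi \<theta> l s) = 0"
  proof (rule almost_periodic_tendsto_0[where z = "\<lambda>l. chi \<theta> l q"])
    show "(\<lambda>l. cmod (G l * chi \<theta> l s)) summable_on UNIV" using G by (simp add: norm_mult)
    have "(\<lambda>t. cmod (\<Sum>\<^sub>\<infinity>l. G l * chi \<theta> l s * chi \<theta> l q ^ t)) \<longlonglongrightarrow> 0"
      using lim[of p] by (simp add: cT norm_mult chi_smul mult.assoc)
    then show "(\<lambda>t. \<Sum>\<^sub>\<infinity>l. G l * chi \<theta> l s * chi \<theta> l q ^ t) \<longlonglongrightarrow> 0"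
      by (rule tendsto_norm_zero_cancel)
  qed simp
  then have "coeff (app T (U s)) (s + p) = 0" by (simp add: cT)
  then show "coeff (app T (U s)) r = coeff 0 r" by (simp add: p_def)
qed

lemma alg_hat_eq_0_iff: "T \<in> alg_hat \<theta> \<Longrightarrow> (\<And>m. app T (U m) = 0) \<Longrightarrow> T = 0"
  by (rule bdd_op_eqI) (auto intro: bdd_op_alg_hat bdd_op_scalar[of 0, simplified])

text \<open>A homogeneous family of operators whose values at lattice points are of lower order vanishes. Along
  the ray \<open>t q + s\<close> its matrix coefficients are almost periodic up to \<open>O(1/t)\<close>.\<close>

lemma homogeneous_lower_order_eq_0:
  fixes T :: "real^4 \<Rightarrow> endo" and l :: int
  assumes T: "\<And>\<xi>. \<xi> \<noteq> 0 \<Longrightarrow> T \<xi> \<in> alg_hat \<theta>"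
    and scale: "\<And>t \<xi>. t > 0 \<Longrightarrow> \<xi> \<noteq> 0 \<Longrightarrow> T (t *\<^sub>R \<xi>) = (t powi l) *\<^sub>R T \<xi>"
    and cont: "\<And>\<xi> e. \<xi> \<noteq> 0 \<Longrightarrow> e > 0 \<Longrightarrow> \<exists>d>0. \<forall>\<eta>. norm (\<eta> - \<xi>) < d \<longrightarrow>
        (\<forall>m q. cmod (coeff (app (T \<eta>) (U m)) q - coeff (app (T \<xi>) (U m)) q) \<le> e)"
    and bound: "\<And>m p. m \<noteq> 0 \<Longrightarrow> cmod (coeff (app (T (lat m)) (U m)) (m + p)) \<le> C * norm (lat m) powi (l - 1)"
    and \<xi>: "\<xi> \<noteq> 0"
  shows "T \<xi> = 0"
proof -
  \<comment> \<open>At a lattice point \<open>q\<close> the progressions \<open>t q + s\<close> all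
    have directions tending to \<open>q\<close>, and varying \<open>s\<close> covers every
    monomial.\<close>
  have lattice: "T (lat q) = 0" if q: "q \<noteq> 0" for q
  proof (rule alg_hat_eq_0_iff[OF T])
    show "lat q \<noteq> 0" using q by simp
    fix s
    show "app (T (lat q)) (U s) = 0"
    proof (rule app_U_0_if_ray_tendsto_0[OF T])
      show "lat q \<noteq> 0" using q by simp
      fix p
      \<comment> \<open>The direction of \<open>t q + s\<close>, rescaled to tend to
        \<open>lat q\<close>. By homogeneity, dividing the bound of degree \<open>l - 1\<close> by
        \<open>t powi l\<close> leaves a factor \<open>1 / t\<close>.\<close>
      define \<eta> where "\<eta> t = lat q + (1 / real t) *\<^sub>R lat s" for t
      let ?m = "\<lambda>t. smul t q + s"
      have \<eta>_lim: "\<eta> \<longlonglongrightarrow> lat q"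
      proof -
        have "(\<lambda>t. lat q + (1 / real t) *\<^sub>R lat s) \<longlonglongrightarrow> lat q + 0 *\<^sub>R lat s"
          by (intro tendsto_intros lim_1_over_n)
        then show ?thesis by (simp add: \<eta>_def[abs_def])
      qed
      have m\<eta>: "lat (?m t) = real t *\<^sub>R \<eta> t" if "t > 0" for t
        using that by (simp add: lat_add lat_smul \<eta>_def scaleR_add_right)
      have ev0: "\<forall>\<^sub>F t in sequentially. \<eta> t \<noteq> 0"
        using \<eta>_lim q by (intro tendsto_imp_eventually_ne[of _ "lat q"]) auto
      show "(\<lambda>t. cmod (coeff (app (T (lat q)) (U (?m t))) (?m t + p))) \<longlonglongrightarrow> 0"
      proof (rule LIMSEQ_I)
        fix e :: real assume e: "e > 0"
        obtain d where d: "d > 0" "\<And>\<eta> m r. norm (\<eta> - lat q) < d \<Longrightarrow>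
            cmod (coeff (app (T \<eta>) (U m)) r - coeff (app (T (lat q)) (U m)) r) \<le> e / 2"
          using cont[of "lat q" "e / 2"] q e by auto
        have ev1: "\<forall>\<^sub>F t in sequentially. norm (\<eta> t - lat q) < d"
          using tendstoD[OF \<eta>_lim d(1)] by (simp add: dist_norm)
        have "(\<lambda>t. C * norm (\<eta> t) powi (l - 1) * (1 / real t)) \<longlonglongrightarrow> C * norm (lat q) powi (l - 1) * 0"
          using q by (intro tendsto_intros \<eta>_lim lim_1_over_n) auto
        then have ev2: "\<forall>\<^sub>F t in sequentially. C * norm (\<eta> t) powi (l - 1) * (1 / real t) < e / 2"
          using e by (intro order_tendstoD) auto
        have "\<forall>\<^sub>F t in sequentially. cmod (coeff (app (T (lat q)) (U (?m t))) (?m t + p)) < e"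
          using ev0 ev1 ev2 eventually_gt_at_top[of 0]
        proof eventually_elim
          case (elim t)
          have t: "real t > 0" using elim by simp
          have m0: "?m t \<noteq> 0"
          proof
            assume "?m t = 0"
            then have "real t *\<^sub>R \<eta> t = 0" using m\<eta> elim by (metis lat_0)
            then show False using elim by simp
          qed
          let ?c = "coeff (app (T (\<eta> t)) (U (?m t))) (?m t + p)"
          have "coeff (app (T (lat (?m t))) (U (?m t))) (?m t + p) = of_real (real t powi l) * ?c"
            using m\<eta>[of t] scale[of "real t" "\<eta> t"] elim by simp
          then have "real t powi l * cmod ?c \<le> C * norm (lat (?m t)) powi (l - 1)"
            using bound[OF m0, of p] t by (simp add: norm_mult norm_power_int)
          also have "\<dots> = real t powi l * (C * norm (\<eta> t) powi (l - 1) * (1 / real t))"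
            using m\<eta>[of t] elim t by (simp add: power_int_mult_distrib power_int_diff mult_ac)
          finally have "cmod ?c \<le> C * norm (\<eta> t) powi (l - 1) * (1 / real t)"
            using t by (simp only: mult_le_cancel_left_pos zero_less_power_int)
          then have "cmod ?c < e / 2" using elim by linarith
          moreover have "cmod (?c - coeff (app (T (lat q)) (U (?m t))) (?m t + p)) \<le> e / 2"
            using d(2) elim by blast
          ultimately show ?case
            using norm_triangle_ineq4[of ?c "?c - coeff (app (T (lat q)) (U (?m t))) (?m t + p)"] by simp
        qed
        then show "\<exists>t0. \<forall>t\<ge>t0. norm (cmod (coeff (app (T (lat q)) (U (?m t))) (?m t + p)) - 0) < e"
          by (simp add: eventually_sequentially)
      qed
    qed
  qed
  \<comment> \<open>Rescaled lattice points approximate \<xi>; homogeneity and continuity carry the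
    vanishing over.\<close>
  define q :: "nat \<Rightarrow> int^4" where "q N = (\<chi> a. \<lfloor>real N * \<xi> $ a\<rfloor>)" for N
  have "(\<lambda>N. (1 / real N) *\<^sub>R lat (q N)) \<longlonglongrightarrow> \<xi>"
  proof (rule vec_tendstoI)
    fix a
    have "(\<lambda>N. of_int \<lfloor>real N * \<xi> $ a\<rfloor> / real N) \<longlonglongrightarrow> \<xi> $ a"
    proof (rule tendsto_sandwich)
      show "\<forall>\<^sub>F N in sequentially. \<xi> $ a - 1 / real N \<le> of_int \<lfloor>real N * \<xi> $ a\<rfloor> / real N"
        using eventually_gt_at_top[of 0]
      proof eventually_elim
        case (elim N)
        have "real N * \<xi> $ a - 1 \<le> of_int \<lfloor>real N * \<xi> $ a\<rfloor>" by linarith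
        then have "(real N * \<xi> $ a - 1) / real N \<le> of_int \<lfloor>real N * \<xi> $ a\<rfloor> / real N"
          by (rule divide_right_mono) simp
        then show ?case using elim by (simp add: diff_divide_distrib)
      qed
      show "\<forall>\<^sub>F N in sequentially. of_int \<lfloor>real N * \<xi> $ a\<rfloor> / real N \<le> \<xi> $ a"
        using eventually_gt_at_top[of 0]
      proof eventually_elim
        case (elim N)
        have "of_int \<lfloor>real N * \<xi> $ a\<rfloor> \<le> real N * \<xi> $ a" by linarith
        then have "of_int \<lfloor>real N * \<xi> $ a\<rfloor> / real N \<le> (real N * \<xi> $ a) / real N"
          by (rule divide_right_mono) simp
        then show ?case using elim by simp
      qed
      have "(\<lambda>N. \<xi> $ a - 1 / real N) \<longlonglongrightarrow> \<xi> $ a - 0" by (intro tendsto_intros lim_1_over_n)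
      then show "(\<lambda>N. \<xi> $ a - 1 / real N) \<longlonglongrightarrow> \<xi> $ a" by simp
    qed simp
    then show "(\<lambda>N. ((1 / real N) *\<^sub>R lat (q N)) $ a) \<longlonglongrightarrow> \<xi> $ a"
      by (simp add: q_def lat_def)
  qed
  note q_lim = this
  have "cmod (coeff (app (T \<xi>) (U m)) r) \<le> 0 + e" if e: "e > 0" for m r and e :: real
  proof -
    obtain d where d: "d > 0" "\<And>\<eta> m r. norm (\<eta> - \<xi>) < d \<Longrightarrow>
        cmod (coeff (app (T \<eta>) (U m)) r - coeff (app (T \<xi>) (U m)) r) \<le> e"
      using cont[OF \<xi> e] by auto
    have "\<forall>\<^sub>F N in sequentially. norm ((1 / real N) *\<^sub>R lat (q N) - \<xi>) < d"
      using tendstoD[OF q_lim d(1)] by (simp add: dist_norm)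
    moreover have "\<forall>\<^sub>F N in sequentially. (1 / real N) *\<^sub>R lat (q N) \<noteq> 0"
      using q_lim \<xi> by (intro tendsto_imp_eventually_ne[of _ \<xi>]) auto
    ultimately have "\<forall>\<^sub>F N in sequentially. norm ((1 / real N) *\<^sub>R lat (q N) - \<xi>) < d \<and>
        (1 / real N) *\<^sub>R lat (q N) \<noteq> 0 \<and> 0 < N"
      using eventually_gt_at_top[of 0] by eventually_elim auto
    then obtain N where N: "norm ((1 / real N) *\<^sub>R lat (q N) - \<xi>) < d" "lat (q N) \<noteq> 0" "0 < N"
      by (auto simp: eventually_sequentially)
    then have "T ((1 / real N) *\<^sub>R lat (q N)) = 0"
      using scale[of "1 / real N" "lat (q N)"] lattice[of "q N"] by simp
    then show ?thesis using d(2)[OF N(1), of m r] by simp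
  qed
  then have "cmod (coeff (app (T \<xi>) (U m)) r) \<le> 0" for m r by (rule field_le_epsilon)
  then have "app (T \<xi>) (U m) = 0" for m by (intro torus_fun_eqI) simp
  then show ?thesis by (rule alg_hat_eq_0_iff[OF T[OF \<xi>]])
qed

lemma homogeneous_symbolD:
  assumes "homogeneous_symbol \<theta> l \<sigma>" "\<xi> \<noteq> 0"
  shows "\<sigma> \<xi> $ i $ j \<in> alg_hat \<theta>"
    and "t > 0 \<Longrightarrow> \<sigma> (t *\<^sub>R \<xi>) $ i $ j = (t powi l) *\<^sub>R (\<sigma> \<xi> $ i $ j)"
    and "smooth_off_0 \<theta> (\<lambda>\<xi>. \<sigma> \<xi> $ i $ j)"
proof -
  show s: "smooth_off_0 \<theta> (\<lambda>\<xi>. \<sigma> \<xi> $ i $ j)" using assms unfolding homogeneous_symbol_def by blast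
  then show "\<sigma> \<xi> $ i $ j \<in> alg_hat \<theta>" using assms(2) unfolding smooth_off_0_def by metis
  show "\<sigma> (t *\<^sub>R \<xi>) $ i $ j = (t powi l) *\<^sub>R (\<sigma> \<xi> $ i $ j)" if "t > 0"
    using assms that unfolding homogeneous_symbol_def by simp
qed

lemma has_classical_symbolD:
  assumes "has_classical_symbol \<theta> d P \<sigma>"
  shows "homogeneous_symbol \<theta> l (\<sigma> l)" and "d < l \<Longrightarrow> \<sigma> l = (\<lambda>_. 0)"
proof -
  note h = assms[unfolded has_classical_symbol_def]
  show "homogeneous_symbol \<theta> l (\<sigma> l)" by (rule conjunct1[OF h, THEN spec])
  show "d < l \<Longrightarrow> \<sigma> l = (\<lambda>_. 0)" by (rule conjunct1[OF conjunct2[OF h], THEN spec, THEN mp])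
qed

text \<open>Summing up to an arbitrary \<open>D \<ge> d\<close> adds only vanishing terms, and
  allows expansions of different nominal orders to be subtracted from each other.\<close>

lemma classical_symbol_remainder:
  assumes \<sigma>: "has_classical_symbol \<theta> d P \<sigma>" and "d \<le> D"
  obtains C where "\<And>m p i j. m \<noteq> 0 \<Longrightarrow>
    cmod (coeff (app ((P - (\<Sum>k\<in>{l..D}. \<sigma> k (lat m))) $ i $ j) (U m)) (m + p)) \<le> C * norm (lat m) powi (l - 1)"
proof -
  define N where "N = nat (d - l + 1)"
  obtain C where C: "\<And>m p i j. m \<noteq> 0 \<Longrightarrow>
      (1 + norm (lat p)) ^ 0 * cmod (coeff (app (P $ i $ j - (\<Sum>l\<in>{d - int N<..d}. \<sigma> l (lat m) $ i $ j)) (U m)) (m + p))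
      \<le> C * norm (lat m) powi (d - int N)"
    using \<sigma> unfolding has_classical_symbol_def by meson
  have zero: "\<sigma> k = (\<lambda>_. 0)" if "k > d" for k using has_classical_symbolD(2)[OF \<sigma>] that .
  have "(\<Sum>k\<in>{l..D}. \<sigma> k \<xi>) = (\<Sum>k\<in>{d - int N<..d}. \<sigma> k \<xi>)" for \<xi>
    using \<open>d \<le> D\<close> by (intro sum.mono_neutral_right) (auto simp: N_def zero)
  then have S: "(P - (\<Sum>k\<in>{l..D}. \<sigma> k (lat m))) $ i $ j = P $ i $ j - (\<Sum>l\<in>{d - int N<..d}. \<sigma> l (lat m) $ i $ j)" for m i j
    by simp
  have "cmod (coeff (app ((P - (\<Sum>k\<in>{l..D}. \<sigma> k (lat m))) $ i $ j) (U m)) (m + p)) \<le> C * norm (lat m) powi (l - 1)"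
    if m: "m \<noteq> 0" for m p i j
  proof -
    have c: "cmod (coeff (app ((P - (\<Sum>k\<in>{l..D}. \<sigma> k (lat m))) $ i $ j) (U m)) (m + p)) \<le> C * norm (lat m) powi (d - int N)"
      using C[OF m, of p i j] by (simp only: S power_0 mult_1)
    then have "0 \<le> C * norm (lat m) powi (d - int N)" by (rule order_trans[OF norm_ge_zero])
    moreover have "0 < norm (lat m) powi (d - int N)" using m by (intro zero_less_power_int) simp
    ultimately have "0 \<le> C" by (simp add: zero_le_mult_iff)
    then have "C * norm (lat m) powi (d - int N) \<le> C * norm (lat m) powi (l - 1)"
      by (intro mult_left_mono powi_norm_lat_mono m) (auto simp: N_def)
    with c show ?thesis by linarith
  qed
  then show thesis by (rule that)
qed

text \<open>Descending induction on the degree: once all higher components agree, the difference of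
  the two remainders bounds the difference of the next components by one order less than their
  degree, which forces it to vanish.\<close>

lemma classical_symbol_unique:
  assumes \<sigma>: "has_classical_symbol \<theta> d P \<sigma>" and \<tau>: "has_classical_symbol \<theta> e P \<tau>"
  shows "\<xi> \<noteq> 0 \<Longrightarrow> \<sigma> l \<xi> = \<tau> l \<xi>"
proof -
  define D where "D = max d e"
  have h: "homogeneous_symbol \<theta> l (\<sigma> l)" "homogeneous_symbol \<theta> l (\<tau> l)" for l
    by (rule has_classical_symbolD[OF \<sigma>], rule has_classical_symbolD[OF \<tau>])
  have main: "\<forall>\<xi>. \<xi> \<noteq> 0 \<longrightarrow> \<sigma> (D - int n) \<xi> = \<tau> (D - int n) \<xi>" for n
  proof (induction n rule: less_induct)
    case (less n)
    define l where "l = D - int n"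
    have IH: "\<sigma> k \<xi> = \<tau> k \<xi>" if "l < k" "k \<le> D" "\<xi> \<noteq> 0" for k \<xi>
      using less.IH[of "nat (D - k)"] that by (simp add: l_def)
    obtain A where A: "\<And>m p i j. m \<noteq> 0 \<Longrightarrow>
      cmod (coeff (app ((P - (\<Sum>k\<in>{l..D}. \<sigma> k (lat m))) $ i $ j) (U m)) (m + p)) \<le> A * norm (lat m) powi (l - 1)"
      using classical_symbol_remainder[OF \<sigma>, of D l] by (auto simp: D_def)
    obtain B where B: "\<And>m p i j. m \<noteq> 0 \<Longrightarrow>
      cmod (coeff (app ((P - (\<Sum>k\<in>{l..D}. \<tau> k (lat m))) $ i $ j) (U m)) (m + p)) \<le> B * norm (lat m) powi (l - 1)"
      using classical_symbol_remainder[OF \<tau>, of D l] by (auto simp: D_def)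
    have "\<sigma> l \<xi> $ i $ j - \<tau> l \<xi> $ i $ j = 0" if \<xi>: "\<xi> \<noteq> 0" for \<xi> i j
    proof (rule homogeneous_lower_order_eq_0[where T = "\<lambda>\<xi>. \<sigma> l \<xi> $ i $ j - \<tau> l \<xi> $ i $ j" and l = l and C = "A + B" and \<theta> = \<theta>])
      show "\<sigma> l \<xi> $ i $ j - \<tau> l \<xi> $ i $ j \<in> alg_hat \<theta>" if "\<xi> \<noteq> 0" for \<xi>
        using that h by (intro alg_hat_diff homogeneous_symbolD)
      show "\<sigma> l (t *\<^sub>R \<xi>) $ i $ j - \<tau> l (t *\<^sub>R \<xi>) $ i $ j = t powi l *\<^sub>R (\<sigma> l \<xi> $ i $ j - \<tau> l \<xi> $ i $ j)"
        if "t > 0" "\<xi> \<noteq> 0" for t \<xi>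
        using homogeneous_symbolD(2)[OF h(1) that(2,1)] homogeneous_symbolD(2)[OF h(2) that(2,1)]
        by (simp add: scaleR_diff_right)
      show "\<exists>d>0. \<forall>\<eta>. norm (\<eta> - \<xi>) < d \<longrightarrow>
          (\<forall>m q. cmod (coeff (app (\<sigma> l \<eta> $ i $ j - \<tau> l \<eta> $ i $ j) (U m)) q
            - coeff (app (\<sigma> l \<xi> $ i $ j - \<tau> l \<xi> $ i $ j) (U m)) q) \<le> e)" if \<xi>: "\<xi> \<noteq> 0" and e: "e > 0" for \<xi> and e :: real
      proof -
        have e2: "e / 2 > 0" using e by simp
        have c: "\<exists>d>0. \<forall>\<eta>. norm (\<eta> - \<xi>) < d \<longrightarrow>
            (\<forall>m q. cmod (coeff (app (\<rho> \<eta> $ i $ j) (U m)) q - coeff (app (\<rho> \<xi> $ i $ j) (U m)) q) \<le> e / 2)"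
          if "homogeneous_symbol \<theta> l \<rho>" for \<rho>
          by (rule smooth_off_0_continuous[OF homogeneous_symbolD(3)[OF that \<xi>] \<xi> e2])
        obtain d1 where d1: "d1 > 0" "\<And>\<eta> m q. norm (\<eta> - \<xi>) < d1 \<Longrightarrow>
            cmod (coeff (app (\<sigma> l \<eta> $ i $ j) (U m)) q - coeff (app (\<sigma> l \<xi> $ i $ j) (U m)) q) \<le> e / 2"
          using c[OF h(1)[of l]] by auto
        obtain d2 where d2: "d2 > 0" "\<And>\<eta> m q. norm (\<eta> - \<xi>) < d2 \<Longrightarrow>
            cmod (coeff (app (\<tau> l \<eta> $ i $ j) (U m)) q - coeff (app (\<tau> l \<xi> $ i $ j) (U m)) q) \<le> e / 2"
          using c[OF h(2)[of l]] by auto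
        have "cmod (coeff (app (\<sigma> l \<eta> $ i $ j - \<tau> l \<eta> $ i $ j) (U m)) q
            - coeff (app (\<sigma> l \<xi> $ i $ j - \<tau> l \<xi> $ i $ j) (U m)) q) \<le> e"
          if "norm (\<eta> - \<xi>) < min d1 d2" for \<eta> m q
          using d1(2)[of \<eta> m q] d2(2)[of \<eta> m q] that
            norm_triangle_ineq4[of "coeff (app (\<sigma> l \<eta> $ i $ j) (U m)) q - coeff (app (\<sigma> l \<xi> $ i $ j) (U m)) q"
              "coeff (app (\<tau> l \<eta> $ i $ j) (U m)) q - coeff (app (\<tau> l \<xi> $ i $ j) (U m)) q"]
          by (simp add: algebra_simps)
        then show ?thesis using d1(1) d2(1) by (intro exI[of _ "min d1 d2"]) auto
      qed
      show "cmod (coeff (app (\<sigma> l (lat m) $ i $ j - \<tau> l (lat m) $ i $ j) (U m)) (m + p))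
          \<le> (A + B) * norm (lat m) powi (l - 1)" if m: "m \<noteq> 0" for m p
      proof -
        have lD: "{l..D} = insert l {l<..D}" by (auto simp: l_def)
        have "(\<Sum>k\<in>{l<..D}. \<sigma> k (lat m)) = (\<Sum>k\<in>{l<..D}. \<tau> k (lat m))"
          using m by (intro sum.cong refl IH) auto
        then have "\<sigma> l (lat m) - \<tau> l (lat m)
            = (P - (\<Sum>k\<in>{l..D}. \<tau> k (lat m))) - (P - (\<Sum>k\<in>{l..D}. \<sigma> k (lat m)))"
          unfolding lD by simp
        then have "\<sigma> l (lat m) $ i $ j - \<tau> l (lat m) $ i $ j
            = (P - (\<Sum>k\<in>{l..D}. \<tau> k (lat m))) $ i $ j - (P - (\<Sum>k\<in>{l..D}. \<sigma> k (lat m))) $ i $ j"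
          by (metis vector_minus_component)
        then have "cmod (coeff (app (\<sigma> l (lat m) $ i $ j - \<tau> l (lat m) $ i $ j) (U m)) (m + p))
            \<le> cmod (coeff (app ((P - (\<Sum>k\<in>{l..D}. \<tau> k (lat m))) $ i $ j) (U m)) (m + p))
              + cmod (coeff (app ((P - (\<Sum>k\<in>{l..D}. \<sigma> k (lat m))) $ i $ j) (U m)) (m + p))"
          by (simp only: minus_endo.rep_eq minus_torus_fun.rep_eq norm_triangle_ineq4)
        then show ?thesis using A[OF m, of i j p] B[OF m, of i j p] by (simp add: distrib_right)
      qed
    qed (rule \<xi>)
    then show ?case by (simp add: l_def vec_eq_iff)
  qed
  assume \<xi>: "\<xi> \<noteq> 0"
  show "\<sigma> l \<xi> = \<tau> l \<xi>"
  proof (cases "l \<le> D")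
    case True
    then show ?thesis using main[of "nat (D - l)"] \<xi> by simp
  next
    case False
    then show ?thesis using has_classical_symbolD(2)[OF \<sigma>, of l] has_classical_symbolD(2)[OF \<tau>, of l]
      by (simp add: D_def)
  qed
qed

lemma osymb_imp_classical:
  assumes "osymb \<theta> d P s"
  shows "has_classical_symbol \<theta> d P (\<lambda>l \<xi>. if l \<le> d then s (nat (d - l)) \<xi> else 0)"
    (is "has_classical_symbol _ _ _ ?\<sigma>")
proof -
  have ms: "msym \<theta> l (?\<sigma> l)" for l
  proof (cases "l \<le> d")
    case True
    have "msym \<theta> (d - int (nat (d - l))) (s (nat (d - l)))" using assms unfolding osymb_def by blast
    then show ?thesis using True by simp
  qed (simp add: msym_zero)
  have "homogeneous_symbol \<theta> l (?\<sigma> l)" for l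
    unfolding homogeneous_symbol_def
  proof (intro conjI allI impI)
    show "smooth_off_0 \<theta> (\<lambda>\<xi>. ?\<sigma> l \<xi> $ i $ j)" for i j
      using ms unfolding msym_def by (intro smooth_off_0_esym) blast
    fix t :: real and \<xi> :: "real^4" assume "t > 0" "\<xi> \<noteq> 0"
    then have "?\<sigma> l (t *\<^sub>R \<xi>) $ i $ j = t powi l *\<^sub>R (?\<sigma> l \<xi> $ i $ j)" for i j
      using ms unfolding msym_def by (intro esym_scale) blast
    then show "?\<sigma> l (t *\<^sub>R \<xi>) = t powi l *\<^sub>R ?\<sigma> l \<xi>" by (simp add: vec_eq_iff)
  qed
  moreover have "\<exists>C. \<forall>m. m \<noteq> 0 \<longrightarrow> (\<forall>p i j. (1 + norm (lat p)) ^ r *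
        cmod (coeff (app (P $ i $ j - (\<Sum>l\<in>{d - int N<..d}. ?\<sigma> l (lat m) $ i $ j)) (U m)) (m + p))
        \<le> C * norm (lat m) powi (d - int N))" for N r
  proof -
    have sum: "(\<Sum>l\<in>{d - int N<..d}. ?\<sigma> l \<xi>) = (\<Sum>n<N. s n \<xi>)" for \<xi>
      by (rule sum.reindex_bij_witness[of _ "\<lambda>n. d - int n" "\<lambda>l. nat (d - l)"]) auto
    have "ordR (d - int N) (\<lambda>m. P - (\<Sum>n<N. s n (lat m)))" using assms unfolding osymb_def by blast
    then obtain C where C: "0 \<le> C" "\<And>m i j. m \<noteq> 0 \<Longrightarrow>
        bnd r m (app ((P - (\<Sum>n<N. s n (lat m))) $ i $ j) (U m)) (C * norm (lat m) powi (d - int N))"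
      by (rule ordRE[where r = r]) (rule that; assumption)
    show ?thesis
    proof (intro exI[of _ C] allI impI)
      fix m p :: "int^4" and i j :: 4 assume m: "m \<noteq> 0"
      have "P $ i $ j - (\<Sum>l\<in>{d - int N<..d}. ?\<sigma> l (lat m) $ i $ j) = (P - (\<Sum>n<N. s n (lat m))) $ i $ j"
        unfolding sum[symmetric] by simp
      then show "(1 + norm (lat p)) ^ r *
        cmod (coeff (app (P $ i $ j - (\<Sum>l\<in>{d - int N<..d}. ?\<sigma> l (lat m) $ i $ j)) (U m)) (m + p))
        \<le> C * norm (lat m) powi (d - int N)"
        using C(2)[OF m, of i j] unfolding bnd_def by simp
    qed
  qed
  ultimately show ?thesis unfolding has_classical_symbol_def by auto
qed

text \<open>Symbols are determined only away from the origin, a point that the sphere avoids. In the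
  nonmeasurable case the integral has the default value 0, and then on both sides, since altering a
  function at one point does not affect measurability.\<close>

lemma sphere_integral_cong_off_0:
  assumes "\<And>\<xi>. \<xi> \<noteq> 0 \<Longrightarrow> f \<xi> = g \<xi>"
  shows "sphere_integral f = sphere_integral g"
proof -
  have meas: "h \<in> borel_measurable sphere_measure" if h: "h' \<in> borel_measurable sphere_measure"
    and eq: "\<And>\<xi>. \<xi> \<noteq> 0 \<Longrightarrow> h \<xi> = h' \<xi>" for h h' :: "real^4 \<Rightarrow> complex"
  proof -
    have "h = (\<lambda>\<xi>. if \<xi> = 0 then h 0 else h' \<xi>)" using eq by (auto simp: fun_eq_iff)
    moreover have "(\<lambda>\<xi>. if \<xi> = 0 then h 0 else h' \<xi>) \<in> borel_measurable sphere_measure"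
      using h by measurable
    ultimately show ?thesis by simp
  qed
  have "(\<integral>\<xi>. h \<xi> \<partial>sphere_measure) = (\<integral>\<xi>. h' \<xi> \<partial>sphere_measure)"
    if eq: "\<And>\<xi>. \<xi> \<noteq> 0 \<Longrightarrow> h \<xi> = h' \<xi>" for h h' :: "real^4 \<Rightarrow> complex"
  proof (cases "h \<in> borel_measurable sphere_measure")
    case True
    then have "h' \<in> borel_measurable sphere_measure" using meas[of h h'] eq by simp
    moreover have "AE \<xi> in sphere_measure. h \<xi> = h' \<xi>"
      using AE_sphere by eventually_elim (rule eq, auto)
    ultimately show ?thesis
      using True by (intro integral_cong_AE)
  next
    case False
    then have "h' \<notin> borel_measurable sphere_measure" using meas[of h' h] eq by auto
    then show ?thesis
      using False by (metis borel_measurable_integrable not_integrable_integral_eq)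
  qed
  then have "(\<integral>\<xi>. coeff (app (f \<xi>) x) m \<partial>sphere_measure) = (\<integral>\<xi>. coeff (app (g \<xi>) x) m \<partial>sphere_measure)" for x m
    by this (simp add: assms)
  then show ?thesis unfolding sphere_integral_def by simp
qed

text \<open>The condition \<open>- 4 \<le> d\<close> makes \<open>nat (d + 4)\<close> the number of
  the component of degree -4; uniqueness of symbols resolves the definite description.\<close>

lemma wres_eq:
  assumes P: "osymb \<theta> d P s" and "- 4 \<le> d"
  shows "wres \<theta> P = 1 / (8 * of_real (pi\<^sup>2)) * tau \<theta> (sphere_integral (\<lambda>\<xi>. trace (s (nat (d + 4)) \<xi>)))"
proof -
  let ?s = "\<lambda>l \<xi>. if l \<le> d then s (nat (d - l)) \<xi> else 0"
  note c = osymb_imp_classical[OF P]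
  have four: "4 * (2 * of_real pi ^ 2) = (8 * of_real (pi\<^sup>2) :: complex)" by simp
  show ?thesis
    unfolding wres_def four
  proof (rule the_equality)
    show "\<exists>e \<sigma>. has_classical_symbol \<theta> e P \<sigma> \<and>
      1 / (8 * of_real (pi\<^sup>2)) * tau \<theta> (sphere_integral (\<lambda>\<xi>. trace (s (nat (d + 4)) \<xi>)))
        = 1 / (8 * of_real (pi\<^sup>2)) * tau \<theta> (sphere_integral (\<lambda>\<xi>. trace (\<sigma> (-4) \<xi>)))"
      by (intro exI[of _ d] exI[of _ ?s] conjI c) (use assms(2) in simp)
    fix w
    assume "\<exists>d \<sigma>. has_classical_symbol \<theta> d P \<sigma> \<and>
      w = 1 / (8 * of_real (pi\<^sup>2)) * tau \<theta> (sphere_integral (\<lambda>\<xi>. trace (\<sigma> (-4) \<xi>)))"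
    then obtain e \<sigma> where \<sigma>: "has_classical_symbol \<theta> e P \<sigma>"
      and w: "w = 1 / (8 * of_real (pi\<^sup>2)) * tau \<theta> (sphere_integral (\<lambda>\<xi>. trace (\<sigma> (-4) \<xi>)))" by blast
    have "\<sigma> (-4) \<xi> = s (nat (d + 4)) \<xi>" if "\<xi> \<noteq> 0" for \<xi>
      using classical_symbol_unique[OF \<sigma> c that, of "-4"] assms(2) by simp
    then have "sphere_integral (\<lambda>\<xi>. trace (\<sigma> (-4) \<xi>)) = sphere_integral (\<lambda>\<xi>. trace (s (nat (d + 4)) \<xi>))"
      by (intro sphere_integral_cong_off_0) simp
    then show "w = 1 / (8 * of_real (pi\<^sup>2)) * tau \<theta> (sphere_integral (\<lambda>\<xi>. trace (s (nat (d + 4)) \<xi>)))"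
      unfolding w by simp
  qed
qed

section \<open>Traces of gamma matrices\<close>

lemma trace_mult_commute: "trace (A ** B) = trace (B ** A)" for A B :: "complex^4^4"
  unfolding trace_def matrix_mult_nth by (subst sum.swap) (simp add: mult.commute)

lemma trace_diff: "trace (A - B) = trace A - trace B" for A B :: "complex^4^4"
  by (simp add: trace_def sum_subtractf)

lemma trace_scaleR: "trace (r *\<^sub>R A) = of_real r * trace A" for A :: "complex^4^4"
  by (simp add: trace_def sum_distrib_left) (simp add: scaleR_conv_of_real)

lemma trace_mat: "trace (mat c :: complex^4^4) = 4 * c"
  by (simp add: trace_def mat_def)

lemma mat_complex_mult: "mat c ** A = (\<chi> i j. c * A $ i $ j)" for A :: "complex^4^4"
proof -
  have "(mat c ** A) $ i $ j = (\<Sum>k\<in>UNIV. if k = i then c * A $ k $ j else 0)" for i j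
    unfolding matrix_mult_nth by (intro sum.cong) (auto simp: mat_def)
  then show ?thesis by (simp add: vec_eq_iff sum.delta)
qed

lemma trace_mat_mult: "trace (mat c ** A) = c * trace A" for A :: "complex^4^4"
  by (simp add: mat_complex_mult trace_def sum_distrib_left)

lemma mat_of_bool_commute: "A ** mat c = mat c ** A" for A :: "complex^4^4"
proof -
  have "(A ** mat c) $ i $ j = (\<Sum>k\<in>UNIV. if k = j then A $ i $ k * c else 0)" for i j
    unfolding matrix_mult_nth by (intro sum.cong) (auto simp: mat_def)
  then show ?thesis by (simp add: vec_eq_iff mat_complex_mult sum.delta mult.commute)
qed

context clifford begin

lemma gamma_swap: "\<gamma> a ** \<gamma> b = mat (2 * of_bool (a = b)) - \<gamma> b ** \<gamma> a"
proof -
  have "mat (2 * of_bool (a = b)) = (mat (if a = b then 2 else 0) :: complex^4^4)" by simp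
  then show ?thesis using anticommute[of a b] by (metis add_diff_cancel_right')
qed

lemma gamma_swap_left: "\<gamma> a ** (\<gamma> b ** X) = mat (2 * of_bool (a = b)) ** X - \<gamma> b ** (\<gamma> a ** X)"
  by (metis matrix_mul_assoc gamma_swap matrix_diff_left)

lemma trace_gamma2: "trace (\<gamma> a ** \<gamma> b) = 4 * of_bool (a = b)"
proof -
  have "trace (\<gamma> a ** \<gamma> b) = 8 * of_bool (a = b) - trace (\<gamma> b ** \<gamma> a)"
    by (subst gamma_swap) (simp add: trace_diff trace_mat)
  then show ?thesis by (simp add: trace_mult_commute[of "\<gamma> b"])
qed

text \<open>Moving \<open>\<gamma> a\<close> through the other three matrices produces the three
  contractions and minus the cyclically rotated trace, which equals the original one.\<close>

lemma trace_gamma4: "trace (\<gamma> a ** (\<gamma> b ** (\<gamma> c ** \<gamma> d)))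
  = 4 * (of_bool (a = b) * of_bool (c = d) - of_bool (a = c) * of_bool (b = d) + of_bool (a = d) * of_bool (b = c))"
proof -
  let ?t = "trace (\<gamma> b ** (\<gamma> c ** (\<gamma> d ** \<gamma> a)))"
  have m: "\<gamma> x ** (mat z ** Y) = mat z ** (\<gamma> x ** Y)" for x z Y
    by (simp add: matrix_mul_assoc mat_of_bool_commute)
  have "trace (\<gamma> a ** (\<gamma> b ** (\<gamma> c ** \<gamma> d)))
      = 2 * of_bool (a = b) * trace (\<gamma> c ** \<gamma> d) - 2 * of_bool (a = c) * trace (\<gamma> b ** \<gamma> d)
        + 2 * of_bool (a = d) * trace (\<gamma> b ** \<gamma> c) - ?t"
    unfolding gamma_swap_left[of a b] gamma_swap_left[of a c] gamma_swap[of a d]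
    by (simp add: matrix_diff_right m trace_diff trace_mat_mult mat_of_bool_commute[of "\<gamma> c"])
  moreover have "?t = trace (\<gamma> a ** (\<gamma> b ** (\<gamma> c ** \<gamma> d)))"
    using trace_mult_commute[of "\<gamma> b ** (\<gamma> c ** \<gamma> d)" "\<gamma> a"] by (simp add: matrix_mul_assoc)
  moreover have "t = 4 * (p * q - u * v + x * y)" if "t = 2 * p * (4 * q) - 2 * u * (4 * v) + 2 * x * (4 * y) - t"
    for t p q u v x y :: complex
  proof -
    have "2 * t = 2 * (4 * (p * q - u * v + x * y))" using that by (simp add: algebra_simps)
    then show ?thesis by (metis mult_cancel_left zero_neq_numeral)
  qed
  ultimately show ?thesis unfolding trace_gamma2 by metis
qed

lemma trace_gamma_slash: "trace (\<gamma> a ** slash \<xi>) = 4 * of_real (\<xi> $ a)"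
  unfolding slash_def matrix_sum_right trace_sum scaleR_matrix_mult trace_scaleR trace_gamma2
  by (simp add: sum.delta' of_bool_def if_distrib cong: if_cong)

lemma sum_of_real_of_bool:
  "(\<Sum>c\<in>UNIV. of_real (\<xi> $ c) * of_bool (c = d)) = (of_real (\<xi> $ d) :: complex)"
  "(\<Sum>c\<in>UNIV. of_real (\<xi> $ c) * of_bool (d = c)) = (of_real (\<xi> $ d) :: complex)" for \<xi> :: "real^4"
proof -
  have "of_real (\<xi> $ c) * of_bool (c = d) = (if c = d then of_real (\<xi> $ c) else 0 :: complex)" for c by simp
  then show "(\<Sum>c\<in>UNIV. of_real (\<xi> $ c) * of_bool (c = d)) = (of_real (\<xi> $ d) :: complex)" by (simp add: sum.delta)
  then show "(\<Sum>c\<in>UNIV. of_real (\<xi> $ c) * of_bool (d = c)) = (of_real (\<xi> $ d) :: complex)" by (simp add: eq_commute[of d])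
qed

lemma trace_gamma3_slash: "trace (\<gamma> a ** (\<gamma> b ** (\<gamma> c ** slash \<xi>)))
  = 4 * (of_bool (a = b) * of_real (\<xi> $ c) - of_bool (a = c) * of_real (\<xi> $ b) + of_real (\<xi> $ a) * of_bool (b = c))"
proof -
  have "trace (\<gamma> a ** (\<gamma> b ** (\<gamma> c ** slash \<xi>)))
    = (\<Sum>d\<in>UNIV. 4 * (of_bool (a = b) * (of_real (\<xi> $ d) * of_bool (c = d)) - of_bool (a = c) * (of_real (\<xi> $ d) * of_bool (b = d))
        + (of_real (\<xi> $ d) * of_bool (a = d)) * of_bool (b = c)))"
    unfolding slash_def matrix_sum_right trace_sum scaleR_matrix_mult trace_scaleR trace_gamma4
    by (intro sum.cong refl) (simp add: algebra_simps)
  then show ?thesis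
    by (simp only: sum_distrib_left[symmetric] sum_distrib_right[symmetric] sum.distrib sum_subtractf sum_of_real_of_bool)
qed

lemma trace_gamma2_slash_gamma: "trace (\<gamma> a ** (\<gamma> b ** (slash \<xi> ** \<gamma> c)))
  = 4 * (of_bool (a = b) * of_real (\<xi> $ c) - of_real (\<xi> $ a) * of_bool (b = c) + of_bool (a = c) * of_real (\<xi> $ b))"
proof -
  have "trace (\<gamma> a ** (\<gamma> b ** (slash \<xi> ** \<gamma> c))) = trace (\<gamma> c ** (\<gamma> a ** (\<gamma> b ** slash \<xi>)))"
    using trace_mult_commute[of "\<gamma> a ** (\<gamma> b ** slash \<xi>)" "\<gamma> c"] by (simp add: matrix_mul_assoc)
  then show ?thesis unfolding trace_gamma3_slash by (simp add: eq_commute[of c] algebra_simps)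
qed

lemma trace_gamma_slash_gamma2: "trace (\<gamma> a ** (slash \<xi> ** (\<gamma> b ** \<gamma> c)))
  = 4 * (of_real (\<xi> $ a) * of_bool (b = c) - of_bool (a = b) * of_real (\<xi> $ c) + of_bool (a = c) * of_real (\<xi> $ b))"
proof -
  have "trace (\<gamma> a ** (slash \<xi> ** (\<gamma> b ** \<gamma> c))) = trace (\<gamma> b ** (\<gamma> c ** (\<gamma> a ** slash \<xi>)))"
    using trace_mult_commute[of "\<gamma> a ** slash \<xi>" "\<gamma> b ** \<gamma> c"] by (simp add: matrix_mul_assoc)
  then show ?thesis unfolding trace_gamma3_slash by (simp add: eq_commute[of _ a] algebra_simps)
qed

text \<open>Conjugation by a unit vector is minus the reflection in its orthogonal hyperplane. This
  shortens the gamma words and leaves only sphere moments of degree at most four.\<close>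

lemma slash_gamma_slash:
  assumes "norm \<xi> = 1"
  shows "slash \<xi> ** (\<gamma> c ** slash \<xi>) = (2 * \<xi> $ c) *\<^sub>R slash \<xi> - \<gamma> c"
proof -
  have "slash \<xi> ** \<gamma> c + \<gamma> c ** slash \<xi> = (\<Sum>a\<in>UNIV. (\<xi> $ a) *\<^sub>R (\<gamma> a ** \<gamma> c + \<gamma> c ** \<gamma> a))"
    unfolding slash_def matrix_sum_left matrix_sum_right scaleR_matrix_mult by (simp add: sum.distrib scaleR_add_right)
  also have "\<dots> = (\<Sum>a\<in>UNIV. if a = c then (2 * \<xi> $ a) *\<^sub>R mat 1 else 0)"
    by (intro sum.cong refl) (simp add: anticommute vec_eq_iff mat_def scaleR_conv_of_real)
  also have "\<dots> = (2 * \<xi> $ c) *\<^sub>R mat 1" by (simp add: sum.delta)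
  finally have "slash \<xi> ** \<gamma> c = (2 * \<xi> $ c) *\<^sub>R mat 1 - \<gamma> c ** slash \<xi>" by (simp add: eq_diff_eq)
  then have "(slash \<xi> ** \<gamma> c) ** slash \<xi> = (2 * \<xi> $ c) *\<^sub>R slash \<xi> - \<gamma> c ** (slash \<xi> ** slash \<xi>)"
    by (simp add: matrix_diff_left scaleR_matrix_mult matrix_mul_assoc)
  moreover have "\<xi> \<bullet> \<xi> = 1" using assms by (simp add: norm_eq_sqrt_inner)
  ultimately show ?thesis by (simp add: slash_slash matrix_mul_assoc)
qed

lemma nhat_unit: "norm \<xi> = 1 \<Longrightarrow> nhat \<xi> = slash \<xi>"
  by (simp add: nhat_def norm_eq_sqrt_inner)

lemma slash_slash_unit: "norm \<xi> = 1 \<Longrightarrow> slash \<xi> ** slash \<xi> = mat 1"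
  by (simp add: slash_slash norm_eq_sqrt_inner)

lemma slash_slash_left: "norm \<xi> = 1 \<Longrightarrow> slash \<xi> ** (slash \<xi> ** X) = X"
  by (simp add: matrix_mul_assoc slash_slash_unit)

end

section \<open>The residue as a functional on symbols\<close>

definition mmeas :: "(real^4 \<Rightarrow> complex^4^4) \<Rightarrow> bool"
  where "mmeas A \<longleftrightarrow> (\<forall>i j. (\<lambda>\<xi>. A \<xi> $ i $ j) \<in> borel_measurable borel)"

lemma mmeas_const: "mmeas (\<lambda>_. A)"
  by (simp add: mmeas_def)

lemma mmeas_mult: "mmeas A \<Longrightarrow> mmeas B \<Longrightarrow> mmeas (\<lambda>\<xi>. A \<xi> ** B \<xi>)"
  unfolding mmeas_def matrix_mult_nth by (auto intro!: borel_measurable_sum borel_measurable_times)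

lemma mmeas_scaleR: "f \<in> borel_measurable borel \<Longrightarrow> mmeas A \<Longrightarrow> mmeas (\<lambda>\<xi>. f \<xi> *\<^sub>R A \<xi>)"
  unfolding mmeas_def by (auto intro: borel_measurable_scaleR)

lemma mmeas_sum: "(\<And>i. i \<in> I \<Longrightarrow> mmeas (f i)) \<Longrightarrow> mmeas (\<lambda>\<xi>. \<Sum>i\<in>I. f i \<xi>)"
  unfolding mmeas_def by (auto intro!: borel_measurable_sum)

lemma mmeas_trace: "mmeas A \<Longrightarrow> (\<lambda>\<xi>. trace (A \<xi>)) \<in> borel_measurable borel"
  unfolding mmeas_def trace_def by (auto intro!: borel_measurable_sum)

lemma (in clifford) mmeas_nhat: "mmeas nhat"
  unfolding nhat_def[abs_def] slash_def by (intro mmeas_scaleR mmeas_sum mmeas_const) measurable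

text \<open>\<open>c\<close> is the mean over the sphere of the normalised trace
  \<open>1/4 tr\<close>: the factor \<open>8 pi^2\<close> is four times the area.\<close>

definition tr_avg :: "(real^4 \<Rightarrow> complex^4^4) \<Rightarrow> complex \<Rightarrow> bool"
  where "tr_avg A c \<longleftrightarrow> has_bochner_integral sphere_measure (\<lambda>\<xi>. trace (A \<xi>)) (8 * of_real (pi\<^sup>2) * c)"

lemma tr_avgI:
  assumes A: "mmeas A" and f: "f \<in> borel_measurable borel"
    and eq: "\<And>\<xi>. norm \<xi> = 1 \<Longrightarrow> trace (A \<xi>) = of_real (f \<xi>)"
    and int: "has_bochner_integral sphere_measure f (8 * pi\<^sup>2 * c)"
  shows "tr_avg A (of_real c)"
proof -
  have "has_bochner_integral sphere_measure (\<lambda>\<xi>. of_real (f \<xi>) :: complex) (of_real (8 * pi\<^sup>2 * c))"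
    using int by (rule has_bochner_integral_of_real)
  moreover have "AE \<xi> in sphere_measure. trace (A \<xi>) = of_real (f \<xi>)"
    using AE_sphere by eventually_elim (rule eq)
  ultimately have "has_bochner_integral sphere_measure (\<lambda>\<xi>. trace (A \<xi>)) (of_real (8 * pi\<^sup>2 * c))"
    using mmeas_trace[OF A] f by (subst has_bochner_integral_cong_AE) auto
  then show ?thesis by (simp add: tr_avg_def)
qed

text \<open>A relation rather than a value: it carries along the integrability of all matrix
  coefficients, which makes the residue additive. \<open>X\<close> is the integrated symbol.\<close>

definition has_res :: "real^4^4 \<Rightarrow> (real^4 \<Rightarrow> endo^4^4) \<Rightarrow> complex \<Rightarrow> bool"
  where "has_res \<theta> s z \<longleftrightarrow> (\<exists>X. X \<in> alg_hat \<theta> \<and> z = 1 / (8 * of_real (pi\<^sup>2)) * tau \<theta> X \<and>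
    (\<forall>x m. has_bochner_integral sphere_measure (\<lambda>\<xi>. coeff (app (trace (s \<xi>)) x) m) (coeff (app X x) m)))"

lemma has_res_sphere_integral:
  assumes "has_res \<theta> s z"
  shows "1 / (8 * of_real (pi\<^sup>2)) * tau \<theta> (sphere_integral (\<lambda>\<xi>. trace (s \<xi>))) = z"
proof -
  obtain X where X: "z = 1 / (8 * of_real (pi\<^sup>2)) * tau \<theta> X"
    "\<And>x m. has_bochner_integral sphere_measure (\<lambda>\<xi>. coeff (app (trace (s \<xi>)) x) m) (coeff (app X x) m)"
    using assms unfolding has_res_def by blast
  have "(\<lambda>m. \<integral>\<xi>. coeff (app (trace (s \<xi>)) x) m \<partial>sphere_measure) = coeff (app X x)" for x
    using has_bochner_integral_integral_eq[OF X(2)] by (simp add: fun_eq_iff)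
  then have "sphere_integral (\<lambda>\<xi>. trace (s \<xi>)) = X"
    unfolding sphere_integral_def by (simp add: coeff_inverse app_inverse)
  then show ?thesis using X(1) by simp
qed

context
  fixes \<theta> :: "real^4^4"
  assumes irr: "strictly_irrational \<theta>"
begin

lemma has_res_add:
  assumes "has_res \<theta> s y" "has_res \<theta> t z"
  shows "has_res \<theta> (\<lambda>\<xi>. s \<xi> + t \<xi>) (y + z)"
proof -
  obtain X where X: "X \<in> alg_hat \<theta>" "y = 1 / (8 * of_real (pi\<^sup>2)) * tau \<theta> X"
    "\<And>x m. has_bochner_integral sphere_measure (\<lambda>\<xi>. coeff (app (trace (s \<xi>)) x) m) (coeff (app X x) m)"
    using assms(1) unfolding has_res_def by blast
  obtain Y where Y: "Y \<in> alg_hat \<theta>" "z = 1 / (8 * of_real (pi\<^sup>2)) * tau \<theta> Y"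
    "\<And>x m. has_bochner_integral sphere_measure (\<lambda>\<xi>. coeff (app (trace (t \<xi>)) x) m) (coeff (app Y x) m)"
    using assms(2) unfolding has_res_def by blast
  have "has_bochner_integral sphere_measure (\<lambda>\<xi>. coeff (app (trace (s \<xi> + t \<xi>)) x) m) (coeff (app (X + Y) x) m)" for x m
    using has_bochner_integral_add[OF X(3) Y(3), of x m x m] by (simp add: trace_add_endo)
  moreover have "y + z = 1 / (8 * of_real (pi\<^sup>2)) * tau \<theta> (X + Y)"
    using X Y by (simp add: tau_add[OF irr] distrib_left)
  ultimately show ?thesis
    unfolding has_res_def using alg_hat.add[OF X(1) Y(1)] by blast
qed

lemma has_res_0: "has_res \<theta> (\<lambda>_. 0) 0"
  unfolding has_res_def by (rule exI[of _ 0]) (simp add: tau_0[OF irr] trace_def has_bochner_integral_zero)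

lemma has_res_sum:
  "(\<And>i. i \<in> I \<Longrightarrow> has_res \<theta> (s i) (z i)) \<Longrightarrow> has_res \<theta> (\<lambda>\<xi>. \<Sum>i\<in>I. s i \<xi>) (\<Sum>i\<in>I. z i)"
  by (induction I rule: infinite_finite_induct) (auto intro: has_res_0 has_res_add)

text \<open>The operator factor does not depend on \<xi> and leaves the integral; the trace then
  splits over the two commuting algebras.\<close>

lemma has_res_tens:
  assumes A: "tr_avg A c" and S: "S \<in> alg \<theta>" and T: "T \<in> alg_op \<theta>"
  shows "has_res \<theta> (\<lambda>\<xi>. tens (A \<xi>) (S * T)) (c * (phi S * phi T))"
  unfolding has_res_def
proof (intro exI[of _ "scalar (8 * of_real (pi\<^sup>2) * c) * (S * T)"] conjI allI)
  have ST: "S * T \<in> alg_hat \<theta>" using S T by (intro alg_hat.intros)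
  then show "scalar (8 * of_real (pi\<^sup>2) * c) * (S * T) \<in> alg_hat \<theta>" by (rule alg_hat.scale)
  show "c * (phi S * phi T) = 1 / (8 * of_real (pi\<^sup>2)) * tau \<theta> (scalar (8 * of_real (pi\<^sup>2) * c) * (S * T))"
    unfolding tau_scalar[OF irr ST] tau_tensor[OF irr S T] by simp
  fix x m
  have "has_bochner_integral sphere_measure (\<lambda>\<xi>. trace (A \<xi>) * coeff (app (S * T) x) m)
      (8 * of_real (pi\<^sup>2) * c * coeff (app (S * T) x) m)"
    using A unfolding tr_avg_def by (intro has_bochner_integral_mult_left)
  then show "has_bochner_integral sphere_measure (\<lambda>\<xi>. coeff (app (trace (tens (A \<xi>) (S * T))) x) m)
      (coeff (app (scalar (8 * of_real (pi\<^sup>2) * c) * (S * T)) x) m)"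
    by (simp add: trace_tens)
qed

end

lemma has_res_cong: "has_res \<theta> s y \<Longrightarrow> (\<And>\<xi>. s \<xi> = t \<xi>) \<Longrightarrow> y = z \<Longrightarrow> has_res \<theta> t z"
  by (simp add: has_res_def)

section \<open>Averages of gamma words over the sphere\<close>

lemma moment_0: "has_bochner_integral sphere_measure (\<lambda>_. 1) (2 * pi\<^sup>2 :: real)"
proof -
  have "integrable sphere_measure (\<lambda>_. 1 :: real)" by (rule integrable_sphere[where B = 1]) auto
  then show ?thesis using integral_sphere_1 by (simp add: has_bochner_integral_iff)
qed

lemma moment_2: "has_bochner_integral sphere_measure (\<lambda>\<xi>. \<xi> $ a * \<xi> $ b) (pi\<^sup>2 / 2 * of_bool (a = b))"
proof -
  have "integrable sphere_measure (\<lambda>\<xi>. \<xi> $ a * \<xi> $ b)"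
    using integrable_sphere_inner_prod[of "\<lambda>i. if i then axis a 1 else axis b 1" UNIV]
    by (simp add: UNIV_bool inner_axis mult.commute)
  then show ?thesis by (simp add: has_bochner_integral_iff sphere_moment_2)
qed

lemma moment_4: "has_bochner_integral sphere_measure (\<lambda>\<xi>. \<xi> $ a * \<xi> $ b * \<xi> $ c * \<xi> $ d)
  (pi\<^sup>2 / 12 * (of_bool (a = b) * of_bool (c = d) + of_bool (a = c) * of_bool (b = d) + of_bool (a = d) * of_bool (b = c)))"
proof -
  have 1: "\<bar>\<xi> $ a\<bar> \<le> 1" if "norm \<xi> = 1" for \<xi> :: "real^4" and a using component_le_norm_cart[of \<xi> a] that by simp
  have "integrable sphere_measure (\<lambda>\<xi>. \<xi> $ a * \<xi> $ b * \<xi> $ c * \<xi> $ d)"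
  proof (rule integrable_sphere[where B = 1])
    fix \<xi> :: "real^4" assume n: "norm \<xi> = 1"
    show "norm (\<xi> $ a * \<xi> $ b * \<xi> $ c * \<xi> $ d) \<le> 1"
      unfolding real_norm_def abs_mult by (intro mult_le_one mult_nonneg_nonneg 1 n abs_ge_zero)
  qed measurable
  then show ?thesis by (simp add: has_bochner_integral_iff sphere_moment_4)
qed

context clifford begin

abbreviation (input) "kr a b \<equiv> of_bool (a = b)"

lemmas mmeas_intros = mmeas_mult mmeas_const mmeas_nhat mmeas_scaleR
lemmas unit_simps = nhat_unit slash_slash_left slash_slash_unit slash_gamma_slash

lemma has_bochner_integral_eq_rhs: "has_bochner_integral M f x \<Longrightarrow> x = y \<Longrightarrow> has_bochner_integral M f y"
  by simp

lemmas hb_add = has_bochner_integral_add and hb_diff = has_bochner_integral_diff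
  and hb0 = has_bochner_integral_mult_right[OF moment_0]
  and hb2 = has_bochner_integral_mult_right[OF moment_2]
  and hb4 = has_bochner_integral_mult_right[OF moment_4]

text \<open>The positions of \<open>\<gamma> c\<close> are those of the derivative in the
  first-order symbol of \<open>k G^3\<close>. Odd numbers of \<open>nhat\<close> on both sides leave
  one on each, with mean \<open>2 * 1/4 - 1 = - 1/2\<close>; even numbers cancel.\<close>

lemma avg_gamma_n_gamma_n:
  "tr_avg (\<lambda>\<xi>. \<gamma> a ** (nhat \<xi> ** (nhat \<xi> ** (nhat \<xi> ** (\<gamma> c ** nhat \<xi>))))) (of_real (- (1/2) * kr a c))" (is ?A)
  "tr_avg (\<lambda>\<xi>. \<gamma> a ** (nhat \<xi> ** (nhat \<xi> ** (\<gamma> c ** (nhat \<xi> ** nhat \<xi>))))) (of_real (kr a c))" (is ?B)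
  "tr_avg (\<lambda>\<xi>. \<gamma> a ** (nhat \<xi> ** (\<gamma> c ** (nhat \<xi> ** (nhat \<xi> ** nhat \<xi>))))) (of_real (- (1/2) * kr a c))" (is ?C)
proof -
  have tr: "trace (\<gamma> a ** ((2 * \<xi> $ c) *\<^sub>R slash \<xi> - \<gamma> c)) = of_real (8 * (\<xi> $ a * \<xi> $ c) - 4 * kr a c * 1)" for \<xi>
    by (simp add: matrix_diff_right scaleR_matrix_mult trace_diff trace_scaleR trace_gamma_slash trace_gamma2)
  have i: "has_bochner_integral sphere_measure (\<lambda>\<xi>. 8 * (\<xi> $ a * \<xi> $ c) - 4 * kr a c * 1) (8 * pi\<^sup>2 * (- (1/2) * kr a c))"
    by (rule has_bochner_integral_eq_rhs[OF hb_diff[OF hb2 hb0]]) simp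
  show ?A
    by (rule tr_avgI[OF _ _ _ i], intro mmeas_intros, measurable) (simp only: unit_simps tr)
  show ?C
    by (rule tr_avgI[OF _ _ _ i], intro mmeas_intros, measurable) (simp only: unit_simps tr matrix_mul_rid)
  have i: "has_bochner_integral sphere_measure (\<lambda>\<xi>::real^4. 4 * kr a c * 1) (8 * pi\<^sup>2 * kr a c)"
    by (rule has_bochner_integral_eq_rhs[OF hb0]) simp
  show ?B
    by (rule tr_avgI[OF _ _ _ i], intro mmeas_intros, measurable)
      (simp add: nhat_unit slash_slash_left slash_slash_unit trace_gamma2)
qed

text \<open>The value of \<open>1/4 tr (\<gamma>\<^sub>a \<gamma>\<^sub>b \<gamma>\<^sub>c \<gamma>\<^sub>d)\<close>.\<close>

definition t4 :: "4 \<Rightarrow> 4 \<Rightarrow> 4 \<Rightarrow> 4 \<Rightarrow> real"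
  where "t4 a b c d = kr a b * kr c d - kr a c * kr b d + kr a d * kr b c"

lemma trace_3_n_gamma_n:
  assumes "norm \<xi> = 1"
  shows "trace (\<gamma> a ** (\<gamma> e ** (\<gamma> b ** ((2 * \<xi> $ c) *\<^sub>R slash \<xi> - \<gamma> c))))
    = of_real (8 * kr a e * (\<xi> $ c * \<xi> $ b) - 8 * kr a b * (\<xi> $ c * \<xi> $ e) + 8 * kr e b * (\<xi> $ c * \<xi> $ a) - 4 * t4 a e b c * 1)"
  by (simp add: matrix_diff_right scaleR_matrix_mult trace_diff trace_scaleR trace_gamma3_slash trace_gamma4 t4_def
      ring_distribs mult_ac)

lemma avg_gamma3_n_gamma_n:
  "tr_avg (\<lambda>\<xi>. \<gamma> a ** (\<gamma> e ** (\<gamma> b ** (nhat \<xi> ** (nhat \<xi> ** (nhat \<xi> ** (\<gamma> c ** nhat \<xi>))))))) (of_real (- (1/2) * t4 a e b c))" (is ?A)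
  "tr_avg (\<lambda>\<xi>. \<gamma> a ** (\<gamma> e ** (\<gamma> b ** (nhat \<xi> ** (nhat \<xi> ** (\<gamma> c ** (nhat \<xi> ** nhat \<xi>))))))) (of_real (t4 a e b c))" (is ?B)
  "tr_avg (\<lambda>\<xi>. \<gamma> a ** (\<gamma> e ** (\<gamma> b ** (nhat \<xi> ** (\<gamma> c ** (nhat \<xi> ** (nhat \<xi> ** nhat \<xi>))))))) (of_real (- (1/2) * t4 a e b c))" (is ?C)
proof -
  have i: "has_bochner_integral sphere_measure (\<lambda>\<xi>. 8 * kr a e * (\<xi> $ c * \<xi> $ b) - 8 * kr a b * (\<xi> $ c * \<xi> $ e)
      + 8 * kr e b * (\<xi> $ c * \<xi> $ a) - 4 * t4 a e b c * 1) (8 * pi\<^sup>2 * (- (1/2) * t4 a e b c))"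
    by (rule has_bochner_integral_eq_rhs[OF hb_diff[OF hb_add[OF hb_diff[OF hb2 hb2] hb2] hb0]])
      (simp add: t4_def eq_commute[of c] algebra_simps)
  show ?A
    by (rule tr_avgI[OF _ _ _ i], intro mmeas_intros, measurable) (simp only: unit_simps trace_3_n_gamma_n)
  show ?C
    by (rule tr_avgI[OF _ _ _ i], intro mmeas_intros, measurable) (simp only: unit_simps trace_3_n_gamma_n matrix_mul_rid)
  have i: "has_bochner_integral sphere_measure (\<lambda>\<xi>::real^4. 4 * t4 a e b c * 1) (8 * pi\<^sup>2 * t4 a e b c)"
    by (rule has_bochner_integral_eq_rhs[OF hb0]) simp
  show ?B
    by (rule tr_avgI[OF _ _ _ i], intro mmeas_intros, measurable)
      (simp add: nhat_unit slash_slash_left slash_slash_unit trace_gamma4 t4_def)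
qed

lemma n_gamma_n_gamma_n:
  assumes "norm \<xi> = 1"
  shows "slash \<xi> ** (\<gamma> d ** (slash \<xi> ** (\<gamma> c ** slash \<xi>)))
    = (4 * (\<xi> $ d * \<xi> $ c)) *\<^sub>R slash \<xi> - (2 * \<xi> $ d) *\<^sub>R \<gamma> c - \<gamma> d ** (\<gamma> c ** slash \<xi>)"
proof -
  have "slash \<xi> ** (\<gamma> d ** (slash \<xi> ** (\<gamma> c ** slash \<xi>))) = (slash \<xi> ** (\<gamma> d ** slash \<xi>)) ** (\<gamma> c ** slash \<xi>)"
    by (simp add: matrix_mul_assoc)
  also have "\<dots> = (2 * \<xi> $ d) *\<^sub>R (slash \<xi> ** (\<gamma> c ** slash \<xi>)) - \<gamma> d ** (\<gamma> c ** slash \<xi>)"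
    unfolding slash_gamma_slash[OF assms, of d] by (simp add: matrix_diff_left scaleR_matrix_mult matrix_mul_assoc)
  also have "(2 * \<xi> $ d) *\<^sub>R (slash \<xi> ** (\<gamma> c ** slash \<xi>)) = (4 * (\<xi> $ d * \<xi> $ c)) *\<^sub>R slash \<xi> - (2 * \<xi> $ d) *\<^sub>R \<gamma> c"
    unfolding slash_gamma_slash[OF assms] by (simp add: scaleR_diff_right mult_ac)
  finally show ?thesis .
qed

text \<open>Symmetric in all indices although the words are not: to each pairing the fourth moments
  contribute \<open>1/6\<close> and the second moments \<open>- 1/4\<close>.\<close>

definition z4 :: "4 \<Rightarrow> 4 \<Rightarrow> 4 \<Rightarrow> 4 \<Rightarrow> real"
  where "z4 a b c d = - (1/12) * (kr a b * kr c d + kr a c * kr b d + kr a d * kr b c)"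

lemma trace_n_gamma_n_gamma_n:
  assumes "norm \<xi> = 1"
  shows "trace ((\<xi> $ b) *\<^sub>R (\<gamma> a ** ((4 * (\<xi> $ d * \<xi> $ c)) *\<^sub>R slash \<xi> - (2 * \<xi> $ d) *\<^sub>R \<gamma> c - \<gamma> d ** (\<gamma> c ** slash \<xi>))))
    = of_real (16 * (\<xi> $ a * \<xi> $ b * \<xi> $ c * \<xi> $ d) - 8 * kr a c * (\<xi> $ b * \<xi> $ d)
      - 4 * kr a d * (\<xi> $ b * \<xi> $ c) + 4 * kr a c * (\<xi> $ b * \<xi> $ d) - 4 * kr c d * (\<xi> $ b * \<xi> $ a))"
  by (simp add: matrix_diff_right scaleR_matrix_mult trace_diff trace_scaleR trace_gamma3_slash trace_gamma_slash trace_gamma2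
      eq_commute[of d] ring_distribs mult_ac)

text \<open>In these words adjacent pairs of \<open>nhat\<close> cancel until three alternate with
  the two derivatives' gammas. In the words of \<open>avg_gamma3_n\<close> a single
  \<open>nhat\<close> is left, which gives \<open>1/4\<close> together with
  \<open>\<xi> $ b\<close>.\<close>

lemma avg_n_gamma_n_gamma_n:
  "tr_avg (\<lambda>\<xi>. (\<xi> $ b) *\<^sub>R (\<gamma> a ** (nhat \<xi> ** (nhat \<xi> ** (nhat \<xi> ** (\<gamma> d ** (nhat \<xi> ** (\<gamma> c ** nhat \<xi>)))))))) (of_real (z4 a b c d))" (is ?A)
  "tr_avg (\<lambda>\<xi>. (\<xi> $ b) *\<^sub>R (\<gamma> a ** (nhat \<xi> ** (\<gamma> d ** (nhat \<xi> ** (nhat \<xi> ** (nhat \<xi> ** (\<gamma> c ** nhat \<xi>)))))))) (of_real (z4 a b c d))" (is ?B)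
  "tr_avg (\<lambda>\<xi>. (\<xi> $ b) *\<^sub>R (\<gamma> a ** (nhat \<xi> ** (\<gamma> d ** (nhat \<xi> ** (\<gamma> c ** (nhat \<xi> ** (nhat \<xi> ** nhat \<xi>)))))))) (of_real (z4 a b c d))" (is ?C)
proof -
  have i: "has_bochner_integral sphere_measure (\<lambda>\<xi>. 16 * (\<xi> $ a * \<xi> $ b * \<xi> $ c * \<xi> $ d) - 8 * kr a c * (\<xi> $ b * \<xi> $ d)
      - 4 * kr a d * (\<xi> $ b * \<xi> $ c) + 4 * kr a c * (\<xi> $ b * \<xi> $ d) - 4 * kr c d * (\<xi> $ b * \<xi> $ a)) (8 * pi\<^sup>2 * z4 a b c d)"
    by (rule has_bochner_integral_eq_rhs[OF hb_diff[OF hb_add[OF hb_diff[OF hb_diff[OF hb4 hb2] hb2] hb2] hb2]])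
      (simp add: z4_def eq_commute[of b a] algebra_simps)
  show ?A
    by (rule tr_avgI[OF _ _ _ i], intro mmeas_intros, measurable)
      (simp only: nhat_unit slash_slash_left slash_slash_unit n_gamma_n_gamma_n trace_n_gamma_n_gamma_n)
  show ?B
    by (rule tr_avgI[OF _ _ _ i], intro mmeas_intros, measurable)
      (simp only: nhat_unit slash_slash_left slash_slash_unit n_gamma_n_gamma_n trace_n_gamma_n_gamma_n)
  show ?C
    by (rule tr_avgI[OF _ _ _ i], intro mmeas_intros, measurable)
      (simp only: nhat_unit slash_slash_left slash_slash_unit matrix_mul_rid n_gamma_n_gamma_n trace_n_gamma_n_gamma_n)
qed

lemma avg_gamma3_n:
  "tr_avg (\<lambda>\<xi>. (\<xi> $ b) *\<^sub>R (\<gamma> a ** (nhat \<xi> ** (nhat \<xi> ** (\<gamma> d ** (nhat \<xi> ** (nhat \<xi> ** (\<gamma> c ** nhat \<xi>)))))))) (of_real (1/4 * t4 a d c b))" (is ?A)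
  "tr_avg (\<lambda>\<xi>. (\<xi> $ b) *\<^sub>R (\<gamma> a ** (nhat \<xi> ** (nhat \<xi> ** (\<gamma> d ** (nhat \<xi> ** (\<gamma> c ** (nhat \<xi> ** nhat \<xi>)))))))) (of_real (1/4 * t4 a d b c))" (is ?B)
  "tr_avg (\<lambda>\<xi>. (\<xi> $ b) *\<^sub>R (\<gamma> a ** (nhat \<xi> ** (\<gamma> d ** (nhat \<xi> ** (nhat \<xi> ** (\<gamma> c ** (nhat \<xi> ** nhat \<xi>)))))))) (of_real (1/4 * t4 a b d c))" (is ?C)
proof -
  have i: "has_bochner_integral sphere_measure (\<lambda>\<xi>. 4 * kr a d * (\<xi> $ b * \<xi> $ c) - 4 * kr a c * (\<xi> $ b * \<xi> $ d) + 4 * kr d c * (\<xi> $ b * \<xi> $ a))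
      (8 * pi\<^sup>2 * (1/4 * t4 a d c b))"
    by (rule has_bochner_integral_eq_rhs[OF hb_add[OF hb_diff[OF hb2 hb2] hb2]]) (simp add: t4_def eq_commute[of b] algebra_simps)
  show ?A
    by (rule tr_avgI[OF _ _ _ i], intro mmeas_intros, measurable)
      (simp add: nhat_unit slash_slash_left trace_scaleR trace_gamma3_slash ring_distribs mult_ac)
  have i: "has_bochner_integral sphere_measure (\<lambda>\<xi>. 4 * kr a d * (\<xi> $ b * \<xi> $ c) - 4 * kr d c * (\<xi> $ b * \<xi> $ a) + 4 * kr a c * (\<xi> $ b * \<xi> $ d))
      (8 * pi\<^sup>2 * (1/4 * t4 a d b c))"
    by (rule has_bochner_integral_eq_rhs[OF hb_add[OF hb_diff[OF hb2 hb2] hb2]]) (simp add: t4_def eq_commute[of b] algebra_simps)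
  show ?B
    by (rule tr_avgI[OF _ _ _ i], intro mmeas_intros, measurable)
      (simp add: nhat_unit slash_slash_left slash_slash_unit trace_scaleR trace_gamma2_slash_gamma ring_distribs mult_ac)
  have i: "has_bochner_integral sphere_measure (\<lambda>\<xi>. 4 * kr d c * (\<xi> $ b * \<xi> $ a) - 4 * kr a d * (\<xi> $ b * \<xi> $ c) + 4 * kr a c * (\<xi> $ b * \<xi> $ d))
      (8 * pi\<^sup>2 * (1/4 * t4 a b d c))"
    by (rule has_bochner_integral_eq_rhs[OF hb_add[OF hb_diff[OF hb2 hb2] hb2]]) (simp add: t4_def eq_commute[of b] algebra_simps)
  show ?C
    by (rule tr_avgI[OF _ _ _ i], intro mmeas_intros, measurable)
      (simp add: nhat_unit slash_slash_left slash_slash_unit trace_scaleR trace_gamma_slash_gamma2 ring_distribs mult_ac)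
qed

lemma avg_nnnn: "tr_avg (\<lambda>\<xi>. \<gamma> a ** (\<gamma> b ** (nhat \<xi> ** (nhat \<xi> ** (nhat \<xi> ** nhat \<xi>))))) (of_real (kr a b))"
proof -
  have i: "has_bochner_integral sphere_measure (\<lambda>\<xi>::real^4. 4 * kr a b * 1) (8 * pi\<^sup>2 * kr a b)"
    by (rule has_bochner_integral_eq_rhs[OF hb0]) simp
  show ?thesis
    by (rule tr_avgI[OF _ _ _ i], intro mmeas_intros, measurable)
      (simp add: nhat_unit slash_slash_left slash_slash_unit trace_gamma2)
qed

end

section \<open>Traces of words in the conformal factor\<close>

context conformal begin

abbreviation "x c \<equiv> pm c k"

lemma pm_K: "pm c K = - (K * x c * K)"
proof -
  have "pm c (k * K) = 0" by (simp add: k_K)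
  then have "K * (x c * K + k * pm c K) = 0" by (simp add: pm_mult)
  then have "K * x c * K + (K * k) * pm c K = 0" by (simp only: distrib_left mult.assoc)
  then show ?thesis by (simp add: K_k eq_neg_iff_add_eq_0 add.commute)
qed

lemma cancel_right: "y * k * K = y" "y * K * k = y"
  by (simp_all add: mult.assoc k_K K_k)

lemmas alg_op_intros = alg_op_mult alg_op_pm alg_op_minus alg_op_add alg_op_diff k_alg K_alg

lemma phi_by_parts: "S \<in> alg_op \<theta> \<Longrightarrow> Y \<in> alg_op \<theta> \<Longrightarrow> phi (S * pm d Y) = - phi (pm d S * Y)"
  using phi_pm[OF alg_op_mult, of S \<theta> Y d] by (simp add: pm_mult phi_simps eq_neg_iff_add_eq_0 add.commute)

text \<open>Rewriting towards a normal form: a word with two derivatives is rotated until it starts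
  with powers of \<open>K\<close> and ends with a derivative. \<open>phi_flip\<close> treats the
  words that start with powers of \<open>k\<close> or with a derivative.\<close>

lemma phi_rotate:
  assumes "y \<in> alg_op \<theta>"
  shows "phi (y * x c * K) = phi (K * y * x c)"
    and "phi (y * x c * K * K) = phi (K * K * y * x c)"
    and "phi (y * x c * K * K * K) = phi (K * K * K * y * x c)"
    and "phi (y * x c * K * K * K * K) = phi (K * K * K * K * y * x c)"
    and "phi (y * x c * K * K * K * K * K) = phi (K * K * K * K * K * y * x c)"
  using phi_cyclic[of "y * x c" \<theta> K] phi_cyclic[of "y * x c" \<theta> "K * K"] phi_cyclic[of "y * x c" \<theta> "K * K * K"]
    phi_cyclic[of "y * x c" \<theta> "K * K * K * K"] phi_cyclic[of "y * x c" \<theta> "K * K * K * K * K"] assms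
  by (simp_all add: alg_op_intros mult.assoc)

lemma phi_flip:
  "phi (x d * K * K * x c) = phi (K * K * x c * x d)"
  "phi (k * x d * K * K * K * x c) = phi (K * K * K * x c * k * x d)"
  "phi (k * k * x d * K * K * K * K * x c) = phi (K * K * K * K * x c * k * k * x d)"
  "phi (k * k * k * x d * K * K * K * K * K * x c) = phi (K * K * K * K * K * x c * k * k * k * x d)"
  using phi_cyclic[of "x d" \<theta> "K * K * x c"] phi_cyclic[of "k * x d" \<theta> "K * K * K * x c"]
    phi_cyclic[of "k * k * x d" \<theta> "K * K * K * K * x c"] phi_cyclic[of "k * k * k * x d" \<theta> "K * K * K * K * K * x c"]
  by (simp_all add: alg_op_intros mult.assoc)

text \<open>The normal forms are \<open>K^p (x d) k^q (x c)\<close> with \<open>q = p - 2\<close>,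
  homogeneous of degree 0 in \<open>k\<close>; the first digit is \<open>p\<close>, and
  \<open>w11\<close> has \<open>q = -1\<close>.\<close>

definition w11 where "w11 d c = phi (K * x d * K * x c)"
definition w20 where "w20 d c = phi (K * K * x d * x c)"
definition w31 where "w31 d c = phi (K * K * K * x d * k * x c)"
definition w42 where "w42 d c = phi (K * K * K * K * x d * k * k * x c)"
definition w53 where "w53 d c = phi (K * K * K * K * K * x d * k * k * k * x c)"

lemma w11_sym: "w11 d c = w11 c d"
  unfolding w11_def using phi_cyclic[of "K * x d" \<theta> "K * x c"] by (simp add: alg_op_intros mult.assoc)

abbreviation "k3 \<equiv> k * k * k"
abbreviation "k5 \<equiv> k * k * k * k * k"

lemmas word_simps = mult.assoc[symmetric] distrib_left distrib_right left_diff_distrib right_diff_distrib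
  mult_minus_left mult_minus_right minus_add_distrib minus_minus pm_mult pm_K phi_simps k_K K_k cancel_right phi_rotate phi_flip
  alg_op_intros mult_1_left mult_1_right
  w11_def[symmetric] w20_def[symmetric] w31_def[symmetric] w42_def[symmetric] w53_def[symmetric]

text \<open>\<open>W1\<close> to \<open>W6\<close> are the operator factors in the second-order
  symbol of \<open>k G^3\<close>, \<open>Y1\<close> to \<open>Y3\<close> those in the first-order
  one.\<close>

abbreviation "W1 d c \<equiv> K * (K * (K * (K * pm d (pm c K))))"
abbreviation "W2 d c \<equiv> K * (K * pm d (K * (K * pm c K)))"
abbreviation "W3 d c \<equiv> K * (K * pm d (pm c (K * (K * K))))"
abbreviation "W4 d c \<equiv> pm d (K * (K * (K * (K * pm c K))))"
abbreviation "W5 d c \<equiv> pm d (K * (K * pm c (K * (K * K))))"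
abbreviation "W6 d c \<equiv> pm d (pm c (K * (K * (K * (K * K)))))"
abbreviation "Y1 c \<equiv> K * (K * (K * (K * pm c K)))"
abbreviation "Y2 c \<equiv> K * (K * pm c (K * (K * K)))"
abbreviation "Y3 c \<equiv> pm c (K * (K * (K * (K * K))))"

lemma W_alg_op: "W1 d c \<in> alg_op \<theta>" "W2 d c \<in> alg_op \<theta>" "W3 d c \<in> alg_op \<theta>"
  "W4 d c \<in> alg_op \<theta>" "W5 d c \<in> alg_op \<theta>" "W6 d c \<in> alg_op \<theta>"
  "Y1 c \<in> alg_op \<theta>" "Y2 c \<in> alg_op \<theta>" "Y3 c \<in> alg_op \<theta>"
  by (simp_all only: alg_op_intros)

text \<open>After cancellation of leading factors against \<open>k5\<close>, one integration by
  parts replaces the second derivative by products of two first ones. The other five words are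
  treated alike.\<close>

lemma word_1: "phi (k5 * W1 d c) = w11 d c"
proof -
  have "k5 * W1 d c = k * pm d (pm c K)"
    by (simp only: mult.assoc[symmetric] cancel_right)
  then show ?thesis
    using phi_by_parts[of k "pm c K" d] by (simp add: alg_op_intros word_simps)
qed

lemma word_2: "phi (k5 * W2 d c) = w11 d c + w20 c d + w31 c d"
proof -
  have "k5 * W2 d c = k3 * pm d (K * (K * pm c K))"
    by (simp only: mult.assoc[symmetric] cancel_right)
  then show ?thesis
    using phi_by_parts[of k3 "K * (K * pm c K)" d] by (simp add: alg_op_intros word_simps)
qed

lemma word_3: "phi (k5 * W3 d c) = w31 d c + 2 * w20 d c + 3 * w11 d c + 2 * w20 c d + w31 c d"
proof -
  have "k5 * W3 d c = k3 * pm d (pm c (K * (K * K)))"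
    by (simp only: mult.assoc[symmetric] cancel_right)
  then show ?thesis
    using phi_by_parts[of k3 "pm c (K * (K * K))" d] by (simp add: alg_op_intros word_simps)
qed

lemma word_4: "phi (k5 * W4 d c) = w11 d c + w20 c d + w31 c d + w42 c d + w53 c d"
  using phi_by_parts[of k5 "Y1 c" d] by (simp add: alg_op_intros word_simps)

lemma word_5: "phi (k5 * W5 d c)
    = w31 d c + 2 * w20 d c + 3 * w11 d c + 3 * w20 c d + 3 * w31 c d + 2 * w42 c d + w53 c d"
  using phi_by_parts[of k5 "Y2 c" d] by (simp add: alg_op_intros word_simps)

text \<open>Five factors \<open>k\<close> are differentiated against five factors \<open>K\<close>;
  the 25 words are sorted by the net power of \<open>k\<close> between the derivatives, from 3 down
  to -5.\<close>

lemma word_6: "phi (k5 * W6 d c) = w53 d c + 2 * w42 d c + 3 * w31 d c + 4 * w20 d c + 5 * w11 d c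
    + 4 * w20 c d + 3 * w31 c d + 2 * w42 c d + w53 c d"
  using phi_by_parts[of k5 "Y3 c" d] by (simp add: alg_op_intros word_simps)

lemma words_Y:
  "phi (k3 * pm e (k * k) * Y1 c) = - (w42 c e + w53 c e)"
  "phi (k3 * pm e (k * k) * Y2 c) = - (w20 c e + 2 * w31 c e + 2 * w42 c e + w53 c e)"
  "phi (k3 * pm e (k * k) * Y3 c) = - (w20 e c + 2 * w11 e c + 2 * w20 c e + 2 * w31 c e + 2 * w42 c e + w53 c e)"
  by (simp_all add: alg_op_intros word_simps)

text \<open>With a single derivative every word is conjugate to \<open>K * x c\<close>, so only the
  number of differentiated factors survives.\<close>

lemma words_k5_Y:
  "phi (k5 * Y1 c) = - phi (K * x c)"
  "phi (k5 * Y2 c) = - 3 * phi (K * x c)"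
  "phi (k5 * Y3 c) = - 5 * phi (K * x c)"
proof -
  have "phi (k ^ n * x c * K ^ Suc n) = phi (K * x c)" for n
  proof (induction n)
    case 0
    show ?case using phi_cyclic[of "x c" \<theta> K] by (simp add: alg_op_intros)
  next
    case (Suc n)
    have "phi (k ^ Suc n * x c * K ^ Suc (Suc n)) = phi (k * (k ^ n * x c * K ^ Suc n * K))"
      by (simp add: mult.assoc power_commutes[symmetric] del: power_Suc) (simp add: mult.assoc power_commutes)
    also have "\<dots> = phi (k ^ n * x c * K ^ Suc n)"
      using phi_cyclic[of k \<theta> "k ^ n * x c * K ^ Suc n * K"]
      by (simp add: alg_op_intros alg_op_power mult.assoc K_k)
    finally show ?case using Suc by simp
  qed
  note this[of 0] this[of 1] this[of 2] this[of 3] this[of 4]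
  then show "phi (k5 * Y1 c) = - phi (K * x c)" "phi (k5 * Y2 c) = - 3 * phi (K * x c)" "phi (k5 * Y3 c) = - 5 * phi (K * x c)"
    by (simp_all add: eval_nat_numeral mult.assoc[symmetric] distrib_left distrib_right left_diff_distrib right_diff_distrib
      mult_minus_left mult_minus_right pm_mult pm_K phi_simps cancel_right k_K K_k)
qed

end

section \<open>Contraction of the sphere averages with the words\<close>

lemma sum_kr1: "(\<Sum>d\<in>UNIV. \<Sum>c\<in>UNIV. of_bool (a = c) * of_bool (b = d) * f d c) = (f b a :: complex)" for a b :: 4
proof -
  have "(\<Sum>c\<in>UNIV. of_bool (a = c) * of_bool (b = d) * f d c) = (if b = d then f d a else 0)" for d
    by (subst sum.remove[of _ a]) auto
  then show ?thesis by (simp add: sum.delta')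
qed

lemma sum_kr2: "(\<Sum>d\<in>UNIV. \<Sum>c\<in>UNIV. of_bool (a = d) * of_bool (b = c) * f d c) = (f a b :: complex)" for a b :: 4
  using sum_kr1[of b a f] by (simp add: mult.commute mult.left_commute)

lemma sum_kr3: "(\<Sum>d\<in>UNIV. \<Sum>c\<in>UNIV. of_bool (d = c) * f d c) = (\<Sum>c\<in>UNIV. f c c :: complex)" for f :: "4 \<Rightarrow> _"
proof -
  have "(\<Sum>c\<in>UNIV. of_bool (d = c) * f d c) = f d d" for d
    by (subst sum.remove[of _ d]) auto
  then show ?thesis by simp
qed

context clifford begin

lemma sum_z4:
  fixes f :: "4 \<Rightarrow> 4 \<Rightarrow> complex"
  shows "(\<Sum>d\<in>UNIV. \<Sum>c\<in>UNIV. of_real (z4 a b c d) * f d c) = - (1/12) * (kr a b * (\<Sum>c\<in>UNIV. f c c) + f b a + f a b)"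
proof -
  have "of_real (z4 a b c d) * f d c = - (1/12) * (kr a b * (kr d c * f d c) + kr a c * kr b d * f d c + kr a d * kr b c * f d c)" for c d
    by (simp add: z4_def eq_commute[of c] algebra_simps)
  then show ?thesis
    by (simp only: sum_distrib_left[symmetric] sum.distrib sum_kr1 sum_kr2 sum_kr3)
qed

lemma sum_t4:
  fixes f :: "4 \<Rightarrow> 4 \<Rightarrow> complex"
  shows
  "(\<Sum>d\<in>UNIV. \<Sum>c\<in>UNIV. of_real (t4 a d c b) * f d c) = f a b - f b a + kr a b * (\<Sum>c\<in>UNIV. f c c)"
  "(\<Sum>d\<in>UNIV. \<Sum>c\<in>UNIV. of_real (t4 a d b c) * f d c) = f a b - kr a b * (\<Sum>c\<in>UNIV. f c c) + f b a"
  "(\<Sum>d\<in>UNIV. \<Sum>c\<in>UNIV. of_real (t4 a b d c) * f d c) = kr a b * (\<Sum>c\<in>UNIV. f c c) - f a b + f b a"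
proof -
  have "of_real (t4 a d c b) * f d c = kr a d * kr b c * f d c - kr a c * kr b d * f d c + kr a b * (kr d c * f d c)"
    "of_real (t4 a d b c) * f d c = kr a d * kr b c * f d c - kr a b * (kr d c * f d c) + kr a c * kr b d * f d c"
    "of_real (t4 a b d c) * f d c = kr a b * (kr d c * f d c) - kr a d * kr b c * f d c + kr a c * kr b d * f d c" for c d
    by (simp_all add: t4_def eq_commute[of _ b] algebra_simps)
  then show
  "(\<Sum>d\<in>UNIV. \<Sum>c\<in>UNIV. of_real (t4 a d c b) * f d c) = f a b - f b a + kr a b * (\<Sum>c\<in>UNIV. f c c)"
  "(\<Sum>d\<in>UNIV. \<Sum>c\<in>UNIV. of_real (t4 a d b c) * f d c) = f a b - kr a b * (\<Sum>c\<in>UNIV. f c c) + f b a"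
  "(\<Sum>d\<in>UNIV. \<Sum>c\<in>UNIV. of_real (t4 a b d c) * f d c) = kr a b * (\<Sum>c\<in>UNIV. f c c) - f a b + f b a"
    by (simp_all only: sum_distrib_left[symmetric] sum.distrib sum_subtractf sum_kr1 sum_kr2 sum_kr3)
qed

end

context conformal begin

text \<open>\<open>E2 + E1\<close> is the contribution of the part \<open>\<gamma>\<^sub>a T (-\<i> \<delta>\<^sub>b) k G\<^sup>3\<close> of the Einstein functional, where \<open>E1\<close> comes from
  \<open>\<delta>\<^sub>b\<close> falling on the symbol, and \<open>E0\<close> the one of the part \<open>\<gamma>\<^sub>a \<gamma>\<^sub>e \<gamma>\<^sub>b T k G\<^sup>3\<close>.\<close>

definition E2 :: "4 \<Rightarrow> 4 \<Rightarrow> endo \<Rightarrow> complex"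
  where "E2 a b T = (\<Sum>d\<in>UNIV. \<Sum>c\<in>UNIV. of_real (z4 a b c d) * phi (T * W1 d c)
    + of_real (1/4 * t4 a d c b) * phi (T * W2 d c) + of_real (1/4 * t4 a d b c) * phi (T * W3 d c)
    + of_real (z4 a b c d) * phi (T * W4 d c) + of_real (1/4 * t4 a b d c) * phi (T * W5 d c)
    + of_real (z4 a b c d) * phi (T * W6 d c))"

definition E1 :: "4 \<Rightarrow> 4 \<Rightarrow> endo \<Rightarrow> complex"
  where "E1 a b T = (\<Sum>c\<in>UNIV. - (of_real (- (1/2) * kr a c) * phi (T * W4 b c))
    - of_real (kr a c) * phi (T * W5 b c) - of_real (- (1/2) * kr a c) * phi (T * W6 b c))"

definition E0 :: "4 \<Rightarrow> 4 \<Rightarrow> 4 \<Rightarrow> endo \<Rightarrow> complex"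
  where "E0 a e b T = (\<Sum>c\<in>UNIV. - (of_real (- (1/2) * t4 a e b c) * phi (T * Y1 c))
    - of_real (t4 a e b c) * phi (T * Y2 c) - of_real (- (1/2) * t4 a e b c) * phi (T * Y3 c))"

text \<open>The counts 1, 3, 5 with the weights 1/2, -1, 1/2 sum to 0. This removes the terms in
  which the anticommutator differentiates \<open>W\<close>.\<close>

lemma E0_k5: "E0 a e b k5 = 0"
  unfolding E0_def words_k5_Y by (intro sum.neutral ballI) (simp add: algebra_simps)

text \<open>The factors 2 come from the Clifford relation in the anticommutator. All occurrences of
  \<open>w53\<close> cancel, within \<open>E0\<close> and between \<open>E2\<close> and
  \<open>E1\<close>.\<close>

lemma E_combined:
  "2 * E2 a b k5 + 2 * E1 a b k5 + (\<Sum>e\<in>UNIV. E0 a e b (k3 * pm e (k * k)))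
    = - (1/3 * w42 a b + 2/3 * w31 a b + w20 a b + 4/3 * w11 a b - 4/3 * w31 b a - 2/3 * w42 b a
      + kr a b * (\<Sum>c\<in>UNIV. 1/3 * w42 c c + 2/3 * w31 c c - 1/3 * w11 c c))"
proof -
  have E2: "E2 a b k5 = (\<Sum>d\<in>UNIV. \<Sum>c\<in>UNIV. of_real (z4 a b c d) * (phi (k5 * W1 d c) + phi (k5 * W4 d c) + phi (k5 * W6 d c)))
    + 1/4 * (\<Sum>d\<in>UNIV. \<Sum>c\<in>UNIV. of_real (t4 a d c b) * phi (k5 * W2 d c))
    + 1/4 * (\<Sum>d\<in>UNIV. \<Sum>c\<in>UNIV. of_real (t4 a d b c) * phi (k5 * W3 d c))
    + 1/4 * (\<Sum>d\<in>UNIV. \<Sum>c\<in>UNIV. of_real (t4 a b d c) * phi (k5 * W5 d c))"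
    unfolding E2_def sum_distrib_left sum.distrib[symmetric] by (intro sum.cong refl) (simp add: algebra_simps)
  have E1: "E1 a b k5 = 1/2 * phi (k5 * W4 b a) - phi (k5 * W5 b a) + 1/2 * phi (k5 * W6 b a)"
    unfolding E1_def by (subst sum.remove[of _ a]) (auto intro!: sum.neutral)
  have E0: "(\<Sum>e\<in>UNIV. E0 a e b (k3 * pm e (k * k))) = (\<Sum>e\<in>UNIV. \<Sum>c\<in>UNIV. of_real (t4 a e b c) *
      (1/2 * phi (k3 * pm e (k * k) * Y1 c) - phi (k3 * pm e (k * k) * Y2 c) + 1/2 * phi (k3 * pm e (k * k) * Y3 c)))"
    unfolding E0_def by (intro sum.cong refl) (simp add: algebra_simps)
  show ?thesis
    unfolding E2 E1 E0 sum_z4 sum_t4 word_1 word_2 word_3 word_4 word_5 word_6 words_Y w11_sym[of b a]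
    by (cases "a = b") (simp_all add: sum.distrib sum_subtractf sum_distrib_left[symmetric] sum_divide_distrib[symmetric] sum_negf algebra_simps)
qed

end

section \<open>The two functionals\<close>

lemma matrix_add_rdistrib: "(A + B) ** C = A ** C + B ** C" for C :: "'a::ring_1^'n^'m"
  by (simp add: vec_eq_iff matrix_mult_nth distrib_right sum.distrib)

lemma has_res_minus_tens:
  assumes "strictly_irrational \<theta>" "tr_avg A c" "S \<in> alg \<theta>" "T \<in> alg_op \<theta>"
  shows "has_res \<theta> (\<lambda>\<xi>. - tens (A \<xi>) (S * T)) (- (c * (phi S * phi T)))"
  using has_res_tens[OF assms(1-3) alg_op_minus[OF assms(4)]] by (simp add: tens_minus_right phi_simps)

lemma tens_scaleR: "tens (r *\<^sub>R A) T = tens A (scalar (of_real r) * T)"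
proof -
  have "scalar (of_real r * z) * T = scalar z * (scalar (of_real r) * T)" for z
    by (metis mult.assoc mult.commute scalar_mult)
  then show ?thesis by (simp add: vec_eq_iff scaleR_conv_of_real[where 'a = complex])
qed

section \<open>Symbols of the powers of the inverse, to second order\<close>

context conformal begin

definition usym :: "nat \<Rightarrow> real^4 \<Rightarrow> endo^4^4"
  where "usym n \<xi> = (if n = 0 then mat 1 else 0)"

text \<open>The symbols of \<open>k G\<^sup>n\<close>.\<close>

definition d1 where "d1 = dsym (\<lambda>n \<xi>. mat K ** usym n \<xi>)"
definition d2 where "d2 = dsym (\<lambda>n \<xi>. mat (K * K) ** d1 n \<xi>)"
definition d3 where "d3 = dsym (\<lambda>n \<xi>. mat (K * K) ** d2 n \<xi>)"
definition d4 where "d4 = dsym (\<lambda>n \<xi>. mat (K * K) ** d3 n \<xi>)"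

lemma k_K_left: "k * (K * y) = y"
  by (simp add: mult.assoc[symmetric] k_K)

text \<open>Each \<open>G\<close> has a \<open>K\<close> on either side of \<open>Dinv\<close>, so
  consecutive factors meet in \<open>K * K\<close>. The symbols \<open>d1\<close> to
  \<open>d4\<close> omit the outermost \<open>K\<close>, which the \<open>k\<close> in
  \<open>k G^3\<close> cancels.\<close>

lemma osymb_k_G3: "osymb \<theta> (- 3) (mat k ** (G ** (G ** G))) d3"
  and osymb_G4: "osymb \<theta> (- 4) (G ** (G ** (G ** G))) (\<lambda>n \<xi>. mat K ** d4 n \<xi>)"
proof -
  have K_mat: "mat K ** (mat K ** X) = mat (K * K) ** X" for X :: "endo^4^4" by (simp add: matrix_mul_assoc mat_mult)
  have u: "osymb \<theta> 0 (mat 1) usym"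
    by (rule osymb_cong[OF osymb_one]) (simp add: usym_def)
  have 1: "osymb \<theta> (- 1) G (\<lambda>n \<xi>. mat K ** d1 n \<xi>)"
    using osymb_G[OF u] by (simp add: d1_def)
  have 2: "osymb \<theta> (- 2) (G ** G) (\<lambda>n \<xi>. mat K ** d2 n \<xi>)"
    using osymb_G[OF 1] by (simp add: d2_def K_mat)
  have 3: "osymb \<theta> (- 3) (G ** (G ** G)) (\<lambda>n \<xi>. mat K ** d3 n \<xi>)"
    using osymb_G[OF 2] by (simp add: d3_def K_mat)
  show "osymb \<theta> (- 4) (G ** (G ** (G ** G))) (\<lambda>n \<xi>. mat K ** d4 n \<xi>)"
    using osymb_G[OF 3] by (simp add: d4_def K_mat)
  show "osymb \<theta> (- 3) (mat k ** (G ** (G ** G))) d3"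
    by (rule osymb_cong[OF osymb_left[OF mat_alg_hat[OF k_alg] 3]]) (simp add: matrix_mul_assoc mat_mult k_K)
qed

lemmas symbol_simps = gpm_def pmm_tens pmm_sum pmm_minus pmm_diff tens_mult matrix_sum_right matrix_sum_left
  matrix_minus_right matrix_diff_right matrix_add_ldistrib matrix_mul_assoc[symmetric] mult.assoc mat_eq_tens sum_negf

lemma d1_0: "d1 0 \<xi> = tens (nhat \<xi>) K"
  by (simp add: d1_def usym_def mat_eq_tens tens_mult)

lemma d1_1: "d1 (Suc 0) \<xi> = - (\<Sum>c\<in>UNIV. tens (nhat \<xi> ** (\<gamma> c ** nhat \<xi>)) (pm c K))"
proof -
  have "d1 (Suc 0) \<xi> = tens (nhat \<xi>) 1 ** (0 - gpm (d1 0 \<xi>))"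
    unfolding d1_def by (simp add: usym_def)
  then show ?thesis unfolding d1_0 by (simp add: symbol_simps)
qed

lemma d1_2: "d1 (Suc (Suc 0)) \<xi> = (\<Sum>d\<in>UNIV. \<Sum>c\<in>UNIV.
    tens (nhat \<xi> ** (\<gamma> d ** (nhat \<xi> ** (\<gamma> c ** nhat \<xi>)))) (pm d (pm c K)))"
proof -
  have "d1 (Suc (Suc 0)) \<xi> = tens (nhat \<xi>) 1 ** (0 - gpm (d1 (Suc 0) \<xi>))"
    unfolding d1_def by (simp add: usym_def)
  then show ?thesis unfolding d1_1 by (simp add: symbol_simps)
qed

lemma d2_0: "d2 0 \<xi> = tens (nhat \<xi> ** nhat \<xi>) (K * (K * K))"
  by (simp add: d2_def d1_0 symbol_simps)

lemma d2_1: "d2 (Suc 0) \<xi> = - (\<Sum>c\<in>UNIV. tens (nhat \<xi> ** (nhat \<xi> ** (\<gamma> c ** nhat \<xi>))) (K * (K * pm c K))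
    + tens (nhat \<xi> ** (\<gamma> c ** (nhat \<xi> ** nhat \<xi>))) (pm c (K * (K * K))))"
proof -
  have "d2 (Suc 0) \<xi> = tens (nhat \<xi>) 1 ** (mat (K * K) ** d1 (Suc 0) \<xi> - gpm (d2 0 \<xi>))"
    by (simp add: d2_def)
  then show ?thesis unfolding d1_1 d2_0 by (simp add: symbol_simps sum.distrib sum_subtractf)
qed

lemma d2_2: "d2 (Suc (Suc 0)) \<xi> = (\<Sum>d\<in>UNIV. \<Sum>c\<in>UNIV.
      tens (nhat \<xi> ** (nhat \<xi> ** (\<gamma> d ** (nhat \<xi> ** (\<gamma> c ** nhat \<xi>))))) (K * (K * pm d (pm c K)))
    + tens (nhat \<xi> ** (\<gamma> d ** (nhat \<xi> ** (nhat \<xi> ** (\<gamma> c ** nhat \<xi>))))) (pm d (K * (K * pm c K)))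
    + tens (nhat \<xi> ** (\<gamma> d ** (nhat \<xi> ** (\<gamma> c ** (nhat \<xi> ** nhat \<xi>))))) (pm d (pm c (K * (K * K)))))"
proof -
  have "d2 (Suc (Suc 0)) \<xi> = tens (nhat \<xi>) 1 ** (mat (K * K) ** d1 (Suc (Suc 0)) \<xi> - gpm (d2 (Suc 0) \<xi>))"
    by (simp add: d2_def)
  then show ?thesis unfolding d1_2 d2_1 by (simp add: symbol_simps sum.distrib sum_subtractf)
qed

lemma d3_0: "d3 0 \<xi> = tens (nhat \<xi> ** (nhat \<xi> ** nhat \<xi>)) (K * (K * (K * (K * K))))"
  by (simp add: d3_def d2_0 symbol_simps)

lemma d3_1: "d3 (Suc 0) \<xi> = (\<Sum>c\<in>UNIV.
    - tens (nhat \<xi> ** (nhat \<xi> ** (nhat \<xi> ** (\<gamma> c ** nhat \<xi>)))) (Y1 c)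
    + - tens (nhat \<xi> ** (nhat \<xi> ** (\<gamma> c ** (nhat \<xi> ** nhat \<xi>)))) (Y2 c)
    + - tens (nhat \<xi> ** (\<gamma> c ** (nhat \<xi> ** (nhat \<xi> ** nhat \<xi>)))) (Y3 c))"
proof -
  have "d3 (Suc 0) \<xi> = tens (nhat \<xi>) 1 ** (mat (K * K) ** d2 (Suc 0) \<xi> - gpm (d3 0 \<xi>))"
    by (simp add: d3_def)
  then show ?thesis unfolding d2_1 d3_0 by (simp add: symbol_simps sum.distrib sum_subtractf)
qed

text \<open>The six terms are the six ways of distributing two derivatives over the three factors
  \<open>Dinv\<close>: a factor that produces \<open>j\<close> derivatives contributes
  \<open>j + 1\<close> copies of \<open>nhat\<close> separated by gammas, and differentiates
  everything on its right.\<close>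

lemma d3_2: "d3 (Suc (Suc 0)) \<xi> = (\<Sum>d\<in>UNIV. \<Sum>c\<in>UNIV.
      tens (nhat \<xi> ** (nhat \<xi> ** (nhat \<xi> ** (\<gamma> d ** (nhat \<xi> ** (\<gamma> c ** nhat \<xi>)))))) (W1 d c)
    + tens (nhat \<xi> ** (nhat \<xi> ** (\<gamma> d ** (nhat \<xi> ** (nhat \<xi> ** (\<gamma> c ** nhat \<xi>)))))) (W2 d c)
    + tens (nhat \<xi> ** (nhat \<xi> ** (\<gamma> d ** (nhat \<xi> ** (\<gamma> c ** (nhat \<xi> ** nhat \<xi>)))))) (W3 d c)
    + tens (nhat \<xi> ** (\<gamma> d ** (nhat \<xi> ** (nhat \<xi> ** (nhat \<xi> ** (\<gamma> c ** nhat \<xi>)))))) (W4 d c)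
    + tens (nhat \<xi> ** (\<gamma> d ** (nhat \<xi> ** (nhat \<xi> ** (\<gamma> c ** (nhat \<xi> ** nhat \<xi>)))))) (W5 d c)
    + tens (nhat \<xi> ** (\<gamma> d ** (nhat \<xi> ** (\<gamma> c ** (nhat \<xi> ** (nhat \<xi> ** nhat \<xi>)))))) (W6 d c))"
proof -
  have "d3 (Suc (Suc 0)) \<xi> = tens (nhat \<xi>) 1 ** (mat (K * K) ** d2 (Suc (Suc 0)) \<xi> - gpm (d3 (Suc 0) \<xi>))"
    by (simp add: d3_def)
  then show ?thesis unfolding d2_2 d3_1 by (simp add: symbol_simps sum.distrib sum_subtractf)
qed

lemma d4_0: "mat K ** d4 0 \<xi> = tens (nhat \<xi> ** (nhat \<xi> ** (nhat \<xi> ** nhat \<xi>))) (K * (K * (K * (K * (K * (K * (K * K)))))))"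
  by (simp add: d4_def d3_0 symbol_simps)

context
  fixes X T
  assumes irr: "strictly_irrational \<theta>" and X: "X \<in> alg \<theta>" and T: "T \<in> alg_op \<theta>"
begin

lemmas res_intros = has_res_sum has_res_add has_res_tens has_res_minus_tens irr X alg_op_mult T W_alg_op

text \<open>Each summand is a gamma word with known average, tensored with an element
  \<open>X\<close> of the algebra times a word in its commuting copy. \<open>E1\<close> and
  \<open>E0\<close> follow the same pattern.\<close>

lemma has_res_E2:
  "has_res \<theta> (\<lambda>\<xi>. tens (\<gamma> a) (X * T) ** (mat (scalar (of_real (\<xi> $ b))) ** d3 (Suc (Suc 0)) \<xi>)) (phi X * E2 a b T)"
proof (rule has_res_cong)
  show "has_res \<theta> (\<lambda>\<xi>. \<Sum>d\<in>UNIV. \<Sum>c\<in>UNIV.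
      tens ((\<xi> $ b) *\<^sub>R (\<gamma> a ** (nhat \<xi> ** (nhat \<xi> ** (nhat \<xi> ** (\<gamma> d ** (nhat \<xi> ** (\<gamma> c ** nhat \<xi>)))))))) (X * (T * W1 d c))
    + tens ((\<xi> $ b) *\<^sub>R (\<gamma> a ** (nhat \<xi> ** (nhat \<xi> ** (\<gamma> d ** (nhat \<xi> ** (nhat \<xi> ** (\<gamma> c ** nhat \<xi>)))))))) (X * (T * W2 d c))
    + tens ((\<xi> $ b) *\<^sub>R (\<gamma> a ** (nhat \<xi> ** (nhat \<xi> ** (\<gamma> d ** (nhat \<xi> ** (\<gamma> c ** (nhat \<xi> ** nhat \<xi>)))))))) (X * (T * W3 d c))
    + tens ((\<xi> $ b) *\<^sub>R (\<gamma> a ** (nhat \<xi> ** (\<gamma> d ** (nhat \<xi> ** (nhat \<xi> ** (nhat \<xi> ** (\<gamma> c ** nhat \<xi>)))))))) (X * (T * W4 d c))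
    + tens ((\<xi> $ b) *\<^sub>R (\<gamma> a ** (nhat \<xi> ** (\<gamma> d ** (nhat \<xi> ** (nhat \<xi> ** (\<gamma> c ** (nhat \<xi> ** nhat \<xi>)))))))) (X * (T * W5 d c))
    + tens ((\<xi> $ b) *\<^sub>R (\<gamma> a ** (nhat \<xi> ** (\<gamma> d ** (nhat \<xi> ** (\<gamma> c ** (nhat \<xi> ** (nhat \<xi> ** nhat \<xi>)))))))) (X * (T * W6 d c)))
    (\<Sum>d\<in>UNIV. \<Sum>c\<in>UNIV. of_real (z4 a b c d) * (phi X * phi (T * W1 d c))
    + of_real (1/4 * t4 a d c b) * (phi X * phi (T * W2 d c)) + of_real (1/4 * t4 a d b c) * (phi X * phi (T * W3 d c))
    + of_real (z4 a b c d) * (phi X * phi (T * W4 d c)) + of_real (1/4 * t4 a b d c) * (phi X * phi (T * W5 d c))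
    + of_real (z4 a b c d) * (phi X * phi (T * W6 d c)))"
    by (intro res_intros avg_n_gamma_n_gamma_n avg_gamma3_n)
qed (simp_all add: d3_2 E2_def tens_scaleR mat_eq_tens tens_mult matrix_sum_right matrix_add_ldistrib sum_distrib_left
    distrib_left mult_ac mult.assoc scalar_left_commute matrix_mul_assoc[symmetric] cong: sum.cong)

lemma has_res_E1:
  "has_res \<theta> (\<lambda>\<xi>. tens (\<gamma> a) (X * T) ** pmm b (d3 (Suc 0) \<xi>)) (phi X * E1 a b T)"
proof (rule has_res_cong)
  show "has_res \<theta> (\<lambda>\<xi>. \<Sum>c\<in>UNIV.
    - tens (\<gamma> a ** (nhat \<xi> ** (nhat \<xi> ** (nhat \<xi> ** (\<gamma> c ** nhat \<xi>))))) (X * (T * W4 b c))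
    + - tens (\<gamma> a ** (nhat \<xi> ** (nhat \<xi> ** (\<gamma> c ** (nhat \<xi> ** nhat \<xi>))))) (X * (T * W5 b c))
    + - tens (\<gamma> a ** (nhat \<xi> ** (\<gamma> c ** (nhat \<xi> ** (nhat \<xi> ** nhat \<xi>))))) (X * (T * W6 b c)))
    (\<Sum>c\<in>UNIV. - (of_real (- (1/2) * kr a c) * (phi X * phi (T * W4 b c)))
    + - (of_real (kr a c) * (phi X * phi (T * W5 b c))) + - (of_real (- (1/2) * kr a c) * (phi X * phi (T * W6 b c))))"
    by (intro res_intros avg_gamma_n_gamma_n)
qed (simp_all add: d3_1 E1_def pmm_sum pmm_diff pmm_minus pmm_tens tens_mult matrix_sum_right matrix_diff_right
    matrix_minus_right sum_distrib_left right_diff_distrib distrib_left mult_ac mult.assoc cong: sum.cong)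

lemma has_res_E0:
  "has_res \<theta> (\<lambda>\<xi>. tens (\<gamma> a ** (\<gamma> e ** \<gamma> b)) (X * T) ** d3 (Suc 0) \<xi>) (phi X * E0 a e b T)"
proof (rule has_res_cong)
  show "has_res \<theta> (\<lambda>\<xi>. \<Sum>c\<in>UNIV.
    - tens (\<gamma> a ** (\<gamma> e ** (\<gamma> b ** (nhat \<xi> ** (nhat \<xi> ** (nhat \<xi> ** (\<gamma> c ** nhat \<xi>))))))) (X * (T * Y1 c))
    + - tens (\<gamma> a ** (\<gamma> e ** (\<gamma> b ** (nhat \<xi> ** (nhat \<xi> ** (\<gamma> c ** (nhat \<xi> ** nhat \<xi>))))))) (X * (T * Y2 c))
    + - tens (\<gamma> a ** (\<gamma> e ** (\<gamma> b ** (nhat \<xi> ** (\<gamma> c ** (nhat \<xi> ** (nhat \<xi> ** nhat \<xi>))))))) (X * (T * Y3 c)))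
    (\<Sum>c\<in>UNIV. - (of_real (- (1/2) * t4 a e b c) * (phi X * phi (T * Y1 c)))
    + - (of_real (t4 a e b c) * (phi X * phi (T * Y2 c))) + - (of_real (- (1/2) * t4 a e b c) * (phi X * phi (T * Y3 c))))"
    by (intro res_intros avg_gamma3_n_gamma_n)
qed (simp_all add: d3_1 E0_def tens_mult matrix_sum_right matrix_diff_right
    matrix_minus_right sum_distrib_left right_diff_distrib distrib_left mult_ac mult.assoc matrix_mul_assoc[symmetric] cong: sum.cong)

end

lemma wres_eq_has_res:
  "osymb \<theta> d P s \<Longrightarrow> - 4 \<le> d \<Longrightarrow> has_res \<theta> (\<lambda>\<xi>. s (nat (d + 4)) \<xi>) z \<Longrightarrow> wres \<theta> P = z"
  using has_res_sphere_integral[of \<theta> "s (nat (d + 4))" z] by (simp add: wres_eq)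

section \<open>The operators under the residue and their values\<close>

lemma one_form_eq: "one_form \<gamma> k V = (\<Sum>a\<in>UNIV. tens (\<gamma> a) (k * k * V a))"
  by (simp add: vec_eq_iff one_form_def power2_eq_square scalar_commute)

context
  fixes V W :: "4 \<Rightarrow> endo"
  assumes irr: "strictly_irrational \<theta>" and V: "\<And>a. V a \<in> alg \<theta>" and W: "\<And>a. W a \<in> alg \<theta>"
begin

text \<open>Collects elements of the algebra to the left of \<open>k\<close>, \<open>K\<close> and
  the derivatives of \<open>k\<close>, the form in which the trace splits.\<close>

lemma alg_commute:
  assumes "X \<in> alg \<theta>"
  shows "k * X = X * k" "K * X = X * K" "k * (X * Y) = X * (k * Y)" "K * (X * Y) = X * (K * Y)"
    "pm c k * X = X * pm c k" "pm c k * (X * Y) = X * (pm c k * Y)"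
  using alg_op_alg_commute[OF k_alg assms] alg_op_alg_commute[OF K_alg assms]
    alg_op_alg_commute[OF alg_op_pm[OF k_alg] assms, of c] by (simp_all add: mult.assoc[symmetric])

text \<open>The operator has order -4, so only leading symbols enter; \<open>k^4\<close> from the
  one-forms meets \<open>K^8\<close> from the inverse.\<close>

lemma metric_eq: "metric_functional \<theta> Dk (one_form \<gamma> k V) (one_form \<gamma> k W) = (\<Sum>a\<in>UNIV. phi (V a * W a)) * phi (K * K * K * K)"
proof -
  have vw: "one_form \<gamma> k V ** one_form \<gamma> k W = (\<Sum>b\<in>UNIV. \<Sum>a\<in>UNIV. tens (\<gamma> a ** \<gamma> b) (V a * W b * (k * (k * (k * k)))))"
    by (simp add: one_form_eq matrix_sum_left matrix_sum_right tens_mult mult.assoc alg_commute V W)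
  have hat: "(\<Sum>b\<in>UNIV. \<Sum>a\<in>UNIV. tens (\<gamma> a ** \<gamma> b) (V a * W b * (k * (k * (k * k))))) $ i $ j \<in> alg_hat \<theta>" for i j
    unfolding sum_component tens_nth
    by (intro alg_hat_sum alg_hat.scale alg_hat.mult[OF alg_hat.left alg_hat.right] alg_mult V W alg_op_mult k_alg)
  have "metric_functional \<theta> Dk (one_form \<gamma> k V) (one_form \<gamma> k W)
      = (\<Sum>b\<in>UNIV. \<Sum>a\<in>UNIV. of_real (kr a b) * (phi (V a * W b) * phi (K * (K * (K * K)))))"
    unfolding metric_functional_def abs_inv4_Dk vw
  proof (rule wres_eq_has_res[OF osymb_left[OF hat osymb_G4]])
    have "has_res \<theta> (\<lambda>\<xi>. \<Sum>b\<in>UNIV. \<Sum>a\<in>UNIV. tens (\<gamma> a ** (\<gamma> b ** (nhat \<xi> ** (nhat \<xi> ** (nhat \<xi> ** nhat \<xi>)))))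
        (V a * W b * (K * (K * (K * K)))))
      (\<Sum>b\<in>UNIV. \<Sum>a\<in>UNIV. of_real (kr a b) * (phi (V a * W b) * phi (K * (K * (K * K)))))"
      by (intro has_res_sum has_res_tens irr avg_nnnn alg_mult V W alg_op_mult K_alg)
    then show "has_res \<theta> (\<lambda>\<xi>. (\<Sum>b\<in>UNIV. \<Sum>a\<in>UNIV. tens (\<gamma> a ** \<gamma> b) (V a * W b * (k * (k * (k * k))))) **
        (mat K ** d4 (nat (- 4 + 4)) \<xi>))
      (\<Sum>b\<in>UNIV. \<Sum>a\<in>UNIV. of_real (kr a b) * (phi (V a * W b) * phi (K * (K * (K * K)))))"
      by (simp add: d4_0 matrix_sum_left tens_mult matrix_mul_assoc[symmetric] mult.assoc k_K_left)
  qed simp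
  also have "\<dots> = (\<Sum>b\<in>UNIV. phi (V b * W b) * phi (K * (K * (K * K))))"
  proof (rule sum.cong[OF refl])
    show "(\<Sum>a\<in>UNIV. of_real (kr a b) * (phi (V a * W b) * phi (K * (K * (K * K))))) = phi (V b * W b) * phi (K * (K * (K * K)))" for b
      by (subst sum.remove[of _ b]) auto
  qed
  finally show ?thesis by (simp add: sum_distrib_right mult.assoc)
qed

lemma anticommutator: "Dk ** one_form \<gamma> k W + one_form \<gamma> k W ** Dk
    = (\<Sum>b\<in>UNIV. mat (2 * k * k * k * W b) ** (mat (Dop b) ** mat k))
    + (\<Sum>b\<in>UNIV. \<Sum>c\<in>UNIV. tens (\<gamma> c ** \<gamma> b) (k * pm c (k * k * W b)) ** mat k)"
proof -
  \<comment> \<open>The part in which the derivation stands to the right of \<open>W b\<close>. It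
    occurs in both products with the gammas in opposite order, so that the Clifford relation leaves
    only \<open>b = c\<close>.\<close>
  let ?A = "\<lambda>b c. k * k * k * W b * (Dop c * k)"
  have 1: "Dk ** one_form \<gamma> k W = (\<Sum>b\<in>UNIV. \<Sum>c\<in>UNIV. tens (\<gamma> c ** \<gamma> b) (k * pm c (k * k * W b) * k + ?A b c))"
  proof -
    have "k * (Dop c * (k * (k * (k * W b)))) = k * pm c (k * k * W b) * k + ?A b c" for b c
      using Dop_mult[of c "k * k * W b"] alg_commute[OF W[of b]]
      by (metis (no_types, opaque_lifting) distrib_left distrib_right mult.assoc)
    then show ?thesis
      by (simp add: conformal_dirac_def one_form_eq flat_dirac_eq mat_eq_tens matrix_sum_left matrix_sum_right tens_mult mult.assoc)
  qed
  have 2: "one_form \<gamma> k W ** Dk = (\<Sum>b\<in>UNIV. \<Sum>c\<in>UNIV. tens (\<gamma> b ** \<gamma> c) (?A b c))"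
    by (simp add: conformal_dirac_def one_form_eq flat_dirac_eq mat_eq_tens matrix_sum_left matrix_sum_right tens_mult
        mult.assoc alg_commute W) (rule sum.swap)
  have "tens (\<gamma> c ** \<gamma> b) (?A b c) + tens (\<gamma> b ** \<gamma> c) (?A b c) = (if b = c then mat (2 * ?A b c) else 0)" for b c
  proof -
    have "tens (\<gamma> c ** \<gamma> b) (?A b c) + tens (\<gamma> b ** \<gamma> c) (?A b c) = tens (mat (if b = c then 2 else 0)) (?A b c)"
      by (simp add: tens_add_left[symmetric] anticommute add.commute)
    then show ?thesis by (simp add: tens_mat_2 mat_0 mat_eq_tens tens_add_right[symmetric] mult_2)
  qed
  then have 3: "(\<Sum>c\<in>UNIV. tens (\<gamma> c ** \<gamma> b) (?A b c) + tens (\<gamma> b ** \<gamma> c) (?A b c)) = mat (2 * ?A b b)" for b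
    by (simp add: sum.delta')
  have "Dk ** one_form \<gamma> k W + one_form \<gamma> k W ** Dk
      = (\<Sum>b\<in>UNIV. \<Sum>c\<in>UNIV. tens (\<gamma> c ** \<gamma> b) (k * pm c (k * k * W b) * k))
        + (\<Sum>b\<in>UNIV. \<Sum>c\<in>UNIV. tens (\<gamma> c ** \<gamma> b) (?A b c) + tens (\<gamma> b ** \<gamma> c) (?A b c))"
    unfolding 1 2 by (simp add: sum.distrib tens_add_right add.assoc)
  then show ?thesis unfolding 3 by (simp add: mat_mult mult.assoc add.commute mat_eq_tens tens_mult)
qed

text \<open>The factor 2 is written as two equal summands, so that every summand keeps the form
  \<open>X * T\<close> with \<open>X\<close> in the algebra and \<open>T\<close> in its commuting
  copy.\<close>

lemma einstein_operator:
  "one_form \<gamma> k V ** (Dk ** one_form \<gamma> k W + one_form \<gamma> k W ** Dk) ** Dk ** abs_inv4 Dk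
  = (\<Sum>b\<in>UNIV. \<Sum>a\<in>UNIV. tens (\<gamma> a) (V a * W b * k5) ** (mat (Dop b) ** (mat k ** (G ** (G ** G))))
      + tens (\<gamma> a) (V a * W b * k5) ** (mat (Dop b) ** (mat k ** (G ** (G ** G)))))
  + (\<Sum>b\<in>UNIV. \<Sum>c\<in>UNIV. \<Sum>a\<in>UNIV. tens (\<gamma> a ** (\<gamma> c ** \<gamma> b)) (V a * W b * (k3 * pm c (k * k))) ** (mat k ** (G ** (G ** G)))
      + tens (\<gamma> a ** (\<gamma> c ** \<gamma> b)) (V a * pm c (W b) * k5) ** (mat k ** (G ** (G ** G))))"
proof -
  define E where "E = mat k ** (G ** (G ** G))"
  have 1: "one_form \<gamma> k V ** mat (2 * k * k * k * W b) ** M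
    = (\<Sum>a\<in>UNIV. tens (\<gamma> a) (V a * W b * k5) ** M + tens (\<gamma> a) (V a * W b * k5) ** M)" for b M
  proof -
    have "k * k * V a * (2 * k * k * k * W b) = V a * W b * k5 + V a * W b * k5" for a
      by (simp only: mult_2 distrib_left distrib_right mult.assoc alg_commute[OF V] alg_commute[OF W])
    then show ?thesis
      by (simp add: one_form_eq mat_eq_tens matrix_sum_left tens_mult tens_add_right matrix_add_rdistrib)
  qed
  have 2: "one_form \<gamma> k V ** tens (\<gamma> c ** \<gamma> b) (k * pm c (k * k * W b)) ** E
    = (\<Sum>a\<in>UNIV. tens (\<gamma> a ** (\<gamma> c ** \<gamma> b)) (V a * W b * (k3 * pm c (k * k))) ** E
      + tens (\<gamma> a ** (\<gamma> c ** \<gamma> b)) (V a * pm c (W b) * k5) ** E)" for b c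
  proof -
    have "k * k * V a * (k * pm c (k * k * W b)) = V a * W b * (k3 * pm c (k * k)) + V a * pm c (W b) * k5" for a
      by (simp only: pm_mult distrib_left distrib_right mult.assoc alg_commute[OF V] alg_commute[OF W]
          alg_commute[OF alg_pm[OF W]] add_ac)
    then show ?thesis
      by (simp add: one_form_eq matrix_sum_left tens_mult tens_add_right matrix_add_rdistrib)
  qed
  have "one_form \<gamma> k V ** (Dk ** one_form \<gamma> k W + one_form \<gamma> k W ** Dk) ** Dk ** abs_inv4 Dk
      = one_form \<gamma> k V ** (Dk ** one_form \<gamma> k W + one_form \<gamma> k W ** Dk) ** (G ** (G ** G))"
    by (simp add: abs_inv4_Dk matrix_mul_assoc[symmetric] DkG)
  also have "\<dots> = (\<Sum>b\<in>UNIV. one_form \<gamma> k V ** mat (2 * k * k * k * W b) ** (mat (Dop b) ** E))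
      + (\<Sum>b\<in>UNIV. \<Sum>c\<in>UNIV. one_form \<gamma> k V ** tens (\<gamma> c ** \<gamma> b) (k * pm c (k * k * W b)) ** E)"
    unfolding anticommutator E_def
    by (simp add: matrix_add_ldistrib matrix_add_rdistrib matrix_sum_right matrix_sum_left matrix_mul_assoc)
  finally show ?thesis unfolding 1 2 unfolding E_def .
qed

lemma einstein_eq:
  "einstein_functional \<theta> Dk (one_form \<gamma> k V) (one_form \<gamma> k W)
  = (\<Sum>b\<in>UNIV. \<Sum>a\<in>UNIV. phi (V a * W b) * (2 * E2 a b k5 + 2 * E1 a b k5 + (\<Sum>e\<in>UNIV. E0 a e b (k3 * pm e (k * k)))))"
proof -
  have ops: "k5 \<in> alg_op \<theta>" "k3 * pm c (k * k) \<in> alg_op \<theta>" for c by (simp_all only: alg_op_intros)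
  have VW: "V a * W b \<in> alg \<theta>" "V a * pm c (W b) \<in> alg \<theta>" for a b c by (intro alg_mult alg_pm V W)+
  have hat: "tens A (X * T) $ i $ j \<in> alg_hat \<theta>" if "X \<in> alg \<theta>" "T \<in> alg_op \<theta>" for A X T i j
    unfolding tens_nth by (intro alg_hat.scale alg_hat.mult[OF alg_hat.left alg_hat.right] that)
  have E2E1: "has_res \<theta> (\<lambda>\<xi>. tens (\<gamma> a) (V a * W b * k5) ** (mat (scalar (of_real (\<xi> $ b))) ** d3 (Suc (Suc 0)) \<xi> + pmm b (d3 (Suc 0) \<xi>)))
      (phi (V a * W b) * E2 a b k5 + phi (V a * W b) * E1 a b k5)" for a b
    unfolding matrix_add_ldistrib by (intro has_res_add has_res_E2 has_res_E1 irr VW ops)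
  \<comment> \<open>The part containing \<open>Dop\<close> has order \<open>- 3 + 1 = - 2\<close>,
    so degree -4 is its term number 2.\<close>
  have n: "nat (- 3 + 1 + 4) = Suc (Suc 0)" by simp
  note Dop = osymb_left[OF hat[OF VW(1) ops(1)] osymb_Dop[OF osymb_k_G3]]
  \<comment> \<open>The part without \<open>Dop\<close> has order -3; shifted to -2, its term number
    2 is \<open>d3 (Suc 0)\<close>.\<close>
  note E0 = osymb_left[OF hat[OF VW(1) ops(2)] osymb_shift[OF osymb_k_G3]] osymb_left[OF hat[OF VW(2) ops(1)] osymb_shift[OF osymb_k_G3]]
  have E0_sum: "(\<Sum>c\<in>UNIV. \<Sum>a\<in>UNIV. phi (V a * W b) * E0 a c b (k3 * pm c (k * k)) + phi (V a * pm c (W b)) * E0 a c b k5)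
      = (\<Sum>a\<in>UNIV. phi (V a * W b) * (\<Sum>e\<in>UNIV. E0 a e b (k3 * pm e (k * k))))" for b
    by (subst sum.swap) (simp only: E0_k5 mult_zero_right add_0_right sum_distrib_left)
  have "einstein_functional \<theta> Dk (one_form \<gamma> k V) (one_form \<gamma> k W)
    = (\<Sum>b\<in>UNIV. \<Sum>a\<in>UNIV. (phi (V a * W b) * E2 a b k5 + phi (V a * W b) * E1 a b k5)
      + (phi (V a * W b) * E2 a b k5 + phi (V a * W b) * E1 a b k5))
    + (\<Sum>b\<in>UNIV. \<Sum>c\<in>UNIV. \<Sum>a\<in>UNIV. phi (V a * W b) * E0 a c b (k3 * pm c (k * k)) + phi (V a * pm c (W b)) * E0 a c b k5)"
    unfolding einstein_functional_def einstein_operator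
    by (rule wres_eq_has_res[OF osymb_add[OF osymb_sum[OF osymb_sum[OF osymb_add[OF Dop Dop]]]
          osymb_sum[OF osymb_sum[OF osymb_sum[OF osymb_add[OF E0]]]]]],
      simp, simp only: n nat.case, intro has_res_add has_res_sum E2E1 has_res_E0 irr VW ops)
  also have "\<dots> = (\<Sum>b\<in>UNIV. \<Sum>a\<in>UNIV. phi (V a * W b) * (2 * E2 a b k5 + 2 * E1 a b k5 + (\<Sum>e\<in>UNIV. E0 a e b (k3 * pm e (k * k)))))"
    unfolding E0_sum sum.distrib[symmetric] by (intro sum.cong refl) (simp only: distrib_left mult_2 add_ac)
  finally show ?thesis .
qed

end

end

section \<open>Comparison with the stated integrand\<close>

lemma \<delta>_eq_pm: "\<delta> c T = scalar \<i> * pm c T"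
proof -
  have "scalar \<i> * scalar (- \<i>) = 1" by (intro endo_eqI torus_fun_eqI) simp
  then show ?thesis by (simp only: pm_def mult.assoc[symmetric] mult_1_left)
qed

context conformal begin

lemma powi_k: "k powi (-1) = K" "k powi (-2) = K * K" "k powi (-3) = K * K * K" "k powi (-4) = K * K * K * K" "k powi 2 = k * k"
  using inverse_endo_eq[OF K_k k_K] by (simp_all add: power_int_def eval_nat_numeral mult.assoc)

text \<open>Each derivation is \<open>\<i>\<close> times \<open>pm\<close>, and the two factors
  produce the sign.\<close>

lemma phi_\<delta>_\<delta>: "phi (S * \<delta> a k * T * \<delta> b k) = - phi (S * x a * T * x b)"
proof -
  have "S * \<delta> a k * T * \<delta> b k = scalar \<i> * (scalar \<i> * (S * x a * T * x b))"
    by (simp only: \<delta>_eq_pm mult.assoc scalar_left_commute[of S] scalar_left_commute[of T] scalar_left_commute[of "x a"])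
  then show ?thesis by (simp add: phi_simps mult.assoc)
qed

text \<open>Integration by parts moves the outer derivation onto \<open>K\<close>, so second
  derivatives of \<open>k\<close> count as \<open>w11\<close>.\<close>

lemma phi_\<delta>\<delta>: "phi (K * \<delta> a (\<delta> b k)) = - w11 a b"
proof -
  have "K * \<delta> a (\<delta> b k) = scalar \<i> * (scalar \<i> * (K * pm a (x b)))"
    by (simp only: \<delta>_eq_pm pm_scalar_mult mult.assoc scalar_left_commute[of K])
  then have "phi (K * \<delta> a (\<delta> b k)) = - phi (K * pm a (x b))" by (simp add: phi_simps mult.assoc)
  also have "\<dots> = - phi (K * x a * K * x b)"
    using phi_by_parts[OF K_alg alg_op_pm[OF k_alg]] by (simp add: pm_K phi_simps)
  finally show ?thesis by (simp add: w11_def)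
qed

definition curv :: "4 \<Rightarrow> 4 \<Rightarrow> endo"
  where "curv a b = (1/3) *\<^sub>R (k powi (-4) * \<delta> a k * k powi 2 * \<delta> b k)
              + (2/3) *\<^sub>R (k powi (-3) * \<delta> a k * k * \<delta> b k)
              + k powi (-2) * \<delta> a k * \<delta> b k
              + (2/3) *\<^sub>R (k powi (-1) * \<delta> a k * k powi (-1) * \<delta> b k)
              - (4/3) *\<^sub>R (k * \<delta> a k * k powi (-3) * \<delta> b k)
              - (2/3) *\<^sub>R (k powi 2 * \<delta> a k * k powi (-4) * \<delta> b k)
              + (2/3) *\<^sub>R (k powi (-1) * \<delta> a (\<delta> b k))
              + (if a = b then
                   (\<Sum>c\<in>UNIV. (1/3) *\<^sub>R (k powi (-1) * \<delta> c k * k powi (-1) * \<delta> c k)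
                             + (1/3) *\<^sub>R (k powi 2 * \<delta> c k * k powi (-4) * \<delta> c k)
                             + (2/3) *\<^sub>R (k * \<delta> c k * k powi (-3) * \<delta> c k))
                   - (2/3) *\<^sub>R (k powi (-1) * laplacian k)
                 else 0)"

lemma curv_alg_op: "curv a b \<in> alg_op \<theta>"
proof -
  have "0 \<in> alg_op \<theta>" using alg_op_diff[OF k_alg k_alg] by simp
  then show ?thesis
    unfolding curv_def powi_k laplacian_def
    by (simp add: alg_op_intros alg_op_\<delta> alg_op_scaleR alg_op_sum)
qed

text \<open>The second-derivative terms merge with \<open>w11\<close>:
  \<open>2/3 + 2/3 = 4/3\<close> for the free indices and \<open>1/3 - 2/3 = - 1/3\<close> under the
  Kronecker symbol. The words starting with positive powers of \<open>k\<close> become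
  \<open>w31\<close> and \<open>w42\<close> with exchanged indices by cyclicity.\<close>

lemma phi_curv: "phi (curv a b) = - (1/3 * w42 a b + 2/3 * w31 a b + w20 a b + 4/3 * w11 a b - 4/3 * w31 b a - 2/3 * w42 b a
      + kr a b * (\<Sum>c\<in>UNIV. 1/3 * w42 c c + 2/3 * w31 c c - 1/3 * w11 c c))"
proof -
  have w: "phi (K * K * K * K * \<delta> a k * (k * k) * \<delta> b k) = - w42 a b"
    "phi (K * K * K * \<delta> a k * k * \<delta> b k) = - w31 a b"
    "phi (K * K * \<delta> a k * \<delta> b k) = - w20 a b"
    "phi (K * \<delta> a k * K * \<delta> b k) = - w11 a b"
    "phi (k * \<delta> a k * (K * K * K) * \<delta> b k) = - w31 b a"
    "phi (k * k * \<delta> a k * (K * K * K * K) * \<delta> b k) = - w42 b a" for a b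
    using phi_\<delta>_\<delta>[of "K * K" a 1 b]
    by (simp_all only: phi_\<delta>_\<delta> mult_1_right) (simp_all only: mult.assoc[symmetric] w42_def w31_def w20_def w11_def phi_flip)
  have l: "phi (K * laplacian k) = - (\<Sum>c\<in>UNIV. w11 c c)"
    by (simp add: laplacian_def sum_distrib_left phi_sum phi_\<delta>\<delta> sum_negf)
  show ?thesis
    unfolding curv_def powi_k
    by (simp add: phi_simps phi_sum w l phi_\<delta>\<delta> sum.distrib sum_subtractf sum_negf sum_distrib_left[symmetric] sum_divide_distrib[symmetric])
qed

context
  fixes V W :: "4 \<Rightarrow> endo"
  assumes irr: "strictly_irrational \<theta>" and V: "\<And>a. V a \<in> alg \<theta>" and W: "\<And>a. W a \<in> alg \<theta>"
begin

lemma metric_functional_Dk: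
  "metric_functional \<theta> Dk (one_form \<gamma> k V) (one_form \<gamma> k W) = tau \<theta> (\<Sum>a\<in>UNIV. V a * W a * k powi (-4))"
proof -
  have K4: "K * K * K * K \<in> alg_op \<theta>" by (simp only: alg_op_intros)
  show ?thesis
    unfolding metric_eq[OF irr V W] powi_k
    by (subst tau_sum[OF irr])
      (simp_all add: tau_tensor[OF irr alg_mult[OF V W] K4] sum_distrib_right
        alg_hat.mult[OF alg_hat.left[OF alg_mult[OF V W]] alg_hat.right[OF K4]])
qed

lemma einstein_functional_Dk:
  "einstein_functional \<theta> Dk (one_form \<gamma> k V) (one_form \<gamma> k W) = tau \<theta> (\<Sum>a\<in>UNIV. \<Sum>b\<in>UNIV. V a * W b * curv a b)"
proof -
  have hat: "V a * W b * curv a b \<in> alg_hat \<theta>" for a b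
    by (intro alg_hat.mult[OF alg_hat.left alg_hat.right] alg_mult V W curv_alg_op)
  have "tau \<theta> (\<Sum>a\<in>UNIV. \<Sum>b\<in>UNIV. V a * W b * curv a b) = (\<Sum>a\<in>UNIV. \<Sum>b\<in>UNIV. tau \<theta> (V a * W b * curv a b))"
    by (simp add: tau_sum[OF irr] alg_hat_sum hat)
  also have "\<dots> = (\<Sum>b\<in>UNIV. \<Sum>a\<in>UNIV. phi (V a * W b) * phi (curv a b))"
    by (subst sum.swap) (simp only: tau_tensor[OF irr alg_mult[OF V W] curv_alg_op])
  finally show ?thesis
    unfolding einstein_eq[OF irr V W] E_combined phi_curv ..
qed

end

end

theorem proposition5p12:
  fixes \<theta> :: "real^4^4" and \<gamma> :: "4 \<Rightarrow> complex^4^4" and k :: endo and V W :: "4 \<Rightarrow> endo"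
  assumes "transpose \<theta> = - \<theta>" and "strictly_irrational \<theta>"
    and "\<And>a b. \<gamma> a ** \<gamma> b + \<gamma> b ** \<gamma> a = mat (if a = b then 2 else 0)"
    and "k \<in> alg_op \<theta>" and "positive_op k" and "\<exists>l\<in>alg_op \<theta>. k * l = 1 \<and> l * k = 1"
    and "\<And>a. V a \<in> alg \<theta>" and "\<And>a. W a \<in> alg \<theta>"
  shows "metric_functional \<theta> (conformal_dirac \<gamma> k) (one_form \<gamma> k V) (one_form \<gamma> k W)
           = tau \<theta> (\<Sum>a\<in>UNIV. V a * W a * k powi (-4))
         \<and> einstein_functional \<theta> (conformal_dirac \<gamma> k) (one_form \<gamma> k V) (one_form \<gamma> k W)
           = tau \<theta> (\<Sum>a\<in>UNIV. \<Sum>b\<in>UNIV. V a * W b *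
               ((1/3) *\<^sub>R (k powi (-4) * \<delta> a k * k powi 2 * \<delta> b k)
              + (2/3) *\<^sub>R (k powi (-3) * \<delta> a k * k * \<delta> b k)
              + k powi (-2) * \<delta> a k * \<delta> b k
              + (2/3) *\<^sub>R (k powi (-1) * \<delta> a k * k powi (-1) * \<delta> b k)
              - (4/3) *\<^sub>R (k * \<delta> a k * k powi (-3) * \<delta> b k)
              - (2/3) *\<^sub>R (k powi 2 * \<delta> a k * k powi (-4) * \<delta> b k)
              + (2/3) *\<^sub>R (k powi (-1) * \<delta> a (\<delta> b k))
              + (if a = b then
                   (\<Sum>c\<in>UNIV. (1/3) *\<^sub>R (k powi (-1) * \<delta> c k * k powi (-1) * \<delta> c k)
                             + (1/3) *\<^sub>R (k powi 2 * \<delta> c k * k powi (-4) * \<delta> c k)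
                             + (2/3) *\<^sub>R (k * \<delta> c k * k powi (-3) * \<delta> c k))
                   - (2/3) *\<^sub>R (k powi (-1) * laplacian k)
                 else 0)))"
proof -
  obtain K where K: "K \<in> alg_op \<theta>" "k * K = 1" "K * k = 1" using assms(6) by blast
  interpret conformal \<gamma> \<theta> k K
    by unfold_locales (fact assms K)+
  show ?thesis
    using metric_functional_Dk[of V W, OF assms(2,7,8)] einstein_functional_Dk[of V W, OF assms(2,7,8)] unfolding curv_def by blast
qed

end
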